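(* Let $\mathcal{O}\subset\mathfrak{g}$ be a regular semisimple adjoint orbit of $\mathrm{G}$. Then for every $\Lambda\in\mathcal{O}\cap\mathfrak{h}$ there exist local coordinates on $\mathcal{O}$ around $\Lambda$, i.e. a diffeomorphism $\varphi_\Lambda:\mathcal{U}_\Lambda\to\mathfrak{l}\times\mathfrak{l}$ from an open subset $\mathcal{U}_\Lambda\subset\mathcal{O}$ containing $\Lambda$, whose image is all of $\mathfrak{l}\times\mathfrak{l}$, which transforms the Toda vector field (restricted to $\mathcal{U}_\Lambda$) into the complete diagonal linear vector field $$(Y,Z)\in\mathfrak{l}\times\mathfrak{l},\qquad (Y',Z')=\big([Y,\pi_{i\mathfrak{a}}\Lambda],\,[Z,-\pi_{\mathfrak{a}}\Lambda]\big).$$ Moreover, each domain $\mathcal{U}_\Lambda$ is dense in $\mathcal{O}$, and the union of the $\mathcal{U}_\Lambda$ over the finite set $\mathcal{O}\cap\mathfrak{h}$ covers $\mathcal{O}$.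
   Context: Let $\mathrm{G}$ be a connected complex semisimple Lie group with Lie algebra $\mathfrak{g}$. Fix an anti-holomorphic Cartan involution $\theta$ of $\mathrm{G}$ whose fixed-point set is a maximal compact subgroup $\mathrm{K}$; its differential gives the decomposition $\mathfrak{g}=\mathfrak{k}\oplus\mathfrak{p}$ into $+1$ and $-1$ eigenspaces. Fix a maximal abelian subspace $\mathfrak{a}\subset\mathfrak{p}$ and an ordering of the roots of $(\mathfrak{g},\mathfrak{a})$. Let $\mathfrak{n}$ (resp. $\mathfrak{l}$) be the sum of the positive (resp. negative) root spaces, and $\mathfrak{u}=\mathfrak{a}\oplus\mathfrak{n}$, so that $\mathfrak{g}=\mathfrak{k}\oplus\mathfrak{u}$ (Iwasawa decomposition). Let $\pi_{\mathfrak{k}}:\mathfrak{g}\to\mathfrak{k}$ be the projection along $\mathfrak{u}$. The Toda vector field on $\mathfrak{g}$ is $X'=[X,\pi_{\mathfrak{k}}X]$; it is tangent to all adjoint orbits. Let $\mathfrak{h}=i\mathfrak{a}\oplus\mathfrak{a}$ (a Cartan subalgebra of $\mathfrak{g}$), and let $\pi_{i\mathfrak{a}},\pi_{\mathfrak{a}}$ be the projections of $\mathfrak{h}$ onto the two summands. A regular semisimple adjoint orbit is an adjoint $\mathrm{G}$-orbit of maximal dimension among adjoint orbits that meets $\mathfrak{h}$. *)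

theory Defs
  imports "HOL-Analysis.Analysis"
begin

text \<open>A complex Lie algebra is modelled as a finite-dimensional real Euclidean space 'g
with a real-bilinear bracket br and a complex structure J (multiplication by i).\<close>

definition lie_algebra :: "('g::euclidean_space \<Rightarrow> 'g \<Rightarrow> 'g) \<Rightarrow> bool" where
  "lie_algebra br \<longleftrightarrow>
     (\<forall>x. linear (br x)) \<and> (\<forall>y. linear (\<lambda>x. br x y)) \<and>
     (\<forall>x y. br x y = - br y x) \<and>
     (\<forall>x y z. br x (br y z) + br y (br z x) + br z (br x y) = 0)"

definition complex_structure :: "('g::euclidean_space \<Rightarrow> 'g \<Rightarrow> 'g) \<Rightarrow> ('g \<Rightarrow> 'g) \<Rightarrow> bool" where
  "complex_structure br J \<longleftrightarrow>
     linear J \<and> (\<forall>x. J (J x) = - x) \<and> (\<forall>x y. br (J x) y = J (br x y))"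

definition csubspace :: "('g::euclidean_space \<Rightarrow> 'g) \<Rightarrow> 'g set \<Rightarrow> bool" where
  "csubspace J V \<longleftrightarrow> subspace V \<and> J ` V \<subseteq> V"

definition lie_ideal :: "('g::euclidean_space \<Rightarrow> 'g \<Rightarrow> 'g) \<Rightarrow> ('g \<Rightarrow> 'g) \<Rightarrow> 'g set \<Rightarrow> bool" where
  "lie_ideal br J I \<longleftrightarrow> csubspace J I \<and> (\<forall>x y. y \<in> I \<longrightarrow> br x y \<in> I)"

primrec derived :: "('g::euclidean_space \<Rightarrow> 'g \<Rightarrow> 'g) \<Rightarrow> 'g set \<Rightarrow> nat \<Rightarrow> 'g set" where
  "derived br I 0 = I"
| "derived br I (Suc k) = span {br x y | x y. x \<in> derived br I k \<and> y \<in> derived br I k}"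

definition solvable_alg :: "('g::euclidean_space \<Rightarrow> 'g \<Rightarrow> 'g) \<Rightarrow> 'g set \<Rightarrow> bool" where
  "solvable_alg br I \<longleftrightarrow> (\<exists>k. derived br I k = {0})"

definition semisimple :: "('g::euclidean_space \<Rightarrow> 'g \<Rightarrow> 'g) \<Rightarrow> ('g \<Rightarrow> 'g) \<Rightarrow> bool" where
  "semisimple br J \<longleftrightarrow> (\<forall>I. lie_ideal br J I \<and> solvable_alg br I \<longrightarrow> I = {0})"

definition killing :: "('g::euclidean_space \<Rightarrow> 'g \<Rightarrow> 'g) \<Rightarrow> 'g \<Rightarrow> 'g \<Rightarrow> real" where
  "killing br x y = (\<Sum>b\<in>Basis. br x (br y b) \<bullet> b)"

text \<open>Differential of an anti-holomorphic Cartan involution: a conjugate-linear involutive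
Lie algebra automorphism theta with -B(X, theta X) positive definite.\<close>
definition cartan_involution ::
  "('g::euclidean_space \<Rightarrow> 'g \<Rightarrow> 'g) \<Rightarrow> ('g \<Rightarrow> 'g) \<Rightarrow> ('g \<Rightarrow> 'g) \<Rightarrow> bool" where
  "cartan_involution br J \<theta> \<longleftrightarrow>
     linear \<theta> \<and> (\<forall>x. \<theta> (\<theta> x) = x) \<and> (\<forall>x y. \<theta> (br x y) = br (\<theta> x) (\<theta> y)) \<and>
     (\<forall>x. \<theta> (J x) = - J (\<theta> x)) \<and> (\<forall>x. x \<noteq> 0 \<longrightarrow> - killing br x (\<theta> x) > 0)"

definition kpart :: "('g \<Rightarrow> 'g) \<Rightarrow> 'g set" where
  "kpart \<theta> = {x. \<theta> x = x}"

definition ppart :: "('g::ab_group_add \<Rightarrow> 'g) \<Rightarrow> 'g set" where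
  "ppart \<theta> = {x. \<theta> x = - x}"

definition abelian :: "('g::euclidean_space \<Rightarrow> 'g \<Rightarrow> 'g) \<Rightarrow> 'g set \<Rightarrow> bool" where
  "abelian br V \<longleftrightarrow> (\<forall>x\<in>V. \<forall>y\<in>V. br x y = 0)"

definition max_abelian_in_p ::
  "('g::euclidean_space \<Rightarrow> 'g \<Rightarrow> 'g) \<Rightarrow> ('g \<Rightarrow> 'g) \<Rightarrow> 'g set \<Rightarrow> bool" where
  "max_abelian_in_p br \<theta> a \<longleftrightarrow>
     subspace a \<and> a \<subseteq> ppart \<theta> \<and> abelian br a \<and>
     (\<forall>b. subspace b \<and> a \<subseteq> b \<and> b \<subseteq> ppart \<theta> \<and> abelian br b \<longrightarrow> b = a)"

text \<open>Restricted roots: linear functionals on a are represented by elements of a via the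
inner product (H \<mapsto> alpha \<bullet> H).\<close>
definition rootspace :: "('g::euclidean_space \<Rightarrow> 'g \<Rightarrow> 'g) \<Rightarrow> 'g set \<Rightarrow> 'g \<Rightarrow> 'g set" where
  "rootspace br a \<alpha> = {X. \<forall>H\<in>a. br H X = (\<alpha> \<bullet> H) *\<^sub>R X}"

definition is_root :: "('g::euclidean_space \<Rightarrow> 'g \<Rightarrow> 'g) \<Rightarrow> 'g set \<Rightarrow> 'g \<Rightarrow> bool" where
  "is_root br a \<alpha> \<longleftrightarrow> \<alpha> \<in> a \<and> \<alpha> \<noteq> 0 \<and> rootspace br a \<alpha> \<noteq> {0}"

text \<open>An ordering (notion of positivity) on the dual of a, given by its positive cone Pos.\<close>
definition positivity :: "'g::euclidean_space set \<Rightarrow> 'g set \<Rightarrow> bool" where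
  "positivity a Pos \<longleftrightarrow>
     Pos \<subseteq> a \<and> 0 \<notin> Pos \<and>
     (\<forall>v\<in>a. v \<noteq> 0 \<longrightarrow> (v \<in> Pos \<longleftrightarrow> - v \<notin> Pos)) \<and>
     (\<forall>u\<in>Pos. \<forall>v\<in>Pos. u + v \<in> Pos) \<and>
     (\<forall>v\<in>Pos. \<forall>c::real. c > 0 \<longrightarrow> c *\<^sub>R v \<in> Pos)"

definition nplus :: "('g::euclidean_space \<Rightarrow> 'g \<Rightarrow> 'g) \<Rightarrow> 'g set \<Rightarrow> 'g set \<Rightarrow> 'g set" where
  "nplus br a Pos = span (\<Union>{rootspace br a \<alpha> | \<alpha>. is_root br a \<alpha> \<and> \<alpha> \<in> Pos})"

definition lminus :: "('g::euclidean_space \<Rightarrow> 'g \<Rightarrow> 'g) \<Rightarrow> 'g set \<Rightarrow> 'g set \<Rightarrow> 'g set" where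
  "lminus br a Pos = span (\<Union>{rootspace br a \<alpha> | \<alpha>. is_root br a \<alpha> \<and> \<alpha> \<notin> Pos})"

definition upart :: "('g::euclidean_space \<Rightarrow> 'g \<Rightarrow> 'g) \<Rightarrow> 'g set \<Rightarrow> 'g set \<Rightarrow> 'g set" where
  "upart br a Pos = {x + y | x y. x \<in> a \<and> y \<in> nplus br a Pos}"

text \<open>Projection onto k along u (Iwasawa decomposition g = k + u).\<close>
definition pi_k ::
  "('g::euclidean_space \<Rightarrow> 'g \<Rightarrow> 'g) \<Rightarrow> ('g \<Rightarrow> 'g) \<Rightarrow> 'g set \<Rightarrow> 'g set \<Rightarrow> 'g \<Rightarrow> 'g" where
  "pi_k br \<theta> a Pos X = (THE K. K \<in> kpart \<theta> \<and> X - K \<in> upart br a Pos)"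

definition toda ::
  "('g::euclidean_space \<Rightarrow> 'g \<Rightarrow> 'g) \<Rightarrow> ('g \<Rightarrow> 'g) \<Rightarrow> 'g set \<Rightarrow> 'g set \<Rightarrow> 'g \<Rightarrow> 'g" where
  "toda br \<theta> a Pos X = br X (pi_k br \<theta> a Pos X)"

definition hcartan :: "('g::euclidean_space \<Rightarrow> 'g) \<Rightarrow> 'g set \<Rightarrow> 'g set" where
  "hcartan J a = {J x + y | x y. x \<in> a \<and> y \<in> a}"

definition pi_ia :: "('g::euclidean_space \<Rightarrow> 'g) \<Rightarrow> 'g set \<Rightarrow> 'g \<Rightarrow> 'g" where
  "pi_ia J a L = (THE T. T \<in> J ` a \<and> L - T \<in> a)"

definition pi_a :: "('g::euclidean_space \<Rightarrow> 'g) \<Rightarrow> 'g set \<Rightarrow> 'g \<Rightarrow> 'g" where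
  "pi_a J a L = (THE A. A \<in> a \<and> L - A \<in> J ` a)"

definition expop :: "('g::euclidean_space \<Rightarrow> 'g) \<Rightarrow> 'g \<Rightarrow> 'g" where
  "expop L y = (\<Sum>n. (1 / fact n) *\<^sub>R (L ^^ n) y)"

text \<open>Adjoint orbit: orbit under Ad(G) = Int(g), the group generated by the exp(ad X)
(G connected).\<close>
inductive_set adj_orbit :: "('g::euclidean_space \<Rightarrow> 'g \<Rightarrow> 'g) \<Rightarrow> 'g \<Rightarrow> 'g set"
  for br :: "'g \<Rightarrow> 'g \<Rightarrow> 'g" and L :: 'g where
  base: "L \<in> adj_orbit br L"
| step: "Y \<in> adj_orbit br L \<Longrightarrow> expop (br X) Y \<in> adj_orbit br L"

text \<open>Real dimension of the adjoint orbit through Y (= dim of its tangent space [g,Y]).\<close>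
definition orbit_dim :: "('g::euclidean_space \<Rightarrow> 'g \<Rightarrow> 'g) \<Rightarrow> 'g \<Rightarrow> nat" where
  "orbit_dim br Y = dim (range (\<lambda>X. br X Y))"

definition regular_semisimple_orbit ::
  "('g::euclidean_space \<Rightarrow> 'g \<Rightarrow> 'g) \<Rightarrow> ('g \<Rightarrow> 'g) \<Rightarrow> 'g set \<Rightarrow> 'g set \<Rightarrow> bool" where
  "regular_semisimple_orbit br J a Orb \<longleftrightarrow>
     (\<exists>L. Orb = adj_orbit br L) \<and> Orb \<inter> hcartan J a \<noteq> {} \<and>
     (\<forall>L\<in>Orb. \<forall>Y. orbit_dim br Y \<le> orbit_dim br L)"

text \<open>C-infinity on an open set: all iterated directional derivatives exist and are continuous.
D vs is the iterated directional derivative along the directions in vs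
(last applied first).\<close>
definition smooth_open :: "'a::euclidean_space set \<Rightarrow> ('a \<Rightarrow> 'b::euclidean_space) \<Rightarrow> bool" where
  "smooth_open W f \<longleftrightarrow> open W \<and>
     (\<exists>D :: 'a list \<Rightarrow> 'a \<Rightarrow> 'b.
        (\<forall>x\<in>W. D [] x = f x) \<and>
        (\<forall>vs. continuous_on W (D vs)) \<and>
        (\<forall>v vs. \<forall>x\<in>W. ((\<lambda>t. D vs (x + t *\<^sub>R v)) has_vector_derivative D (v # vs) x) (at 0)))"

definition smooth_on_set :: "'a::euclidean_space set \<Rightarrow> ('a \<Rightarrow> 'b::euclidean_space) \<Rightarrow> bool" where
  "smooth_on_set S f \<longleftrightarrow>
     (\<forall>x\<in>S. \<exists>W F. x \<in> W \<and> smooth_open W F \<and> (\<forall>y\<in>S \<inter> W. F y = f y))"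

definition diffeo_onto :: "'a::euclidean_space set \<Rightarrow> 'b::euclidean_space set \<Rightarrow> ('a \<Rightarrow> 'b) \<Rightarrow> bool" where
  "diffeo_onto U V \<phi> \<longleftrightarrow>
     inj_on \<phi> U \<and> \<phi> ` U = V \<and> smooth_on_set U \<phi> \<and> smooth_on_set V (the_inv_into U \<phi>)"

text \<open>phi transforms the vector field X on U (tangent to U) into the vector field V:
the differential of phi maps X p to V (phi p), computed through any smooth local extension.\<close>
definition transforms_field ::
  "'a::euclidean_space set \<Rightarrow> ('a \<Rightarrow> 'b::euclidean_space) \<Rightarrow> ('a \<Rightarrow> 'a) \<Rightarrow> ('b \<Rightarrow> 'b) \<Rightarrow> bool" where
  "transforms_field U \<phi> X V \<longleftrightarrow>
     (\<forall>p\<in>U. \<forall>W F D. p \<in> W \<and> smooth_open W F \<and> (\<forall>y\<in>U \<inter> W. F y = \<phi> y) \<and>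
        (F has_derivative D) (at p) \<longrightarrow> D (X p) = V (\<phi> p))"

definition iwasawa_setting ::
  "('g::euclidean_space \<Rightarrow> 'g \<Rightarrow> 'g) \<Rightarrow> ('g \<Rightarrow> 'g) \<Rightarrow> ('g \<Rightarrow> 'g) \<Rightarrow> 'g set \<Rightarrow> 'g set \<Rightarrow> bool" where
  "iwasawa_setting br J \<theta> a Pos \<longleftrightarrow>
     lie_algebra br \<and> complex_structure br J \<and> semisimple br J \<and>
     cartan_involution br J \<theta> \<and> max_abelian_in_p br \<theta> a \<and> positivity a Pos"

end

theory Submission
  imports Defs "HOL-Complex_Analysis.Complex_Analysis" "Jordan_Normal_Form.Determinant"
begin

text \<open>
Let \<open>\<theta>\<close> be the Cartan involution and grade \<open>g\<close> by the eigenvalues of \<open>ad H0\<close>, where \<open>H0\<close> in \<open>a\<close> is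
strictly dominant, so that \<open>n\<close>, \<open>h\<close> and \<open>l\<close> are the parts of positive, zero and negative degree.

Call \<open>g\<close> good if \<open>g (h + n)\<close> is transversal to \<open>l\<close>. Along a complex one-parameter family, the bad
parameters are zeros of an entire determinant, hence form a countable set with connected complement. As
a finite-valued continuous function is constant on a connected set, every good inner automorphism acts
trivially on \<open>h\<close> in the sense of its Gauss decomposition \<open>l z n\<close>: the factor \<open>z\<close> fixes \<open>h\<close> pointwise.
Applied to the positive definite operator \<open>g\<^sup>* g\<close>, which is always good, this gives the Iwasawa
decomposition \<open>g = k e\<^sup>A u\<close>.

The chart domain of \<open>\<Lambda>\<close> is the set of all \<open>n (l \<Lambda>)\<close>. Writing \<open>n l = k e\<^sup>A u\<close>, the coordinates of
\<open>n (l \<Lambda>)\<close> are \<open>Y = \<theta> (e\<^sup>A (u \<Lambda> - \<Lambda>))\<close> and \<open>Z = e\<^sup>A (l \<Lambda> - \<Lambda>)\<close>; the inverse map is the Iwasawa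
decomposition of the quotient of the unipotent elements belonging to \<open>Y\<close> and \<open>Z\<close>. The Toda flow
is \<open>p \<mapsto> R\<^sub>t p\<close> for the triangular factor \<open>R\<^sub>t\<close> of \<open>e\<^sup>t\<^sup>p = k\<^sub>t R\<^sub>t\<close>, to first order at \<open>t = 0\<close>. With
\<open>p = g \<Lambda>\<close> one has \<open>e\<^sup>t\<^sup>p g = g e\<^sup>t\<^sup>\<Lambda>\<close>, which makes the coordinates evolve linearly.

Density of the domains is density of good automorphisms. For the covering, let \<open>k\<^sub>j\<close> be the compact
factor of \<open>e\<^sup>j\<^sup>H\<^sup>0 g\<^sup>-\<^sup>1\<close> and \<open>q\<close> a limit point of the \<open>k\<^sub>j\<close>: comparing leading terms, \<open>q n\<close> is invariant under
\<open>ad H0\<close>, so \<open>q\<^sup>-\<^sup>1 H0\<close> lies in \<open>a\<close>, \<open>q\<close> normalizes \<open>h\<close>, and \<open>g \<Lambda>\<close> lies in the domain of \<open>q\<^sup>-\<^sup>1 \<Lambda>\<close>.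
\<close>

section \<open>Functions of class C^k\<close>

text \<open>The group enters only through \<open>inn\<close>, the automorphisms generated by the
  exp(ad X). Transversality alone gives unipotent factors and a middle factor carrying
  \<open>sig g H\<close> to H; the obstacle is to exclude a nontrivial action on h. Spectra do this:
  triangular elements conjugate under g link \<open>sig g H\<close> to H, so each eigenvalue of ad
  (\<open>sig g H\<close>) is one of ad H, and root values determine an element of h, which leaves
  finitely many candidates. The parameter has to be complex: removing a countable set can disconnect
  a line, but not the plane. The chart has a symmetric form. If n l^-1 = k^-1 R with k compact and R
  in AN, then X = k (n \<Lambda>) = R (l \<Lambda>): X is conjugate to an upper triangular element
  under K and to a lower triangular one under AN, and Y, Z are the strictly triangular parts, the
  first reflected by \<theta>. The exponential of t \<Lambda> splits into a compact factor from the
  J a-part and a factor from the a-part; n absorbs one and l the other, so the two projections of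
  \<Lambda> drive Y and Z separately, with opposite signs.\<close>

no_notation scalar_prod (infix \<open>\<bullet>\<close> 70)
no_notation m_inv (\<open>(\<open>open_block notation=\<open>prefix inv\<close>\<close>inv\<index> _)\<close> [81] 80)

text \<open>Derivatives are tested on constant directions v, so all orders concern functions with
  the same value space and induction on k never meets operator-valued maps. The total derivative is
  kept because products, compositions and inverses need it; \<open>smooth_open_of_Ck\<close> returns
  to iterated directional derivatives.\<close>

primrec Ck :: "nat \<Rightarrow> 'a::euclidean_space set \<Rightarrow> ('a \<Rightarrow> 'b::euclidean_space) \<Rightarrow> bool" where
  "Ck 0 W f = continuous_on W f"
| "Ck (Suc k) W f = (\<exists>f'. (\<forall>x\<in>W. (f has_derivative f' x) (at x)) \<and> (\<forall>v. Ck k W (\<lambda>x. f' x v)))"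

lemma Ck_SucI:
  assumes "\<And>x. x \<in> W \<Longrightarrow> (f has_derivative f' x) (at x)" "\<And>v. Ck k W (\<lambda>x. f' x v)"
  shows "Ck (Suc k) W f"
  using assms by auto

lemma Ck_SucE:
  assumes "Ck (Suc k) W f"
  obtains f' where "\<And>x. x \<in> W \<Longrightarrow> (f has_derivative f' x) (at x)" "\<And>v. Ck k W (\<lambda>x. f' x v)"
  using assms by auto

lemma Ck_imp_continuous_on: "Ck k W f \<Longrightarrow> continuous_on W f"
  by (cases k) (auto intro!: continuous_at_imp_continuous_on dest: has_derivative_continuous)

lemma Ck_SucD: "Ck (Suc k) W f \<Longrightarrow> Ck k W f"
proof (induction k arbitrary: f)
  case 0 then show ?case using Ck_imp_continuous_on[OF 0] by simp
next
  case (Suc k)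
  obtain f' where f': "\<And>x. x\<in>W \<Longrightarrow> (f has_derivative f' x) (at x)" "\<And>v. Ck (Suc k) W (\<lambda>x. f' x v)"
    using Suc.prems unfolding Ck.simps(2)[of "Suc k"] by blast
  show ?case by (rule Ck_SucI[OF f'(1)]) (use f'(2) Suc.IH in auto)
qed

lemma Ck_cong:
  assumes "open W" "\<And>x. x \<in> W \<Longrightarrow> f x = g x" "Ck k W f"
  shows "Ck k W g"
proof (cases k)
  case 0 then show ?thesis using assms by (simp cong: continuous_on_cong)
next
  case (Suc j)
  then obtain f' where f': "\<And>x. x\<in>W \<Longrightarrow> (f has_derivative f' x) (at x)" "\<And>v. Ck j W (\<lambda>x. f' x v)"
    using assms by auto
  show ?thesis unfolding Suc
    by (rule Ck_SucI[OF _ f'(2)]) (rule has_derivative_transform_within_open[OF f'(1) assms(1)], use assms in auto)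
qed

lemma Ck_subset: "Ck k W f \<Longrightarrow> V \<subseteq> W \<Longrightarrow> Ck k V f"
proof (induction k arbitrary: f)
  case 0 then show ?case using continuous_on_subset by auto
next
  case (Suc k)
  then obtain f' where f': "\<And>x. x\<in>W \<Longrightarrow> (f has_derivative f' x) (at x)" "\<And>v. Ck k W (\<lambda>x. f' x v)"
    by auto
  show ?case by (rule Ck_SucI) (use f' Suc in auto)
qed

lemma Ck_const: "Ck k W (\<lambda>x. c)"
proof (induction k arbitrary: c)
  case (Suc k) show ?case by (rule Ck_SucI[where f'="\<lambda>x v. 0"]) (use Suc in auto)
qed auto

lemma Ck_linear: "linear f \<Longrightarrow> Ck k W f"
proof (induction k)
  case 0 then show ?case by (simp add: linear_continuous_on linear_conv_bounded_linear)
next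
  case (Suc k) show ?case
    by (rule Ck_SucI[where f'="\<lambda>x. f"]) (use Suc Ck_const in \<open>auto simp: linear_imp_has_derivative\<close>)
qed

lemma Ck_add: "Ck k W f \<Longrightarrow> Ck k W g \<Longrightarrow> Ck k W (\<lambda>x. f x + g x)"
proof (induction k arbitrary: f g)
  case 0 then show ?case by (auto intro: continuous_intros)
next
  case (Suc k)
  have "Ck (Suc k) W f" "Ck (Suc k) W g" using Suc.prems by auto
  then obtain f' g' where f': "\<And>x. x\<in>W \<Longrightarrow> (f has_derivative f' x) (at x)" "\<And>v. Ck k W (\<lambda>x. f' x v)"
    and g': "\<And>x. x\<in>W \<Longrightarrow> (g has_derivative g' x) (at x)" "\<And>v. Ck k W (\<lambda>x. g' x v)"
    unfolding Ck.simps by blast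
  show ?case by (rule Ck_SucI[where f'="\<lambda>x v. f' x v + g' x v"])
      (use f' g' Suc.IH in \<open>auto intro: has_derivative_add\<close>)
qed

lemma Ck_sum: "(\<And>i. i \<in> I \<Longrightarrow> Ck k W (f i)) \<Longrightarrow> Ck k W (\<lambda>x. \<Sum>i\<in>I. f i x)"
proof (induction I rule: infinite_finite_induct)
  case (insert i I)
  then show ?case by (simp add: Ck_add)
qed (simp_all add: Ck_const)

lemma Ck_linear_comp: "linear h \<Longrightarrow> Ck k W f \<Longrightarrow> Ck k W (\<lambda>x. h (f x))"
proof (induction k arbitrary: f)
  case 0 then show ?case
    using linear_continuous_on linear_conv_bounded_linear continuous_on_compose2 by (metis Ck.simps(1) top_greatest)
next
  case (Suc k)
  then obtain f' where f': "\<And>x. x\<in>W \<Longrightarrow> (f has_derivative f' x) (at x)" "\<And>v. Ck k W (\<lambda>x. f' x v)"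
    by auto
  show ?case by (rule Ck_SucI[where f'="\<lambda>x v. h (f' x v)"])
      (use f' Suc in \<open>auto intro: bounded_linear.has_derivative simp: linear_conv_bounded_linear\<close>)
qed

lemma Ck_bilinear: "bounded_bilinear h \<Longrightarrow> Ck k W f \<Longrightarrow> Ck k W g \<Longrightarrow> Ck k W (\<lambda>x. h (f x) (g x))"
proof (induction k arbitrary: f g)
  case 0 then show ?case by (auto intro: bounded_bilinear.continuous_on)
next
  case (Suc k)
  have "Ck (Suc k) W f" "Ck (Suc k) W g" using Suc.prems by auto
  then obtain f' g' where f': "\<And>x. x\<in>W \<Longrightarrow> (f has_derivative f' x) (at x)" "\<And>v. Ck k W (\<lambda>x. f' x v)"
    and g': "\<And>x. x\<in>W \<Longrightarrow> (g has_derivative g' x) (at x)" "\<And>v. Ck k W (\<lambda>x. g' x v)"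
    unfolding Ck.simps by blast
  have fg: "Ck k W f" "Ck k W g" using Suc.prems Ck_SucD by blast+
  show ?case by (rule Ck_SucI[where f'="\<lambda>x v. h (f x) (g' x v) + h (f' x v) (g x)"])
      (use f' g' Suc.prems(1) Suc.IH fg in \<open>auto intro!: bounded_bilinear.FDERIV Ck_add\<close>)
qed

lemmas Ck_scaleR = Ck_bilinear[OF bounded_bilinear_scaleR]
lemma Ck_mult:
  fixes f g :: "'a::euclidean_space \<Rightarrow> real"
  shows "Ck k W f \<Longrightarrow> Ck k W g \<Longrightarrow> Ck k W (\<lambda>x. f x * g x)"
  by (rule Ck_bilinear[OF bounded_bilinear_mult])

lemma linear_expand:
  fixes g :: "'a::euclidean_space \<Rightarrow> 'b::real_vector"
  assumes "linear g" shows "g x = (\<Sum>b\<in>Basis. (x \<bullet> b) *\<^sub>R g b)"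
proof -
  have "g x = g (\<Sum>b\<in>Basis. (x \<bullet> b) *\<^sub>R b)" by (simp add: euclidean_representation)
  also have "\<dots> = (\<Sum>b\<in>Basis. (x \<bullet> b) *\<^sub>R g b)" by (simp add: linear_sum[OF assms] linear_scale[OF assms])
  finally show ?thesis .
qed

text \<open>A family of linear maps is known only vector by vector. Expanding the moving argument in
  the basis reduces to finitely many scalar multiples of such vectors.\<close>

lemma Ck_apply:
  fixes g :: "'a::euclidean_space \<Rightarrow> 'b::euclidean_space \<Rightarrow> 'c::euclidean_space"
  assumes "open W" "\<And>x. x \<in> W \<Longrightarrow> linear (g x)" "\<And>v. Ck k W (\<lambda>x. g x v)" "Ck k W f"
  shows "Ck k W (\<lambda>x. g x (f x))"
proof (rule Ck_cong[OF assms(1)])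
  show "Ck k W (\<lambda>x. \<Sum>b\<in>Basis. (f x \<bullet> b) *\<^sub>R g x b)"
    by (intro Ck_sum Ck_scaleR assms(3) Ck_linear_comp[OF _ assms(4)])
       (simp add: linear_conv_bounded_linear bounded_linear_inner_left)
qed (use linear_expand[OF assms(2)] in auto)

lemma Ck_compose:
  fixes f :: "'b::euclidean_space \<Rightarrow> 'c::euclidean_space" and g :: "'a::euclidean_space \<Rightarrow> 'b"
  assumes "open W" "Ck k W g" "Ck k V f" "g ` W \<subseteq> V" "open V"
  shows "Ck k W (\<lambda>x. f (g x))"
  using assms
proof (induction k arbitrary: f)
  case 0 then show ?case using continuous_on_compose2 by auto
next
  case (Suc k)
  obtain f' where f': "\<And>x. x\<in>V \<Longrightarrow> (f has_derivative f' x) (at x)" "\<And>v. Ck k V (\<lambda>x. f' x v)"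
    using Suc.prems(3) unfolding Ck.simps by blast
  obtain g' where g': "\<And>x. x\<in>W \<Longrightarrow> (g has_derivative g' x) (at x)" "\<And>v. Ck k W (\<lambda>x. g' x v)"
    using Suc.prems(2) unfolding Ck.simps by blast
  show ?case
  proof (rule Ck_SucI[where f'="\<lambda>x v. f' (g x) (g' x v)"])
    fix x assume x: "x \<in> W"
    have "(f has_derivative f' (g x)) (at (g x))" using f' Suc.prems x by auto
    then show "((\<lambda>x. f (g x)) has_derivative (\<lambda>v. f' (g x) (g' x v))) (at x)"
      using has_derivative_compose[OF g'(1)[OF x]] by auto
  next
    fix v show "Ck k W (\<lambda>x. f' (g x) (g' x v))"
    proof (rule Ck_apply[OF Suc.prems(1) _ _ g'(2)])
      show "linear (f' (g x))" if "x \<in> W" for x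
        using f'(1)[of "g x"] that Suc.prems has_derivative_linear by blast
      show "Ck k W (\<lambda>x. f' (g x) v)" for v
        using Suc.IH[of "\<lambda>y. f' y v"] f'(2) Suc.prems Ck_SucD by blast
    qed
  qed
qed

lemma Ck_inverse_real: "Ck k {0<..} (inverse :: real \<Rightarrow> real)"
proof (induction k)
  case 0 show ?case by (auto intro!: continuous_intros)
next
  case (Suc k) show ?case
  proof (rule Ck_SucI[where f'="\<lambda>x v. - (inverse x * (inverse x * v))"])
    show "(inverse has_derivative (\<lambda>v. - (inverse x * (inverse x * v)))) (at x)" if "x \<in> {0<..}" for x :: real
      using has_derivative_inverse'[of x] that by (simp add: mult_ac)
    have "linear (uminus :: real \<Rightarrow> real)" by (simp add: linear_uminus)
    then show "Ck k {0<..} (\<lambda>x. - (inverse x * (inverse x * v)))" for v :: real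
      by (rule Ck_linear_comp) (intro Ck_mult Suc Ck_const)
  qed
qed

text \<open>The square root enters through \<open>iA\<close>, whose diagonal entries are roots of
  positive entries of a Gauss factor.\<close>

lemma Ck_sqrt_real: "Ck k {0<..} sqrt"
proof (induction k)
  case 0 show ?case by (auto intro!: continuous_intros)
next
  case (Suc k) show ?case
  proof (rule Ck_SucI[where f'="\<lambda>x v. inverse (sqrt x) * (v / 2)"])
    show "(sqrt has_derivative (\<lambda>v. inverse (sqrt x) * (v / 2))) (at x)" if "x \<in> {0<..}" for x :: real
      using DERIV_real_sqrt[of x] that by (auto simp: has_field_derivative_def divide_simps mult_ac elim!: has_derivative_eq_rhs)
    show "Ck k {0<..} (\<lambda>x. inverse (sqrt x) * (v / 2))" for v
      by (intro Ck_mult Ck_const Ck_compose[OF _ Suc Ck_inverse_real]) auto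
  qed
qed

section \<open>Linear systems whose coefficients depend on a parameter\<close>

lemma linear_family_lower_bound:
  fixes M :: "'i \<Rightarrow> 'a::euclidean_space \<Rightarrow> 'b::euclidean_space"
  assumes lin: "\<forall>\<^sub>F i in F. linear (M i)" and N: "linear N" "inj N"
    and lim: "\<And>v. ((\<lambda>i. M i v) \<longlongrightarrow> N v) F"
  obtains c where "c > 0" "\<forall>\<^sub>F i in F. \<forall>v. norm (M i v) \<ge> c * norm v"
proof -
  obtain B where B: "B > 0" "\<And>x. B * norm x \<le> norm (N x)"
    using linear_inj_bounded_below_pos[OF N] by metis
  \<comment> \<open>The sum over the basis dominates the operator norm of \<open>M i - N\<close>, so
    half of the lower bound B of N survives.\<close>
  have "((\<lambda>i. \<Sum>b\<in>Basis. norm (M i b - N b)) \<longlongrightarrow> (\<Sum>b\<in>Basis. norm (N b - N b))) F"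
    by (intro tendsto_intros lim)
  then have "\<forall>\<^sub>F i in F. (\<Sum>b\<in>Basis. norm (M i b - N b)) < B/2"
    by (rule order_tendstoD(2)) (use B in simp)
  then have "\<forall>\<^sub>F i in F. \<forall>v. norm (M i v) \<ge> B/2 * norm v"
    using lin
  proof eventually_elim
    case (elim i)
    show ?case
    proof
      fix v
      have l: "linear (\<lambda>v. M i v - N v)" using elim(2) N(1) by (rule linear_compose_sub)
      have "norm (M i v - N v) = norm (\<Sum>b\<in>Basis. (v \<bullet> b) *\<^sub>R (M i b - N b))"
        by (subst linear_expand[OF l]) auto
      also have "\<dots> \<le> (\<Sum>b\<in>Basis. norm ((v \<bullet> b) *\<^sub>R (M i b - N b)))" by (rule norm_sum)
      also have "\<dots> \<le> (\<Sum>b\<in>Basis. norm v * norm (M i b - N b))"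
        by (rule sum_mono) (simp add: Basis_le_norm mult_right_mono)
      also have "\<dots> = norm v * (\<Sum>b\<in>Basis. norm (M i b - N b))" by (simp add: sum_distrib_left)
      also have "\<dots> \<le> norm v * (B/2)" using elim(1) by (intro mult_left_mono) auto
      finally have "norm (M i v - N v) \<le> norm v * (B/2)" .
      moreover have "norm (N v) \<le> norm (M i v - N v) + norm (M i v)"
        using norm_triangle_ineq4[of "M i v - N v" "M i v"] by (simp add: norm_minus_commute)
      ultimately show "norm (M i v) \<ge> B/2 * norm v" using B(2)[of v] by (simp add: algebra_simps)
    qed
  qed
  then show ?thesis using that B(1) half_gt_zero by blast
qed

lemma linear_family_eventually_inj:
  fixes M :: "'i \<Rightarrow> 'a::euclidean_space \<Rightarrow> 'b::euclidean_space"
  assumes lin: "\<forall>\<^sub>F i in F. linear (M i)" and N: "linear N" "inj N"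
    and lim: "\<And>v. ((\<lambda>i. M i v) \<longlongrightarrow> N v) F"
  shows "\<forall>\<^sub>F i in F. inj (M i)"
proof -
  obtain c where c: "c > 0" "\<forall>\<^sub>F i in F. \<forall>v. norm (M i v) \<ge> c * norm v"
    using linear_family_lower_bound[OF assms] by blast
  show ?thesis using c(2) lin
  proof eventually_elim
    case (elim i)
    show ?case unfolding linear_injective_0[OF elim(2)]
    proof (intro allI impI)
      fix v assume "M i v = 0"
      then have "c * norm v \<le> 0" using elim(1) norm_zero by metis
      then show "v = 0" using c(1) by (simp add: mult_le_0_iff)
    qed
  qed
qed

lemma linear_system_tendsto:
  fixes M :: "'i \<Rightarrow> 'a::euclidean_space \<Rightarrow> 'b::euclidean_space"
  assumes lin: "\<forall>\<^sub>F i in F. linear (M i)" and N: "linear N" "inj N"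
    and lim: "\<And>v. ((\<lambda>i. M i v) \<longlongrightarrow> N v) F"
    and b: "(b \<longlongrightarrow> N y0) F" and y: "\<forall>\<^sub>F i in F. M i (y i) = b i"
  shows "(y \<longlongrightarrow> y0) F"
proof -
  obtain c where c: "c > 0" "\<forall>\<^sub>F i in F. \<forall>v. norm (M i v) \<ge> c * norm v"
    using linear_family_lower_bound[OF assms(1-4)] by blast
  have "((\<lambda>i. norm (b i - M i y0) / c) \<longlongrightarrow> norm (N y0 - N y0) / c) F"
    by (intro tendsto_intros b lim) (use c in auto)
  then have 1: "((\<lambda>i. norm (b i - M i y0) / c) \<longlongrightarrow> 0) F" by simp
  have 2: "\<forall>\<^sub>F i in F. norm (y i - y0) \<le> norm (b i - M i y0) / c"
    using c(2) lin y
  proof eventually_elim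
    case (elim i)
    have "c * norm (y i - y0) \<le> norm (M i (y i - y0))" using elim(1) by blast
    also have "M i (y i - y0) = b i - M i y0" using elim by (simp add: linear_diff)
    finally show ?case using c(1) by (simp add: field_simps)
  qed
  have "((\<lambda>i. norm (y i - y0)) \<longlongrightarrow> 0) F"
    by (rule tendsto_sandwich[OF _ 2 tendsto_const 1]) auto
  then have "((\<lambda>i. y i - y0) \<longlongrightarrow> 0) F" by (rule tendsto_norm_zero_cancel)
  then show ?thesis by (rule LIM_zero_cancel)
qed

text \<open>The formula for y' is implicit differentiation of \<open>M x (y x) = b x\<close>.
  Applied to the normalized remainder of y, \<open>M z\<close> gives the remainder E1 of b, minus
  the remainder E2 of M at the fixed vector \<open>y x\<close>, minus the error E3 of replacing
  \<open>M x\<close> by \<open>M z\<close> on \<open>y'\<close>. All three vanish in the limit, and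
  \<open>M z\<close> is bounded below uniformly.\<close>

lemma has_derivative_linear_system:
  fixes M :: "'a::euclidean_space \<Rightarrow> 'b::euclidean_space \<Rightarrow> 'b"
  assumes W: "open W" "x \<in> W" and lin: "\<And>x. x \<in> W \<Longrightarrow> linear (M x)" and inj: "\<And>x. x \<in> W \<Longrightarrow> inj (M x)"
    and M': "\<And>v. ((\<lambda>x. M x v) has_derivative (\<lambda>h. M' v h)) (at x)"
    and b': "(b has_derivative b') (at x)" and sol: "\<And>x. x \<in> W \<Longrightarrow> M x (y x) = b x"
    and y': "\<And>h. M x (y' h) = b' h - M' (y x) h"
  shows "(y has_derivative y') (at x)"
proof -
  have ev: "\<forall>\<^sub>F z in at x. z \<in> W" using W eventually_at_topological by blast
  have limM: "((\<lambda>z. M z v) \<longlongrightarrow> M x v) (at x)" for v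
    using has_derivative_continuous[OF M'[of v]] by (simp add: continuous_within)
  have linx: "linear (M x)" and injx: "inj (M x)" using lin inj W by auto
  define Mi where "Mi = inv (M x)"
  have linMi: "linear Mi" unfolding Mi_def using inj_linear_imp_inv_linear linx injx linear_injective_imp_surjective by blast
  have MMi: "M x (Mi v) = v" for v
    unfolding Mi_def using linear_injective_imp_surjective[OF linx injx] by (simp add: surj_f_inv_f)
  have MiM: "Mi (M x v) = v" for v unfolding Mi_def using injx by simp
  have y'eq: "y' = (\<lambda>h. Mi (b' h - M' (y x) h))" 
  proof
    fix h
    show "y' h = Mi (b' h - M' (y x) h)" using MiM[of "y' h"] unfolding y' by (rule sym)
  qed
  have bl: "bounded_linear y'"
    unfolding y'eq
    by (rule bounded_linear_compose[OF _ bounded_linear_sub[OF has_derivative_bounded_linear[OF b'] has_derivative_bounded_linear[OF M']]])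
       (simp add: linMi flip: linear_conv_bounded_linear)
  obtain c where c: "c > 0" "\<forall>\<^sub>F z in at x. \<forall>v. norm (M z v) \<ge> c * norm v"
    by (rule linear_family_lower_bound[OF eventually_mono[OF ev lin] linx injx limM])
  have ly: "linear y'" using bl linear_conv_bounded_linear by blast
  define E1 where "E1 z = (b z - b x - b' (z - x)) /\<^sub>R norm (z - x)" for z
  define E2 where "E2 z = (M z (y x) - M x (y x) - M' (y x) (z - x)) /\<^sub>R norm (z - x)" for z
  define E3 where "E3 z = (\<Sum>e\<in>Basis. ((((z - x) /\<^sub>R norm (z - x)) \<bullet> e)) *\<^sub>R (M z (y' e) - M x (y' e)))" for z
  have t1: "(E1 \<longlongrightarrow> 0) (at x)" using b' unfolding has_derivative_at_within E1_def by simp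
  have t2: "(E2 \<longlongrightarrow> 0) (at x)" using M'[of "y x"] unfolding has_derivative_at_within E2_def by simp
  have t3: "(E3 \<longlongrightarrow> 0) (at x)" unfolding E3_def
  proof (rule tendsto_null_sum)
    fix e :: 'a assume e: "e \<in> Basis"
    have 0: "((\<lambda>z. norm (M z (y' e) - M x (y' e))) \<longlongrightarrow> 0) (at x)"
      using limM by (intro tendsto_norm_zero LIM_zero)
    have "norm (((z - x) /\<^sub>R norm (z - x)) \<bullet> e) \<le> 1" for z
      using Basis_le_norm[OF e, of "(z - x) /\<^sub>R norm (z - x)"] by (cases "z = x") auto
    then have "norm ((((z - x) /\<^sub>R norm (z - x)) \<bullet> e) *\<^sub>R (M z (y' e) - M x (y' e))) \<le> norm (M z (y' e) - M x (y' e))" for z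
      using mult_right_mono[of "norm (((z - x) /\<^sub>R norm (z - x)) \<bullet> e)" 1 "norm (M z (y' e) - M x (y' e))"]
      by (simp only: norm_scaleR real_norm_def norm_ge_zero mult_1)
    then show "((\<lambda>z. (((z - x) /\<^sub>R norm (z - x)) \<bullet> e) *\<^sub>R (M z (y' e) - M x (y' e))) \<longlongrightarrow> 0) (at x)"
      by (intro Lim_null_comparison[OF _ 0] always_eventually) blast
  qed
  have "((\<lambda>z. norm (E1 z - E2 z - E3 z) / c) \<longlongrightarrow> norm (0 - 0 - 0 :: 'b) / c) (at x)"
    by (intro tendsto_intros t1 t2 t3) (use c in auto)
  then have t: "((\<lambda>z. norm (E1 z - E2 z - E3 z) / c) \<longlongrightarrow> 0) (at x)" by simp
  have ne: "\<forall>\<^sub>F z in at x. z \<noteq> x" by (simp add: eventually_at_filter)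
  have le: "\<forall>\<^sub>F z in at x. norm ((y z - y x - y' (z - x)) /\<^sub>R norm (z - x)) \<le> norm (E1 z - E2 z - E3 z) / c"
    using ev c(2) ne
  proof eventually_elim
    case (elim z)
    note lz = lin[OF elim(1)]
    have e3: "E3 z = (M z (y' (z - x)) - M x (y' (z - x))) /\<^sub>R norm (z - x)"
    proof -
      have l: "linear (\<lambda>h. M z (y' h) - M x (y' h))"
        using linear_compose_sub[OF linear_compose[OF ly lz] linear_compose[OF ly linx]] by (simp add: o_def)
      have "E3 z = (\<lambda>h. M z (y' h) - M x (y' h)) ((z - x) /\<^sub>R norm (z - x))"
        unfolding E3_def by (subst linear_expand[OF l]) simp
      then show ?thesis using linear_scale[OF l] by simp
    qed
    have "M z ((y z - y x - y' (z - x)) /\<^sub>R norm (z - x)) = (b z - M z (y x) - M z (y' (z - x))) /\<^sub>R norm (z - x)"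
      using lz sol[OF elim(1)] by (simp add: linear_scale linear_diff)
    also have "\<dots> = E1 z - E2 z - E3 z"
      unfolding E1_def E2_def e3 using y'[of "z - x"] sol[OF W(2)] 
      by (simp flip: scaleR_diff_right)
    finally have "c * norm ((y z - y x - y' (z - x)) /\<^sub>R norm (z - x)) \<le> norm (E1 z - E2 z - E3 z)"
      using elim(2) by (metis (no_types))
    then show ?case using c(1) by (simp add: pos_le_divide_eq mult.commute)
  qed
  have "((\<lambda>z. norm ((y z - y x - y' (z - x)) /\<^sub>R norm (z - x))) \<longlongrightarrow> 0) (at x)"
    by (rule tendsto_sandwich[OF _ le tendsto_const t]) auto
  then have "((\<lambda>z. (y z - y x - y' (z - x)) /\<^sub>R norm (z - x)) \<longlongrightarrow> 0) (at x)" by (rule tendsto_norm_zero_cancel)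
  then show ?thesis unfolding has_derivative_at_within using bl by simp
qed

text \<open>Bootstrapping: y' solves a system with the same matrix and a right-hand side that is C^k
  as soon as y is, so the induction hypothesis is used twice, for y and then for y'. Inverses of
  automorphisms and the lower Gauss factor become smooth through this lemma.\<close>

lemma Ck_linear_system:
  fixes M :: "'a::euclidean_space \<Rightarrow> 'b::euclidean_space \<Rightarrow> 'b"
  assumes "open W" "\<And>x. x \<in> W \<Longrightarrow> linear (M x)" "\<And>x. x \<in> W \<Longrightarrow> inj (M x)"
    "\<And>v. Ck k W (\<lambda>x. M x v)" "Ck k W b" "\<And>x. x \<in> W \<Longrightarrow> M x (y x) = b x"
  shows "Ck k W y"
  using assms
proof (induction k arbitrary: b y)
  case 0
  have "(y \<longlongrightarrow> y x) (at x)" if x: "x \<in> W" for x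
  proof (rule linear_system_tendsto)
    have ev: "\<forall>\<^sub>F z in at x. z \<in> W" using 0(1) x eventually_at_topological by blast
    show "\<forall>\<^sub>F i in at x. linear (M i)" "\<forall>\<^sub>F i in at x. M i (y i) = b i"
      using 0 by (auto intro: eventually_mono[OF ev])
    show "linear (M x)" "inj (M x)" using 0 x by auto
    show "((\<lambda>i. M i v) \<longlongrightarrow> M x v) (at x)" for v
      using 0(4)[of v] x 0(1) by (simp add: continuous_on_eq_continuous_at isCont_def)
    show "(b \<longlongrightarrow> M x (y x)) (at x)"
      using 0(5,6) x 0(1) by (simp add: continuous_on_eq_continuous_at isCont_def)
  qed
  then show ?case using 0(1) by (simp add: continuous_on_eq_continuous_at isCont_def)
next
  case (Suc k)
  note lin = Suc.prems(2) and inj = Suc.prems(3)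
  obtain b' where b': "\<And>x. x\<in>W \<Longrightarrow> (b has_derivative b' x) (at x)" "\<And>v. Ck k W (\<lambda>x. b' x v)"
    using Suc.prems(5) unfolding Ck.simps by blast
  have "\<forall>v. \<exists>f'. (\<forall>x\<in>W. ((\<lambda>x. M x v) has_derivative f' x) (at x)) \<and> (\<forall>h. Ck k W (\<lambda>x. f' x h))"
    using Suc.prems(4) by simp
  then obtain M' where "\<forall>v. (\<forall>x\<in>W. ((\<lambda>x. M x v) has_derivative M' v x) (at x)) \<and> (\<forall>h. Ck k W (\<lambda>x. M' v x h))"
    using choice[where Q="\<lambda>v f'. (\<forall>x\<in>W. ((\<lambda>x. M x v) has_derivative f' x) (at x)) \<and> (\<forall>h. Ck k W (\<lambda>x. f' x h))"] by blast
  then have M': "\<And>v x. x \<in> W \<Longrightarrow> ((\<lambda>x. M x v) has_derivative M' v x) (at x)" "\<And>v h. Ck k W (\<lambda>x. M' v x h)"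
    by auto
  define y' where "y' x h = inv (M x) (b' x h - M' (y x) x h)" for x h
  have My': "M x (y' x h) = b' x h - M' (y x) x h" if "x \<in> W" for x h
    unfolding y'_def using linear_injective_imp_surjective[OF lin inj, OF that that] by (simp add: surj_f_inv_f)
  \<comment> \<open>Each \<open>M' v\<close> was chosen separately; uniqueness of derivatives makes
    the choice linear in v, as \<open>Ck_apply\<close> needs in order to insert
    \<open>y x\<close>.\<close>
  have M'lin: "linear (\<lambda>v. M' v x h)" if x: "x \<in> W" for x h
  proof (rule linearI)
    have "((\<lambda>x. M x (u + v)) has_derivative (\<lambda>h. M' u x h + M' v x h)) (at x)" for u v
      by (rule has_derivative_transform_within_open[OF has_derivative_add[OF M'(1)[OF x, of u] M'(1)[OF x, of v]] Suc.prems(1) x])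
         (simp add: linear_add[OF lin])
    then show "M' (u + v) x h = M' u x h + M' v x h" for u v
      using has_derivative_unique[OF M'(1)[OF x]] by metis
    have "((\<lambda>x. M x (c *\<^sub>R v)) has_derivative (\<lambda>h. c *\<^sub>R M' v x h)) (at x)" for c v
      by (rule has_derivative_transform_within_open[OF has_derivative_scaleR_right[OF M'(1)[OF x, of v]] Suc.prems(1) x])
         (simp add: linear_scale[OF lin])
    then show "M' (c *\<^sub>R v) x h = c *\<^sub>R M' v x h" for c v
      using has_derivative_unique[OF M'(1)[OF x]] by metis
  qed
  have Mk: "Ck k W (\<lambda>x. M x v)" for v using Suc.prems(4) Ck_SucD by blast
  have yk: "Ck k W y" by (rule Suc.IH[OF Suc.prems(1-3) Mk Ck_SucD[OF Suc.prems(5)] Suc.prems(6)])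
  show ?case
  proof (rule Ck_SucI)
    show "(y has_derivative y' x) (at x)" if "x \<in> W" for x
      by (rule has_derivative_linear_system[OF Suc.prems(1) that lin inj M'(1)[OF that] b'(1)[OF that] Suc.prems(6) My'[OF that]])
    show "Ck k W (\<lambda>x. y' x v)" for v
    proof (rule Suc.IH[OF Suc.prems(1-3) Mk _ My'])
      have "Ck k W (\<lambda>x. M' (y x) x v)"
        by (rule Ck_apply[where g="\<lambda>x u. M' u x v", OF Suc.prems(1) M'lin M'(2) yk])
      then have "Ck k W (\<lambda>x. - M' (y x) x v)" by (rule Ck_linear_comp[OF linear_uminus])
      from Ck_add[OF b'(2)[of v] this] show "Ck k W (\<lambda>x. b' x v - M' (y x) x v)" by simp
    qed
  qed
qed

section \<open>Inverse functions and the passage to \<open>smooth_open\<close>\<close>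

lemma smooth_inverse_function:
  fixes f :: "'a::euclidean_space \<Rightarrow> 'a"
  assumes U: "open U" "x0 \<in> U" and f: "\<And>k. Ck k U f"
    and f0: "(f has_derivative f0) (at x0)" "inj f0"
  obtains U' V g where "open U'" "U' \<subseteq> U" "x0 \<in> U'" "open V" "f x0 \<in> V" "g ` V \<subseteq> U'" "\<And>y. y \<in> V \<Longrightarrow> f (g y) = y"
    "\<And>k. Ck k V g" "g (f x0) = x0"
proof -
  define f' where "f' x = frechet_derivative f (at x)" for x
  have der: "(f has_derivative f' x) (at x)" if "x \<in> U" for x
    unfolding f'_def
    by (rule Ck_SucE[OF f[of "Suc 0"]]) (use that frechet_derivative_works differentiable_def in blast)
  have f'k: "Ck k U (\<lambda>x. f' x v)" for k v
  proof -
    obtain d where d: "\<And>x. x\<in>U \<Longrightarrow> (f has_derivative d x) (at x)" "\<And>v. Ck k U (\<lambda>x. d x v)"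
      using f[of "Suc k"] by auto
    have "d x v = f' x v" if "x \<in> U" for x using has_derivative_unique[OF d(1) der] that by metis
    then show ?thesis by (rule Ck_cong[OF U(1) _ d(2)])
  qed
  define F where "F x = Blinfun (f' x)" for x
  have F: "blinfun_apply (F x) = f' x" if "x \<in> U" for x
    unfolding F_def using bounded_linear_Blinfun_apply has_derivative_bounded_linear[OF der[OF that]] by blast
  have cF: "continuous_on U F"
    by (rule continuous_on_blinfun_componentwise)
       (use Ck_imp_continuous_on[OF f'k] F in \<open>simp cong: continuous_on_cong\<close>)
  have f0': "f0 = f' x0" using has_derivative_unique[OF f0(1) der[OF U(2)]] .
  have lin0: "linear (f' x0)" using der[OF U(2)] has_derivative_linear by blast
  obtain i where i: "linear i" "i \<circ> f' x0 = id"
    using linear_injective_left_inverse[OF lin0] f0(2) f0' by blast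
  have "Blinfun i o\<^sub>L F x0 = id_blinfun"
  proof (rule blinfun_eqI)
    fix v
    have "i (f' x0 v) = v" using i(2) by (metis comp_apply id_apply)
    then show "blinfun_apply (Blinfun i o\<^sub>L F x0) v = blinfun_apply id_blinfun v"
      using i(1) by (simp add: F[OF U(2)] bounded_linear_Blinfun_apply linear_conv_bounded_linear)
  qed
  from inverse_function_theorem[OF U(1) _ cF U(2) this] der F
  obtain U' V g g' where *: "open U'" "U' \<subseteq> U" "x0 \<in> U'" "open V" "f x0 \<in> V" "homeomorphism U' V f g"
    "\<And>y. y \<in> V \<Longrightarrow> (g has_derivative (g' y)) (at y)"
    "\<And>y. y \<in> V \<Longrightarrow> g' y = inv (blinfun_apply (F(g y)))"
    "\<And>y. y \<in> V \<Longrightarrow> bij (blinfun_apply (F(g y)))" by metis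
  have gV: "g ` V = U'" and fg: "\<And>y. y \<in> V \<Longrightarrow> f (g y) = y" and gf: "g (f x0) = x0"
    using *(3,6) by (auto simp: homeomorphism_def)
  have gU: "g y \<in> U" if "y \<in> V" for y using gV *(2) that by auto
  \<comment> \<open>The inverse function theorem gives one derivative. Higher ones come from the
    linear system \<open>f' (g y) (g' y v) = v\<close>, whose matrix is C^k once g is.\<close>
  have "Ck k V g" for k
  proof (induction k)
    case 0 show ?case using *(6) by (simp add: homeomorphism_def)
  next
    case (Suc k)
    show ?case
    proof (rule Ck_SucI[OF *(7)])
      show "Ck k V (\<lambda>y. g' y v)" for v
      proof (rule Ck_linear_system[where M="\<lambda>y. f' (g y)" and b="\<lambda>y. v", OF *(4)])
        fix y assume y: "y \<in> V"
        show "linear (f' (g y))" using der[OF gU[OF y]] has_derivative_linear by blast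
        show "inj (f' (g y))" using *(9)[OF y] F[OF gU[OF y]] by (simp add: bij_is_inj)
        show "f' (g y) (g' y v) = v" using *(8,9)[OF y] F[OF gU[OF y]] 
          by (simp add: bij_is_surj surj_f_inv_f)
      next
        show "Ck k V (\<lambda>y. f' (g y) u)" for u
          by (rule Ck_compose[OF *(4) Suc f'k _ U(1)]) (use gU in auto)
      qed (rule Ck_const)
    qed
  qed
  then show ?thesis using that[OF *(1-5) _ fg] gV gf by blast
qed

text \<open>\<open>Ck k\<close> supplies a derivative for each k separately;
  \<open>frechet_derivative\<close> is one choice serving every order, which the single D of
  \<open>smooth_open\<close> requires.\<close>

lemma smooth_open_of_Ck:
  assumes W: "open W" and f: "\<And>k. Ck k W f"
  shows "smooth_open W f"
proof -
  define D where "D = rec_list f (\<lambda>v vs F x. frechet_derivative F (at x) v)"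
  have D0: "D [] = f" and DS: "D (v # vs) = (\<lambda>x. frechet_derivative (D vs) (at x) v)" for v vs
    by (auto simp: D_def)
  have key: "(h has_derivative frechet_derivative h (at x)) (at x)" "Ck k W (\<lambda>x. frechet_derivative h (at x) v)"
    if h: "\<And>k. Ck k W h" and "x \<in> W" for h :: "'a \<Rightarrow> 'b" and x k v
  proof -
    have works: "(h has_derivative frechet_derivative h (at x)) (at x)" if "x \<in> W" for x
      by (rule Ck_SucE[OF h[of "Suc 0"]]) (use that frechet_derivative_works differentiable_def in blast)
    obtain d where d: "\<And>x. x\<in>W \<Longrightarrow> (h has_derivative d x) (at x)" "\<And>v. Ck k W (\<lambda>x. d x v)"
      using h[of "Suc k"] by auto
    have "d x v = frechet_derivative h (at x) v" if "x \<in> W" for x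
      using has_derivative_unique[OF d(1) works] that by metis
    then show "Ck k W (\<lambda>x. frechet_derivative h (at x) v)" by (rule Ck_cong[OF W _ d(2)])
    show "(h has_derivative frechet_derivative h (at x)) (at x)" using works \<open>x \<in> W\<close> .
  qed
  have Dk: "Ck k W (D vs)" for k vs
  proof (induction vs arbitrary: k)
    case Nil show ?case using f D0 by simp
  next
    case (Cons v vs)
    show ?case unfolding DS
    proof (cases "W = {}")
      case True
      show "Ck k W (\<lambda>x. frechet_derivative (D vs) (at x) v)"
        by (rule Ck_cong[OF W _ Ck_const[of k W 0]]) (use True in auto)
    qed (use key(2)[OF Cons.IH] in auto)
  qed
  show ?thesis unfolding smooth_open_def
  proof (intro conjI exI[of _ D] allI ballI)
    show "continuous_on W (D vs)" for vs using Ck_imp_continuous_on Dk by blast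
    fix v vs x assume x: "x \<in> W"
    have 1: "(D vs has_derivative frechet_derivative (D vs) (at x)) (at (x + 0 *\<^sub>R v))"
      using key(1)[OF Dk x] by simp
    have 2: "((\<lambda>t. x + t *\<^sub>R v) has_derivative (\<lambda>t. t *\<^sub>R v)) (at 0)"
      by (auto intro!: derivative_eq_intros)
    have "((\<lambda>t. D vs (x + t *\<^sub>R v)) has_derivative (\<lambda>t. frechet_derivative (D vs) (at x) (t *\<^sub>R v))) (at 0)"
      using has_derivative_compose[OF 2 1] by simp
    then show "((\<lambda>t. D vs (x + t *\<^sub>R v)) has_vector_derivative D (v # vs) x) (at 0)"
      unfolding has_vector_derivative_def DS
      using linear_scale[OF has_derivative_linear[OF key(1)[OF Dk x]]] by simp
  qed (use W D0 in auto)
qed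

lemma Ck_Pair:
  assumes "Ck k W f" "Ck k W g" shows "Ck k W (\<lambda>x. (f x, g x))"
proof -
  have "linear (\<lambda>u. (u, 0))" "linear (\<lambda>u. (0, u))" by (auto intro!: linearI)
  then have "Ck k W (\<lambda>x. (f x, 0))" "Ck k W (\<lambda>x. (0, g x))"
    using Ck_linear_comp[OF _ assms(1)] Ck_linear_comp[OF _ assms(2)] by fast+
  from Ck_add[OF this] show ?thesis by simp
qed

lemma Ck_diff: assumes "Ck k W f" "Ck k W g" shows "Ck k W (\<lambda>x. f x - g x)"
  using Ck_add[OF assms(1) Ck_linear_comp[OF linear_uminus assms(2)]] by simp

section \<open>Exponentials of linear maps\<close>

lemma linear_funpow: "linear L \<Longrightarrow> linear ((L ^^ n) :: 'a::real_vector \<Rightarrow> 'a)"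
  by (induction n) (auto intro: linear_compose simp: id_def[symmetric] linear_id)

lemma funpow_scaleR:
  fixes L :: "'a::real_vector \<Rightarrow> 'a"
  assumes "linear L" shows "((\<lambda>x. t *\<^sub>R L x) ^^ n) y = t ^ n *\<^sub>R (L ^^ n) y"
  by (induction n) (simp_all add: linear_scale[OF assms])

lemma linear_scaleR_comp: "linear L \<Longrightarrow> linear (\<lambda>x. t *\<^sub>R L x)"
  using linear_compose_scale_right by blast

lemma expop_summable_norm:
  fixes L :: "'g::euclidean_space \<Rightarrow> 'g"
  assumes "linear L"
  shows "summable (\<lambda>n. norm ((1 / fact n) *\<^sub>R (L ^^ n) y))"
proof (rule summable_comparison_test')
  have B: "bounded_linear L" using assms linear_conv_bounded_linear by blast
  have le: "norm ((L ^^ n) y) \<le> onorm L ^ n * norm y" for n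
  proof (induction n)
    case (Suc n)
    have "norm ((L ^^ Suc n) y) \<le> onorm L * norm ((L ^^ n) y)" using onorm[OF B] by simp
    also have "\<dots> \<le> onorm L * (onorm L ^ n * norm y)" using Suc onorm_pos_le[OF B] mult_left_mono by blast
    finally show ?case by (simp add: mult_ac)
  qed simp
  show "norm (norm ((1 / fact n) *\<^sub>R (L ^^ n) y)) \<le> (inverse (fact n) * onorm L ^ n) * norm y" for n
    using le[of n] by (simp add: divide_simps)
  show "summable (\<lambda>n. inverse (fact n) * onorm L ^ n * norm y)"
    by (intro summable_mult2 summable_exp)
qed

lemma expop_summable:
  fixes L :: "'g::euclidean_space \<Rightarrow> 'g"
  shows "linear L \<Longrightarrow> summable (\<lambda>n. (1 / fact n) *\<^sub>R (L ^^ n) y)"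
  by (intro summable_norm_cancel[where f="\<lambda>n. (1 / fact n) *\<^sub>R (L ^^ n) y"] expop_summable_norm)

lemma expop_intertwine:
  fixes L :: "'g::euclidean_space \<Rightarrow> 'g" and L' :: "'h::euclidean_space \<Rightarrow> 'h"
  assumes "linear g" "linear L" "\<And>x. g (L x) = L' (g x)"
  shows "g (expop L y) = expop L' (g y)"
proof -
  have g: "bounded_linear g" using assms(1) linear_conv_bounded_linear by blast
  have "g ((L ^^ n) y) = (L' ^^ n) (g y)" for n by (induction n) (auto simp: assms(3))
  then show ?thesis unfolding expop_def bounded_linear.suminf[OF g expop_summable[OF assms(2)]]
    by (simp add: linear_scale[OF assms(1)])
qed

lemma linear_expop:
  fixes L :: "'g::euclidean_space \<Rightarrow> 'g"
  assumes "linear L" shows "linear (expop L)"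
proof (rule linearI)
  note l = linear_funpow[OF assms]
  show "expop L (x + y) = expop L x + expop L y" for x y
    unfolding expop_def
    by (simp add: linear_add[OF l] scaleR_add_right suminf_add[OF expop_summable expop_summable, OF assms assms])
  show "expop L (c *\<^sub>R x) = c *\<^sub>R expop L x" for c x
    by (rule expop_intertwine[OF _ assms, symmetric]) (auto simp: linear_scale[OF assms] linear_iff algebra_simps)
qed

text \<open>Componentwise the exponential is an everywhere convergent real power series in t,
  differentiated term by term.\<close>

lemma expop_has_vector_derivative:
  fixes L :: "'g::euclidean_space \<Rightarrow> 'g"
  assumes L: "linear L"
  shows "((\<lambda>t. expop (\<lambda>x. t *\<^sub>R L x) y) has_vector_derivative expop (\<lambda>x. t *\<^sub>R L x) (L y)) (at t)"
proof -
  have comp: "expop (\<lambda>x. t *\<^sub>R L x) y \<bullet> b = (\<Sum>n. ((L ^^ n) y \<bullet> b) / fact n * t ^ n)"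
    "summable (\<lambda>n. ((L ^^ n) y \<bullet> b) / fact n * t ^ n)" for t y b
  proof -
    note s = expop_summable[OF linear_scaleR_comp[OF L, of t], of y]
    have "expop (\<lambda>x. t *\<^sub>R L x) y \<bullet> b = (\<Sum>n. ((1 / fact n) *\<^sub>R ((\<lambda>x. t *\<^sub>R L x) ^^ n) y) \<bullet> b)"
      unfolding expop_def by (rule bounded_linear.suminf[OF bounded_linear_inner_left s])
    then show "expop (\<lambda>x. t *\<^sub>R L x) y \<bullet> b = (\<Sum>n. ((L ^^ n) y \<bullet> b) / fact n * t ^ n)"
      by (simp add: funpow_scaleR[OF L] mult_ac)
    show "summable (\<lambda>n. ((L ^^ n) y \<bullet> b) / fact n * t ^ n)"
      using bounded_linear.summable[OF bounded_linear_inner_left s, of b] by (simp add: funpow_scaleR[OF L] mult_ac)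
  qed
  have "((\<lambda>t. expop (\<lambda>x. t *\<^sub>R L x) y \<bullet> b) has_real_derivative expop (\<lambda>x. t *\<^sub>R L x) (L y) \<bullet> b) (at t)" for b
  proof -
    have "((\<lambda>t. \<Sum>n. ((L ^^ n) y \<bullet> b) / fact n * t ^ n) has_real_derivative
        (\<Sum>n. diffs (\<lambda>n. ((L ^^ n) y \<bullet> b) / fact n) n * t ^ n)) (at t)"
      by (rule termdiffs_strong_converges_everywhere) (rule comp(2))
    moreover have "diffs (\<lambda>n. ((L ^^ n) y \<bullet> b) / fact n) n = ((L ^^ n) (L y) \<bullet> b) / fact n" for n
      by (simp add: diffs_def funpow_swap1 divide_simps)
    ultimately show ?thesis by (simp add: comp(1))
  qed
  then show ?thesis unfolding has_vector_derivative_def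
    by (subst has_derivative_componentwise_within)
       (auto simp: has_field_derivative_def mult.commute[of _ "_ \<bullet> _"] elim!: has_derivative_eq_rhs)
qed

lemma expop_0: "expop (\<lambda>x. 0) y = (y::'g::euclidean_space)"
proof -
  have "((\<lambda>x::'g. 0::'g) ^^ n) y = 0" if "n \<notin> {0::nat}" for n using that by (cases n) auto
  then show ?thesis unfolding expop_def by (subst suminf_finite[of "{0}"]) auto
qed

lemma expop_apply_has_vector_derivative:
  fixes L :: "'g::euclidean_space \<Rightarrow> 'g"
  assumes L: "linear L" and w: "(w has_vector_derivative w') (at t)"
  shows "((\<lambda>t. expop (\<lambda>x. t *\<^sub>R L x) (w t)) has_vector_derivative expop (\<lambda>x. t *\<^sub>R L x) (L (w t) + w')) (at t)"
proof -
  define E where "E t = expop (\<lambda>x. t *\<^sub>R L x)" for t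
  have lE: "linear (E t)" for t unfolding E_def by (rule linear_expop[OF linear_scaleR_comp[OF L]])
  have c: "((\<lambda>t. w t \<bullet> b) has_real_derivative w' \<bullet> b) (at t)" for b
    using bounded_linear.has_vector_derivative[OF bounded_linear_inner_left w]
    by (simp add: has_real_derivative_iff_has_vector_derivative)
  have "((\<lambda>t. \<Sum>b\<in>Basis. (w t \<bullet> b) *\<^sub>R E t b) has_vector_derivative
      (\<Sum>b\<in>Basis. (w t \<bullet> b) *\<^sub>R E t (L b) + (w' \<bullet> b) *\<^sub>R E t b)) (at t)"
    by (intro has_vector_derivative_sum has_vector_derivative_scaleR c)
       (simp add: E_def expop_has_vector_derivative[OF L])
  moreover have "(\<lambda>t. \<Sum>b\<in>Basis. (w t \<bullet> b) *\<^sub>R E t b) = (\<lambda>t. E t (w t))"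
    by (rule ext) (rule linear_expand[OF lE, symmetric])
  moreover have "(\<Sum>b\<in>Basis. (w t \<bullet> b) *\<^sub>R E t (L b) + (w' \<bullet> b) *\<^sub>R E t b) = E t (L (w t) + w')"
    using linear_expand[OF linear_compose[OF L lE[of t]], of "w t"] linear_expand[OF lE[of t], of w']
    by (simp add: sum.distrib linear_add[OF lE])
  ultimately show ?thesis by (simp add: E_def)
qed

lemma vector_derivative_0_const:
  fixes f :: "real \<Rightarrow> 'g::euclidean_space"
  assumes "\<And>t. (f has_vector_derivative 0) (at t)" shows "f t = f 0"
proof -
  obtain c where "\<And>x. x \<in> UNIV \<Longrightarrow> f x = c"
    by (rule has_vector_derivative_zero_constant[of UNIV f]) (use assms in auto)
  then show ?thesis by simp
qed

lemma expop_uminus_cancel: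
  fixes L :: "'g::euclidean_space \<Rightarrow> 'g"
  assumes L: "linear L"
  shows "expop (\<lambda>x. t *\<^sub>R - L x) (expop (\<lambda>x. t *\<^sub>R L x) y) = y"
proof -
  have comm: "L (expop (\<lambda>x. t *\<^sub>R L x) y) = expop (\<lambda>x. t *\<^sub>R L x) (L y)" for t y
    by (rule expop_intertwine[OF L linear_scaleR_comp[OF L]]) (simp add: linear_scale[OF L])
  have mL: "linear (\<lambda>x. - L x)" using L by (rule linear_compose_neg)
  have z: "expop (\<lambda>x. - (t *\<^sub>R L x)) 0 = 0" for t
    using linear_0[OF linear_expop[OF linear_scaleR_comp[OF mL, of t]]] by simp
  have "((\<lambda>t. expop (\<lambda>x. t *\<^sub>R - L x) (expop (\<lambda>x. t *\<^sub>R L x) y)) has_vector_derivative 0) (at t)" for t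
    using expop_apply_has_vector_derivative[OF mL expop_has_vector_derivative[OF L, of y t]]
    by (simp add: comm z)
  from vector_derivative_0_const[OF this, of t] show ?thesis by (simp add: expop_0)
qed

text \<open>Applying the exponential of -tL to w gives a constant. The identities for exponentials
  that follow are obtained by recognizing one side as a solution of the linear equation solved by
  the other.\<close>

lemma linear_ode_unique:
  fixes L :: "'g::euclidean_space \<Rightarrow> 'g"
  assumes L: "linear L" and w: "\<And>t. (w has_vector_derivative L (w t)) (at t)"
  shows "w t = expop (\<lambda>x. t *\<^sub>R L x) (w 0)"
proof -
  have mL: "linear (\<lambda>x. - L x)" using L by (rule linear_compose_neg)
  have z: "expop (\<lambda>x. - (t *\<^sub>R L x)) 0 = 0" for t
    using linear_0[OF linear_expop[OF linear_scaleR_comp[OF mL, of t]]] by simp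
  have "((\<lambda>t. expop (\<lambda>x. t *\<^sub>R - L x) (w t)) has_vector_derivative 0) (at t)" for t
    using expop_apply_has_vector_derivative[OF mL w] by (simp add: z)
  from vector_derivative_0_const[OF this, of t]
  have "expop (\<lambda>x. t *\<^sub>R - L x) (w t) = w 0" by (simp add: expop_0)
  then show ?thesis using expop_uminus_cancel[OF mL, of t "w t"] by simp
qed

lemma expop_add:
  fixes L M :: "'g::euclidean_space \<Rightarrow> 'g"
  assumes L: "linear L" and M: "linear M" and c: "\<And>x. L (M x) = M (L x)"
  shows "expop (\<lambda>x. L x + M x) y = expop L (expop M y)"
proof -
  define w where "w t = expop (\<lambda>x. t *\<^sub>R L x) (expop (\<lambda>x. t *\<^sub>R M x) y)" for t
  have "(w has_vector_derivative L (w t) + M (w t)) (at t)" for t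
  proof -
    have "(w has_vector_derivative expop (\<lambda>x. t *\<^sub>R L x) (L (expop (\<lambda>x. t *\<^sub>R M x) y) + expop (\<lambda>x. t *\<^sub>R M x) (M y))) (at t)"
      unfolding w_def by (rule expop_apply_has_vector_derivative[OF L expop_has_vector_derivative[OF M]])
    moreover have "L (w t) = expop (\<lambda>x. t *\<^sub>R L x) (L (expop (\<lambda>x. t *\<^sub>R M x) y))"
      unfolding w_def by (rule expop_intertwine[OF L linear_scaleR_comp[OF L]]) (simp add: linear_scale[OF L])
    moreover have "M (w t) = expop (\<lambda>x. t *\<^sub>R L x) (M (expop (\<lambda>x. t *\<^sub>R M x) y))"
      unfolding w_def by (rule expop_intertwine[OF M linear_scaleR_comp[OF L]]) (simp add: linear_scale[OF M] c)
    moreover have "M (expop (\<lambda>x. t *\<^sub>R M x) y) = expop (\<lambda>x. t *\<^sub>R M x) (M y)"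
      by (rule expop_intertwine[OF M linear_scaleR_comp[OF M]]) (simp add: linear_scale[OF M])
    ultimately show ?thesis by (simp add: linear_add[OF linear_expop[OF linear_scaleR_comp[OF L]]])
  qed
  from linear_ode_unique[OF linear_compose_add[OF L M] this, of 1]
  show ?thesis by (simp add: w_def expop_0)
qed

lemma expop_inverse:
  fixes L :: "'g::euclidean_space \<Rightarrow> 'g"
  assumes "linear L"
  shows "expop (\<lambda>x. - L x) (expop L y) = y" "expop L (expop (\<lambda>x. - L x) y) = y"
  using expop_uminus_cancel[OF assms, of 1] expop_uminus_cancel[OF linear_compose_neg[OF assms], of 1] by auto

lemma expop_derivation:
  fixes D :: "'g::euclidean_space \<Rightarrow> 'g"
  assumes D: "linear D" and b: "bounded_bilinear b" and der: "\<And>x y. D (b x y) = b (D x) y + b x (D y)"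
  shows "expop D (b x y) = b (expop D x) (expop D y)"
proof -
  define w where "w t = b (expop (\<lambda>x. t *\<^sub>R D x) x) (expop (\<lambda>x. t *\<^sub>R D x) y)" for t
  have comm: "D (expop (\<lambda>x. t *\<^sub>R D x) y) = expop (\<lambda>x. t *\<^sub>R D x) (D y)" for t y
    by (rule expop_intertwine[OF D linear_scaleR_comp[OF D]]) (simp add: linear_scale[OF D])
  have "(w has_vector_derivative D (w t)) (at t)" for t
    unfolding w_def
    by (rule has_vector_derivative_eq_rhs[OF bounded_bilinear.has_vector_derivative[OF b expop_has_vector_derivative[OF D] expop_has_vector_derivative[OF D]]])
       (simp add: der comm add.commute)
  from linear_ode_unique[OF D this, of 1] show ?thesis by (simp add: w_def expop_0)
qed

text \<open>Subspaces are closed, so the tail of the exponential series stays in S. With m = 1 and m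
  = 2 this controls unipotent maps modulo higher degrees; with S = {0} it makes the exponential of a
  nilpotent map a finite sum.\<close>

lemma expop_minus_partial_sum_mem:
  fixes L :: "'g::euclidean_space \<Rightarrow> 'g"
  assumes L: "linear L" and S: "subspace S" "\<And>n. n \<ge> m \<Longrightarrow> (L ^^ n) y \<in> S"
  shows "expop L y - (\<Sum>n<m. (1 / fact n) *\<^sub>R (L ^^ n) y) \<in> S"
proof -
  let ?f = "\<lambda>n. (1 / fact n) *\<^sub>R (L ^^ n) y"
  have s: "summable (\<lambda>n. ?f (n + m))" by (rule summable_ignore_initial_segment[OF expop_summable[OF L]])
  have "(\<lambda>k. \<Sum>n<k. ?f (n + m)) \<longlonglongrightarrow> (\<Sum>n. ?f (n + m))" using summable_LIMSEQ[OF s] .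
  moreover have "(\<Sum>n<k. ?f (n + m)) \<in> S" for k
    by (intro subspace_sum S(1) subspace_scale S(2)) auto
  ultimately have "(\<Sum>n. ?f (n + m)) \<in> S" using closed_subspace[OF S(1)] 
    unfolding closed_sequential_limits by (elim allE[of _ "\<lambda>k. \<Sum>n<k. ?f (n + m)"] allE[of _ "\<Sum>n. ?f (n + m)"]) blast
  moreover have "(\<Sum>n. ?f (n + m)) = expop L y - (\<Sum>n<m. ?f n)"
    unfolding expop_def by (rule suminf_minus_initial_segment[OF expop_summable[OF L]])
  ultimately show ?thesis by simp
qed

lemma expop_eigenvector:
  fixes L :: "'g::euclidean_space \<Rightarrow> 'g"
  assumes L: "linear L" and y: "L y = c *\<^sub>R y"
  shows "expop L y = exp c *\<^sub>R y"
proof -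
  have "((\<lambda>t. exp (t * c) *\<^sub>R y) has_vector_derivative L (exp (t * c) *\<^sub>R y)) (at t)" for t
    by (auto intro!: derivative_eq_intros simp: linear_scale[OF L] y)
  from linear_ode_unique[OF L this, of 1] show ?thesis by simp
qed

section \<open>Cartan involutions and restricted root vectors\<close>

definition lin_trace :: "('g::euclidean_space \<Rightarrow> 'g) \<Rightarrow> real" where
  "lin_trace f = (\<Sum>b\<in>Basis. f b \<bullet> b)"

lemma lin_trace_swap:
  fixes f g :: "'g::euclidean_space \<Rightarrow> 'g"
  assumes "linear f" "linear g"
  shows "lin_trace (\<lambda>x. f (g x)) = lin_trace (\<lambda>x. g (f x))"
proof -
  have e: "lin_trace (\<lambda>x. f (g x)) = (\<Sum>b\<in>Basis. \<Sum>c\<in>Basis. (g b \<bullet> c) * (f c \<bullet> b))" if "linear f" for f g :: "'g \<Rightarrow> 'g"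
    unfolding lin_trace_def by (subst linear_expand[OF that]) (simp add: inner_sum_left)
  show ?thesis unfolding e[OF assms(1)] e[OF assms(2)] by (subst sum.swap) (simp add: mult.commute)
qed

lemma lin_trace_add: "lin_trace (\<lambda>x. f x + g x) = lin_trace f + lin_trace g"
  and lin_trace_diff: "lin_trace (\<lambda>x. f x - g x) = lin_trace f - lin_trace g"
  and lin_trace_scale: "lin_trace (\<lambda>x. c *\<^sub>R f x) = c * lin_trace f"
  by (simp_all add: lin_trace_def inner_add_left inner_diff_left sum.distrib sum_subtractf sum_distrib_left)

lemma quadratic_nonneg_linear_coeff:
  assumes "\<And>t::real. 0 \<le> 2 * t * p + t^2 * q" shows "p = 0"
proof (rule ccontr)
  assume p: "p \<noteq> 0"
  \<comment> \<open>Replacing q by the larger positive number Q gives a quadratic minimized at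
    \<open>t = - p / Q\<close>; the added 1 keeps Q positive when q = 0.\<close>
  define Q where "Q = \<bar>q\<bar> + 1"
  have Q: "Q > 0" "q \<le> Q" unfolding Q_def by auto
  have "0 \<le> 2 * (- p / Q) * p + (- p / Q)^2 * q" using assms .
  also have "\<dots> \<le> 2 * (- p / Q) * p + (- p / Q)^2 * Q" using Q by (intro add_left_mono mult_left_mono) auto
  also have "\<dots> = - (p^2 / Q)" using Q by (simp add: field_simps power2_eq_square)
  finally show False using p Q by (simp add: divide_le_0_iff)
qed

text \<open>The Euclidean product of the ambient type serves for topology, traces and the coding of
  functionals. The product adapted to the bracket is another one, so the spectral theorem is
  developed for an arbitrary positive definite form.\<close>

locale pos_def_form =
  fixes ip :: "'g::euclidean_space \<Rightarrow> 'g \<Rightarrow> real"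
  assumes ip_lin: "linear (\<lambda>x. ip x y)" and ip_sym: "ip x y = ip y x"
    and ip_pos: "x \<noteq> 0 \<Longrightarrow> ip x x > 0"
begin

lemma ip_lin2: "linear (ip x)"
proof -
  have "ip x = (\<lambda>y. ip y x)" by (rule ext) (rule ip_sym)
  then show ?thesis using ip_lin[of x] by simp
qed

lemmas ip_simps = linear_add[OF ip_lin] linear_add[OF ip_lin2] linear_diff[OF ip_lin] linear_diff[OF ip_lin2]
  linear_scale[OF ip_lin] linear_scale[OF ip_lin2] linear_0[OF ip_lin] linear_0[OF ip_lin2]
  linear_neg[OF ip_lin] linear_neg[OF ip_lin2] linear_sum[OF ip_lin] linear_sum[OF ip_lin2]

lemma ip_eq0: "ip x x = 0 \<longleftrightarrow> x = 0"
  using ip_pos[of x] linear_0[OF ip_lin[of x]] by (cases "x = 0") auto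

lemma ip_bounded_bilinear: "bounded_bilinear ip"
  by (rule bilinear_conv_bounded_bilinear[THEN iffD1]) (simp add: bilinear_def ip_lin ip_lin2)

text \<open>Take a maximizer of the Rayleigh quotient on the compact Euclidean unit sphere of V. The
  first-order condition makes \<open>c *\<^sub>R v - f v\<close> orthogonal to V, to which it
  belongs.\<close>

lemma eigenvector_exists:
  assumes V: "subspace V" "V \<noteq> {0}" and f: "linear f" "f ` V \<subseteq> V" and sym: "\<And>x y. ip (f x) y = ip x (f y)"
  shows "\<exists>v\<in>V. v \<noteq> 0 \<and> (\<exists>c. f v = c *\<^sub>R v)"
proof -
  have contf: "continuous_on S f" for S using f(1) by (simp add: linear_continuous_on linear_conv_bounded_linear)
  have cont1: "continuous_on S (\<lambda>v. ip v v)" for S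
    by (intro bounded_bilinear.continuous_on[OF ip_bounded_bilinear] continuous_intros)
  have cont2: "continuous_on S (\<lambda>v. ip (f v) v)" for S
    by (intro bounded_bilinear.continuous_on[OF ip_bounded_bilinear] contf continuous_intros)
  obtain u where u: "u \<in> V" "u \<noteq> 0" using V subspace_0[of V] by auto
  let ?K = "V \<inter> sphere 0 1"
  have K: "compact ?K" using closed_subspace[OF V(1)] by (simp add: closed_Int_compact)
  have "(1 / norm u) *\<^sub>R u \<in> ?K" using u V(1) by (simp add: subspace_scale)
  then have ne: "?K \<noteq> {}" by blast
  have pos: "ip v v > 0" if "v \<in> ?K" for v using that by (intro ip_pos) auto
  have "continuous_on ?K (\<lambda>v. ip (f v) v / ip v v)"
    by (intro continuous_on_divide cont1 cont2) (use pos in \<open>metis less_irrefl\<close>)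
  then obtain v where v: "v \<in> ?K" "\<And>w. w \<in> ?K \<Longrightarrow> ip (f w) w / ip w w \<le> ip (f v) v / ip v v"
    using continuous_attains_sup[OF K ne] by blast
  define c where "c = ip (f v) v / ip v v"
  have le: "ip (f w) w \<le> c * ip w w" if "w \<in> V" for w
  proof (cases "w = 0")
    case False
    let ?w = "(1 / norm w) *\<^sub>R w"
    have "?w \<in> ?K" using False that V(1) by (simp add: subspace_scale)
    then have "ip (f ?w) ?w \<le> c * ip ?w ?w" using v(2)[of ?w] pos[of ?w] unfolding c_def by (simp only: pos_divide_le_eq)
    then have "(1 / norm w)^2 * ip (f w) w \<le> (1 / norm w)^2 * (c * ip w w)"
      by (simp add: linear_scale[OF f(1)] ip_simps power2_eq_square mult_ac)
    then show ?thesis using False by (simp add: mult_le_cancel_left_pos)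
  qed (simp add: linear_0[OF f(1)] ip_simps)
  have vV: "v \<in> V" and v0: "v \<noteq> 0" using v(1) by auto
  have eqv: "ip (f v) v = c * ip v v" unfolding c_def using pos[OF v(1)] by simp
  have orth: "ip (c *\<^sub>R v - f v) w = 0" if w: "w \<in> V" for w
  proof (rule quadratic_nonneg_linear_coeff)
    fix t :: real
    have "v + t *\<^sub>R w \<in> V" using vV w V(1) by (simp add: subspace_add subspace_scale)
    from le[OF this] show "0 \<le> 2 * t * ip (c *\<^sub>R v - f v) w + t^2 * (c * ip w w - ip (f w) w)"
      using sym[of w v] ip_sym[of w v] eqv ip_sym[of w "f v"]
      by (simp add: linear_add[OF f(1)] linear_scale[OF f(1)] ip_simps power2_eq_square algebra_simps)
  qed
  have "c *\<^sub>R v - f v \<in> V" using vV f(2) V(1) by (auto intro: subspace_diff subspace_scale)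
  then have "c *\<^sub>R v - f v = 0" using orth ip_eq0 by blast
  then have "f v = c *\<^sub>R v" by simp
  then show ?thesis using vV v0 by blast
qed

text \<open>In a nonzero invariant subspace of least dimension, an eigenspace of f is invariant by
  commutation and hence is everything, so every f acts there by a scalar. F may be infinite.\<close>

lemma common_eigenvector_exists:
  assumes F: "\<And>f. f \<in> F \<Longrightarrow> linear f" "\<And>f x y. f \<in> F \<Longrightarrow> ip (f x) y = ip x (f y)"
    "\<And>f g x. f \<in> F \<Longrightarrow> g \<in> F \<Longrightarrow> f (g x) = g (f x)"
    and W: "subspace W" "W \<noteq> {0}" "\<And>f. f \<in> F \<Longrightarrow> f ` W \<subseteq> W"
  shows "\<exists>x\<in>W. x \<noteq> 0 \<and> (\<forall>f\<in>F. \<exists>c. f x = c *\<^sub>R x)"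
proof -
  define P where "P V \<longleftrightarrow> subspace V \<and> V \<noteq> {0} \<and> V \<subseteq> W \<and> (\<forall>f\<in>F. f ` V \<subseteq> V)" for V
  have "P W" using W unfolding P_def by auto
  then obtain V where V: "P V" "\<And>V'. P V' \<Longrightarrow> dim V \<le> dim V'"
    using ex_has_least_nat[of P W dim] by blast
  have "\<exists>c. \<forall>x\<in>V. f x = c *\<^sub>R x" if f: "f \<in> F" for f
  proof -
    obtain v c where v: "v \<in> V" "v \<noteq> 0" "f v = c *\<^sub>R v"
      using eigenvector_exists[of V f] V(1) F(1,2)[OF f] f unfolding P_def by blast
    let ?V = "{x\<in>V. f x = c *\<^sub>R x}"
    have sub: "subspace ?V" using V(1) F(1)[OF f] unfolding P_def subspace_def
      by (auto simp: linear_0 linear_add linear_scale algebra_simps)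
    have "P ?V" unfolding P_def
    proof (intro conjI sub ballI)
      show "?V \<noteq> {0}" using v by blast
      show "?V \<subseteq> W" using V(1) unfolding P_def by auto
      fix g assume g: "g \<in> F"
      show "g ` ?V \<subseteq> ?V" using V(1) g F(3)[OF f g] unfolding P_def
        by (auto simp: linear_scale[OF F(1)[OF g]] image_subset_iff)
    qed
    then have "?V = V" using subspace_dim_equal[OF sub, of V] V unfolding P_def by auto
    then show ?thesis by blast
  qed
  moreover obtain x where "x \<in> V" "x \<noteq> 0" using V(1) subspace_0[of V] unfolding P_def by auto
  moreover have "x \<in> W" using V(1) \<open>x \<in> V\<close> unfolding P_def by auto
  ultimately show ?thesis by (intro bexI[of _ x]) auto
qed

text \<open>Take a maximal orthonormal set of common eigenvectors: symmetry makes its orthogonal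
  complement invariant, and a nonzero complement would contain a further one.\<close>

lemma orthonormal_eigenbasis:
  assumes F: "\<And>f. f \<in> F \<Longrightarrow> linear f" "\<And>f x y. f \<in> F \<Longrightarrow> ip (f x) y = ip x (f y)"
    "\<And>f g x. f \<in> F \<Longrightarrow> g \<in> F \<Longrightarrow> f (g x) = g (f x)"
  obtains \<beta> where "finite \<beta>" "\<And>b c. b \<in> \<beta> \<Longrightarrow> c \<in> \<beta> \<Longrightarrow> ip b c = (if b = c then 1 else 0)"
    "\<And>x. x = (\<Sum>b\<in>\<beta>. ip x b *\<^sub>R b)" "\<And>b f. b \<in> \<beta> \<Longrightarrow> f \<in> F \<Longrightarrow> \<exists>c. f b = c *\<^sub>R b"
proof -
  define P where "P \<beta> \<longleftrightarrow> finite \<beta> \<and> (\<forall>b\<in>\<beta>. \<forall>c\<in>\<beta>. ip b c = (if b = c then 1 else 0)) \<and> (\<forall>b\<in>\<beta>. \<forall>f\<in>F. \<exists>c. f b = c *\<^sub>R b)" for \<beta>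
  have bound: "card \<beta> \<le> DIM('g)" if "P \<beta>" for \<beta>
  proof -
    have "independent \<beta>"
    proof (rule independent_if_scalars_zero)
      show "finite \<beta>" using that unfolding P_def by blast
      fix u b assume u: "(\<Sum>x\<in>\<beta>. u x *\<^sub>R x) = 0" and b: "b \<in> \<beta>"
      have "0 = (\<Sum>x\<in>\<beta>. u x * ip x b)" using u linear_0[OF ip_lin[of b]] by (simp add: ip_simps flip: u)
      also have "\<dots> = (\<Sum>x\<in>\<beta>. if x = b then u x else 0)"
        by (rule sum.cong) (use that b in \<open>simp_all add: P_def\<close>)
      also have "\<dots> = u b" using b \<open>finite \<beta>\<close> by simp
      finally show "u b = 0" by simp
    qed
    then show ?thesis using independent_bound by blast
  qed
  have "P {}" unfolding P_def by auto
  then obtain \<beta> where \<beta>: "P \<beta>" "\<And>\<gamma>. P \<gamma> \<Longrightarrow> card \<gamma> \<le> card \<beta>"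
    using ex_has_greatest_nat[of P "{}" card "DIM('g) + 1"] bound by (metis less_Suc_eq_le Suc_eq_plus1)
  define W where "W = {x. \<forall>b\<in>\<beta>. ip x b = 0}"
  have sub: "subspace W" unfolding W_def subspace_def by (auto simp: ip_simps)
  have W0: "W = {0}"
  proof (rule ccontr)
    assume "W \<noteq> {0}"
    moreover have "f ` W \<subseteq> W" if f: "f \<in> F" for f
    proof clarify
      fix x assume x: "x \<in> W"
      show "f x \<in> W" unfolding W_def
      proof safe
        fix b assume b: "b \<in> \<beta>"
        obtain c where "f b = c *\<^sub>R b" using \<beta>(1) b f unfolding P_def by blast
        then show "ip (f x) b = 0" using F(2)[OF f, of x b] x b unfolding W_def by (simp add: ip_simps)
      qed
    qed
    ultimately obtain x where x: "x \<in> W" "x \<noteq> 0" "\<And>f. f \<in> F \<Longrightarrow> \<exists>c. f x = c *\<^sub>R x"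
      using common_eigenvector_exists[of F W] F sub by blast
    define e where "e = (1 / sqrt (ip x x)) *\<^sub>R x"
    have e1: "ip e e = 1" unfolding e_def using ip_pos[OF x(2)] by (simp add: ip_simps)
    have eb: "ip e b = 0" "ip b e = 0" if "b \<in> \<beta>" for b
      using x(1) that unfolding e_def W_def by (auto simp: ip_simps ip_sym[of b x])
    have en: "e \<notin> \<beta>" using eb(1) e1 by fastforce
    have ee: "\<exists>c. f e = c *\<^sub>R e" if "f \<in> F" for f
      using x(3)[OF that] unfolding e_def by (auto simp: linear_scale[OF F(1)[OF that]])
    have "P (insert e \<beta>)" using \<beta>(1) e1 eb ee unfolding P_def by (auto simp: en)
    then have "card (insert e \<beta>) \<le> card \<beta>" by (rule \<beta>(2))
    then show False using en \<beta>(1) unfolding P_def by simp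
  qed
  show ?thesis
  proof
    show "finite \<beta>" and on: "\<And>b c. b \<in> \<beta> \<Longrightarrow> c \<in> \<beta> \<Longrightarrow> ip b c = (if b = c then 1 else 0)"
      and "\<And>b f. b \<in> \<beta> \<Longrightarrow> f \<in> F \<Longrightarrow> \<exists>c. f b = c *\<^sub>R b"
      using \<beta>(1) unfolding P_def by blast+
    fix x
    have "x - (\<Sum>b\<in>\<beta>. ip x b *\<^sub>R b) \<in> W" unfolding W_def
    proof safe
      fix c assume c: "c \<in> \<beta>"
      have "ip (\<Sum>b\<in>\<beta>. ip x b *\<^sub>R b) c = (\<Sum>b\<in>\<beta>. ip x b * ip b c)" by (simp add: ip_simps)
      also have "\<dots> = (\<Sum>b\<in>\<beta>. if b = c then ip x b else 0)"
        by (rule sum.cong) (use on c in simp_all)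
      also have "\<dots> = ip x c" using c \<open>finite \<beta>\<close> by simp
      finally show "ip (x - (\<Sum>b\<in>\<beta>. ip x b *\<^sub>R b)) c = 0" by (simp add: ip_simps)
    qed
    then show "x = (\<Sum>b\<in>\<beta>. ip x b *\<^sub>R b)" using W0 by simp
  qed
qed

end

section \<open>The Cartan inner product and the weights of a\<close>

locale cartan_setting =
  fixes br :: "'g::euclidean_space \<Rightarrow> 'g \<Rightarrow> 'g" and J \<theta> :: "'g \<Rightarrow> 'g" and a :: "'g set"
  assumes lie: "lie_algebra br" and cplx: "complex_structure br J"
    and cartan: "cartan_involution br J \<theta>" and maxab: "max_abelian_in_p br \<theta> a"
begin

lemma br_linear: "linear (br x)" and br_linear_left: "linear (\<lambda>x. br x y)"
  and br_anti: "br x y = - br y x" and jacobi0: "br x (br y z) + br y (br z x) + br z (br x y) = 0"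
  using lie unfolding lie_algebra_def by blast+

lemmas br_simps = linear_add[OF br_linear] linear_add[OF br_linear_left] linear_diff[OF br_linear] linear_diff[OF br_linear_left]
  linear_scale[OF br_linear] linear_scale[OF br_linear_left] linear_0[OF br_linear] linear_0[OF br_linear_left]
  linear_neg[OF br_linear] linear_neg[OF br_linear_left] linear_sum[OF br_linear] linear_sum[OF br_linear_left]

lemma jacobi: "br x (br y z) = br (br x y) z + br y (br x z)"
proof -
  have "br (br x y) z = - br z (br x y)" "br y (br z x) = - br y (br x z)"
    using br_anti[of "br x y" z] br_anti[of z x] by (auto simp: br_simps)
  then show ?thesis using jacobi0[of x y z] by (simp add: algebra_simps add_eq_0_iff)
qed

lemma br_self: "br x x = 0"
  using br_anti[of x x] by (metis eq_neg_iff_add_eq_0 scaleR_2 scaleR_eq_0_iff zero_neq_numeral)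

lemma br_bilinear: "bounded_bilinear br"
  by (rule bilinear_conv_bounded_bilinear[THEN iffD1]) (simp add: bilinear_def br_linear br_linear_left)

lemma J_linear: "linear J" and JJ: "J (J x) = - x" and br_J_left: "br (J x) y = J (br x y)"
  using cplx unfolding complex_structure_def by blast+

lemmas J_simps = linear_add[OF J_linear] linear_diff[OF J_linear] linear_scale[OF J_linear] linear_0[OF J_linear]
  linear_neg[OF J_linear] linear_sum[OF J_linear]

lemma br_J: "br x (J y) = J (br x y)"
  using br_anti[of x "J y"] br_anti[of x y] by (simp add: br_J_left J_simps)

lemma J_eq0: "J x = 0 \<longleftrightarrow> x = 0"
  by (metis JJ J_simps(4) neg_equal_0_iff_equal)

lemma \<theta>_linear: "linear \<theta>" and \<theta>\<theta>: "\<theta> (\<theta> x) = x" and \<theta>_br: "\<theta> (br x y) = br (\<theta> x) (\<theta> y)"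
  and \<theta>_J: "\<theta> (J x) = - J (\<theta> x)" and \<theta>_pos: "x \<noteq> 0 \<Longrightarrow> - killing br x (\<theta> x) > 0"
  using cartan unfolding cartan_involution_def by blast+

lemmas \<theta>_simps = linear_add[OF \<theta>_linear] linear_diff[OF \<theta>_linear] linear_scale[OF \<theta>_linear] linear_0[OF \<theta>_linear]
  linear_neg[OF \<theta>_linear] linear_sum[OF \<theta>_linear]

lemma killing_trace: "killing br x y = lin_trace (\<lambda>z. br x (br y z))"
  unfolding killing_def lin_trace_def ..

lemma killing_linear: "linear (\<lambda>x. killing br x y)"
  by (rule linearI) (simp_all add: killing_trace br_simps lin_trace_add lin_trace_scale)

lemma killing_sym: "killing br x y = killing br y x"
  unfolding killing_trace by (rule lin_trace_swap[OF br_linear br_linear])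

lemma killing_invariant: "killing br (br x y) z = killing br x (br y z)"
proof -
  have 1: "br (br x y) w = br x (br y w) - br y (br x w)" for x y w using jacobi[of x y w] by simp
  have "killing br (br x y) z = lin_trace (\<lambda>w. br x (br y (br z w))) - lin_trace (\<lambda>w. br y (br x (br z w)))"
    unfolding killing_trace 1 by (rule lin_trace_diff)
  also have "lin_trace (\<lambda>w. br y (br x (br z w))) = lin_trace (\<lambda>w. br x (br z (br y w)))"
    using lin_trace_swap[OF br_linear[of y] linear_compose[OF br_linear[of z] br_linear[of x]]] by simp
  also have "lin_trace (\<lambda>w. br x (br y (br z w))) - \<dots> = killing br x (br y z)"
    unfolding killing_trace 1 by (simp add: br_simps lin_trace_diff)
  finally show ?thesis .
qed

lemma killing_automorphism:
  assumes "linear g" "linear g'" "\<And>x. g (g' x) = x" "\<And>x. g' (g x) = x" "\<And>x y. g (br x y) = br (g x) (g y)"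
  shows "killing br (g x) (g y) = killing br x y"
proof -
  have 1: "br (g x) w = g (br x (g' w))" for x w by (simp add: assms)
  have "killing br (g x) (g y) = lin_trace (\<lambda>w. g (br x (br y (g' w))))"
    unfolding killing_trace 1 by (simp add: assms)
  also have "\<dots> = lin_trace (\<lambda>w. br x (br y (g' (g w))))"
    using lin_trace_swap[OF assms(1) linear_compose[OF assms(2) linear_compose[OF br_linear[of y] br_linear[of x]]]] by simp
  finally show ?thesis by (simp add: assms killing_trace)
qed

text \<open>The Cartan inner product. For it ad x has adjoint -ad (\<theta> x), so p acts by
  symmetric and k by skew operators.\<close>

definition ip :: "'g \<Rightarrow> 'g \<Rightarrow> real" where "ip x y = - killing br x (\<theta> y)"

lemma killing_\<theta>: "killing br (\<theta> x) (\<theta> y) = killing br x y"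
  by (rule killing_automorphism[OF \<theta>_linear \<theta>_linear]) (auto simp: \<theta>\<theta> \<theta>_br)

sublocale pos_def_form ip
proof (rule pos_def_form.intro)
  show "linear (\<lambda>x. ip x y)" for y unfolding ip_def by (rule linear_compose_neg[OF killing_linear])
  show "ip x y = ip y x" for x y
    unfolding ip_def using killing_\<theta>[of x "\<theta> y"] killing_sym by (simp add: \<theta>\<theta>)
  show "ip x x > 0" if "x \<noteq> 0" for x unfolding ip_def using \<theta>_pos[OF that] .
qed

lemma ip_br: "ip (br x y) z = - ip y (br (\<theta> x) z)"
  unfolding ip_def using killing_invariant[of y x "\<theta> z"] br_anti[of x y]
  by (simp add: \<theta>_br \<theta>\<theta> linear_neg[OF killing_linear])

lemma ip_\<theta>: "ip (\<theta> x) (\<theta> y) = ip x y"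
  unfolding ip_def by (simp add: killing_\<theta>)

lemma ip_J: "ip (J x) (J y) = ip x y"
proof -
  have "killing br (J x) (J z) = - killing br x z" for x z
    unfolding killing_trace by (simp add: br_J_left br_J JJ lin_trace_def sum_negf)
  then show ?thesis unfolding ip_def by (simp add: \<theta>_J linear_neg[OF linear_compose[OF killing_linear, unfolded o_def]] killing_sym[of _ "- _"] linear_neg[OF killing_linear]) (simp add: killing_sym)
qed

lemma center_trivial: "(\<And>y. br x y = 0) \<Longrightarrow> x = 0"
proof (rule ccontr)
  assume "\<And>y. br x y = 0" "x \<noteq> 0"
  then show False using ip_pos[of x] by (simp add: ip_def killing_trace lin_trace_def)
qed

lemma a_subspace: "subspace a" and a_p: "H \<in> a \<Longrightarrow> \<theta> H = - H"
  and a_abelian: "H \<in> a \<Longrightarrow> K \<in> a \<Longrightarrow> br H K = 0"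
  using maxab unfolding max_abelian_in_p_def abelian_def ppart_def by auto

text \<open>Otherwise adjoining x to a would give a larger abelian subspace of p.\<close>

lemma a_maximal:
  assumes x: "\<theta> x = - x" "\<And>H. H \<in> a \<Longrightarrow> br H x = 0" shows "x \<in> a"
proof -
  let ?b = "{h + t *\<^sub>R x |h t. h \<in> a}"
  have sub: "subspace ?b"
    unfolding subspace_def
  proof (intro conjI ballI allI)
    show "0 \<in> ?b" using subspace_0[OF a_subspace] by (intro CollectI exI[of _ 0]) auto
    fix u v assume "u \<in> ?b" "v \<in> ?b"
    then obtain h t h' t' where "u = h + t *\<^sub>R x" "v = h' + t' *\<^sub>R x" "h \<in> a" "h' \<in> a" by blast
    then show "u + v \<in> ?b" using subspace_add[OF a_subspace]
      by (intro CollectI exI[of _ "h + h'"] exI[of _ "t + t'"]) (auto simp: algebra_simps)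
  next
    fix c u assume "u \<in> ?b"
    then obtain h t where "u = h + t *\<^sub>R x" "h \<in> a" by blast
    then show "c *\<^sub>R u \<in> ?b" using subspace_scale[OF a_subspace]
      by (intro CollectI exI[of _ "c *\<^sub>R h"] exI[of _ "c * t"]) (auto simp: algebra_simps)
  qed
  have x': "br x H = 0" if "H \<in> a" for H using x(2)[OF that] br_anti[of x H] by simp
  have "a \<subseteq> ?b" by (intro subsetI CollectI, rule_tac x=xa in exI, rule_tac x=0 in exI) auto
  moreover have "?b \<subseteq> ppart \<theta>" using a_p x(1) by (auto simp: ppart_def \<theta>_simps)
  moreover have "abelian br ?b" using a_abelian x(2) x' br_self by (auto simp: abelian_def br_simps)
  ultimately have "?b = a" using sub maxab unfolding max_abelian_in_p_def by blast
  moreover have "x \<in> ?b" using subspace_0[OF a_subspace] by (intro CollectI exI[of _ 0] exI[of _ 1]) auto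
  ultimately show ?thesis by blast
qed

text \<open>Since \<theta> = -1 on a, the centralizer is \<theta>-stable. Its p-part lies in a by
  maximality, and J moves its k-part into p, where the same argument applies.\<close>

lemma centralizer_of_a: "(\<forall>H\<in>a. br H x = 0) \<longleftrightarrow> x \<in> hcartan J a"
proof
  assume "x \<in> hcartan J a"
  then show "\<forall>H\<in>a. br H x = 0" unfolding hcartan_def using a_abelian by (auto simp: br_simps br_J J_simps)
next
  assume x: "\<forall>H\<in>a. br H x = 0"
  have t: "br H (\<theta> x) = 0" if "H \<in> a" for H
  proof -
    have "\<theta> (br H x) = - br H (\<theta> x)" using a_p[OF that] by (simp add: \<theta>_br br_simps)
    then show ?thesis using x that by (simp add: \<theta>_simps)
  qed
  define p where "p = (1/2) *\<^sub>R (x - \<theta> x)"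
  define k where "k = (1/2) *\<^sub>R (x + \<theta> x)"
  have xkp: "x = k + p" unfolding k_def p_def by (simp add: algebra_simps flip: scaleR_add_left)
  have "p \<in> a" by (rule a_maximal) (use x t in \<open>auto simp: p_def \<theta>_simps \<theta>\<theta> br_simps algebra_simps\<close>)
  moreover have "J k \<in> a" by (rule a_maximal) (use x t in \<open>auto simp: k_def \<theta>_simps \<theta>\<theta> \<theta>_J br_simps br_J J_simps algebra_simps\<close>)
  then have "- J k \<in> a" using subspace_neg[OF a_subspace] by blast
  moreover have "x = J (- J k) + p" using xkp by (simp add: J_simps JJ)
  ultimately show "x \<in> hcartan J a" unfolding hcartan_def by blast
qed

text \<open>The operators ad H with H in a commute and are symmetric. Weight 0 is included: the
  basis vectors with \<open>\<alpha> b = 0\<close> span the centralizer of a.\<close>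

lemma root_basis_exists:
  obtains \<beta> \<alpha> where "finite \<beta>" "\<And>b c. b \<in> \<beta> \<Longrightarrow> c \<in> \<beta> \<Longrightarrow> ip b c = (if b = c then 1 else 0)"
    "\<And>x. x = (\<Sum>b\<in>\<beta>. ip x b *\<^sub>R b)" "\<And>b. b \<in> \<beta> \<Longrightarrow> \<alpha> b \<in> a" "\<And>b. b \<in> \<beta> \<Longrightarrow> b \<in> rootspace br a (\<alpha> b)"
proof -
  obtain \<beta> where \<beta>: "finite \<beta>" "\<And>b c. b \<in> \<beta> \<Longrightarrow> c \<in> \<beta> \<Longrightarrow> ip b c = (if b = c then 1 else 0)"
    "\<And>x. x = (\<Sum>b\<in>\<beta>. ip x b *\<^sub>R b)" "\<And>b f. b \<in> \<beta> \<Longrightarrow> f \<in> br ` a \<Longrightarrow> \<exists>c. f b = c *\<^sub>R b"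
  proof (rule orthonormal_eigenbasis[of "br ` a"])
    show "linear f" if "f \<in> br ` a" for f using that br_linear by blast
    show "ip (f x) y = ip x (f y)" if "f \<in> br ` a" for f x y
      using that by (auto simp: ip_br a_p br_simps ip_simps)
    show "f (g x) = g (f x)" if "f \<in> br ` a" "g \<in> br ` a" for f g x
    proof -
      obtain H K where HK: "H \<in> a" "K \<in> a" "f = br H" "g = br K" using \<open>f \<in> br ` a\<close> \<open>g \<in> br ` a\<close> by blast
      show ?thesis using jacobi[of H K x] a_abelian[OF HK(1,2)] HK by (simp add: br_simps)
    qed
  qed blast
  have "\<exists>\<alpha>. \<alpha> \<in> a \<and> b \<in> rootspace br a \<alpha>" if b: "b \<in> \<beta>" for b
  proof -
    define f where "f H = ip (br H b) b" for H
    have lf: "linear f" unfolding f_def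
      using linear_compose[OF br_linear_left[of b] ip_lin[of b]] by (simp add: o_def)
    define v where "v = adjoint f 1"
    have v: "H \<bullet> v = f H" for H unfolding v_def using adjoint_works[OF lf, of H 1] by (simp add: inner_commute)
    \<comment> \<open>The Riesz vector of the eigenvalue functional lies in the ambient space;
      \<open>is_root\<close> wants a representative in a, hence the projection.\<close>
    obtain y z where yz: "y \<in> span a" "\<And>w. w \<in> span a \<Longrightarrow> z \<bullet> w = 0" "v = y + z"
      using orthogonal_subspace_decomp_exists[of a v] unfolding real_inner_class.orthogonal_def by metis
    have span: "span a = a" using a_subspace by (simp add: span_eq_iff)
    have "br H b = (y \<bullet> H) *\<^sub>R b" if H: "H \<in> a" for H
    proof -
      obtain c where c: "br H b = c *\<^sub>R b" using \<beta>(4)[OF b] H by blast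
      have "c = f H" unfolding f_def c using \<beta>(2)[OF b b] by (simp add: ip_simps)
      also have "\<dots> = y \<bullet> H" using v[of H] yz(2)[of H] H span
        by (simp add: yz(3) inner_add_right inner_commute)
      finally show ?thesis using c by simp
    qed
    then show ?thesis using yz(1) span unfolding rootspace_def by blast
  qed
  then obtain \<alpha> where "\<And>b. b \<in> \<beta> \<Longrightarrow> \<alpha> b \<in> a \<and> b \<in> rootspace br a (\<alpha> b)" by metis
  then show ?thesis using that[OF \<beta>(1-3)] by blast
qed

end

section \<open>Automorphisms and the grading by a regular element\<close>

context cartan_setting begin

definition aut :: "('g \<Rightarrow> 'g) \<Rightarrow> bool" where
  "aut g \<longleftrightarrow> linear g \<and> bij g \<and> (\<forall>x y. g (br x y) = br (g x) (g y)) \<and> (\<forall>x. g (J x) = J (g x))"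

lemma aut_linear: "aut g \<Longrightarrow> linear g" and aut_bij: "aut g \<Longrightarrow> bij g"
  and aut_br: "aut g \<Longrightarrow> g (br x y) = br (g x) (g y)" and aut_J: "aut g \<Longrightarrow> g (J x) = J (g x)"
  unfolding aut_def by blast+

lemma aut_inv_apply: "aut g \<Longrightarrow> inv g (g x) = x" "aut g \<Longrightarrow> g (inv g x) = x"
  using aut_bij by (simp_all add: bij_is_inj bij_is_surj surj_f_inv_f)

lemma aut_id: "aut id" unfolding aut_def by (simp add: linear_id)

lemma aut_comp: "aut f \<Longrightarrow> aut g \<Longrightarrow> aut (f \<circ> g)"
  unfolding aut_def by (auto intro: linear_compose bij_comp)

lemma aut_inv: assumes "aut g" shows "aut (inv g)"
  unfolding aut_def
proof (intro conjI allI)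
  show "linear (inv g)" using inj_linear_imp_inv_linear[OF aut_linear[OF assms]] aut_bij[OF assms] by (simp add: bij_is_inj)
  show "bij (inv g)" using aut_bij[OF assms] by (rule bij_imp_bij_inv)
  have "g (br (inv g x) (inv g y)) = br x y" for x y
    by (simp add: aut_br[OF assms] aut_inv_apply[OF assms])
  then show "inv g (br x y) = br (inv g x) (inv g y)" for x y
    using aut_inv_apply(1)[OF assms, of "br (inv g x) (inv g y)"] by simp
  have "g (J (inv g x)) = J x" for x by (simp add: aut_J[OF assms] aut_inv_apply[OF assms])
  then show "inv g (J x) = J (inv g x)" for x
    using aut_inv_apply(1)[OF assms, of "J (inv g x)"] by simp
qed

lemma aut_inv_inv: "aut g \<Longrightarrow> inv (inv g) = g"
  by (simp add: aut_bij inv_inv_eq)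

lemma aut_eq0: "aut g \<Longrightarrow> g x = 0 \<longleftrightarrow> x = 0"
  by (metis aut_inv_apply(1) aut_linear linear_0)

lemma ip_aut: assumes "aut g" shows "ip (g x) y = ip x (\<theta> (inv g (\<theta> y)))"
proof -
  have "killing br (g x) (\<theta> y) = killing br (g x) (g (inv g (\<theta> y)))" using aut_inv_apply[OF assms] by simp
  also have "\<dots> = killing br x (inv g (\<theta> y))"
    by (rule killing_automorphism[OF aut_linear[OF assms] aut_linear[OF aut_inv[OF assms]]])
       (auto simp: aut_inv_apply[OF assms] aut_br[OF assms])
  finally show ?thesis unfolding ip_def by (simp add: \<theta>\<theta>)
qed

lemma aut_theta: assumes "aut g" shows "aut (\<lambda>x. \<theta> (g (\<theta> x)))"
  unfolding aut_def
proof (intro conjI allI)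
  show "linear (\<lambda>x. \<theta> (g (\<theta> x)))"
    using linear_compose[OF linear_compose[OF \<theta>_linear aut_linear[OF assms]] \<theta>_linear] by (simp add: o_def)
  show "bij (\<lambda>x. \<theta> (g (\<theta> x)))"
    by (rule o_bij[of "\<lambda>x. \<theta> (inv g (\<theta> x))"]) (auto simp: fun_eq_iff \<theta>\<theta> aut_inv_apply[OF assms])
qed (auto simp: \<theta>_br \<theta>_J aut_br[OF assms] aut_J[OF assms] linear_neg[OF aut_linear[OF assms]] \<theta>_simps)

lemma expop_br_uminus: "expop (br (- X)) (expop (br X) y) = y" "expop (br X) (expop (br (- X)) y) = y"
proof -
  have "br (- X) = (\<lambda>x. - br X x)" by (auto simp: br_simps)
  then show "expop (br (- X)) (expop (br X) y) = y" "expop (br X) (expop (br (- X)) y) = y"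
    using expop_inverse[OF br_linear[of X]] by simp_all
qed

lemma inv_expop_br: "inv (expop (br X)) = expop (br (- X))"
  by (rule inv_unique_comp) (auto simp: fun_eq_iff expop_br_uminus)

lemma aut_expop: "aut (expop (br X))"
  unfolding aut_def
proof (intro conjI allI)
  show "linear (expop (br X))" by (rule linear_expop[OF br_linear])
  show "bij (expop (br X))"
    by (rule o_bij[of "expop (br (- X))"]) (auto simp: fun_eq_iff expop_br_uminus)
  show "expop (br X) (br x y) = br (expop (br X) x) (expop (br X) y)" for x y
    by (rule expop_derivation[where D="br X" and b=br, OF br_linear br_bilinear jacobi])
  show "expop (br X) (J x) = J (expop (br X) x)" for x
    using expop_intertwine[where g=J and L="br X" and L'="br X"] by (simp add: br_J J_linear br_linear)
qed

lemma aut_expop_conj: "aut g \<Longrightarrow> g (expop (br X) y) = expop (br (g X)) (g y)"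
  using expop_intertwine[where g=g and L="br X" and L'="br (g X)"] by (simp add: aut_br aut_linear br_linear)

lemma theta_expop: "\<theta> (expop (br X) y) = expop (br (\<theta> X)) (\<theta> y)"
  using expop_intertwine[where g=\<theta> and L="br X" and L'="br (\<theta> X)"] by (simp add: \<theta>_br \<theta>_linear br_linear)

section \<open>Inner automorphisms and adjoint orbits\<close>

inductive_set inn :: "('g \<Rightarrow> 'g) set" where
  inn_id: "id \<in> inn"
| inn_step: "g \<in> inn \<Longrightarrow> expop (br X) \<circ> g \<in> inn"

lemma inn_aut: "g \<in> inn \<Longrightarrow> aut g"
  by (induction rule: inn.induct) (auto intro: aut_id[unfolded id_def] aut_comp[OF aut_expop, unfolded o_def])

lemma inn_comp: "f \<in> inn \<Longrightarrow> g \<in> inn \<Longrightarrow> f \<circ> g \<in> inn"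
  by (induction rule: inn.induct) (auto simp: comp_assoc intro: inn_step)

lemma inn_expop: "expop (br X) \<in> inn"
  using inn_step[OF inn_id] by simp

lemma inn_inv: "g \<in> inn \<Longrightarrow> inv g \<in> inn"
proof (induction rule: inn.induct)
  case inn_id show ?case using inn.inn_id inv_id unfolding id_def by simp
next
  case (inn_step g X)
  have "inv (expop (br X) \<circ> g) = inv g \<circ> expop (br (- X))"
    using o_inv_distrib[OF aut_bij[OF aut_expop[of X]] aut_bij[OF inn_aut[OF inn_step(1)]]] by (simp add: inv_expop_br)
  then show ?case using inn_comp[OF inn_step(2) inn_expop] by (simp add: o_def)
qed

lemma inn_theta: "g \<in> inn \<Longrightarrow> (\<lambda>x. \<theta> (g (\<theta> x))) \<in> inn"
proof (induction rule: inn.induct)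
  case inn_id show ?case using inn.inn_id unfolding id_def by (simp add: \<theta>\<theta>)
next
  case (inn_step g X)
  have "(\<lambda>x. \<theta> ((expop (br X) \<circ> g) (\<theta> x))) = expop (br (\<theta> X)) \<circ> (\<lambda>x. \<theta> (g (\<theta> x)))"
    by (simp add: theta_expop fun_eq_iff)
  then show ?case using inn.inn_step[OF inn_step(2)] by simp
qed

lemma adj_orbit_inn: "adj_orbit br L = {g L |g. g \<in> inn}"
proof safe
  show "\<exists>g. x = g L \<and> g \<in> inn" if "x \<in> adj_orbit br L" for x
    using that
  proof (induction rule: adj_orbit.induct)
    case base show ?case using inn_id unfolding id_def by (intro exI[of _ "\<lambda>x. x"]) simp
  next
    case (step Y X)
    then obtain g where "Y = g L" "g \<in> inn" by blast
    then show ?case using inn_step[of g X] by (intro exI[of _ "expop (br X) \<circ> g"]) (simp add: o_def)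
  qed
  show "g L \<in> adj_orbit br L" if "g \<in> inn" for g
    using that by (induction rule: inn.induct) (auto intro: adj_orbit.intros)
qed

definition cs :: "complex \<Rightarrow> 'g \<Rightarrow> 'g" where "cs c x = Re c *\<^sub>R x + Im c *\<^sub>R J x"

text \<open>Eigenvalues of ad X as a complex-linear operator, without multiplicities. They are
  constant on orbits and leave only finitely many elements of h, which is all that the rigidity
  arguments need.\<close>

definition spec :: "'g \<Rightarrow> complex set" where "spec X = {c. \<exists>x. x \<noteq> 0 \<and> br X x = cs c x}"

lemma cs_linear: "linear (cs c)"
  unfolding cs_def by (rule linearI) (simp_all add: J_simps algebra_simps)

lemma aut_cs: "aut g \<Longrightarrow> g (cs c x) = cs c (g x)"
  unfolding cs_def by (simp add: linear_add[OF aut_linear] linear_scale[OF aut_linear] aut_J)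

lemma spec_aut: assumes "aut g" shows "spec (g X) = spec X"
proof -
  have 1: "spec X \<subseteq> spec (g X)" if "aut g" for g X
  proof
    fix c assume "c \<in> spec X"
    then obtain x where "x \<noteq> 0" "br X x = cs c x" unfolding spec_def by blast
    then have "g x \<noteq> 0" "br (g X) (g x) = cs c (g x)"
      using that by (simp_all add: aut_eq0 flip: aut_br aut_cs)
    then show "c \<in> spec (g X)" unfolding spec_def by blast
  qed
  have "spec (g X) \<subseteq> spec (inv g (g X))" by (rule 1[OF aut_inv[OF assms]])
  then show ?thesis using 1[OF assms, of X] aut_inv_apply[OF assms] by auto
qed

text \<open>\<theta> is the conjugation fixing the compact form k, so every x is
  \<open>J (im x) + re x\<close> with both parts in p. On h these are the coordinates with respect
  to J a + a.\<close>

definition re :: "'g \<Rightarrow> 'g" where "re x = (1/2) *\<^sub>R (x - \<theta> x)"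
definition im :: "'g \<Rightarrow> 'g" where "im x = - ((1/2) *\<^sub>R J (x + \<theta> x))"

lemma re_im: "J (im x) + re x = x"
  unfolding re_def im_def by (simp add: J_simps JJ algebra_simps flip: scaleR_add_left)

lemma re_im_unique: "y \<in> a \<Longrightarrow> r \<in> a \<Longrightarrow> re (J y + r) = r" "y \<in> a \<Longrightarrow> r \<in> a \<Longrightarrow> im (J y + r) = y"
proof -
  assume "y \<in> a" "r \<in> a"
  then have "\<theta> (J y + r) = J y - r" by (simp add: \<theta>_simps \<theta>_J a_p J_simps)
  then show "re (J y + r) = r" "im (J y + r) = y"
    unfolding re_def im_def by (simp_all add: J_simps JJ flip: scaleR_2)
qed

lemma re_im_a: assumes "x \<in> hcartan J a" shows "re x \<in> a" "im x \<in> a"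
  using assms re_im_unique unfolding hcartan_def by auto

lemma pi_a_re: assumes "x \<in> hcartan J a" shows "pi_a J a x = re x"
  unfolding pi_a_def
proof (rule the_equality)
  show "re x \<in> a \<and> x - re x \<in> J ` a" using re_im_a[OF assms] re_im[of x] by (metis add_diff_cancel_right' imageI)
  fix A assume A: "A \<in> a \<and> x - A \<in> J ` a"
  then obtain y where "y \<in> a" "x = J y + A" by (metis diff_add_cancel imageE)
  then show "A = re x" using re_im_unique A by metis
qed

lemma pi_ia_im: assumes "x \<in> hcartan J a" shows "pi_ia J a x = J (im x)"
  unfolding pi_ia_def
proof (rule the_equality)
  show "J (im x) \<in> J ` a \<and> x - J (im x) \<in> a" using re_im_a[OF assms] re_im[of x] by (metis add_diff_cancel_left' imageI)
  fix T assume A: "T \<in> J ` a \<and> x - T \<in> a"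
  then obtain y where "y \<in> a" "T = J y" by blast
  then show "T = J (im x)" using re_im_unique(2)[of y "x - T"] A by simp
qed

end

locale root_setting = cartan_setting br J \<theta> a for br :: "'g::euclidean_space \<Rightarrow> 'g \<Rightarrow> 'g" and J \<theta> a +
  fixes \<beta> :: "'g set" and \<alpha> :: "'g \<Rightarrow> 'g"
  assumes \<beta>_fin: "finite \<beta>" and \<beta>_on: "b \<in> \<beta> \<Longrightarrow> c \<in> \<beta> \<Longrightarrow> ip b c = (if b = c then 1 else 0)"
    and \<beta>_exp: "x = (\<Sum>b\<in>\<beta>. ip x b *\<^sub>R b)"
    and \<alpha>_a: "b \<in> \<beta> \<Longrightarrow> \<alpha> b \<in> a" and \<beta>_root: "b \<in> \<beta> \<Longrightarrow> b \<in> rootspace br a (\<alpha> b)"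
begin

lemma \<beta>_nz: "b \<in> \<beta> \<Longrightarrow> b \<noteq> 0"
  using \<beta>_on[of b b] by (auto simp: ip_simps)

lemma expand: "linear f \<Longrightarrow> f x = (\<Sum>b\<in>\<beta>. ip x b *\<^sub>R f b)"
  by (subst \<beta>_exp[of x]) (simp add: linear_sum linear_scale)

lemma ip_eqI: "(\<And>b. b \<in> \<beta> \<Longrightarrow> ip x b = ip y b) \<Longrightarrow> x = y"
  by (subst \<beta>_exp[of x], subst \<beta>_exp[of y]) simp

lemma linear_eqI: "linear f \<Longrightarrow> linear g \<Longrightarrow> (\<And>b. b \<in> \<beta> \<Longrightarrow> f b = g b) \<Longrightarrow> f = g"
  by (rule ext) (subst expand, assumption, subst (2) expand, assumption, simp)

lemma parseval: "ip x y = (\<Sum>b\<in>\<beta>. ip x b * ip y b)"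
  using expand[OF ip_lin[of y], of x] by (simp add: ip_sym[of y])

lemma br_a_\<beta>: "H \<in> a \<Longrightarrow> b \<in> \<beta> \<Longrightarrow> br H b = (\<alpha> b \<bullet> H) *\<^sub>R b"
  using \<beta>_root unfolding rootspace_def by blast

text \<open>The complex-linear extension of the weight \<open>\<alpha> b\<close> from a to
  h.\<close>

definition rt :: "'g \<Rightarrow> 'g \<Rightarrow> complex" where "rt b H = Complex (\<alpha> b \<bullet> re H) (\<alpha> b \<bullet> im H)"

lemma br_h_\<beta>: assumes "H \<in> hcartan J a" "b \<in> \<beta>" shows "br H b = cs (rt b H) b"
proof -
  have "br H b = br (J (im H) + re H) b" by (simp add: re_im)
  also have "\<dots> = cs (rt b H) b"
    using br_a_\<beta> re_im_a[OF assms(1)] assms(2) by (simp add: br_simps br_J_left cs_def rt_def J_simps)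
  finally show ?thesis .
qed

lemma ip_J_left: "ip (J x) y = - ip x (J y)"
  using ip_J[of x "J y"] by (simp add: JJ ip_simps)

lemma spec_h: assumes H: "H \<in> hcartan J a" shows "spec H = (\<lambda>b. rt b H) ` \<beta>"
proof safe
  fix b assume "b \<in> \<beta>" then show "rt b H \<in> spec H" unfolding spec_def using br_h_\<beta>[OF H] \<beta>_nz by blast
next
  fix c assume "c \<in> spec H"
  then obtain x where x: "x \<noteq> 0" "br H x = cs c x" unfolding spec_def by blast
  \<comment> \<open>ad H - c is a normal operator for ip, diagonalized over the complex numbers by the root vectors.\<close>
  define T where "T x = br H x - cs c x" for x
  define T' where "T' x = - br (\<theta> H) x - cs (cnj c) x" for x
  have linT: "linear T" "linear T'" unfolding T_def T'_def
    using linear_compose_sub[OF br_linear cs_linear] linear_compose_sub[OF linear_compose_neg[OF br_linear] cs_linear] by auto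
  have adj: "ip (T x) y = ip x (T' y)" for x y
    unfolding T_def T'_def by (simp add: ip_simps ip_br cs_def ip_J_left algebra_simps)
  have Tb: "T' (T b) = (norm (rt b H - c))^2 *\<^sub>R b" if "b \<in> \<beta>" for b
  proof -
    have th: "- \<theta> H = J (- im H) + re H"
    proof -
      have "\<theta> H = \<theta> (J (im H) + re H)" by (simp add: re_im)
      then show ?thesis using re_im_a[OF H] by (simp add: \<theta>_simps \<theta>_J a_p J_simps)
    qed
    have ma: "- im H \<in> a" using re_im_a(2)[OF H] a_subspace subspace_neg by blast
    have "- \<theta> H \<in> hcartan J a" unfolding hcartan_def using th re_im_a[OF H] ma by blast
    from br_h_\<beta>[OF this that] have "- br (\<theta> H) b = cs (rt b (- \<theta> H)) b" by (simp add: br_simps)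
    moreover have "rt b (- \<theta> H) = cnj (rt b H)"
      unfolding rt_def th using re_im_unique[OF ma re_im_a(1)[OF H]] by (simp add: complex_eq_iff)
    ultimately have m: "- br (\<theta> H) b = cs (cnj (rt b H)) b" by simp
    have mJ: "- br (\<theta> H) (J b) = J (cs (cnj (rt b H)) b)" using arg_cong[OF m, of J] by (simp add: br_J J_simps)
    define m where "m = rt b H - c"
    have TB: "T b = Re m *\<^sub>R b + Im m *\<^sub>R J b"
      unfolding T_def br_h_\<beta>[OF H that] cs_def m_def by (simp add: algebra_simps)
    have T'B: "T' b = Re m *\<^sub>R b - Im m *\<^sub>R J b" unfolding T'_def m cs_def m_def by (simp add: algebra_simps)
    have T'J: "T' (J b) = Re m *\<^sub>R J b + Im m *\<^sub>R b"
      unfolding T'_def mJ cs_def m_def by (simp add: algebra_simps J_simps JJ)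
    have "T' (T b) = Re m *\<^sub>R T' b + Im m *\<^sub>R T' (J b)"
      unfolding TB by (simp add: linear_add[OF linT(2)] linear_scale[OF linT(2)])
    also have "\<dots> = (Re m * Re m + Im m * Im m) *\<^sub>R b" unfolding T'B T'J by (simp add: algebra_simps)
    also have "Re m * Re m + Im m * Im m = (norm m)^2" using cmod_power2[of m] by (simp only: power2_eq_square)
    finally have "T' (T b) = (norm m)^2 *\<^sub>R b" .
    then show ?thesis unfolding m_def .
  qed
  \<comment> \<open>\<open>T' \<circ> T\<close> is a real scalar on each basis vector, although T
    itself need not be, so the pairing becomes a sum of squares in real coordinates.\<close>
  have "0 = ip x (T' (T x))" using adj[of x "T x"] x(2) by (simp add: T_def ip_simps linear_0[OF linT(2)])
  also have "\<dots> = (\<Sum>b\<in>\<beta>. ip x b * (ip x b * (norm (rt b H - c))^2))"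
    using expand[OF linear_compose[OF linT], of x] by (simp add: Tb ip_simps mult_ac)
  finally have "(\<Sum>b\<in>\<beta>. (ip x b * norm (rt b H - c))^2) = 0" by (simp add: power2_eq_square mult_ac)
  then have z: "ip x b * norm (rt b H - c) = 0" if "b \<in> \<beta>" for b
    using that \<beta>_fin by (simp add: sum_nonneg_eq_0_iff)
  obtain b where "b \<in> \<beta>" "ip x b \<noteq> 0" using x(1) ip_eqI[of x 0] by (auto simp: ip_simps)
  then show "c \<in> (\<lambda>b. rt b H) ` \<beta>" using z[of b] by auto
qed

lemma h_eqI:
  assumes "H \<in> hcartan J a" "K \<in> hcartan J a" "\<And>b. b \<in> \<beta> \<Longrightarrow> rt b H = rt b K" shows "H = K"
proof -
  have "br (H - K) = (\<lambda>x. 0)"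
    by (rule linear_eqI[OF br_linear]) (use assms br_h_\<beta> in \<open>auto simp: br_simps linear_zero\<close>)
  then have "br (H - K) y = 0" for y by simp
  then have "H - K = 0" by (rule center_trivial)
  then show ?thesis by simp
qed

text \<open>The centre is trivial, so an element of h is determined by its root values, here a
  function from \<beta> to S. This is behind both the finiteness of the intersection of the orbit
  with h and the constancy of \<open>sig\<close>.\<close>

lemma finite_h_spec: assumes "finite S" shows "finite {H \<in> hcartan J a. spec H \<subseteq> S}"
proof (rule finite_imageD)
  let ?f = "\<lambda>H. restrict (\<lambda>b. rt b H) \<beta>"
  have "?f ` {H \<in> hcartan J a. spec H \<subseteq> S} \<subseteq> PiE \<beta> (\<lambda>_. S)"
    using spec_h by (auto simp: PiE_def)
  moreover have "finite (PiE \<beta> (\<lambda>_. S))" using \<beta>_fin assms by (simp add: finite_PiE)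
  ultimately show "finite (?f ` {H \<in> hcartan J a. spec H \<subseteq> S})" by (rule finite_subset)
  show "inj_on ?f {H \<in> hcartan J a. spec H \<subseteq> S}"
    by (intro inj_onI h_eqI) (auto dest: fun_cong simp: restrict_def split: if_splits)
qed

lemma finite_spec_h: "H \<in> hcartan J a \<Longrightarrow> finite (spec H)"
  using spec_h \<beta>_fin by simp

end

text \<open>Only regularity of H0 is required, not positivity: besides the dominant element of the
  ordering, the grading is later taken with respect to an element of a fixed by a given
  automorphism.\<close>

locale graded = root_setting br J \<theta> a \<beta> \<alpha> for br :: "'g::euclidean_space \<Rightarrow> 'g \<Rightarrow> 'g" and J \<theta> a \<beta> \<alpha> +
  fixes H0 :: 'g
  assumes H0_a: "H0 \<in> a" and H0_reg: "b \<in> \<beta> \<Longrightarrow> \<alpha> b \<bullet> H0 = 0 \<Longrightarrow> \<alpha> b = 0"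
begin

definition deg :: "'g \<Rightarrow> real" where "deg b = \<alpha> b \<bullet> H0"
text \<open>Sum of the eigenspaces of ad H0 with eigenvalue in S. Arbitrary S covers at once the
  summands h, n, l and the filtrations by \<open>G {c..}\<close> and \<open>G {..c}\<close>.\<close>

definition G :: "real set \<Rightarrow> 'g set" where "G S = {x. \<forall>b\<in>\<beta>. deg b \<notin> S \<longrightarrow> ip x b = 0}"
definition pr :: "real set \<Rightarrow> 'g \<Rightarrow> 'g" where "pr S x = (\<Sum>b\<in>{b\<in>\<beta>. deg b \<in> S}. ip x b *\<^sub>R b)"

lemma ip_pr: assumes "b \<in> \<beta>" shows "ip (pr S x) b = (if deg b \<in> S then ip x b else 0)"
proof -
  have "ip (pr S x) b = (\<Sum>c\<in>{b\<in>\<beta>. deg b \<in> S}. ip x c * ip c b)" unfolding pr_def by (simp add: ip_simps)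
  also have "\<dots> = (\<Sum>c\<in>{b\<in>\<beta>. deg b \<in> S}. if c = b then ip x c else 0)"
    by (rule sum.cong) (use assms \<beta>_on in auto)
  also have "\<dots> = (if deg b \<in> S then ip x b else 0)" using \<beta>_fin assms by (simp add: sum.delta)
  finally show ?thesis .
qed

lemma pr_linear: "linear (pr S)"
  unfolding pr_def by (rule linearI) (simp_all add: ip_simps algebra_simps sum.distrib scaleR_sum_right)

lemmas pr_simps = linear_add[OF pr_linear] linear_diff[OF pr_linear] linear_scale[OF pr_linear] linear_0[OF pr_linear]
  linear_neg[OF pr_linear]

lemma G_subspace: "subspace (G S)"
  unfolding G_def subspace_def by (auto simp: ip_simps)

lemmas G_add = subspace_add[OF G_subspace] and G_diff = subspace_diff[OF G_subspace]
  and G_scale = subspace_scale[OF G_subspace] and G_0 = subspace_0[OF G_subspace]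
  and G_neg = subspace_neg[OF G_subspace] and G_sum = subspace_sum[OF G_subspace]

lemma pr_mem: "pr S x \<in> G S"
  unfolding G_def by (auto simp: ip_pr)

lemma pr_id: "x \<in> G S \<Longrightarrow> pr S x = x"
  by (rule ip_eqI) (auto simp: ip_pr G_def)

lemma pr_zero: "x \<in> G S \<Longrightarrow> S \<inter> T = {} \<Longrightarrow> pr T x = 0"
  by (rule ip_eqI) (auto simp: ip_pr G_def ip_simps)

lemma pr_pr: "pr S (pr T x) = pr (S \<inter> T) x"
  by (rule ip_eqI) (auto simp: ip_pr)

lemma pr_Un: "S \<inter> T = {} \<Longrightarrow> pr (S \<union> T) x = pr S x + pr T x"
  by (rule ip_eqI) (auto simp: ip_pr ip_simps)

lemma pr_UNIV: "pr UNIV x = x"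
  by (rule ip_eqI) (auto simp: ip_pr)

lemma pr_split: "S \<inter> T = {} \<Longrightarrow> S \<union> T = UNIV \<Longrightarrow> x = pr S x + pr T x"
  using pr_Un[of S T x] pr_UNIV by simp

lemma G_mono: "x \<in> G S \<Longrightarrow> S \<subseteq> T \<Longrightarrow> x \<in> G T"
  unfolding G_def by blast

lemma G_disjoint: "x \<in> G S \<Longrightarrow> x \<in> G T \<Longrightarrow> S \<inter> T = {} \<Longrightarrow> x = 0"
  using pr_id pr_zero by metis

lemma \<beta>_G: "b \<in> \<beta> \<Longrightarrow> deg b \<in> S \<Longrightarrow> b \<in> G S"
  unfolding G_def using \<beta>_on by auto

lemma G_linear_image:
  assumes "linear f" "\<And>b. b \<in> \<beta> \<Longrightarrow> deg b \<in> S \<Longrightarrow> f b \<in> G T" "x \<in> G S" shows "f x \<in> G T"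
proof -
  have "f x = f (pr S x)" using pr_id[OF assms(3)] by simp
  also have "\<dots> = (\<Sum>b\<in>{b\<in>\<beta>. deg b \<in> S}. ip x b *\<^sub>R f b)"
    unfolding pr_def using assms(1) by (simp add: linear_sum linear_scale)
  also have "\<dots> \<in> G T" by (intro G_sum G_scale) (use assms(2) in auto)
  finally show ?thesis .
qed

lemma ip_G: "x \<in> G S \<Longrightarrow> y \<in> G T \<Longrightarrow> S \<inter> T = {} \<Longrightarrow> ip x y = 0"
  unfolding parseval[of x y] by (rule sum.neutral) (auto simp: G_def)

lemma G_eig: "x \<in> G {c} \<longleftrightarrow> br H0 x = c *\<^sub>R x"
proof -
  have e: "ip (br H0 x) b = deg b * ip x b" if "b \<in> \<beta>" for b
    using that br_a_\<beta>[OF H0_a that] a_p[OF H0_a] by (simp add: ip_br deg_def ip_simps br_simps)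
  show ?thesis
  proof
    assume x: "x \<in> G {c}"
    show "br H0 x = c *\<^sub>R x" by (rule ip_eqI) (use x in \<open>auto simp: e ip_simps G_def\<close>)
  next
    assume "br H0 x = c *\<^sub>R x"
    then have "ip x b = 0 \<or> deg b = c" if "b \<in> \<beta>" for b using e[OF that] by (auto simp: ip_simps)
    then show "x \<in> G {c}" unfolding G_def by auto
  qed
qed

lemma br_G: assumes "x \<in> G S" "y \<in> G T" "\<And>s t. s \<in> S \<Longrightarrow> t \<in> T \<Longrightarrow> s + t \<in> U" shows "br x y \<in> G U"
proof (rule G_linear_image[OF br_linear_left _ assms(1)])
  fix b assume b: "b \<in> \<beta>" "deg b \<in> S"
  show "br b y \<in> G U"
  proof (rule G_linear_image[OF br_linear _ assms(2)])
    fix c assume c: "c \<in> \<beta>" "deg c \<in> T"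
    have "b \<in> G {deg b}" "c \<in> G {deg c}" using b c \<beta>_G by auto
    then have "br b c \<in> G {deg b + deg c}" unfolding G_eig by (simp add: jacobi[of H0 b c] br_simps algebra_simps)
    then show "br b c \<in> G U" by (rule G_mono) (use b c assms(3) in auto)
  qed
qed

lemma J_G: assumes "x \<in> G S" shows "J x \<in> G S"
proof (rule G_linear_image[OF J_linear _ assms])
  fix b assume b: "b \<in> \<beta>" "deg b \<in> S"
  then have "b \<in> G {deg b}" using \<beta>_G by auto
  then have "J b \<in> G {deg b}" unfolding G_eig by (simp add: br_J J_simps)
  then show "J b \<in> G S" by (rule G_mono) (use b in auto)
qed

lemma cs_G: "x \<in> G S \<Longrightarrow> cs c x \<in> G S"
  unfolding cs_def by (intro G_add G_scale J_G)

lemma \<theta>_G: assumes "x \<in> G S" "\<And>s. s \<in> S \<Longrightarrow> - s \<in> T" shows "\<theta> x \<in> G T"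
proof (rule G_linear_image[OF \<theta>_linear _ assms(1)])
  fix b assume b: "b \<in> \<beta>" "deg b \<in> S"
  then have "b \<in> G {deg b}" using \<beta>_G by auto
  then have "\<theta> (br H0 b) = deg b *\<^sub>R \<theta> b" unfolding G_eig by (simp add: \<theta>_simps)
  then have "- br H0 (\<theta> b) = deg b *\<^sub>R \<theta> b" using a_p[OF H0_a] by (simp add: \<theta>_br br_simps)
  then have "\<theta> b \<in> G {- deg b}" unfolding G_eig by (metis minus_minus scaleR_minus_left)
  then show "\<theta> b \<in> G T" by (rule G_mono) (use b assms(2) in auto)
qed

text \<open>Regularity of H0 turns degree 0 into weight 0, so this part commutes with all of
  a.\<close>

lemma G_h: "G {0} = hcartan J a"
proof safe
  fix x assume x: "x \<in> G {0}"
  have "br H x = 0" if "H \<in> a" for H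
  proof -
    have "br H x = (\<Sum>b\<in>{b\<in>\<beta>. deg b \<in> {0}}. ip x b *\<^sub>R br H b)"
    proof -
      have "br H x = br H (pr {0} x)" using pr_id[OF x] by simp
      then show ?thesis unfolding pr_def by (simp only: br_simps)
    qed
    also have "\<dots> = 0"
    proof (rule sum.neutral, safe)
      fix b assume "b \<in> \<beta>" "deg b = 0"
      then show "ip x b *\<^sub>R br H b = 0" using br_a_\<beta>[OF that] H0_reg[of b] by (simp add: deg_def)
    qed
    finally show ?thesis .
  qed
  then show "x \<in> hcartan J a" using centralizer_of_a by blast
next
  fix x assume "x \<in> hcartan J a" then have "br H0 x = 0" using centralizer_of_a[of x] H0_a by blast
  then show "x \<in> G {0}" by (simp add: G_eig)
qed

lemma G_0_of_degrees: "deg ` \<beta> \<inter> S = {} \<Longrightarrow> x \<in> G S \<Longrightarrow> x = 0"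
  by (rule ip_eqI) (auto simp: G_def ip_simps)

lemma G_cong_degrees: "deg ` \<beta> \<inter> S \<subseteq> T \<Longrightarrow> x \<in> G S \<Longrightarrow> x \<in> G T"
  unfolding G_def by blast

lemma H0_h: "H0 \<in> G {0}" unfolding G_eig by (simp add: br_self)

lemma pr_commute:
  assumes "linear f" "\<And>x. f (br H0 x) = br H0 (f x)" shows "pr S (f x) = f (pr S x)"
proof -
  have "(\<lambda>x. pr S (f x)) = (\<lambda>x. f (pr S x))"
  proof (rule linear_eqI)
    show "linear (\<lambda>x. pr S (f x))" "linear (\<lambda>x. f (pr S x))"
      using linear_compose[OF assms(1) pr_linear] linear_compose[OF pr_linear assms(1)] by (auto simp: o_def)
    fix b assume b: "b \<in> \<beta>"
    then have "b \<in> G {deg b}" using \<beta>_G by auto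
    then have fb: "f b \<in> G {deg b}" unfolding G_eig using assms by (metis linear_scale)
    show "pr S (f b) = f (pr S b)"
    proof (cases "deg b \<in> S")
      case True
      then have "f b \<in> G S" "b \<in> G S" using fb G_mono \<beta>_G b by auto
      then show ?thesis by (simp add: pr_id)
    next
      case False
      then have "pr S (f b) = 0" "pr S b = 0" using pr_zero[OF fb] pr_zero[OF \<open>b \<in> G {deg b}\<close>] by auto
      then show ?thesis by (simp add: linear_0[OF assms(1)])
    qed
  qed
  then show ?thesis by (rule fun_cong)
qed

lemma h_abelian: "H \<in> G {0} \<Longrightarrow> K \<in> G {0} \<Longrightarrow> br H K = 0"
  unfolding G_h hcartan_def using a_abelian by (auto simp: br_simps br_J br_J_left J_simps)

lemma pr_br_h: assumes "H \<in> G {0}" shows "pr S (br H x) = br H (pr S x)"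
  by (rule pr_commute[OF br_linear]) (use jacobi[of H0 H] h_abelian[OF H0_h assms] in \<open>simp add: br_simps\<close>)

section \<open>Regular elements of h and the unipotent groups\<close>

definition regular :: "'g \<Rightarrow> bool" where
  "regular \<Lambda> \<longleftrightarrow> \<Lambda> \<in> G {0} \<and> (\<forall>x. br \<Lambda> x = 0 \<longrightarrow> x \<in> G {0})"

lemma regular_h: "regular \<Lambda> \<Longrightarrow> \<Lambda> \<in> G {0}" unfolding regular_def by blast

lemma regular_H0: "regular H0"
  unfolding regular_def using H0_h by (simp add: G_eig)

lemma regular_theta: assumes "regular \<Lambda>" shows "regular (\<theta> \<Lambda>)"
  unfolding regular_def
proof (intro conjI allI impI)
  show "\<theta> \<Lambda> \<in> G {0}" by (rule \<theta>_G) (use assms regular_h in auto)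
  fix x assume "br (\<theta> \<Lambda>) x = 0"
  then have "br \<Lambda> (\<theta> x) = 0" using \<theta>_br[of "\<theta> \<Lambda>" x] by (simp add: \<theta>\<theta> \<theta>_simps)
  then have "\<theta> x \<in> G {0}" using assms unfolding regular_def by blast
  then have "\<theta> (\<theta> x) \<in> G {0}" by (rule \<theta>_G) auto
  then show "x \<in> G {0}" by (simp add: \<theta>\<theta>)
qed

lemma regular_inj: "regular \<Lambda> \<Longrightarrow> br \<Lambda> x = 0 \<Longrightarrow> x \<in> G S \<Longrightarrow> 0 \<notin> S \<Longrightarrow> x = 0"
  unfolding regular_def using G_disjoint[of x "{0}" S] by auto

text \<open>ad \<Lambda> preserves degrees and has its kernel in h. Adding \<open>pr {0}\<close>
  makes it injective, hence invertible, and the solution is projected to the degrees in S.\<close>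

lemma regular_solve:
  assumes "regular \<Lambda>" "0 \<notin> S" "w \<in> G S" shows "\<exists>x\<in>G S. br \<Lambda> x = w"
proof -
  note h = regular_h[OF assms(1)]
  let ?T = "\<lambda>x. br \<Lambda> x + pr {0} x"
  have lin: "linear ?T" by (rule linear_compose_add[OF br_linear pr_linear])
  have "inj ?T" unfolding linear_injective_0[OF lin]
  proof (intro allI impI)
    fix x assume x: "br \<Lambda> x + pr {0} x = 0"
    have "pr {0} (br \<Lambda> x) + pr {0} (pr {0} x) = pr {0} (br \<Lambda> x + pr {0} x)" by (simp add: pr_simps)
    then have "pr {0} (br \<Lambda> x) + pr {0} (pr {0} x) = 0" by (simp add: x pr_simps)
    moreover have "pr {0} (br \<Lambda> x) = 0" using pr_br_h[OF h] h_abelian[OF h pr_mem] by simp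
    ultimately have p: "pr {0} x = 0" by (simp add: pr_pr)
    then have "x \<in> G {0}" using x assms(1) unfolding regular_def by simp
    then show "x = 0" using p pr_id[of x "{0}"] by simp
  qed
  then have "surj ?T" using linear_inj_imp_surj[OF lin] by blast
  then obtain x where x: "w = br \<Lambda> x + pr {0} x" by (rule surjE)
  have "br \<Lambda> (pr S x) = pr S (br \<Lambda> x + pr {0} x)"
    using assms(2) by (simp add: pr_simps pr_pr pr_br_h[OF h]) (simp add: pr_def)
  then show ?thesis using x pr_id[OF assms(3)] pr_mem[of S x] by auto
qed

text \<open>Unipotence is expressed by the degree filtration instead of by exponentials, which makes
  products and inverses easy. Being inner is a separate condition, carried by
  \<open>inn\<close>.\<close>

definition NN :: "('g \<Rightarrow> 'g) set" where "NN = {g. aut g \<and> (\<forall>c. \<forall>x\<in>G {c..}. g x - x \<in> G {c<..})}"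
definition LL :: "('g \<Rightarrow> 'g) set" where "LL = {g. aut g \<and> (\<forall>c. \<forall>x\<in>G {..c}. g x - x \<in> G {..<c})}"

lemma NN_aut: "g \<in> NN \<Longrightarrow> aut g" and NN_diff: "g \<in> NN \<Longrightarrow> x \<in> G {c..} \<Longrightarrow> g x - x \<in> G {c<..}"
  unfolding NN_def by auto

lemma NN_ge: assumes "g \<in> NN" "x \<in> G {c..}" shows "g x \<in> G {c..}"
proof -
  have "g x - x \<in> G {c..}" by (rule G_mono[OF NN_diff[OF assms]]) auto
  then show ?thesis using G_add[OF _ assms(2)] by force
qed

lemma greaterThan_Union: "G {c<..} = {x. \<exists>d>c. x \<in> G {d..}}"
proof safe
  fix x assume x: "x \<in> G {c<..}"
  let ?D = "deg ` \<beta> \<inter> {c<..}"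
  show "\<exists>d>c. x \<in> G {d..}"
  proof (cases "?D = {}")
    case True
    then have "x = 0" using G_0_of_degrees[OF _ x] by blast
    then show ?thesis using G_0 by (intro exI[of _ "c + 1"]) auto
  next
    case False
    have f: "finite ?D" using \<beta>_fin by auto
    have "Min ?D \<in> ?D" using Min_in[OF f False] .
    moreover have "x \<in> G {Min ?D..}" by (rule G_cong_degrees[OF _ x]) (use f in auto)
    ultimately show ?thesis by auto
  qed
qed (auto elim: G_mono)

lemma NN_gt: "g \<in> NN \<Longrightarrow> x \<in> G {c<..} \<Longrightarrow> g x \<in> G {c<..}"
  unfolding greaterThan_Union using NN_ge by blast

lemma NN_id: "id \<in> NN" unfolding NN_def using aut_id G_0 by auto

lemma NN_comp: assumes "f \<in> NN" "g \<in> NN" shows "f \<circ> g \<in> NN"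
  unfolding NN_def
proof (intro CollectI conjI allI ballI)
  show "aut (f \<circ> g)" using assms NN_aut aut_comp by blast
  fix c x assume x: "x \<in> G {c..}"
  have "f (g x) - g x \<in> G {c<..}" "g x - x \<in> G {c<..}"
    using NN_diff[OF assms(1) NN_ge[OF assms(2) x]] NN_diff[OF assms(2) x] by auto
  from G_add[OF this] show "(f \<circ> g) x - x \<in> G {c<..}" by simp
qed

lemma aut_inv_mem: assumes g: "aut g" and S: "subspace S" "\<And>x. x \<in> S \<Longrightarrow> g x \<in> S" and x: "x \<in> S" shows "inv g x \<in> S"
proof -
  have "dim (g ` S) = dim S" by (rule dim_image_eq[OF aut_linear[OF g]]) (meson aut_bij[OF g] bij_is_inj inj_on_subset subset_UNIV)
  then have "g ` S = S" using subspace_dim_equal[of "g ` S" S] S linear_subspace_image[OF aut_linear[OF g] S(1)] by auto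
  then obtain y where "y \<in> S" "x = g y" using x by blast
  then show ?thesis using aut_inv_apply[OF g] by simp
qed

lemma NN_inv: assumes "g \<in> NN" shows "inv g \<in> NN"
  unfolding NN_def
proof (intro CollectI conjI allI ballI)
  note ga = NN_aut[OF assms]
  show "aut (inv g)" using ga by (rule aut_inv)
  fix c x assume x: "x \<in> G {c..}"
  have "inv g x \<in> G {c..}" by (rule aut_inv_mem[OF ga G_subspace NN_ge[OF assms] x])
  from NN_diff[OF assms this] have "x - inv g x \<in> G {c<..}" by (simp add: aut_inv_apply[OF ga])
  from G_neg[OF this] show "inv g x - x \<in> G {c<..}" by simp
qed

lemma NN_theta: assumes "g \<in> NN" shows "(\<lambda>x. \<theta> (g (\<theta> x))) \<in> LL"
  unfolding LL_def
proof (intro CollectI conjI allI ballI)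
  show "aut (\<lambda>x. \<theta> (g (\<theta> x)))" using assms NN_aut aut_theta by blast
  fix c x assume x: "x \<in> G {..c}"
  have "\<theta> x \<in> G {-c..}" by (rule \<theta>_G[OF x]) auto
  then have "\<theta> (g (\<theta> x) - \<theta> x) \<in> G {..<c}" using NN_diff[OF assms] by (intro \<theta>_G[where S="{-c<..}"]) auto
  then show "\<theta> (g (\<theta> x)) - x \<in> G {..<c}" by (simp add: \<theta>_simps \<theta>\<theta>)
qed

lemma LL_theta: assumes "g \<in> LL" shows "(\<lambda>x. \<theta> (g (\<theta> x))) \<in> NN"
  unfolding NN_def
proof (intro CollectI conjI allI ballI)
  show "aut (\<lambda>x. \<theta> (g (\<theta> x)))" using assms aut_theta unfolding LL_def by blast
  fix c x assume x: "x \<in> G {c..}"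
  have "\<theta> x \<in> G {..-c}" by (rule \<theta>_G[OF x]) auto
  then have "\<theta> (g (\<theta> x) - \<theta> x) \<in> G {c<..}" using assms unfolding LL_def by (intro \<theta>_G[where S="{..<-c}"]) auto
  then show "\<theta> (g (\<theta> x)) - x \<in> G {c<..}" by (simp add: \<theta>_simps \<theta>\<theta>)
qed

lemma LL_aut: "g \<in> LL \<Longrightarrow> aut g" and LL_diff: "g \<in> LL \<Longrightarrow> x \<in> G {..c} \<Longrightarrow> g x - x \<in> G {..<c}"
  unfolding LL_def by auto

lemma theta_conj_theta: "(\<lambda>x. \<theta> ((\<lambda>x. \<theta> (g (\<theta> x))) (\<theta> x))) = g"
  by (auto simp: \<theta>\<theta>)

lemma LL_lt: assumes "g \<in> LL" "x \<in> G {..<c}" shows "g x \<in> G {..<c}"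
proof -
  have "\<theta> x \<in> G {-c<..}" by (rule \<theta>_G[OF assms(2)]) auto
  from NN_gt[OF LL_theta[OF assms(1)] this] have "\<theta> (g x) \<in> G {-c<..}" by (simp add: \<theta>\<theta>)
  then have "\<theta> (\<theta> (g x)) \<in> G {..<c}" by (rule \<theta>_G) auto
  then show ?thesis by (simp add: \<theta>\<theta>)
qed

lemma LL_comp: assumes "f \<in> LL" "g \<in> LL" shows "f \<circ> g \<in> LL"
proof -
  have "(\<lambda>x. \<theta> (((\<lambda>x. \<theta> (f (\<theta> x))) \<circ> (\<lambda>x. \<theta> (g (\<theta> x)))) (\<theta> x))) \<in> LL"
    by (intro NN_theta NN_comp LL_theta assms)
  then show ?thesis by (simp add: \<theta>\<theta> o_def)
qed

lemma inv_theta_conj: assumes "aut g" shows "inv (\<lambda>x. \<theta> (g (\<theta> x))) = (\<lambda>x. \<theta> (inv g (\<theta> x)))"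
  by (rule inv_unique_comp) (auto simp: fun_eq_iff \<theta>\<theta> aut_inv_apply[OF assms])

lemma LL_inv: assumes "g \<in> LL" shows "inv g \<in> LL"
  using NN_theta[OF NN_inv[OF LL_theta[OF assms]]] unfolding inv_theta_conj[OF LL_aut[OF assms]] theta_conj_theta .

lemma NN_expop: assumes "x \<in> G {0<..}" shows "expop (br x) \<in> NN"
  unfolding NN_def
proof (intro CollectI conjI allI ballI aut_expop)
  fix c y assume y: "y \<in> G {c..}"
  have "(br x ^^ n) y \<in> G {c<..}" if "n \<ge> 1" for n
    using that
  proof (induction n rule: nat_induct_at_least)
    case base show ?case using br_G[OF assms y, of "{c<..}"] by simp
  next
    case (Suc n) show ?case using br_G[OF assms Suc(2), of "{c<..}"] by simp
  qed
  from expop_minus_partial_sum_mem[where m=1, OF br_linear G_subspace this]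
  show "expop (br x) y - y \<in> G {c<..}" by simp
qed

text \<open>Triangular solving from the lowest possible degree d of \<nu>: if
  \<open>br \<Lambda> x\<close> is the d-part of \<nu>, then exp(ad x) removes that part from
  \<Lambda> + \<nu> and otherwise changes only higher degrees. The induction counts the degrees
  above c.\<close>

lemma NN_transitive:
  assumes \<Lambda>: "regular \<Lambda>" and \<nu>: "\<nu> \<in> G {0<..}"
  obtains n where "n \<in> NN" "n \<in> inn" "n \<Lambda> = \<Lambda> + \<nu>"
proof -
  have "\<exists>n. n \<in> NN \<and> n \<in> inn \<and> n \<Lambda> = \<Lambda> + \<nu>"
    if "c \<ge> 0" "\<nu> \<in> G {c<..}" "card (deg ` \<beta> \<inter> {c<..}) = k" for c \<nu> k
    using that
  proof (induction k arbitrary: c \<nu> rule: less_induct)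
    case (less k)
    let ?D = "deg ` \<beta> \<inter> {c<..}"
    have f: "finite ?D" using \<beta>_fin by auto
    show ?case
    proof (cases "?D = {}")
      case True
      then have "\<nu> = 0" using G_0_of_degrees[OF _ less.prems(2)] by blast
      then have "id \<Lambda> = \<Lambda> + \<nu>" by simp
      then show ?thesis using NN_id inn_id by blast
    next
      case False
      define d where "d = Min ?D"
      have d: "d \<in> ?D" unfolding d_def using Min_in[OF f False] .
      have dc: "d > c" "d > 0" using d less.prems(1) by auto
      have \<nu>d: "\<nu> \<in> G {d..}" by (rule G_cong_degrees[OF _ less.prems(2)]) (use f in \<open>auto simp: d_def\<close>)
      obtain x where x: "x \<in> G {d}" "br \<Lambda> x = pr {d} \<nu>"
        using regular_solve[OF \<Lambda> _ pr_mem, of "{d}" \<nu>] dc by auto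
      have xG: "x \<in> G {d..}" "x \<in> G {0<..}" using G_mono[OF x(1)] dc by auto
      have h: "\<Lambda> \<in> G {0..}" using G_mono[OF regular_h[OF \<Lambda>]] by auto
      let ?y = "\<Lambda> + \<nu>"
      have y: "?y \<in> G {0..}" using G_add[OF h G_mono[OF \<nu>d, of "{0..}"]] dc by auto
      have ad1: "br x ?y \<in> G {d..}" by (rule br_G[OF xG(1) y]) auto
      have "(br x ^^ n) ?y \<in> G {d<..}" if "n \<ge> 2" for n
        using that
      proof (induction n rule: nat_induct_at_least)
        case base
        have "br x (br x ?y) \<in> G {d<..}" by (rule br_G[OF xG(1) ad1]) (use dc in auto)
        then show ?case by (simp add: numeral_2_eq_2)
      next
        case (Suc n)
        have "br x ((br x ^^ n) ?y) \<in> G {d<..}" by (rule br_G[OF xG(1) Suc(2)]) (use dc in auto)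
        then show ?case by simp
      qed
      from expop_minus_partial_sum_mem[where m=2, OF br_linear G_subspace this]
      have e: "expop (br x) ?y - (?y + br x ?y) \<in> G {d<..}" by (simp add: numeral_2_eq_2)
      have "br x ?y = br x \<nu> - pr {d} \<nu>" using x(2) br_anti[of x \<Lambda>] by (simp add: br_simps)
      moreover have "br x \<nu> \<in> G {d<..}" by (rule br_G[OF xG(1) \<nu>d]) (use dc in auto)
      moreover have "\<nu> - pr {d} \<nu> \<in> G {d<..}"
        unfolding G_def using \<nu>d by (auto simp: ip_simps ip_pr G_def)
      ultimately have "(expop (br x) ?y - (?y + br x ?y)) + (br x \<nu> + (\<nu> - pr {d} \<nu>)) \<in> G {d<..}"
        using e by (intro G_add)
      then have "expop (br x) ?y - \<Lambda> \<in> G {d<..}" using \<open>br x ?y = _\<close> by (simp add: algebra_simps)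
      moreover have "card (deg ` \<beta> \<inter> {d<..}) < k"
        unfolding less.prems(3)[symmetric] using d dc f by (intro psubset_card_mono) auto
      ultimately obtain n where n: "n \<in> NN" "n \<in> inn" "n \<Lambda> = \<Lambda> + (expop (br x) ?y - \<Lambda>)"
        using less.IH[of "card (deg ` \<beta> \<inter> {d<..})" d "expop (br x) ?y - \<Lambda>"] dc by auto
      have "expop (br (- x)) (n \<Lambda>) = \<Lambda> + \<nu>" using n(3) by (simp add: expop_br_uminus)
      moreover have "expop (br (- x)) \<in> NN" by (rule NN_expop[OF G_neg[OF xG(2)]])
      ultimately have "expop (br (- x)) \<circ> n \<in> NN" "(expop (br (- x)) \<circ> n) \<Lambda> = \<Lambda> + \<nu>"
        using NN_comp n by auto
      then show ?thesis using inn_step[OF n(2)] by blast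
    qed
  qed
  from this[of 0] show ?thesis using \<nu> that by blast
qed

text \<open>n preserves the centralizer of \<Lambda>, which is h, and being unipotent fixes it
  pointwise. So n commutes with ad H0 and preserves degrees, while \<open>n b - b\<close> has higher
  degree than b.\<close>

lemma NN_free: assumes "regular \<Lambda>" "n \<in> NN" "n \<Lambda> = \<Lambda>" shows "n = id"
proof -
  note na = NN_aut[OF assms(2)]
  have nh: "n H = H" if H: "H \<in> G {0}" for H
  proof -
    have "br \<Lambda> (n H) = n (br \<Lambda> H)" using aut_br[OF na] assms(3) by simp
    also have "\<dots> = 0" using h_abelian[OF regular_h[OF assms(1)] H] linear_0[OF aut_linear[OF na]] by simp
    finally have "n H \<in> G {0}" using assms(1) unfolding regular_def by blast
    then have "n H - H \<in> G {0}" using H by (rule G_diff)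
    moreover have "n H - H \<in> G {0<..}" by (rule NN_diff[OF assms(2) G_mono[OF H]]) auto
    ultimately have "n H - H = 0" by (rule G_disjoint) auto
    then show ?thesis by simp
  qed
  show ?thesis
  proof (rule linear_eqI[OF aut_linear[OF na] linear_id])
    fix b assume b: "b \<in> \<beta>"
    then have bG: "b \<in> G {deg b}" using \<beta>_G by auto
    then have "n b \<in> G {deg b}" unfolding G_eig using aut_br[OF na, of H0 b] nh[OF H0_h] linear_scale[OF aut_linear[OF na]] by metis
    then have "n b - b \<in> G {deg b}" using bG by (rule G_diff)
    moreover have "n b - b \<in> G {deg b<..}" by (rule NN_diff[OF assms(2) G_mono[OF bG]]) auto
    ultimately have "n b - b = 0" by (rule G_disjoint) auto
    then show "n b = id b" by simp
  qed
qed

lemma LL_transitive: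
  assumes \<Lambda>: "regular \<Lambda>" and \<zeta>: "\<zeta> \<in> G {..<0}"
  obtains l where "l \<in> LL" "l \<in> inn" "l \<Lambda> = \<Lambda> + \<zeta>"
proof -
  have "\<theta> \<zeta> \<in> G {0<..}" by (rule \<theta>_G[OF \<zeta>]) auto
  then obtain n where n: "n \<in> NN" "n \<in> inn" "n (\<theta> \<Lambda>) = \<theta> \<Lambda> + \<theta> \<zeta>"
    using NN_transitive[OF regular_theta[OF \<Lambda>]] by metis
  show ?thesis
    by (rule that[OF NN_theta[OF n(1)] inn_theta[OF n(2)]]) (simp add: n(3) \<theta>_simps \<theta>\<theta>)
qed

lemma LL_free: assumes "regular \<Lambda>" "l \<in> LL" "l \<Lambda> = \<Lambda>" shows "l = id"
proof -
  have "(\<lambda>x. \<theta> (l (\<theta> x))) = id"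
    by (rule NN_free[OF regular_theta[OF assms(1)] LL_theta[OF assms(2)]]) (simp add: \<theta>\<theta> assms(3))
  then have "\<theta> (l (\<theta> (\<theta> x))) = \<theta> x" for x by (simp add: fun_eq_iff)
  then have "\<theta> (\<theta> (l x)) = \<theta> (\<theta> x)" for x by (simp add: \<theta>\<theta>)
  then show ?thesis by (simp add: \<theta>\<theta> fun_eq_iff)
qed

end

section \<open>Holomorphic families and the Gauss decomposition\<close>

text \<open>The Leibniz formula makes the determinant entire. Singularity is stated through a null
  vector given as a plain function, so that matrices do not appear in the conclusion.\<close>

lemma holomorphic_family_determinant:
  fixes A :: "nat \<Rightarrow> nat \<Rightarrow> complex \<Rightarrow> complex"
  assumes "\<And>i j. i < m \<Longrightarrow> j < m \<Longrightarrow> A i j holomorphic_on UNIV"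
  shows "\<exists>F. F holomorphic_on UNIV \<and>
    (\<forall>s. F s = 0 \<longleftrightarrow> (\<exists>v. (\<exists>j<m. v j \<noteq> 0) \<and> (\<forall>i<m. (\<Sum>j<m. A i j s * v j) = 0)))"
proof (intro exI conjI allI)
  define M where "M s = Matrix.mat m m (\<lambda>(i, j). A i j s)" for s
  have carr: "M s \<in> carrier_mat m m" for s unfolding M_def by simp
  have det: "Determinant.det (M s) = (\<Sum>p\<in>{p. p permutes {0..<m}}. signof p * (\<Prod>i=0..<m. A i (p i) s))" for s
  proof -
    have "Determinant.det (M s) = (\<Sum>p\<in>{p. p permutes {0..<m}}. signof p * (\<Prod>i=0..<m. M s $$ (i, p i)))"
      using carr[of s] by (auto simp: Determinant.det_def)
    also have "\<dots> = (\<Sum>p\<in>{p. p permutes {0..<m}}. signof p * (\<Prod>i=0..<m. A i (p i) s))"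
    proof (rule sum.cong[OF refl])
      fix p assume p: "p \<in> {p. p permutes {0..<m}}"
      have "(\<Prod>i=0..<m. M s $$ (i, p i)) = (\<Prod>i=0..<m. A i (p i) s)"
      proof (rule prod.cong[OF refl])
        fix i assume "i \<in> {0..<m}"
        then have "i < m" "p i < m" using p permutes_in_image[of p "{0..<m}" i] by auto
        then show "M s $$ (i, p i) = A i (p i) s" unfolding M_def by simp
      qed
      then show "signof p * (\<Prod>i=0..<m. M s $$ (i, p i)) = signof p * (\<Prod>i=0..<m. A i (p i) s)" by simp
    qed
    finally show ?thesis .
  qed
  show "(\<lambda>s. Determinant.det (M s)) holomorphic_on UNIV"
    unfolding det
  proof (intro holomorphic_intros)
    fix p i assume "p \<in> {p. p permutes {0..<m}}" "i \<in> {0..<m}"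
    then have "i < m" "p i < m" using permutes_in_image[of p "{0..<m}" i] by auto
    then show "(\<lambda>s. A i (p i) s) holomorphic_on UNIV" using assms by simp
  qed
  fix s
  have mult: "(M s *\<^sub>v v) $ i = (\<Sum>j<m. A i j s * v $ j)" if "v \<in> carrier_vec m" "i < m" for v i
    using that unfolding M_def by (simp add: scalar_prod_def atLeast0LessThan)
  have "Determinant.det (M s) = 0 \<longleftrightarrow> (\<exists>v. v \<in> carrier_vec m \<and> v \<noteq> 0\<^sub>v m \<and> M s *\<^sub>v v = 0\<^sub>v m)"
    by (rule det_0_iff_vec_prod_zero_field[OF carr])
  also have "\<dots> \<longleftrightarrow> (\<exists>v. (\<exists>j<m. v j \<noteq> 0) \<and> (\<forall>i<m. (\<Sum>j<m. A i j s * v j) = 0))" (is "?l \<longleftrightarrow> ?r")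
  proof
    assume ?l
    then obtain v where v: "v \<in> carrier_vec m" "v \<noteq> 0\<^sub>v m" "M s *\<^sub>v v = 0\<^sub>v m" by blast
    have "\<exists>j<m. v $ j \<noteq> 0" using v(1,2) by (metis eq_vecI carrier_vecD index_zero_vec)
    moreover have "(\<Sum>j<m. A i j s * v $ j) = 0" if "i < m" for i
      using mult[OF v(1) that] v(3) that by simp
    ultimately show ?r by (intro exI[of _ "\<lambda>j. v $ j"]) auto
  next
    assume ?r
    then obtain v where v: "\<exists>j<m. v j \<noteq> 0" "\<forall>i<m. (\<Sum>j<m. A i j s * v j) = 0" by blast
    let ?v = "Matrix.vec m v"
    have c: "?v \<in> carrier_vec m" by simp
    have "?v \<noteq> 0\<^sub>v m"
    proof
      assume z: "?v = 0\<^sub>v m"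
      obtain j where "j < m" "v j \<noteq> 0" using v(1) by blast
      then show False using arg_cong[OF z, of "\<lambda>u. vec_index u j"] by simp
    qed
    moreover have "M s *\<^sub>v ?v = 0\<^sub>v m"
    proof (rule eq_vecI)
      show "dim_vec (M s *\<^sub>v ?v) = dim_vec (0\<^sub>v m :: complex Matrix.vec)" using carr[of s] by simp
      fix i assume "i < dim_vec (0\<^sub>v m :: complex Matrix.vec)"
      then have i: "i < m" by simp
      then show "(M s *\<^sub>v ?v) $ i = 0\<^sub>v m $ i" using mult[OF c i] v(2) by simp
    qed
    ultimately show ?l using c by blast
  qed
  finally show "Determinant.det (M s) = 0 \<longleftrightarrow> (\<exists>v. (\<exists>j<m. v j \<noteq> 0) \<and> (\<forall>i<m. (\<Sum>j<m. A i j s * v j) = 0))" .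
qed

section \<open>Complex coordinates and families with a complex parameter\<close>

context cartan_setting begin

text \<open>The complex-linear functional with real part \<open>ip x b\<close>.\<close>

definition xi :: "'g \<Rightarrow> 'g \<Rightarrow> complex" where "xi b x = Complex (ip x b) (- ip (J x) b)"

lemma xi_linear: "linear (xi b)"
  unfolding xi_def by (rule linearI) (simp_all add: J_simps ip_simps complex_eq_iff)

lemma xi_J: "xi b (J x) = \<i> * xi b x"
  unfolding xi_def by (simp add: JJ ip_simps complex_eq_iff)

lemma cs_eq: "linear f \<Longrightarrow> (\<And>x. f (J x) = \<i> * f x) \<Longrightarrow> f (cs c x) = c * f x"
  for f :: "'g \<Rightarrow> complex"
  unfolding cs_def by (simp add: linear_add linear_scale) (simp add: complex_eq_iff)

lemma cs_cs: "cs c (cs d x) = cs (c * d) x"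
  unfolding cs_def by (simp add: J_simps JJ algebra_simps)

lemma br_cs: "br (cs c x) y = cs c (br x y)" "br x (cs c y) = cs c (br x y)"
  unfolding cs_def by (simp_all add: br_simps br_J br_J_left)

text \<open>An orthonormal real basis of the compact form k, found among the eigenvectors of
  \<theta>, is a complex basis of g = k + J k. Duality holds because J k is orthogonal to k.\<close>

lemma complex_basis_exists:
  "\<exists>\<gamma>. finite \<gamma> \<and> (\<forall>x. x = (\<Sum>b\<in>\<gamma>. cs (xi b x) b)) \<and> (\<forall>b\<in>\<gamma>. \<forall>c\<in>\<gamma>. xi c b = (if b = c then 1 else 0))"
proof -
  have sym: "ip (\<theta> x) y = ip x (\<theta> y)" for x y using ip_\<theta>[of x "\<theta> y"] by (simp add: \<theta>\<theta>)
  obtain \<delta> where \<delta>: "finite \<delta>" "\<And>b c. b \<in> \<delta> \<Longrightarrow> c \<in> \<delta> \<Longrightarrow> ip b c = (if b = c then 1 else 0)"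
    "\<And>x. x = (\<Sum>b\<in>\<delta>. ip x b *\<^sub>R b)" "\<And>b f. b \<in> \<delta> \<Longrightarrow> f \<in> {\<theta>} \<Longrightarrow> \<exists>c. f b = c *\<^sub>R b"
  proof (rule orthonormal_eigenbasis[of "{\<theta>}"])
    show "linear f" if "f \<in> {\<theta>}" for f using that \<theta>_linear by simp
    show "ip (f x) y = ip x (f y)" if "f \<in> {\<theta>}" for f x y using that sym by simp
    show "f (g x) = g (f x)" if "f \<in> {\<theta>}" "g \<in> {\<theta>}" for f g x using that by simp
  qed blast
  define \<gamma> where "\<gamma> = {b\<in>\<delta>. \<theta> b = b}"
  have fin: "finite \<gamma>" using \<delta>(1) unfolding \<gamma>_def by simp
  have J_orth: "ip (J b) c = 0" if "\<theta> b = b" "\<theta> c = c" for b c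
    using sym[of "J b" c] that by (simp add: \<theta>_J ip_simps)
  have dual: "xi c b = (if b = c then 1 else 0)" if "b \<in> \<gamma>" "c \<in> \<gamma>" for b c
    using that \<delta>(2)[of b c] J_orth[of b c] unfolding \<gamma>_def xi_def by (auto simp: complex_eq_iff)
  have k0: "x = 0" if "\<theta> x = x" "\<And>b. b \<in> \<gamma> \<Longrightarrow> ip x b = 0" for x
  proof -
    have "ip x b = 0" if b: "b \<in> \<delta>" for b
    proof (cases "b \<in> \<gamma>")
      case False
      obtain c where c: "\<theta> b = c *\<^sub>R b" using \<delta>(4)[OF b] by blast
      have "c \<noteq> 1" using False b c unfolding \<gamma>_def by auto
      moreover have "ip x b = c * ip x b" using sym[of x b] \<open>\<theta> x = x\<close> c by (simp add: ip_simps)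
      ultimately show ?thesis by simp
    qed (use \<open>\<And>b. b \<in> \<gamma> \<Longrightarrow> ip x b = 0\<close> in blast)
    then show ?thesis using \<delta>(3)[of x] by simp
  qed
  have inj: "x = 0" if x: "\<And>b. b \<in> \<gamma> \<Longrightarrow> xi b x = 0" for x
  proof -
    have kk: "x + \<theta> x = 0" if "\<And>b. b \<in> \<gamma> \<Longrightarrow> ip x b = 0" for x
    proof (rule k0)
      show "\<theta> (x + \<theta> x) = x + \<theta> x" by (simp add: \<theta>_simps \<theta>\<theta>)
      fix b assume b: "b \<in> \<gamma>"
      then have "\<theta> b = b" unfolding \<gamma>_def by blast
      then show "ip (x + \<theta> x) b = 0" using that[OF b] sym[of x b] by (simp add: ip_simps)
    qed
    have 1: "x + \<theta> x = 0" by (rule kk) (use x in \<open>simp add: xi_def complex_eq_iff\<close>)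
    have "J x + \<theta> (J x) = 0" by (rule kk) (use x in \<open>simp add: xi_def complex_eq_iff\<close>)
    then have "J (x - \<theta> x) = 0" by (simp add: \<theta>_J J_simps)
    then have "x - \<theta> x = 0" using J_eq0 by blast
    then have "x + x = 0" using 1 by simp
    then show ?thesis by (simp flip: scaleR_2)
  qed
  have exp: "x = (\<Sum>b\<in>\<gamma>. cs (xi b x) b)" for x
  proof -
    have "xi c (x - (\<Sum>b\<in>\<gamma>. cs (xi b x) b)) = 0" if c: "c \<in> \<gamma>" for c
    proof -
      have "xi c (\<Sum>b\<in>\<gamma>. cs (xi b x) b) = (\<Sum>b\<in>\<gamma>. xi b x * xi c b)"
        by (simp add: linear_sum[OF xi_linear] cs_eq[OF xi_linear xi_J])
      also have "\<dots> = (\<Sum>b\<in>\<gamma>. if b = c then xi b x else 0)" by (rule sum.cong) (use dual c in auto)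
      also have "\<dots> = xi c x" using fin c by simp
      finally show ?thesis by (simp add: linear_diff[OF xi_linear])
    qed
    from inj[OF this] show ?thesis by simp
  qed
  show ?thesis by (intro exI[of _ \<gamma>] conjI allI ballI fin exp dual)
qed

text \<open>In complex coordinates injectivity is the nonvanishing of an entire determinant that is
  nonzero at s0, so its zeros are countable.\<close>

lemma holomorphic_family_noninjective:
  assumes S: "\<And>s. linear (S s)" "\<And>s x. S s (J x) = J (S s x)"
    and hol: "\<And>b x. (\<lambda>s. xi b (S s x)) holomorphic_on UNIV" and inj0: "inj (S s0)"
  shows "countable {s. \<not> inj (S s)}"
proof -
  obtain \<gamma> where "finite \<gamma> \<and> (\<forall>x. x = (\<Sum>b\<in>\<gamma>. cs (xi b x) b)) \<and> (\<forall>b\<in>\<gamma>. \<forall>c\<in>\<gamma>. xi c b = (if b = c then 1 else 0))"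
    using complex_basis_exists ..
  then have \<gamma>: "finite \<gamma>" "\<And>x. x = (\<Sum>b\<in>\<gamma>. cs (xi b x) b)"
    "\<And>b c. b \<in> \<gamma> \<Longrightarrow> c \<in> \<gamma> \<Longrightarrow> xi c b = (if b = c then 1 else 0)" by blast+
  define m where "m = card \<gamma>"
  obtain e where e: "bij_betw e {..<m} \<gamma>"
    using ex_bij_betw_nat_finite[OF \<gamma>(1)] unfolding m_def atLeast0LessThan by blast
  have exp: "x = (\<Sum>j<m. cs (xi (e j) x) (e j))" for x
    by (subst \<gamma>(2)) (rule sum.reindex_bij_betw[OF e, symmetric])
  have em: "e j \<in> \<gamma>" if "j < m" for j using e that bij_betwE by fastforce
  have ej: "e i = e j \<longleftrightarrow> i = j" if "i < m" "j < m" for i j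
    using e that unfolding bij_betw_def by (auto dest: inj_onD)
  have Scs: "S s (cs c x) = cs c (S s x)" for s c x
    unfolding cs_def by (simp add: linear_add[OF S(1)] linear_scale[OF S(1)] S(2))
  have xiS: "xi (e i) (S s x) = (\<Sum>j<m. xi (e i) (S s (e j)) * xi (e j) x)" for s x i
  proof -
    have "S s x = (\<Sum>j<m. cs (xi (e j) x) (S s (e j)))"
      by (subst exp[of x]) (simp add: linear_sum[OF S(1)] Scs)
    then show ?thesis by (simp add: linear_sum[OF xi_linear] cs_eq[OF xi_linear xi_J] mult.commute)
  qed
  obtain F where F: "F holomorphic_on UNIV"
    "\<And>s. F s = 0 \<longleftrightarrow> (\<exists>v. (\<exists>j<m. v j \<noteq> 0) \<and> (\<forall>i<m. (\<Sum>j<m. xi (e i) (S s (e j)) * v j) = 0))"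
    using holomorphic_family_determinant[of m "\<lambda>i j s. xi (e i) (S s (e j))"] hol by auto
  have F0: "F s = 0 \<longleftrightarrow> \<not> inj (S s)" for s
  proof
    assume "F s = 0"
    then obtain v j where v: "j < m" "v j \<noteq> 0" "\<And>i. i < m \<Longrightarrow> (\<Sum>j<m. xi (e i) (S s (e j)) * v j) = 0"
      using F(2) by blast
    define x where "x = (\<Sum>j<m. cs (v j) (e j))"
    have xi: "xi (e i) x = v i" if "i < m" for i
    proof -
      have "xi (e i) x = (\<Sum>j<m. v j * xi (e i) (e j))"
        unfolding x_def by (simp add: linear_sum[OF xi_linear] cs_eq[OF xi_linear xi_J])
      also have "\<dots> = (\<Sum>j<m. if j = i then v j else 0)"
        by (rule sum.cong) (use that \<gamma>(3) em ej in auto)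
      also have "\<dots> = v i" using that by simp
      finally show ?thesis .
    qed
    have "xi (e i) (S s x) = 0" if "i < m" for i
    proof -
      have "xi (e i) (S s x) = (\<Sum>j<m. xi (e i) (S s (e j)) * xi (e j) x)" by (rule xiS)
      also have "\<dots> = (\<Sum>j<m. xi (e i) (S s (e j)) * v j)" by (rule sum.cong) (auto simp: xi)
      finally show ?thesis using v(3)[OF that] by simp
    qed
    then have "(\<Sum>j<m. cs (xi (e j) (S s x)) (e j)) = 0" by (intro sum.neutral) (simp add: cs_def)
    then have "S s x = 0" using exp[of "S s x"] by (rule trans[rotated])
    moreover have "x \<noteq> 0" using xi[OF v(1)] v(2) linear_0[OF xi_linear] by auto
    ultimately show "\<not> inj (S s)" using linear_injective_0[OF S(1)] by blast
  next
    assume "\<not> inj (S s)"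
    then obtain x where x: "S s x = 0" "x \<noteq> 0" using linear_injective_0[OF S(1)] by blast
    have "\<exists>j<m. xi (e j) x \<noteq> 0"
    proof (rule ccontr)
      assume "\<not> ?thesis"
      then have "(\<Sum>j<m. cs (xi (e j) x) (e j)) = 0" by (intro sum.neutral) (simp add: cs_def)
      then have "x = 0" using exp[of x] by (rule trans[rotated])
      then show False using x by simp
    qed
    moreover have "(\<Sum>j<m. xi (e i) (S s (e j)) * xi (e j) x) = 0" for i
      using xiS[of i s x] x(1) linear_0[OF xi_linear] by simp
    ultimately show "F s = 0" unfolding F(2) by (intro exI[of _ "\<lambda>j. xi (e j) x"]) auto
  qed
  show ?thesis
  proof (cases "F constant_on UNIV")
    case True
    then obtain c where "\<And>s. F s = c" unfolding constant_on_def by blast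
    then have "{s. \<not> inj (S s)} = {}" using F0 inj0 by (metis (mono_tags, lifting) Collect_empty_eq)
    then show ?thesis by simp
  next
    case False
    have "countable {s\<in>UNIV. F s = 0}"
      by (rule holomorphic_countable_zeros[OF F(1)]) (use False in auto)
    then show ?thesis using F0 by simp
  qed
qed

text \<open>The n-th power of ad (s X) is s^n times that of ad X, so matrix coefficients are
  everywhere convergent power series in s.\<close>

lemma holomorphic_expop:
  "(\<lambda>s. xi b (L (expop (br (cs s X)) w))) holomorphic_on UNIV" if L: "linear L" "\<And>x. L (J x) = J (L x)"
proof -
  have lin: "linear (\<lambda>x. xi b (L x))" using linear_compose[OF L(1) xi_linear] by (simp add: o_def)
  have J: "xi b (L (J x)) = \<i> * xi b (L x)" for x by (simp add: L(2) xi_J)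
  have bl: "bounded_linear (\<lambda>x. xi b (L x))" using lin linear_conv_bounded_linear by blast
  have pow: "(br (cs s X) ^^ n) w = cs (s ^ n) ((br X ^^ n) w)" for s n
    by (induction n) (simp_all add: br_cs cs_cs mult.commute, simp add: cs_def)
  define c where "c n = xi b (L ((br X ^^ n) w)) / fact n" for n
  have trm: "xi b (L ((1 / fact n) *\<^sub>R (br (cs s X) ^^ n) w)) = c n * s ^ n" for s n
    unfolding c_def pow using linear_scale[OF lin] cs_eq[OF lin J]
    by (simp add: scaleR_conv_of_real)
  have eq: "xi b (L (expop (br (cs s X)) w)) = (\<Sum>n. c n * s ^ n)" for s
    unfolding expop_def bounded_linear.suminf[OF bl expop_summable[OF br_linear]] trm ..
  have sm: "summable (\<lambda>n. c n * s ^ n)" for s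
    unfolding trm[symmetric] by (rule bounded_linear.summable[OF bl expop_summable[OF br_linear]])
  have "((\<lambda>s. \<Sum>n. c n * s ^ n) has_field_derivative (\<Sum>n. diffs c n * s ^ n)) (at s)" for s
    by (rule termdiffs_strong_converges_everywhere[OF sm])
  then show ?thesis unfolding eq holomorphic_on_def field_differentiable_def by (auto intro: has_field_derivative_at_within)
qed

end

context root_setting begin

lemma tendsto_ipI:
  assumes "\<And>b. b \<in> \<beta> \<Longrightarrow> ((\<lambda>i. ip (f i) b) \<longlongrightarrow> ip l b) F" shows "(f \<longlongrightarrow> l) F"
proof -
  have "((\<lambda>i. \<Sum>b\<in>\<beta>. ip (f i) b *\<^sub>R b) \<longlongrightarrow> (\<Sum>b\<in>\<beta>. ip l b *\<^sub>R b)) F"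
    by (intro tendsto_intros assms)
  then show ?thesis by (simp flip: \<beta>_exp)
qed

lemma tendsto_ip: "(f \<longlongrightarrow> l) F \<Longrightarrow> ((\<lambda>i. ip (f i) b) \<longlongrightarrow> ip l b) F"
  by (rule bounded_bilinear.tendsto[OF ip_bounded_bilinear _ tendsto_const])

lemma tendsto_apply_family:
  fixes M :: "'i \<Rightarrow> 'g \<Rightarrow> 'g" and x :: "'i \<Rightarrow> 'g"
  assumes "\<And>i. linear (M i)" "linear N" "\<And>v. ((\<lambda>i. M i v) \<longlongrightarrow> N v) F" "(x \<longlongrightarrow> y) F"
  shows "((\<lambda>i. M i (x i)) \<longlongrightarrow> N y) F"
proof -
  have "((\<lambda>i. \<Sum>b\<in>\<beta>. ip (x i) b *\<^sub>R M i b) \<longlongrightarrow> (\<Sum>b\<in>\<beta>. ip y b *\<^sub>R N b)) F"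
    by (intro tendsto_intros assms tendsto_ip)
  then show ?thesis by (simp flip: expand[OF assms(1)] expand[OF assms(2)])
qed

lemma expop_cs_tendsto: "((\<lambda>s. expop (br (cs s X)) w) \<longlongrightarrow> expop (br (cs s0 X)) w) (at s0)"
proof (rule tendsto_ipI)
  fix b
  have "(\<lambda>s. xi b (id (expop (br (cs s X)) w))) holomorphic_on UNIV"
    by (rule holomorphic_expop[OF linear_id]) simp
  then have "isCont (\<lambda>s. xi b (id (expop (br (cs s X)) w))) s0"
    using holomorphic_on_imp_continuous_on continuous_on_eq_continuous_at[OF open_UNIV] by blast
  then have "((\<lambda>s. Re (xi b (expop (br (cs s X)) w))) \<longlongrightarrow> Re (xi b (expop (br (cs s0 X)) w))) (at s0)"
    unfolding isCont_def by (intro tendsto_Re) simp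
  then show "((\<lambda>s. ip (expop (br (cs s X)) w) b) \<longlongrightarrow> ip (expop (br (cs s0 X)) w) b) (at s0)"
    by (simp add: xi_def)
qed

end

section \<open>Spectra of triangular elements and transversality\<close>

context graded begin

text \<open>Let T = ad (H + \<nu>) - c with c the eigenvalue of H at b. T preserves the sum of the
  degrees above \<open>deg b\<close> and maps b into it. An injective T would map this sum onto
  itself, and b would have to lie in it.\<close>

lemma spec_upper: assumes H: "H \<in> G {0}" and \<nu>: "\<nu> \<in> G {0<..}" shows "spec H \<subseteq> spec (H + \<nu>)"
proof
  fix c assume "c \<in> spec H"
  then obtain b where b: "b \<in> \<beta>" "c = rt b H" using spec_h H G_h by auto
  define T where "T x = br (H + \<nu>) x - cs c x" for x
  have lin: "linear T" unfolding T_def by (rule linear_compose_sub[OF br_linear cs_linear])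
  have Tb: "T b = br \<nu> b" unfolding T_def using br_h_\<beta>[of H b] H G_h b by (simp add: br_simps)
  show "c \<in> spec (H + \<nu>)"
  proof (rule ccontr)
    assume "c \<notin> spec (H + \<nu>)"
    then have inj: "inj T" unfolding linear_injective_0[OF lin] T_def spec_def by auto
    let ?V = "G {deg b<..}"
    have TV: "T x \<in> ?V" if "x \<in> ?V" for x
    proof -
      have "br H x \<in> ?V" by (rule br_G[OF H that]) auto
      moreover have "br \<nu> x \<in> ?V" by (rule br_G[OF \<nu> that]) auto
      ultimately show ?thesis unfolding T_def using cs_G[OF that] by (simp add: br_simps G_add G_diff)
    qed
    have "dim (T ` ?V) = dim ?V" by (rule dim_image_eq[OF lin]) (meson inj inj_on_subset subset_UNIV)
    then have "T ` ?V = ?V"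
      using subspace_dim_equal[OF linear_subspace_image[OF lin G_subspace] G_subspace] TV by (simp add: image_subset_iff)
    moreover have "T b \<in> ?V" unfolding Tb by (rule br_G[OF \<nu> \<beta>_G[OF b(1), of "{deg b}"]]) auto
    ultimately obtain v where "v \<in> ?V" "T b = T v" by blast
    then have "b \<in> ?V" using injD[OF inj \<open>T b = T v\<close>] by simp
    then have "b = 0" by (rule G_disjoint[OF _ \<beta>_G[OF b(1), of "{deg b}"]]) auto
    then show False using \<beta>_nz b by blast
  qed
qed

text \<open>The component of highest degree of an eigenvector of H + \<zeta> is an eigenvector of H
  with the same eigenvalue.\<close>

lemma spec_lower: assumes H: "H \<in> G {0}" and \<zeta>: "\<zeta> \<in> G {..<0}" shows "spec (H + \<zeta>) \<subseteq> spec H"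
proof
  fix c assume "c \<in> spec (H + \<zeta>)"
  then obtain x where x: "x \<noteq> 0" "br (H + \<zeta>) x = cs c x" unfolding spec_def by blast
  let ?D = "{b\<in>\<beta>. ip x b \<noteq> 0}"
  have fin: "finite ?D" using \<beta>_fin by simp
  have ne: "?D \<noteq> {}" using ip_eqI[of x 0] x(1) by (auto simp: ip_simps)
  define m where "m = Max (deg ` ?D)"
  have "m \<in> deg ` ?D" unfolding m_def using fin ne by (intro Max_in) auto
  then obtain b where b: "b \<in> \<beta>" "ip x b \<noteq> 0" "deg b = m" by auto
  have xG: "x \<in> G {..m}" unfolding G_def
  proof (intro CollectI ballI impI)
    fix b assume b: "b \<in> \<beta>" "deg b \<notin> {..m}"
    show "ip x b = 0"
    proof (rule ccontr)
      assume "ip x b \<noteq> 0"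
      then have "deg b \<le> m" unfolding m_def using fin b(1) by (intro Max_ge) auto
      then show False using b(2) by simp
    qed
  qed
  have y: "pr {m} x \<noteq> 0" using ip_pr[OF b(1), of "{m}" x] b by (auto simp: ip_simps)
  have "pr {m} (br \<zeta> x) = 0" by (rule pr_zero[OF br_G[OF \<zeta> xG, of "{..<m}"]]) auto
  moreover have "pr {m} (cs c x) = cs c (pr {m} x)"
    by (rule pr_commute[OF cs_linear]) (simp add: br_cs)
  ultimately have "br H (pr {m} x) = cs c (pr {m} x)"
    using arg_cong[OF x(2), of "pr {m}"] by (simp add: br_simps pr_simps pr_br_h[OF H])
  then show "c \<in> spec H" unfolding spec_def using y by blast
qed

text \<open>Injectivity of \<open>Sg g\<close> says that the Borel subalgebra \<open>g (h + n)\<close> is transversal to \<open>l\<close>.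
  If \<open>g = l z n\<close> is a Gauss decomposition, \<open>sig g\<close> is the action of \<open>z\<^sup>-\<^sup>1\<close> on \<open>h\<close>.\<close>

definition Sg :: "('g \<Rightarrow> 'g) \<Rightarrow> 'g \<Rightarrow> 'g" where "Sg g x = pr {..<0} x + pr {0..} (g (pr {0..} x))"
definition good :: "('g \<Rightarrow> 'g) \<Rightarrow> bool" where "good g \<longleftrightarrow> inj (Sg g)"
definition sig :: "('g \<Rightarrow> 'g) \<Rightarrow> 'g \<Rightarrow> 'g" where "sig g H = pr {0} (inv (Sg g) H)"

lemma Sg_linear: "linear g \<Longrightarrow> linear (Sg g)"
  unfolding Sg_def using linear_compose_add[OF pr_linear linear_compose[OF linear_compose[OF pr_linear] pr_linear]] by (simp add: o_def)

lemma half_split: "x = pr {..<0} x + pr {0..} x"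
  by (rule pr_split) auto

lemma good_iff: assumes "linear g" shows "good g \<longleftrightarrow> (\<forall>x\<in>G {0..}. g x \<in> G {..<0} \<longrightarrow> x = 0)"
proof
  assume g: "good g"
  show "\<forall>x\<in>G {0..}. g x \<in> G {..<0} \<longrightarrow> x = 0"
  proof (intro ballI impI)
    fix x assume x: "x \<in> G {0..}" "g x \<in> G {..<0}"
    have "pr {..<0} x = 0" by (rule pr_zero[OF x(1)]) auto
    moreover have "pr {0..} (g x) = 0" by (rule pr_zero[OF x(2)]) auto
    ultimately have "Sg g x = 0" unfolding Sg_def using pr_id[OF x(1)] by simp
    then show "x = 0" using g linear_injective_0[OF Sg_linear[OF assms]] unfolding good_def by blast
  qed
next
  assume *: "\<forall>x\<in>G {0..}. g x \<in> G {..<0} \<longrightarrow> x = 0"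
  show "good g" unfolding good_def linear_injective_0[OF Sg_linear[OF assms]]
  proof (intro allI impI)
    fix x assume x: "Sg g x = 0"
    have d: "{..<0} \<inter> {0..} = ({}::real set)" "{0..} \<inter> {..<0} = ({}::real set)" by auto
    have p0: "pr {} y = 0" for y unfolding pr_def by simp
    have "pr {..<0} (Sg g x) = pr {..<0} x" unfolding Sg_def by (simp add: pr_simps pr_pr d p0)
    then have 1: "pr {..<0} x = 0" using x by (simp add: pr_simps)
    then have xG: "x = pr {0..} x" using half_split[of x] by simp
    have "pr {0..} (g (pr {0..} x)) = 0" using x 1 unfolding Sg_def by simp
    then have "g (pr {0..} x) \<in> G {..<0}" using half_split[of "g (pr {0..} x)"] pr_mem[of "{..<0}" "g (pr {0..} x)"] by simp
    then have "pr {0..} x = 0" using * pr_mem[of "{0..}" x] by blast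
    then show "x = 0" using xG by simp
  qed
qed

text \<open>\<open>Sg g\<close> is the identity on l and the compression of g on h + n, so a
  preimage of H is an element of h + n that g sends to H modulo l.\<close>

lemma Sg_solution:
  assumes g: "linear g" "good g" and H: "H \<in> G {0}"
  obtains \<nu> \<zeta> where "\<nu> \<in> G {0<..}" "\<zeta> \<in> G {..<0}" "g (sig g H + \<nu>) = H + \<zeta>" "inv (Sg g) H = sig g H + \<nu>"
proof -
  define x where "x = inv (Sg g) H"
  have "surj (Sg g)" using linear_inj_imp_surj[OF Sg_linear[OF g(1)]] g(2) unfolding good_def by blast
  then have S: "pr {..<0} x + pr {0..} (g (pr {0..} x)) = H" unfolding x_def using surj_f_inv_f[of "Sg g" H] unfolding Sg_def by simp
  have d: "{..<0} \<inter> {0..} = ({}::real set)" "{0..} \<inter> {..<0} = ({}::real set)" by auto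
  have p0: "pr {} y = 0" for y unfolding pr_def by simp
  have "pr {..<0} H = 0" by (rule pr_zero[OF H]) auto
  then have 1: "pr {..<0} x = 0" using arg_cong[OF S, of "pr {..<0}"] by (simp add: pr_simps pr_pr d p0)
  then have x: "x = pr {0..} x" using half_split[of x] by simp
  have u: "{0::real..} = {0} \<union> {0<..}" by auto
  have "pr {0..} x = pr {0} x + pr {0<..} x" unfolding u by (rule pr_Un) auto
  then have xs: "x = sig g H + pr {0<..} x" using x unfolding sig_def x_def by simp
  have "g x = pr {..<0} (g x) + H" using half_split[of "g x"] S 1 x by simp
  then have "g (sig g H + pr {0<..} x) = H + pr {..<0} (g x)" using xs by (simp add: add.commute)
  then show ?thesis using that[of "pr {0<..} x" "pr {..<0} (g x)"] pr_mem xs unfolding x_def by blast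
qed

text \<open>\<open>sig g H + \<nu>\<close> and H + \<zeta> are conjugate under g; triangularity
  compares each of them with its part in h.\<close>

lemma sig_spec: assumes "aut g" "good g" "H \<in> G {0}" shows "spec (sig g H) \<subseteq> spec H" "sig g H \<in> G {0}"
proof -
  obtain \<nu> \<zeta> where *: "\<nu> \<in> G {0<..}" "\<zeta> \<in> G {..<0}" "g (sig g H + \<nu>) = H + \<zeta>"
    using Sg_solution[OF aut_linear[OF assms(1)] assms(2,3)] by metis
  show h: "sig g H \<in> G {0}" unfolding sig_def by (rule pr_mem)
  have "spec (sig g H) \<subseteq> spec (sig g H + \<nu>)" by (rule spec_upper[OF h *(1)])
  also have "\<dots> = spec (H + \<zeta>)" using spec_aut[OF assms(1), of "sig g H + \<nu>"] *(3) by simp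
  also have "\<dots> \<subseteq> spec H" by (rule spec_lower[OF assms(3) *(2)])
  finally show "spec (sig g H) \<subseteq> spec H" .
qed

lemma pr_tendsto: "(f \<longlongrightarrow> l) F \<Longrightarrow> ((\<lambda>i. pr S (f i)) \<longlongrightarrow> pr S l) F"
  using pr_linear linear_conv_bounded_linear bounded_linear.tendsto by blast

lemma Sg_tendsto:
  assumes "\<And>v. ((\<lambda>i. g i v) \<longlongrightarrow> h v) F" shows "((\<lambda>i. Sg (g i) v) \<longlongrightarrow> Sg h v) F"
  unfolding Sg_def by (intro tendsto_intros pr_tendsto assms)

lemma good_eventually:
  assumes "\<And>i. linear (g i)" "linear h" "good h" "\<And>v. ((\<lambda>i. g i v) \<longlongrightarrow> h v) F"
  shows "\<forall>\<^sub>F i in F. good (g i)"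
  unfolding good_def
proof (rule linear_family_eventually_inj[of _ _ "Sg h"])
  show "\<forall>\<^sub>F i in F. linear (Sg (g i))" using Sg_linear[OF assms(1)] by simp
  show "linear (Sg h)" "inj (Sg h)" using Sg_linear[OF assms(2)] assms(3) unfolding good_def by auto
  show "((\<lambda>i. Sg (g i) v) \<longlongrightarrow> Sg h v) F" for v by (rule Sg_tendsto[OF assms(4)])
qed

lemma sig_tendsto:
  assumes lin: "\<And>i. linear (g i)" "linear h" and good: "good h" and lim: "\<And>v. ((\<lambda>i. g i v) \<longlongrightarrow> h v) F"
  shows "((\<lambda>i. sig (g i) H) \<longlongrightarrow> sig h H) F"
  unfolding sig_def
proof (rule pr_tendsto, rule linear_system_tendsto[where M="\<lambda>i. Sg (g i)" and N="Sg h" and b="\<lambda>i. H"])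
  show "\<forall>\<^sub>F i in F. linear (Sg (g i))" using Sg_linear[OF lin(1)] by simp
  show "linear (Sg h)" by (rule Sg_linear[OF lin(2)])
  show "inj (Sg h)" using good unfolding good_def .
  show "((\<lambda>i. Sg (g i) v) \<longlongrightarrow> Sg h v) F" for v by (rule Sg_tendsto[OF lim])
  have "surj (Sg h)" using linear_inj_imp_surj[OF Sg_linear[OF lin(2)]] good unfolding good_def by blast
  then show "((\<lambda>i. H) \<longlongrightarrow> Sg h (inv (Sg h) H)) F" by (simp add: surj_f_inv_f)
  show "\<forall>\<^sub>F i in F. Sg (g i) (inv (Sg (g i)) H) = H"
    using good_eventually[OF lin good lim]
  proof eventually_elim
    case (elim i)
    have "surj (Sg (g i))" using linear_inj_imp_surj[OF Sg_linear[OF lin(1)]] elim unfolding good_def by blast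
    then show ?case by (simp add: surj_f_inv_f)
  qed
qed

definition sigid :: "('g \<Rightarrow> 'g) \<Rightarrow> bool" where "sigid g \<longleftrightarrow> (\<forall>H\<in>G {0}. sig g H = H)"

lemma Sg_id: "Sg id x = x"
proof -
  have "pr {0..} (pr {0..} x) = pr {0..} x" by (simp add: pr_pr)
  then show ?thesis unfolding Sg_def using half_split[of x] by simp
qed

lemma good_id: "good id" "sigid id"
proof -
  have "Sg id = id" using Sg_id by auto
  then show "good id" "sigid id" unfolding good_def sigid_def sig_def using pr_id by auto
qed

lemma pr_J: "pr S (J x) = J (pr S x)"
  by (rule pr_commute[OF J_linear]) (simp add: br_J)

text \<open>The parameters at which transversality holds form the complement of the zeros of an entire
  determinant, a connected set, on which \<open>sig\<close> is continuous with finitely many values.\<close>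

lemma complex_curve_good:
  assumes h: "aut h" "good h" "sigid h"
  shows "countable {s. \<not> good (expop (br (cs s X)) \<circ> h)}"
    and "good (expop (br (cs s X)) \<circ> h) \<Longrightarrow> sigid (expop (br (cs s X)) \<circ> h)"
proof -
  let ?g = "\<lambda>s. expop (br (cs s X)) \<circ> h"
  have cs0: "cs 0 X = 0" unfolding cs_def by simp
  have b0: "br 0 = (\<lambda>x. 0)" by (auto simp: br_simps)
  have g0: "?g 0 = h" unfolding cs0 b0 by (simp add: expop_0 fun_eq_iff)
  have ga: "aut (?g s)" for s by (rule aut_comp[OF aut_expop h(1)])
  show cnt: "countable {s. \<not> good (?g s)}"
    unfolding good_def
  proof (rule holomorphic_family_noninjective[of "\<lambda>s. Sg (?g s)" 0])
    show "linear (Sg (?g s))" for s by (rule Sg_linear[OF aut_linear[OF ga]])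
    show "Sg (?g s) (J x) = J (Sg (?g s) x)" for s x
      unfolding Sg_def pr_J aut_J[OF ga] J_simps ..
    show "inj (Sg (?g 0))" unfolding g0 using h(2) good_def by blast
    fix b x
    have "(\<lambda>s. xi b (pr {0..} (expop (br (cs s X)) (h (pr {0..} x))))) holomorphic_on UNIV"
      by (rule holomorphic_expop[OF pr_linear pr_J])
    then show "(\<lambda>s. xi b (Sg (?g s) x)) holomorphic_on UNIV"
      unfolding Sg_def linear_add[OF xi_linear] comp_def by (intro holomorphic_intros)
  qed
  assume gs: "good (?g s)"
  show "sigid (?g s)" unfolding sigid_def
  proof
    fix H assume H: "H \<in> G {0}"
    let ?W = "UNIV - {s. \<not> good (?g s)}"
    have conn: "connected ?W" by (rule connected_open_diff_countable[OF _ open_UNIV connected_UNIV cnt]) simp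
    have lim: "((\<lambda>s. sig (?g s) H) \<longlongrightarrow> sig (?g s0) H) (at s0)" if "s0 \<in> ?W" for s0
      by (rule sig_tendsto) (use that aut_linear[OF ga] expop_cs_tendsto in auto)
    have fin: "finite {K \<in> hcartan J a. spec K \<subseteq> spec H}"
      by (rule finite_h_spec[OF finite_spec_h]) (use H G_h in auto)
    show "sig (?g s) H = H"
    proof (rule ip_eqI)
      fix b assume "b \<in> \<beta>"
      have "(\<lambda>s. ip (sig (?g s) H) b) constant_on ?W"
      proof (rule continuous_finite_range_constant[OF conn])
        show "continuous_on ?W (\<lambda>s. ip (sig (?g s) H) b)"
          unfolding continuous_on_def using tendsto_within_subset[OF tendsto_ip[OF lim]] by blast
        have "(\<lambda>s. ip (sig (?g s) H) b) ` ?W \<subseteq> (\<lambda>K. ip K b) ` {K \<in> hcartan J a. spec K \<subseteq> spec H}"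
          using sig_spec[OF ga _ H] G_h by blast
        then show "finite ((\<lambda>s. ip (sig (?g s) H) b) ` ?W)" using fin finite_subset by blast
      qed
      moreover have "s \<in> ?W" "0 \<in> ?W" using gs h(2) g0 by auto
      ultimately have "ip (sig (?g s) H) b = ip (sig (?g 0) H) b" unfolding constant_on_def by metis
      then show "ip (sig (?g s) H) b = ip H b" using h(3) H unfolding sigid_def g0 by simp
    qed
  qed
qed

text \<open>g itself may fail to be good, and \<open>complex_curve_good\<close> has to start at a
  good automorphism. So each generator is applied to good approximants \<open>h n\<close>, with its
  parameter 1 moved slightly to avoid a countable set.\<close>

lemma inn_approx:
  assumes "g \<in> inn"
  shows "\<exists>h. (\<forall>n::nat. h n \<in> inn \<and> good (h n) \<and> sigid (h n)) \<and> (\<forall>v. (\<lambda>n. h n v) \<longlonglongrightarrow> g v)"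
  using assms
proof (induction rule: inn.induct)
  case inn_id
  show ?case by (rule exI[of _ "\<lambda>n. id"]) (use inn.inn_id good_id in \<open>auto simp: id_def\<close>)
next
  case (inn_step g X)
  then obtain h where h: "\<And>n::nat. h n \<in> inn" "\<And>n. good (h n)" "\<And>n. sigid (h n)" "\<And>v. (\<lambda>n. h n v) \<longlonglongrightarrow> g v" by blast
  have "\<exists>s. dist s 1 < 1 / real (Suc n) \<and> good (expop (br (cs s X)) \<circ> h n)" for n
  proof -
    have "uncountable (ball (1::complex) (1 / real (Suc n)))" by (rule uncountable_ball) simp
    then have "\<not> ball 1 (1 / real (Suc n)) \<subseteq> {s. \<not> good (expop (br (cs s X)) \<circ> h n)}"
      using complex_curve_good(1)[OF inn_aut[OF h(1)] h(2,3)] countable_subset by blast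
    then show ?thesis by (auto simp: dist_commute)
  qed
  then obtain s where s: "\<And>n. dist (s n) 1 < 1 / real (Suc n)" "\<And>n. good (expop (br (cs (s n) X)) \<circ> h n)" by metis
  have slim: "s \<longlonglongrightarrow> 1"
    unfolding tendsto_iff
  proof (intro allI impI)
    fix e :: real assume "e > 0"
    then have "\<forall>\<^sub>F n in sequentially. 1 / real (Suc n) < e"
      using order_tendstoD(2)[OF LIMSEQ_inverse_real_of_nat] by (simp add: inverse_eq_divide)
    then show "\<forall>\<^sub>F n in sequentially. dist (s n) 1 < e" by eventually_elim (use s(1) less_trans in blast)
  qed
  have cs1: "cs 1 X = X" unfolding cs_def by simp
  have elim: "(\<lambda>n. expop (br (cs (s n) X)) v) \<longlonglongrightarrow> expop (br X) v" for v
    using isCont_tendsto_compose[OF _ slim, of "\<lambda>z. expop (br (cs z X)) v"] expop_cs_tendsto[of X v 1]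
    by (simp add: isCont_def cs1)
  define k where "k n = expop (br (cs (s n) X)) \<circ> h n" for n
  have "(\<lambda>n. expop (br (cs (s n) X)) (h n v)) \<longlonglongrightarrow> expop (br X) (g v)" for v
    by (rule tendsto_apply_family[OF _ _ elim h(4)]) (auto intro: linear_expop br_linear)
  then have "(\<lambda>n. k n v) \<longlonglongrightarrow> expop (br X) (g v)" for v unfolding k_def by simp
  moreover have "k n \<in> inn" for n unfolding k_def by (rule inn.inn_step[OF h(1)])
  moreover have "sigid (k n)" for n
    unfolding k_def by (rule complex_curve_good(2)[OF inn_aut[OF h(1)] h(2,3) s(2)])
  moreover have "good (k n)" for n unfolding k_def by (rule s(2))
  ultimately show ?case by (intro exI[of _ k]) auto
qed

lemma sigid_limit:
  assumes h: "\<And>n::nat. aut (h n)" "\<And>n. sigid (h n)" and g: "aut g" "good g" "\<And>v. (\<lambda>n. h n v) \<longlonglongrightarrow> g v"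
  shows "sigid g"
  unfolding sigid_def
proof
  fix H assume H: "H \<in> G {0}"
  have "(\<lambda>n. sig (h n) H) \<longlonglongrightarrow> sig g H"
    by (rule sig_tendsto) (use aut_linear h g in auto)
  moreover have "(\<lambda>n. sig (h n) H) \<longlonglongrightarrow> H" using h(2) H unfolding sigid_def by simp
  ultimately show "sig g H = H" by (rule LIMSEQ_unique)
qed

lemma inn_sigid: assumes "g \<in> inn" "good g" shows "sigid g"
proof -
  obtain h where "\<And>n::nat. h n \<in> inn" "\<And>n. sigid (h n)" "\<And>v. (\<lambda>n. h n v) \<longlonglongrightarrow> g v"
    using inn_approx[OF assms(1)] by blast
  then show ?thesis using sigid_limit[of h g] inn_aut assms by blast
qed

text \<open>In the covering argument the limit automorphism is not known to be inner; being a limit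
  of inner ones is enough.\<close>

lemma inn_limit_sigid:
  assumes h: "\<And>n::nat. h n \<in> inn" and g: "aut g" "good g" "\<And>v. (\<lambda>n. h n v) \<longlonglongrightarrow> g v"
  shows "sigid g"
proof -
  have "\<forall>\<^sub>F n in sequentially. good (h n)"
    by (rule good_eventually[OF _ _ g(2,3)]) (use h inn_aut aut_linear g in auto)
  then obtain m where m: "\<And>n. n \<ge> m \<Longrightarrow> good (h n)" unfolding eventually_sequentially by blast
  show ?thesis
  proof (rule sigid_limit[of "\<lambda>n. h (n + m)" g])
    show "aut (h (n + m))" "sigid (h (n + m))" for n using inn_aut[OF h] inn_sigid[OF h m] by auto
    show "(\<lambda>n. h (n + m) v) \<longlonglongrightarrow> g v" for v using g(3) by (rule LIMSEQ_ignore_initial_segment)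
  qed (use g in auto)
qed

text \<open>Plays the role of the Cartan subgroup with Lie algebra h, without asking its elements to
  be inner.\<close>

definition ZZ :: "('g \<Rightarrow> 'g) set" where "ZZ = {z. aut z \<and> (\<forall>H\<in>G {0}. z H = H)}"

lemma ZZ_aut: "z \<in> ZZ \<Longrightarrow> aut z" and ZZ_h: "z \<in> ZZ \<Longrightarrow> H \<in> G {0} \<Longrightarrow> z H = H"
  unfolding ZZ_def by auto

lemma ZZ_comp: "z \<in> ZZ \<Longrightarrow> w \<in> ZZ \<Longrightarrow> z \<circ> w \<in> ZZ"
  unfolding ZZ_def using aut_comp by auto

lemma ZZ_inv: assumes "z \<in> ZZ" shows "inv z \<in> ZZ"
proof -
  have "inv z H = H" if "H \<in> G {0}" for H
    using ZZ_h[OF assms that] aut_inv_apply(1)[OF ZZ_aut[OF assms], of H] by simp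
  then show ?thesis unfolding ZZ_def using aut_inv ZZ_aut[OF assms] by auto
qed

lemma fixes_H0_pr: assumes "aut z" "z H0 = H0" shows "pr S (z x) = z (pr S x)"
  by (rule pr_commute[OF aut_linear[OF assms(1)]]) (simp add: aut_br[OF assms(1)] assms(2))

lemma fixes_H0_G: assumes "aut z" "z H0 = H0" "x \<in> G S" shows "z x \<in> G S"
  using fixes_H0_pr[OF assms(1,2), of S x] pr_id[OF assms(3)] pr_mem[of S "z x"] by simp

lemma ZZ_G: "z \<in> ZZ \<Longrightarrow> x \<in> G S \<Longrightarrow> z x \<in> G S"
  using fixes_H0_G ZZ_aut ZZ_h H0_h by blast

text \<open>Transitivity of N and L turns \<open>g (H0 + \<nu>0) = H0 + \<zeta>0\<close> into an
  automorphism z = l^-1 g n fixing H0. It commutes with the projections to degrees, so the analogous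
  equation for another H in h, compared in degree 0, gives z H = H.\<close>

lemma gauss_decomposition:
  assumes g: "aut g" "good g" "sigid g"
  obtains l z n where "l \<in> LL" "l \<in> inn" "z \<in> ZZ" "n \<in> NN" "n \<in> inn" "g = l \<circ> z \<circ> n"
proof -
  have sol: "\<exists>\<nu> \<zeta>. \<nu> \<in> G {0<..} \<and> \<zeta> \<in> G {..<0} \<and> g (H + \<nu>) = H + \<zeta>" if H: "H \<in> G {0}" for H
    using Sg_solution[OF aut_linear[OF g(1)] g(2) H] g(3) H unfolding sigid_def by metis
  obtain \<nu>0 \<zeta>0 where 0: "\<nu>0 \<in> G {0<..}" "\<zeta>0 \<in> G {..<0}" "g (H0 + \<nu>0) = H0 + \<zeta>0" using sol[OF H0_h] by blast
  obtain n where n: "n \<in> NN" "n \<in> inn" "n H0 = H0 + \<nu>0" using NN_transitive[OF regular_H0 0(1)] .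
  obtain l where l: "l \<in> LL" "l \<in> inn" "l H0 = H0 + \<zeta>0" using LL_transitive[OF regular_H0 0(2)] .
  note na = NN_aut[OF n(1)] and la = LL_aut[OF l(1)]
  define z where "z = inv l \<circ> g \<circ> n"
  have za: "aut z" unfolding z_def by (intro aut_comp aut_inv g na la)
  have z0: "z H0 = H0"
    using aut_inv_apply(1)[OF la, of H0] l(3) n(3) 0(3) unfolding z_def by simp
  have "z H = H" if H: "H \<in> G {0}" for H
  proof -
    obtain \<nu> \<zeta> where *: "\<nu> \<in> G {0<..}" "\<zeta> \<in> G {..<0}" "g (H + \<nu>) = H + \<zeta>" using sol[OF H] by blast
    have "H + \<nu> \<in> G {0..}" by (rule G_add[OF G_mono[OF H] G_mono[OF *(1)]]) auto
    then have "inv n (H + \<nu>) - (H + \<nu>) \<in> G {0<..}" by (rule NN_diff[OF NN_inv[OF n(1)]])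
    then have "inv n (H + \<nu>) - (H + \<nu>) + \<nu> \<in> G {0<..}" using *(1) by (rule G_add)
    then have y: "inv n (H + \<nu>) - H \<in> G {0<..}" by simp
    have "H + \<zeta> \<in> G {..0}" by (rule G_add[OF G_mono[OF H] G_mono[OF *(2)]]) auto
    then have "inv l (H + \<zeta>) - (H + \<zeta>) \<in> G {..<0}" by (rule LL_diff[OF LL_inv[OF l(1)]])
    then have "inv l (H + \<zeta>) - (H + \<zeta>) + \<zeta> \<in> G {..<0}" using *(2) by (rule G_add)
    then have w: "inv l (H + \<zeta>) - H \<in> G {..<0}" by simp
    have eq: "z (inv n (H + \<nu>)) = inv l (H + \<zeta>)" unfolding z_def by (simp add: aut_inv_apply[OF na] *(3))
    have "pr {0} (inv n (H + \<nu>) - H) = 0" by (rule pr_zero[OF y]) auto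
    then have "pr {0} (inv n (H + \<nu>)) = H" by (simp add: pr_simps pr_id[OF H])
    moreover have "pr {0} (inv l (H + \<zeta>) - H) = 0" by (rule pr_zero[OF w]) auto
    then have "pr {0} (inv l (H + \<zeta>)) = H" by (simp add: pr_simps pr_id[OF H])
    ultimately show "z H = H" using fixes_H0_pr[OF za z0, of "{0}" "inv n (H + \<nu>)"] eq by simp
  qed
  then have zZ: "z \<in> ZZ" unfolding ZZ_def using za by blast
  have "g = l \<circ> z \<circ> inv n" unfolding z_def by (auto simp: fun_eq_iff aut_inv_apply[OF na] aut_inv_apply[OF la])
  then show ?thesis using that[OF l(1,2) zZ NN_inv[OF n(1)] inn_inv[OF n(2)]] by blast
qed

lemma gauss_good: assumes "l \<in> LL" "z \<in> ZZ" "n \<in> NN" shows "good (l \<circ> z \<circ> n)"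
proof -
  note la = LL_aut[OF assms(1)] and za = ZZ_aut[OF assms(2)] and na = NN_aut[OF assms(3)]
  have a: "aut (l \<circ> z \<circ> n)" by (intro aut_comp la za na)
  show ?thesis unfolding good_iff[OF aut_linear[OF a]]
  proof (intro ballI impI)
    fix x assume x: "x \<in> G {0..}" "(l \<circ> z \<circ> n) x \<in> G {..<0}"
    have "z (n x) \<in> G {0..}" by (rule ZZ_G[OF assms(2) NN_ge[OF assms(3) x(1)]])
    moreover have "inv l (l (z (n x))) \<in> G {..<0}" using LL_lt[OF LL_inv[OF assms(1)]] x(2) by simp
    moreover have "{0..} \<inter> {..<0} = ({}::real set)" by auto
    ultimately have "z (n x) = 0" using G_disjoint[of "z (n x)" "{0..}" "{..<0}"] by (simp add: aut_inv_apply[OF la])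
    then show "x = 0" using aut_eq0[OF za] aut_eq0[OF na] by simp
  qed
qed

text \<open>Fixing H0 means preserving degrees, so z is good and the rigidity of \<open>sig\<close>
  for inner maps applies.\<close>

lemma inn_fixing_H0: assumes "z \<in> inn" "z H0 = H0" shows "z \<in> ZZ"
proof -
  note za = inn_aut[OF assms(1)]
  have g: "good z" unfolding good_iff[OF aut_linear[OF za]]
  proof (intro ballI impI)
    fix x assume x: "x \<in> G {0..}" "z x \<in> G {..<0}"
    have "z x = 0" by (rule G_disjoint[OF fixes_H0_G[OF za assms(2) x(1)] x(2)]) auto
    then show "x = 0" using aut_eq0[OF za] by simp
  qed
  have "z H = H" if H: "H \<in> G {0}" for H
  proof -
    obtain \<nu> \<zeta> where *: "\<nu> \<in> G {0<..}" "\<zeta> \<in> G {..<0}" "z (sig z H + \<nu>) = H + \<zeta>"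
      using Sg_solution[OF aut_linear[OF za] g H] by metis
    have s: "sig z H = H" using inn_sigid[OF assms(1) g] H unfolding sigid_def by blast
    have 1: "pr {0} (H + \<nu>) = H" using pr_zero[OF *(1), of "{0}"] pr_id[OF H] by (simp add: pr_simps)
    have 2: "pr {0} (H + \<zeta>) = H" using pr_zero[OF *(2), of "{0}"] pr_id[OF H] by (simp add: pr_simps)
    show ?thesis using fixes_H0_pr[OF za assms(2), of "{0}" "H + \<nu>"] *(3) s 1 2 by simp
  qed
  then show ?thesis unfolding ZZ_def using za by blast
qed

text \<open>H0 is the comparison element: its bracket image is the full sum of the nonzero degrees,
  which contains that of \<Lambda>. The dimension bound makes the images equal, and surjectivity of
  ad \<Lambda> + \<open>pr {0}\<close> gives injectivity, which confines the kernel of ad \<Lambda>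
  to h.\<close>

lemma regular_of_orbit_dim:
  assumes \<Lambda>: "\<Lambda> \<in> G {0}" and d: "orbit_dim br H0 \<le> orbit_dim br \<Lambda>" shows "regular \<Lambda>"
proof -
  have sw: "range (\<lambda>X. br X Y) = range (br Y)" for Y
  proof safe
    show "br X Y \<in> range (br Y)" for X using br_anti[of X Y] linear_neg[OF br_linear[of Y], of X] by (metis rangeI)
    show "br Y X \<in> range (\<lambda>X. br X Y)" for X
      using br_anti[of Y X] linear_neg[OF br_linear_left[of Y], of X] by (metis (mono_tags, lifting) rangeI)
  qed
  have sub: "range (br K) \<subseteq> G (- {0})" if K: "K \<in> G {0}" for K
  proof clarify
    fix x
    have z: "pr {0} (br K x) = 0" using pr_br_h[OF K] h_abelian[OF K pr_mem] by simp
    have "br K x = pr {0} (br K x) + pr (- {0}) (br K x)" by (rule pr_split) auto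
    then have "br K x = pr (- {0}) (br K x)" using z by simp
    then show "br K x \<in> G (- {0})" using pr_mem by metis
  qed
  have "G (- {0}) \<subseteq> range (br H0)"
  proof
    fix w assume "w \<in> G (- {0})"
    then show "w \<in> range (br H0)" using regular_solve[OF regular_H0, of "- {0}" w] by auto
  qed
  then have "range (br H0) = G (- {0})" using sub[OF H0_h] by blast
  then have "dim (G (- {0})) \<le> dim (range (br \<Lambda>))" using d unfolding orbit_dim_def sw by simp
  then have R: "range (br \<Lambda>) = G (- {0})"
    using subspace_dim_equal[OF _ G_subspace sub[OF \<Lambda>]] linear_subspace_image[OF br_linear[of \<Lambda>] subspace_UNIV] by simp
  define T where "T x = br \<Lambda> x + pr {0} x" for x
  have lin: "linear T" unfolding T_def by (rule linear_compose_add[OF br_linear pr_linear])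
  have "surj T"
  proof (rule surjI)
    fix w
    have "pr (- {0}) w \<in> range (br \<Lambda>)" using R pr_mem by blast
    then show "T (pr (- {0}) (SOME x. br \<Lambda> x = pr (- {0}) w) + pr {0} w) = w"
    proof -
      assume "pr (- {0}) w \<in> range (br \<Lambda>)"
      then have "\<exists>x. br \<Lambda> x = pr (- {0}) w" by (metis rangeE)
      then have x: "br \<Lambda> (SOME x. br \<Lambda> x = pr (- {0}) w) = pr (- {0}) w" by (rule someI_ex)
      have e: "pr {} y = 0" for y unfolding pr_def by simp
      have "br \<Lambda> (pr (- {0}) (SOME x. br \<Lambda> x = pr (- {0}) w)) = pr (- {0}) w"
        using pr_br_h[OF \<Lambda>, of "- {0}" "SOME x. br \<Lambda> x = pr (- {0}) w"] x by (simp add: pr_pr)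
      moreover have "br \<Lambda> (pr {0} w) = 0" by (rule h_abelian[OF \<Lambda> pr_mem])
      moreover have "w = pr (- {0}) w + pr {0} w" by (rule pr_split) auto
      ultimately show ?thesis unfolding T_def by (simp add: br_simps pr_simps pr_pr e)
    qed
  qed
  then have inj: "inj T" by (rule linear_surj_imp_inj[OF lin])
  show ?thesis unfolding regular_def
  proof (intro conjI allI impI \<Lambda>)
    fix x assume x: "br \<Lambda> x = 0"
    have "T (pr (- {0}) x) = 0"
    proof -
      have e: "pr {} y = 0" for y unfolding pr_def by simp
      show ?thesis unfolding T_def using pr_br_h[OF \<Lambda>, of "- {0}" x] x by (simp add: pr_pr pr_simps e)
    qed
    then have "pr (- {0}) x = 0" using inj linear_injective_0[OF lin] by blast
    then have "x = pr {0} x" using pr_split[of "{0}" "- {0}" x] by simp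
    then show "x \<in> G {0}" using pr_mem by metis
  qed
qed

end

section \<open>Stabilizers of regular elements\<close>

context root_setting begin

text \<open>Neither the real nor the imaginary part of \<Lambda> need be regular. An automorphism
  fixing \<Lambda> fixes both parts, hence a generic real combination A of them, and regrading by A
  reduces to an inner automorphism fixing the grading element.\<close>

lemma stabilizer_fixes_cartan:
  assumes \<Lambda>: "\<Lambda> \<in> hcartan J a" "\<And>x. br \<Lambda> x = 0 \<Longrightarrow> x \<in> hcartan J a"
    and z: "z \<in> inn" "z \<Lambda> = \<Lambda>" and H: "H \<in> hcartan J a"
  shows "z H = H"
proof -
  note za = inn_aut[OF z(1)]
  note ri = re_im_a[OF \<Lambda>(1)]
  have zh: "z K \<in> hcartan J a" if "K \<in> hcartan J a" for K
  proof -
    have K: "\<forall>H\<in>a. br H K = 0" using centralizer_of_a that by blast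
    have "br \<Lambda> K = 0"
      using \<Lambda>(1) K unfolding hcartan_def by (auto simp: br_simps br_J_left J_simps)
    then have "z (br \<Lambda> K) = 0" by (simp add: linear_0[OF aut_linear[OF za]])
    then show ?thesis using \<Lambda>(2) by (simp add: aut_br[OF za] z(2))
  qed
  have a_h: "x \<in> hcartan J a" if "x \<in> a" for x
    unfolding hcartan_def using that subspace_0[OF a_subspace] by (intro CollectI exI[of _ 0] exI[of _ x]) (simp add: J_simps)
  \<comment> \<open>Within h, the elements of a are those with real spectrum, a property kept by
    automorphisms.\<close>
  have za_a: "z x \<in> a" if x: "x \<in> a" for x
  proof -
    have zx: "z x \<in> hcartan J a" using zh a_h x by blast
    have im0: "im x = 0" using re_im_unique(2)[OF subspace_0[OF a_subspace] x] by (simp add: J_simps)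
    have real: "Im c = 0" if "c \<in> spec x" for c
      using that spec_h[OF a_h[OF x]] im0 by (auto simp: rt_def)
    have "br (im (z x)) b = 0" if b: "b \<in> \<beta>" for b
    proof -
      have "rt b (z x) \<in> spec x" using spec_h[OF zx] spec_aut[OF za, of x] b by auto
      then have "\<alpha> b \<bullet> im (z x) = 0" using real[of "rt b (z x)"] by (simp add: rt_def)
      then show ?thesis using br_a_\<beta>[OF re_im_a(2)[OF zx] b] by simp
    qed
    then have "br (im (z x)) = (\<lambda>x. 0)" by (intro linear_eqI[OF br_linear linear_zero]) auto
    then have "br (im (z x)) y = 0" for y by simp
    then have "im (z x) = 0" by (rule center_trivial)
    then have "z x = re (z x)" using re_im[of "z x"] by (simp add: J_simps)
    then show ?thesis using re_im_a(1)[OF zx] by simp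
  qed
  have "z \<Lambda> = J (z (im \<Lambda>)) + z (re \<Lambda>)"
    using re_im[of \<Lambda>] by (metis aut_J[OF za] linear_add[OF aut_linear[OF za]])
  then have zri: "z (re \<Lambda>) = re \<Lambda>" "z (im \<Lambda>) = im \<Lambda>"
    using re_im_unique[OF za_a[OF ri(2)] za_a[OF ri(1)]] z(2) by auto
  have nz: "\<alpha> b \<bullet> re \<Lambda> \<noteq> 0 \<or> \<alpha> b \<bullet> im \<Lambda> \<noteq> 0" if b: "b \<in> \<beta>" "\<alpha> b \<noteq> 0" for b
  proof (rule ccontr)
    assume "\<not> ?thesis"
    then have "br \<Lambda> b = 0" using br_h_\<beta>[OF \<Lambda>(1) b(1)] by (simp add: rt_def cs_def)
    then have "\<forall>H\<in>a. br H b = 0" using \<Lambda>(2) centralizer_of_a by blast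
    then have "br (\<alpha> b) b = 0" using \<alpha>_a[OF b(1)] by blast
    then show False using br_a_\<beta>[OF \<alpha>_a[OF b(1)] b(1)] b \<beta>_nz by simp
  qed
  \<comment> \<open>No nonzero weight vanishes at both parts of \<Lambda>, so each one excludes at
    most one t.\<close>
  have "finite (\<Union>b\<in>{b\<in>\<beta>. \<alpha> b \<noteq> 0}. {t. \<alpha> b \<bullet> (re \<Lambda> + t *\<^sub>R im \<Lambda>) = 0})"
  proof (intro finite_UN_I)
    show "finite {b\<in>\<beta>. \<alpha> b \<noteq> 0}" using \<beta>_fin by simp
    fix b assume b: "b \<in> {b\<in>\<beta>. \<alpha> b \<noteq> 0}"
    have "{t. \<alpha> b \<bullet> (re \<Lambda> + t *\<^sub>R im \<Lambda>) = 0} \<subseteq> {- (\<alpha> b \<bullet> re \<Lambda>) / (\<alpha> b \<bullet> im \<Lambda>)}"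
    proof
      fix t assume "t \<in> {t. \<alpha> b \<bullet> (re \<Lambda> + t *\<^sub>R im \<Lambda>) = 0}"
      then have e: "t * (\<alpha> b \<bullet> im \<Lambda>) = - (\<alpha> b \<bullet> re \<Lambda>)" by (simp add: inner_add_right add_eq_0_iff)
      then have "\<alpha> b \<bullet> im \<Lambda> \<noteq> 0" using nz[of b] b by auto
      then have "t = t * (\<alpha> b \<bullet> im \<Lambda>) / (\<alpha> b \<bullet> im \<Lambda>)" by simp
      then have "t = - (\<alpha> b \<bullet> re \<Lambda>) / (\<alpha> b \<bullet> im \<Lambda>)" unfolding e .
      then show "t \<in> {- (\<alpha> b \<bullet> re \<Lambda>) / (\<alpha> b \<bullet> im \<Lambda>)}" by blast
    qed
    then show "finite {t. \<alpha> b \<bullet> (re \<Lambda> + t *\<^sub>R im \<Lambda>) = 0}" using finite_subset by blast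
  qed
  then obtain t :: real where t: "t \<notin> (\<Union>b\<in>{b\<in>\<beta>. \<alpha> b \<noteq> 0}. {t. \<alpha> b \<bullet> (re \<Lambda> + t *\<^sub>R im \<Lambda>) = 0})"
    using ex_new_if_finite[OF infinite_UNIV_char_0] by blast
  define A where "A = re \<Lambda> + t *\<^sub>R im \<Lambda>"
  have Aa: "A \<in> a" unfolding A_def using ri a_subspace by (simp add: subspace_add subspace_scale)
  interpret A: graded br J \<theta> a \<beta> \<alpha> A
    by unfold_locales (use Aa t in \<open>auto simp: A_def\<close>)
  have "z A = A" unfolding A_def using zri by (simp add: linear_add[OF aut_linear[OF za]] linear_scale[OF aut_linear[OF za]])
  then have "z \<in> A.ZZ" by (rule A.inn_fixing_H0[OF z(1)])
  then show ?thesis using A.ZZ_h H A.G_h by blast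
qed

end

section \<open>The Iwasawa decomposition\<close>

context graded begin

text \<open>\<open>inv l2 \<circ> l1\<close> differs from the identity by lower degrees and, written
  through the other factors, lowers no degree; so it is the identity. The N-factors then differ by a
  map that is both unipotent and degree-preserving.\<close>

lemma gauss_unique:
  assumes "l1 \<in> LL" "z1 \<in> ZZ" "n1 \<in> NN" "l2 \<in> LL" "z2 \<in> ZZ" "n2 \<in> NN" "l1 \<circ> z1 \<circ> n1 = l2 \<circ> z2 \<circ> n2"
  shows "l1 = l2" "z1 = z2" "n1 = n2"
proof -
  note a = LL_aut[OF assms(1)] ZZ_aut[OF assms(2)] NN_aut[OF assms(3)] LL_aut[OF assms(4)] ZZ_aut[OF assms(5)] NN_aut[OF assms(6)]
  have eq: "l1 (z1 (n1 x)) = l2 (z2 (n2 x))" for x using fun_cong[OF assms(7), of x] by simp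
  have k: "inv l2 (l1 b) = z2 (n2 (inv n1 (inv z1 b)))" for b
    using eq[of "inv n1 (inv z1 b)"] by (simp add: aut_inv_apply[OF a(1)] aut_inv_apply[OF a(2)] aut_inv_apply[OF a(3)] aut_inv_apply[OF a(4)])
  have kL: "inv l2 \<circ> l1 \<in> LL" by (rule LL_comp[OF LL_inv[OF assms(4)] assms(1)])
  have "inv l2 \<circ> l1 = id"
  proof (rule linear_eqI[OF aut_linear[OF LL_aut[OF kL]] linear_id])
    fix b assume b: "b \<in> \<beta>"
    then have bG: "b \<in> G {deg b}" using \<beta>_G by auto
    have "b \<in> G {deg b..}" by (rule G_mono[OF bG]) auto
    then have "(inv l2 \<circ> l1) b \<in> G {deg b..}" unfolding comp_def k
      using ZZ_G[OF assms(5)] NN_ge[OF assms(6)] NN_ge[OF NN_inv[OF assms(3)]] ZZ_G[OF ZZ_inv[OF assms(2)]] by blast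
    then have "(inv l2 \<circ> l1) b - b \<in> G {deg b..}" using \<open>b \<in> G {deg b..}\<close> by (rule G_diff)
    moreover have "(inv l2 \<circ> l1) b - b \<in> G {..<deg b}" by (rule LL_diff[OF kL G_mono[OF bG]]) auto
    ultimately have "(inv l2 \<circ> l1) b - b = 0" by (rule G_disjoint) auto
    then show "(inv l2 \<circ> l1) b = id b" by simp
  qed
  then have il: "inv l2 (l1 x) = x" for x by (simp add: fun_eq_iff)
  have "l1 x = l2 x" for x using arg_cong[OF il[of x], of l2] by (simp add: aut_inv_apply[OF a(4)])
  then show l: "l1 = l2" by auto
  then have zn: "z1 (n1 x) = z2 (n2 x)" for x using eq[of x] aut_inv_apply(1)[OF a(4)] by (metis (no_types))
  have w: "n2 (inv n1 x) = inv z2 (z1 x)" for x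
    using zn[of "inv n1 x"] by (simp add: aut_inv_apply[OF a(3)] aut_inv_apply[OF a(5)])
  have wN: "n2 \<circ> inv n1 \<in> NN" by (rule NN_comp[OF assms(6) NN_inv[OF assms(3)]])
  have "n2 \<circ> inv n1 = id"
  proof (rule linear_eqI[OF aut_linear[OF NN_aut[OF wN]] linear_id])
    fix b assume b: "b \<in> \<beta>"
    then have bG: "b \<in> G {deg b}" using \<beta>_G by auto
    have "(n2 \<circ> inv n1) b \<in> G {deg b}" unfolding comp_def w
      using ZZ_G[OF ZZ_inv[OF assms(5)]] ZZ_G[OF assms(2)] bG by blast
    then have "(n2 \<circ> inv n1) b - b \<in> G {deg b}" using bG by (rule G_diff)
    moreover have "(n2 \<circ> inv n1) b - b \<in> G {deg b<..}" by (rule NN_diff[OF wN G_mono[OF bG]]) auto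
    ultimately have "(n2 \<circ> inv n1) b - b = 0" by (rule G_disjoint) auto
    then show "(n2 \<circ> inv n1) b = id b" by simp
  qed
  then have "n2 (inv n1 x) = x" for x by (simp add: fun_eq_iff)
  from this[of "n1 _"] have "n2 x = n1 x" for x by (simp add: aut_inv_apply[OF a(3)])
  then show n: "n1 = n2" by auto
  then have "z1 x = z2 x" for x using zn[of "inv n1 x"] by (simp add: aut_inv_apply[OF a(6)])
  then show "z1 = z2" by auto
qed

lemma ea_\<beta>: "H \<in> a \<Longrightarrow> b \<in> \<beta> \<Longrightarrow> expop (br H) b = exp (\<alpha> b \<bullet> H) *\<^sub>R b"
  by (rule expop_eigenvector[OF br_linear br_a_\<beta>])

lemma ea_add: assumes "H \<in> a" "K \<in> a" shows "expop (br H) (expop (br K) x) = expop (br (H + K)) x"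
proof -
  have "br (H + K) = (\<lambda>x. br H x + br K x)" by (auto simp: br_simps)
  moreover have "br H (br K x) = br K (br H x)" for x using jacobi[of H K x] a_abelian[OF assms] by (simp add: br_simps)
  ultimately show ?thesis using expop_add[OF br_linear[of H] br_linear[of K]] by simp
qed

lemma a_G0: "H \<in> a \<Longrightarrow> H \<in> G {0}"
  using a_abelian H0_a unfolding G_eig by simp

lemma ea_ZZ: assumes "H \<in> a" shows "expop (br H) \<in> ZZ"
  unfolding ZZ_def
proof (intro CollectI conjI ballI aut_expop)
  fix K assume "K \<in> G {0}"
  then have "br H K = 0 *\<^sub>R K" using h_abelian[OF a_G0[OF assms]] by simp
  from expop_eigenvector[OF br_linear this] show "expop (br H) K = K" by simp
qed

lemma ea_sym: assumes "H \<in> a" shows "ip (expop (br H) x) y = ip x (expop (br H) y)"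
proof -
  have e: "ip (expop (br H) x) y = (\<Sum>b\<in>\<beta>. exp (\<alpha> b \<bullet> H) * ip x b * ip y b)" for x y
  proof -
    have "expop (br H) x = (\<Sum>b\<in>\<beta>. ip x b *\<^sub>R expop (br H) b)" by (rule expand[OF linear_expop[OF br_linear]])
    also have "\<dots> = (\<Sum>b\<in>\<beta>. (exp (\<alpha> b \<bullet> H) * ip x b) *\<^sub>R b)" by (rule sum.cong) (auto simp: ea_\<beta>[OF assms] mult.commute)
    finally show ?thesis by (simp add: ip_simps ip_sym[of _ y])
  qed
  show ?thesis unfolding e ip_sym[of x "expop (br H) y"] by (simp add: mult_ac)
qed

text \<open>The logarithm \<delta> of z multiplies eigenvectors by the ln of their eigenvalue.
  Brackets multiply eigenvalues, so \<delta> is a derivation, hence ad x0. Since z fixes a, x0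
  centralizes a; symmetry of \<delta> puts x0 in p, and maximality puts it in a.\<close>

lemma posdef_ZZ_exp:
  assumes z: "z \<in> ZZ" and sym: "\<And>x y. ip (z x) y = ip x (z y)" and pos: "\<And>x. x \<noteq> 0 \<Longrightarrow> ip (z x) x > 0"
  shows "\<exists>A\<in>a. z = expop (br A)"
proof -
  note za = ZZ_aut[OF z]
  obtain \<gamma> where \<gamma>: "finite \<gamma>" "\<And>b c. b \<in> \<gamma> \<Longrightarrow> c \<in> \<gamma> \<Longrightarrow> ip b c = (if b = c then 1 else 0)"
    "\<And>x. x = (\<Sum>b\<in>\<gamma>. ip x b *\<^sub>R b)" "\<And>b f. b \<in> \<gamma> \<Longrightarrow> f \<in> {z} \<Longrightarrow> \<exists>c. f b = c *\<^sub>R b"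
  proof (rule orthonormal_eigenbasis[of "{z}"])
    show "linear f" if "f \<in> {z}" for f using that aut_linear[OF za] by simp
    show "ip (f x) y = ip x (f y)" if "f \<in> {z}" for f x y using that sym by simp
    show "f (g x) = g (f x)" if "f \<in> {z}" "g \<in> {z}" for f g x using that by simp
  qed blast
  have "\<exists>\<mu>. \<forall>c\<in>\<gamma>. z c = \<mu> c *\<^sub>R c" using \<gamma>(4) by (intro bchoice) auto
  then obtain \<mu> where \<mu>: "\<And>c. c \<in> \<gamma> \<Longrightarrow> z c = \<mu> c *\<^sub>R c" by blast
  have \<mu>pos: "\<mu> c > 0" if "c \<in> \<gamma>" for c
  proof -
    have "ip c c = 1" using \<gamma>(2)[OF that that] by simp
    moreover have "c \<noteq> 0" using calculation by (auto simp: ip_simps)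
    ultimately show ?thesis using pos[of c] \<mu>[OF that] by (simp add: ip_simps)
  qed
  have exp: "f x = (\<Sum>c\<in>\<gamma>. ip x c *\<^sub>R f c)" if "linear f" for f :: "'g \<Rightarrow> 'g" and x
  proof -
    have "f x = f (\<Sum>c\<in>\<gamma>. ip x c *\<^sub>R c)" using \<gamma>(3)[of x] by simp
    then show ?thesis by (simp add: linear_sum[OF that] linear_scale[OF that])
  qed
  have lin0: "f x = 0" if "linear f" "\<And>c. c \<in> \<gamma> \<Longrightarrow> f c = 0" for f :: "'g \<Rightarrow> 'g" and x
    using exp[OF that(1), of x] that(2) by simp
  define \<delta> where "\<delta> x = (\<Sum>c\<in>\<gamma>. (ln (\<mu> c) * ip x c) *\<^sub>R c)" for x
  have \<delta>lin: "linear \<delta>" unfolding \<delta>_def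
    by (rule linearI) (simp_all add: ip_simps algebra_simps sum.distrib scaleR_sum_right)
  have \<delta>eig: "\<delta> y = ln m *\<^sub>R y" if "z y = m *\<^sub>R y" for y m
  proof -
    have or: "ip y c = 0 \<or> \<mu> c = m" if c: "c \<in> \<gamma>" for c
      using sym[of y c] \<mu>[OF c] \<open>z y = m *\<^sub>R y\<close> by (auto simp: ip_simps)
    have "ln (\<mu> c) * ip y c = ln m * ip y c" if c: "c \<in> \<gamma>" for c using or[OF c] by auto
    then have "\<delta> y = (\<Sum>c\<in>\<gamma>. ln m *\<^sub>R (ip y c *\<^sub>R c))" unfolding \<delta>_def by (intro sum.cong) auto
    also have "\<dots> = ln m *\<^sub>R (\<Sum>c\<in>\<gamma>. ip y c *\<^sub>R c)" by (rule scaleR_sum_right[symmetric])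
    also have "\<dots> = ln m *\<^sub>R y" using \<gamma>(3)[of y] by simp
    finally show ?thesis .
  qed
  have \<delta>\<gamma>: "\<delta> c = ln (\<mu> c) *\<^sub>R c" if "c \<in> \<gamma>" for c by (rule \<delta>eig[OF \<mu>[OF that]])
  have der0: "\<delta> (br c d) = br (\<delta> c) d + br c (\<delta> d)" if c: "c \<in> \<gamma>" "d \<in> \<gamma>" for c d
  proof -
    have "z (br c d) = (\<mu> c * \<mu> d) *\<^sub>R br c d" using \<mu>[OF c(1)] \<mu>[OF c(2)] by (simp add: aut_br[OF za] br_simps)
    from \<delta>eig[OF this] have "\<delta> (br c d) = ln (\<mu> c * \<mu> d) *\<^sub>R br c d" .
    also have "ln (\<mu> c * \<mu> d) = ln (\<mu> c) + ln (\<mu> d)" using \<mu>pos[OF c(1)] \<mu>pos[OF c(2)] by (simp add: ln_mult)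
    finally show ?thesis using \<delta>\<gamma>[OF c(1)] \<delta>\<gamma>[OF c(2)] by (simp add: br_simps algebra_simps)
  qed
  have der1: "\<delta> (br c y) = br (\<delta> c) y + br c (\<delta> y)" if c: "c \<in> \<gamma>" for c y
  proof -
    have "linear (\<lambda>y. \<delta> (br c y) - (br (\<delta> c) y + br c (\<delta> y)))"
      by (rule linearI) (simp_all add: br_simps linear_add[OF \<delta>lin] linear_scale[OF \<delta>lin] algebra_simps)
    from lin0[OF this, of y] der0[OF c] show ?thesis by simp
  qed
  have der: "\<delta> (br x y) = br (\<delta> x) y + br x (\<delta> y)" for x y
  proof -
    have "linear (\<lambda>x. \<delta> (br x y) - (br (\<delta> x) y + br x (\<delta> y)))"
      by (rule linearI) (simp_all add: br_simps linear_add[OF \<delta>lin] linear_scale[OF \<delta>lin] algebra_simps)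
    from lin0[OF this, of x] der1 show ?thesis by simp
  qed
  \<comment> \<open>Derivations are inner: represent the functional \<open>y \<mapsto> tr (\<delta> \<circ> ad y)\<close> by the Killing form.\<close>
  define f where "f y = lin_trace (\<lambda>w. \<delta> (br y w))" for y
  have flin: "linear f" unfolding f_def
    by (rule linearI) (simp_all add: br_simps linear_add[OF \<delta>lin] linear_scale[OF \<delta>lin] lin_trace_add lin_trace_scale)
  define x0 where "x0 = (\<Sum>c\<in>\<gamma>. - f (\<theta> c) *\<^sub>R c)"
  have kx0: "killing br x0 y = f y" for y
  proof -
    have ft: "f (\<theta> w) = (\<Sum>c\<in>\<gamma>. ip w c * f (\<theta> c))" for w
    proof -
      have "f (\<theta> w) = f (\<theta> (\<Sum>c\<in>\<gamma>. ip w c *\<^sub>R c))" using \<gamma>(3)[of w] by simp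
      then show ?thesis by (simp add: linear_sum[OF flin] \<theta>_simps linear_scale[OF flin])
    qed
    have "ip x0 w = - f (\<theta> w)" for w
    proof -
      have "ip x0 w = (\<Sum>c\<in>\<gamma>. - (ip w c * f (\<theta> c)))"
        unfolding x0_def by (simp add: ip_simps ip_sym[of _ w] mult.commute)
      also have "\<dots> = - (\<Sum>c\<in>\<gamma>. ip w c * f (\<theta> c))" by (rule sum_negf)
      finally show ?thesis unfolding ft[symmetric] .
    qed
    from this[of "\<theta> y"] show ?thesis unfolding ip_def by (simp add: \<theta>\<theta>)
  qed
  define e where "e y = \<delta> y - br x0 y" for y
  have elin: "linear e" unfolding e_def by (rule linear_compose_sub[OF \<delta>lin br_linear])
  have eder: "e (br x y) = br (e x) y + br x (e y)" for x y
    unfolding e_def der jacobi[of x0 x y] by (simp add: br_simps)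
  have etr: "lin_trace (\<lambda>w. e (br y w)) = 0" for y
    unfolding e_def lin_trace_diff using kx0[of y] unfolding f_def killing_trace by simp
  \<comment> \<open>As tr(e ad y) = 0 for all y, the derivation rule and cyclicity of the trace give
    B(e y, w) = tr(e ad [y, w]) = 0.\<close>
  have e0: "e y = 0" for y
  proof -
    have "killing br (e y) w = 0" for w
    proof -
      have 1: "br (e y) u = e (br y u) - br y (e u)" for u using eder[of y u] by simp
      have 2: "br (br y w) u = br y (br w u) - br w (br y u)" for u using jacobi[of y w u] by simp
      have "killing br (e y) w = lin_trace (\<lambda>u. e (br y (br w u))) - lin_trace (\<lambda>u. br y (e (br w u)))"
        unfolding killing_trace 1 by (rule lin_trace_diff)
      also have "lin_trace (\<lambda>u. br y (e (br w u))) = lin_trace (\<lambda>u. e (br w (br y u)))"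
        using lin_trace_swap[OF br_linear[of y] linear_compose[OF br_linear[of w] elin]] by simp
      also have "lin_trace (\<lambda>u. e (br y (br w u))) - \<dots> = lin_trace (\<lambda>u. e (br (br y w) u))"
        unfolding 2 by (simp add: linear_diff[OF elin] lin_trace_diff)
      finally show ?thesis using etr by simp
    qed
    then have "ip (e y) (e y) = 0" unfolding ip_def by simp
    then show ?thesis using ip_eq0 by blast
  qed
  have ad: "br x0 y = \<delta> y" for y using e0[of y] unfolding e_def by simp
  have cent: "br H x0 = 0" if "H \<in> a" for H
  proof -
    have "z H = 1 *\<^sub>R H" using ZZ_h[OF z a_G0[OF that]] by simp
    from \<delta>eig[OF this] have "br x0 H = 0" unfolding ad by simp
    then show ?thesis using br_anti[of H x0] by simp
  qed
  have "ip (\<delta> x) y = ip x (\<delta> y)" for x y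
    unfolding \<delta>_def by (simp add: ip_simps ip_sym[of _ y] mult_ac)
  then have sy: "- ip y (br (\<theta> x0) w) = ip y (br x0 w)" for y w using ip_br[of x0 y w] unfolding ad by simp
  have "br (\<theta> x0 + x0) w = 0" for w
  proof -
    have "ip y (br (\<theta> x0 + x0) w) = 0" for y using sy[of y w] by (simp add: br_simps ip_simps)
    then show ?thesis using ip_eq0 by blast
  qed
  then have "\<theta> x0 + x0 = 0" by (rule center_trivial)
  then have "\<theta> x0 = - x0" by (simp add: eq_neg_iff_add_eq_0)
  then have xa: "x0 \<in> a" using a_maximal cent by blast
  have "expop (br x0) x - z x = 0" for x
  proof (rule lin0[where f="\<lambda>x. expop (br x0) x - z x"])
    show "linear (\<lambda>x. expop (br x0) x - z x)" by (rule linear_compose_sub[OF linear_expop[OF br_linear] aut_linear[OF za]])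
    fix c assume c: "c \<in> \<gamma>"
    have "br x0 c = ln (\<mu> c) *\<^sub>R c" unfolding ad by (rule \<delta>\<gamma>[OF c])
    from expop_eigenvector[OF br_linear this] show "expop (br x0) c - z c = 0" using \<mu>[OF c] \<mu>pos[OF c] by simp
  qed
  then have "z = expop (br x0)" by (simp add: fun_eq_iff)
  then show ?thesis using xa by blast
qed

text \<open>The adjoint of g for \<open>ip\<close>. This form shows that it is again an
  automorphism, inner if g is.\<close>

definition gadj :: "('g \<Rightarrow> 'g) \<Rightarrow> 'g \<Rightarrow> 'g" where "gadj g x = \<theta> (inv g (\<theta> x))"

lemma gadj_ip: "aut g \<Longrightarrow> ip (g x) y = ip x (gadj g y)" "aut g \<Longrightarrow> ip (gadj g x) y = ip x (g y)"
  using ip_aut[of g x y] ip_aut[of g y x] unfolding gadj_def by (auto simp: ip_sym)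

lemma gadj_aut: "aut g \<Longrightarrow> aut (gadj g)"
  using aut_theta[OF aut_inv] unfolding gadj_def by blast

lemma gadj_inn: "g \<in> inn \<Longrightarrow> gadj g \<in> inn"
  using inn_theta[OF inn_inv] unfolding gadj_def by blast

lemma gadj_comp: assumes "aut f" "aut g" shows "gadj (f \<circ> g) = gadj g \<circ> gadj f"
  using o_inv_distrib[OF aut_bij[OF assms(1)] aut_bij[OF assms(2)]] unfolding gadj_def by (auto simp: \<theta>\<theta> fun_eq_iff)

lemma gadj_gadj: assumes "aut g" shows "gadj (gadj g) = g"
proof -
  have "gadj g = (\<lambda>x. \<theta> (inv g (\<theta> x)))" by (rule ext) (simp add: gadj_def)
  then have "inv (gadj g) = (\<lambda>x. \<theta> (g (\<theta> x)))" using inv_theta_conj[OF aut_inv[OF assms]] aut_inv_inv[OF assms] by simp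
  then show ?thesis by (auto simp: gadj_def \<theta>\<theta>)
qed

lemma gadj_NN: "n \<in> NN \<Longrightarrow> gadj n \<in> LL"
  using NN_theta[OF NN_inv] unfolding gadj_def by blast

lemma gadj_LL: "l \<in> LL \<Longrightarrow> gadj l \<in> NN"
  using LL_theta[OF LL_inv] unfolding gadj_def by blast

lemma gadj_ZZ: assumes "z \<in> ZZ" shows "gadj z \<in> ZZ"
  unfolding ZZ_def
proof (intro CollectI conjI ballI gadj_aut ZZ_aut[OF assms])
  fix H assume "H \<in> G {0}"
  then have "\<theta> H \<in> G {0}" by (rule \<theta>_G) auto
  then show "gadj z H = H" unfolding gadj_def using ZZ_h[OF ZZ_inv[OF assms]] by (simp add: \<theta>\<theta>)
qed

text \<open>For automorphisms, commuting with \<theta> is the same as being an isometry of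
  \<open>ip\<close>, so this is a compact group.\<close>

definition KK :: "('g \<Rightarrow> 'g) set" where "KK = {k. aut k \<and> (\<forall>x. \<theta> (k x) = k (\<theta> x))}"

lemma KK_aut: "k \<in> KK \<Longrightarrow> aut k" unfolding KK_def by blast

lemma KK_gadj: assumes "k \<in> KK" shows "gadj k (k x) = x"
proof -
  have "gadj k (k x) = \<theta> (inv k (k (\<theta> x)))" using assms unfolding gadj_def KK_def by simp
  then show ?thesis using aut_inv_apply(1)[OF KK_aut[OF assms]] by (simp add: \<theta>\<theta>)
qed

lemma KK_ip: "k \<in> KK \<Longrightarrow> ip (k x) (k y) = ip x y"
  using gadj_ip(1)[OF KK_aut] KK_gadj by simp

lemma KK_of_ip: assumes "aut k" "\<And>x y. ip (k x) (k y) = ip x y" shows "k \<in> KK"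
proof -
  have "gadj k (k x) = x" for x
  proof (rule ip_eqI)
    fix b show "ip (gadj k (k x)) b = ip x b" using gadj_ip(2)[OF assms(1)] assms(2) by simp
  qed
  then have "\<theta> (\<theta> (inv k (\<theta> (k x)))) = \<theta> x" for x unfolding gadj_def by simp
  then have "k (inv k (\<theta> (k x))) = k (\<theta> x)" for x by (simp add: \<theta>\<theta>)
  then show ?thesis unfolding KK_def using assms(1) aut_inv_apply(2)[OF assms(1)] by simp
qed

lemma KK_comp: "k \<in> KK \<Longrightarrow> l \<in> KK \<Longrightarrow> k \<circ> l \<in> KK"
  unfolding KK_def using aut_comp by auto

lemma KK_inv: assumes "k \<in> KK" shows "inv k \<in> KK"
proof (rule KK_of_ip[OF aut_inv[OF KK_aut[OF assms]]])
  show "ip (inv k x) (inv k y) = ip x y" for x y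
    using KK_ip[OF assms, of "inv k x" "inv k y"] aut_inv_apply(2)[OF KK_aut[OF assms]] by simp
qed

text \<open>Uniqueness of the Gauss decomposition l z n of the self-adjoint P forces l to be the
  adjoint of n and z to be self-adjoint, and z inherits positivity. Removing n and the square root
  of z from g leaves an isometry.\<close>

lemma iwasawa_exists:
  assumes g: "g \<in> inn"
  obtains k A n where "k \<in> KK" "A \<in> a" "n \<in> NN" "n \<in> inn" "k \<in> inn" "g = k \<circ> expop (br A) \<circ> n"
proof -
  note ga = inn_aut[OF g]
  define P where "P = gadj g \<circ> g"
  have Pi: "P \<in> inn" unfolding P_def by (rule inn_comp[OF gadj_inn[OF g] g])
  note Pa = inn_aut[OF Pi]
  have Pip: "ip (P x) y = ip (g x) (g y)" for x y unfolding P_def using gadj_ip(2)[OF ga] by simp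
  \<comment> \<open>The negative degrees are orthogonal to h + n, so \<open>P x\<close> in them
    gives 0 = \<open>ip (P x) x\<close> = \<open>ip (g x) (g x)\<close>.\<close>
  have good: "good P" unfolding good_iff[OF aut_linear[OF Pa]]
  proof (intro ballI impI)
    fix x assume x: "x \<in> G {0..}" "P x \<in> G {..<0}"
    have "ip (P x) x = 0" by (rule ip_G[OF x(2,1)]) auto
    then show "x = 0" unfolding Pip ip_eq0 aut_eq0[OF ga] .
  qed
  obtain l z n where *: "l \<in> LL" "l \<in> inn" "z \<in> ZZ" "n \<in> NN" "n \<in> inn" "P = l \<circ> z \<circ> n"
    using gauss_decomposition[OF Pa good inn_sigid[OF Pi good]] .
  note a = LL_aut[OF *(1)] ZZ_aut[OF *(3)] NN_aut[OF *(4)]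
  have "gadj P = P" unfolding P_def gadj_comp[OF gadj_aut[OF ga] ga] gadj_gadj[OF ga] ..
  moreover have "gadj P = gadj n \<circ> gadj z \<circ> gadj l"
    unfolding *(6) gadj_comp[OF aut_comp[OF a(1,2)] a(3)] gadj_comp[OF a(1,2)] by (simp add: comp_assoc)
  ultimately have "gadj n \<circ> gadj z \<circ> gadj l = l \<circ> z \<circ> n" using *(6) by simp
  from gauss_unique[OF gadj_NN[OF *(4)] gadj_ZZ[OF *(3)] gadj_LL[OF *(1)] *(1,3,4) this]
  have ln: "gadj n = l" and zs: "gadj z = z" by auto
  have zP: "ip (z (n x)) (n y) = ip (g x) (g y)" for x y
  proof -
    have "ip (P x) y = ip (gadj n (z (n x))) y" unfolding *(6) ln by simp
    also have "\<dots> = ip (z (n x)) (n y)" by (rule gadj_ip(2)[OF a(3)])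
    finally show ?thesis unfolding Pip by simp
  qed
  have "\<exists>A\<in>a. z = expop (br A)"
  proof (rule posdef_ZZ_exp[OF *(3)])
    show "ip (z x) y = ip x (z y)" for x y using gadj_ip(1)[OF a(2), of x y] zs by simp
    fix x :: 'g assume "x \<noteq> 0"
    then have "inv n x \<noteq> 0" using aut_eq0[OF aut_inv[OF a(3)]] by simp
    then have "g (inv n x) \<noteq> 0" using aut_eq0[OF ga] by simp
    then show "ip (z x) x > 0" using zP[of "inv n x" "inv n x"] ip_pos by (simp add: aut_inv_apply[OF a(3)])
  qed
  then obtain A where A: "A \<in> a" "z = expop (br A)" by blast
  let ?A = "(1/2) *\<^sub>R A"
  have Aa: "?A \<in> a" using A(1) a_subspace subspace_scale by blast
  have mAa: "- ?A \<in> a" using Aa a_subspace subspace_neg by blast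
  have zaa: "z x = expop (br ?A) (expop (br ?A) x)" for x
    unfolding ea_add[OF Aa Aa] A(2) by (simp flip: scaleR_add_left)
  define k where "k = g \<circ> inv n \<circ> expop (br (- ?A))"
  have ka: "aut k" unfolding k_def by (intro aut_comp ga aut_inv a aut_expop)
  have kK: "k \<in> KK"
  proof (rule KK_of_ip[OF ka])
    fix x y
    let ?u = "expop (br (- ?A)) x" and ?v = "expop (br (- ?A)) y"
    have "ip (k x) (k y) = ip (z ?u) ?v"
      using zP[of "inv n ?u" "inv n ?v"] unfolding k_def by (simp add: aut_inv_apply[OF a(3)])
    also have "\<dots> = ip x y" unfolding zaa by (simp add: ea_sym[OF Aa] expop_br_uminus)
    finally show "ip (k x) (k y) = ip x y" .
  qed
  have "g = k \<circ> expop (br ?A) \<circ> n"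
    unfolding k_def by (auto simp: fun_eq_iff expop_br_uminus aut_inv_apply[OF a(3)])
  moreover have "k \<in> inn" unfolding k_def by (intro inn_comp g inn_inv *(5) inn_expop)
  ultimately show ?thesis using that[OF kK Aa *(4,5)] by blast
qed

lemma iwasawa_gadj:
  assumes "k \<in> KK" "A \<in> a" "n \<in> NN"
  shows "gadj (k \<circ> expop (br A) \<circ> n) \<circ> (k \<circ> expop (br A) \<circ> n) = gadj n \<circ> (expop (br A) \<circ> expop (br A)) \<circ> n"
proof -
  note ka = KK_aut[OF assms(1)] and na = NN_aut[OF assms(3)]
  have "gadj (expop (br A)) = expop (br A)"
  proof
    fix x show "gadj (expop (br A)) x = expop (br A) x"
    proof (rule ip_eqI)
      fix b show "ip (gadj (expop (br A)) x) b = ip (expop (br A) x) b"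
        using gadj_ip(2)[OF aut_expop] ea_sym[OF assms(2)] by simp
    qed
  qed
  then show ?thesis
    unfolding gadj_comp[OF aut_comp[OF ka aut_expop] na] gadj_comp[OF ka aut_expop]
    using KK_gadj[OF assms(1)] by (auto simp: fun_eq_iff)
qed

text \<open>Only the factor l is chosen; z is then the degree-preserving part of l^-1 g and n the
  rest. These formulas make the smoothness of all factors follow from that of
  \<open>gL\<close>.\<close>

definition gL :: "('g \<Rightarrow> 'g) \<Rightarrow> 'g \<Rightarrow> 'g" where
  "gL g = (SOME l. \<exists>z n. l \<in> LL \<and> z \<in> ZZ \<and> n \<in> NN \<and> g = l \<circ> z \<circ> n)"
definition gZ :: "('g \<Rightarrow> 'g) \<Rightarrow> 'g \<Rightarrow> 'g" where
  "gZ g x = (\<Sum>b\<in>\<beta>. ip x b *\<^sub>R pr {deg b} (inv (gL g) (g b)))"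
definition gN :: "('g \<Rightarrow> 'g) \<Rightarrow> 'g \<Rightarrow> 'g" where
  "gN g x = inv (gZ g) (inv (gL g) (g x))"

lemma gL_eq: assumes "l \<in> LL" "z \<in> ZZ" "n \<in> NN" shows "gL (l \<circ> z \<circ> n) = l"
proof -
  have "\<exists>l' z' n'. l' \<in> LL \<and> z' \<in> ZZ \<and> n' \<in> NN \<and> l \<circ> z \<circ> n = l' \<circ> z' \<circ> n'" using assms by blast
  then have "\<exists>z' n'. gL (l \<circ> z \<circ> n) \<in> LL \<and> z' \<in> ZZ \<and> n' \<in> NN \<and> l \<circ> z \<circ> n = gL (l \<circ> z \<circ> n) \<circ> z' \<circ> n'"
    unfolding gL_def by (rule someI_ex)
  then obtain z' n' where "gL (l \<circ> z \<circ> n) \<in> LL" "z' \<in> ZZ" "n' \<in> NN" "l \<circ> z \<circ> n = gL (l \<circ> z \<circ> n) \<circ> z' \<circ> n'" by blast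
  from gauss_unique(1)[OF assms this] show ?thesis by (rule sym)
qed

lemma gZ_eq: assumes "l \<in> LL" "z \<in> ZZ" "n \<in> NN" shows "gZ (l \<circ> z \<circ> n) = z"
proof -
  note a = LL_aut[OF assms(1)] ZZ_aut[OF assms(2)] NN_aut[OF assms(3)]
  have zb: "pr {deg b} (inv l (l (z (n b)))) = z b" if b: "b \<in> \<beta>" for b
  proof -
    have bG: "b \<in> G {deg b}" using \<beta>_G b by auto
    have "n b - b \<in> G {deg b<..}" by (rule NN_diff[OF assms(3) G_mono[OF bG]]) auto
    then have "z (n b - b) \<in> G {deg b<..}" by (rule ZZ_G[OF assms(2)])
    then have "pr {deg b} (z (n b - b)) = 0" by (rule pr_zero) auto
    then have "pr {deg b} (z (n b)) = pr {deg b} (z b)" by (simp add: linear_diff[OF aut_linear[OF a(2)]] pr_simps)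
    then show ?thesis using pr_id[OF ZZ_G[OF assms(2) bG]] by (simp add: aut_inv_apply[OF a(1)])
  qed
  show ?thesis
  proof
    fix x
    have "gZ (l \<circ> z \<circ> n) x = (\<Sum>b\<in>\<beta>. ip x b *\<^sub>R z b)"
      unfolding gZ_def gL_eq[OF assms] by (rule sum.cong) (auto simp: zb)
    then show "gZ (l \<circ> z \<circ> n) x = z x" using expand[OF aut_linear[OF a(2)], of x] by simp
  qed
qed

lemma gN_eq: assumes "l \<in> LL" "z \<in> ZZ" "n \<in> NN" shows "gN (l \<circ> z \<circ> n) = n"
  using aut_inv_apply[OF LL_aut[OF assms(1)]] aut_inv_apply[OF ZZ_aut[OF assms(2)]]
  unfolding gN_def gL_eq[OF assms] gZ_eq[OF assms] by (auto simp: fun_eq_iff)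

text \<open>If \<open>g = k e\<^sup>A n\<close>, then \<open>g\<^sup>* g = n\<^sup>* e\<^sup>2\<^sup>A n\<close> is a Gauss decomposition, from which \<open>n\<close> and \<open>e\<^sup>A\<close> are read off.\<close>

definition iN :: "('g \<Rightarrow> 'g) \<Rightarrow> 'g \<Rightarrow> 'g" where "iN g = gN (gadj g \<circ> g)"
definition iA :: "('g \<Rightarrow> 'g) \<Rightarrow> 'g \<Rightarrow> 'g" where
  "iA g x = (\<Sum>b\<in>\<beta>. (sqrt (ip (gZ (gadj g \<circ> g) b) b) * ip x b) *\<^sub>R b)"

lemma iN_eq: assumes "k \<in> KK" "A \<in> a" "n \<in> NN" shows "iN (k \<circ> expop (br A) \<circ> n) = n"
  unfolding iN_def iwasawa_gadj[OF assms] by (rule gN_eq[OF gadj_NN[OF assms(3)] ZZ_comp[OF ea_ZZ ea_ZZ] assms(3)]) (rule assms)+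

lemma iA_gZ: assumes "k \<in> KK" "A \<in> a" "n \<in> NN" "b \<in> \<beta>"
  shows "ip (gZ (gadj (k \<circ> expop (br A) \<circ> n) \<circ> (k \<circ> expop (br A) \<circ> n)) b) b = (exp (\<alpha> b \<bullet> A))\<^sup>2"
proof -
  have "gZ (gadj (k \<circ> expop (br A) \<circ> n) \<circ> (k \<circ> expop (br A) \<circ> n)) = expop (br A) \<circ> expop (br A)"
    unfolding iwasawa_gadj[OF assms(1-3)] by (rule gZ_eq[OF gadj_NN[OF assms(3)] ZZ_comp[OF ea_ZZ ea_ZZ] assms(3)]) (rule assms)+
  then show ?thesis using ea_\<beta>[OF assms(2,4)] \<beta>_on[OF assms(4,4)]
    by (simp add: linear_scale[OF linear_expop[OF br_linear]] ip_simps power2_eq_square)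
qed

lemma iA_eq: assumes "k \<in> KK" "A \<in> a" "n \<in> NN" shows "iA (k \<circ> expop (br A) \<circ> n) = expop (br A)"
proof
  fix x
  have "iA (k \<circ> expop (br A) \<circ> n) x = (\<Sum>b\<in>\<beta>. ip x b *\<^sub>R expop (br A) b)"
    unfolding iA_def by (rule sum.cong) (auto simp: iA_gZ[OF assms] ea_\<beta>[OF assms(2)] mult.commute)
  then show "iA (k \<circ> expop (br A) \<circ> n) x = expop (br A) x" using expand[OF linear_expop[OF br_linear[of A]], of x] by simp
qed

text \<open>Regularity is tested on each vector; invertibility at every point is what lets inverses
  and decompositions inherit it.\<close>

definition Cf :: "nat \<Rightarrow> 'w::euclidean_space set \<Rightarrow> ('w \<Rightarrow> 'g \<Rightarrow> 'g) \<Rightarrow> bool" where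
  "Cf k W g \<longleftrightarrow> (\<forall>y\<in>W. aut (g y)) \<and> (\<forall>v. Ck k W (\<lambda>y. g y v))"

lemma Cf_aut: "Cf k W g \<Longrightarrow> y \<in> W \<Longrightarrow> aut (g y)" and Cf_Ck: "Cf k W g \<Longrightarrow> Ck k W (\<lambda>y. g y v)"
  unfolding Cf_def by blast+

lemma Cf_apply: assumes "open W" "Cf k W g" "Ck k W f" shows "Ck k W (\<lambda>y. g y (f y))"
  by (rule Ck_apply[OF assms(1) aut_linear[OF Cf_aut[OF assms(2)]] Cf_Ck[OF assms(2)] assms(3)])

lemma Cf_comp: assumes "open W" "Cf k W g" "Cf k W h" shows "Cf k W (\<lambda>y. g y \<circ> h y)"
  unfolding Cf_def
proof (intro conjI ballI allI)
  show "aut (g y \<circ> h y)" if "y \<in> W" for y using assms that Cf_aut aut_comp by blast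
  show "Ck k W (\<lambda>y. (g y \<circ> h y) v)" for v
    using Cf_apply[OF assms(1,2) Cf_Ck[OF assms(3)]] by simp
qed

lemma Cf_inv: assumes "open W" "Cf k W g" shows "Cf k W (\<lambda>y. inv (g y))"
  unfolding Cf_def
proof (intro conjI ballI allI)
  show "aut (inv (g y))" if "y \<in> W" for y using assms that Cf_aut aut_inv by blast
  show "Ck k W (\<lambda>y. inv (g y) v)" for v
    by (rule Ck_linear_system[where M=g and b="\<lambda>y. v", OF assms(1)])
       (use Cf_aut[OF assms(2)] Cf_Ck[OF assms(2)] in \<open>auto simp: aut_linear aut_bij bij_is_inj aut_inv_apply Ck_const\<close>)
qed

lemma Cf_theta: assumes "open W" "Cf k W g" shows "Cf k W (\<lambda>y x. \<theta> (g y (\<theta> x)))"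
  unfolding Cf_def
proof (intro conjI ballI allI)
  show "aut (\<lambda>x. \<theta> (g y (\<theta> x)))" if "y \<in> W" for y using assms that Cf_aut aut_theta by blast
  show "Ck k W (\<lambda>y. \<theta> (g y (\<theta> v)))" for v by (rule Ck_linear_comp[OF \<theta>_linear Cf_Ck[OF assms(2)]])
qed

lemma Cf_gadj: assumes "open W" "Cf k W g" shows "Cf k W (\<lambda>y. gadj (g y))"
  using Cf_theta[OF assms(1) Cf_inv[OF assms]] unfolding gadj_def .

lemma Cf_const: "aut g \<Longrightarrow> Cf k W (\<lambda>y. g)"
  unfolding Cf_def by (simp add: Ck_const)

text \<open>With c = \<open>deg b\<close>, the vector x = l b - b is the only one in degrees below c
  for which g^-1 (b + x) has no component below c. Adding \<open>pr {c..} x\<close> turns this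
  condition into an invertible linear system on all of g.\<close>

lemma Cf_gL:
  assumes W: "open W" "Cf k W g" and gs: "\<And>y. y \<in> W \<Longrightarrow> \<exists>l z n. l \<in> LL \<and> z \<in> ZZ \<and> n \<in> NN \<and> g y = l \<circ> z \<circ> n"
  shows "Cf k W (\<lambda>y. gL (g y))"
  unfolding Cf_def
proof (intro conjI ballI allI)
  show "aut (gL (g y))" if "y \<in> W" for y using gs[OF that] gL_eq LL_aut by metis
  have lin: "linear (gL (g y))" if "y \<in> W" for y using gs[OF that] gL_eq LL_aut aut_linear by metis
  have Lb: "Ck k W (\<lambda>y. gL (g y) b)" if b: "b \<in> \<beta>" for b
  proof -
    define c where "c = deg b"
    have bG: "b \<in> G {c}" using \<beta>_G b unfolding c_def by auto
    define M where "M y x = pr {c..} x + pr {..<c} (inv (g y) (pr {..<c} x))" for y x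
    have d: "{c..} \<inter> {..<c} = {}" "{..<c} \<inter> {c..} = {}" by auto
    have p0: "pr {} x = 0" for x unfolding pr_def by simp
    have spl: "x = pr {..<c} x + pr {c..} x" for x by (rule pr_split) auto
    have "Ck k W (\<lambda>y. gL (g y) b - b)"
    proof (rule Ck_linear_system[where M=M and b="\<lambda>y. - pr {..<c} (inv (g y) b)", OF W(1)])
      fix y assume y: "y \<in> W"
      obtain l z n where *: "l \<in> LL" "z \<in> ZZ" "n \<in> NN" "g y = l \<circ> z \<circ> n" using gs[OF y] by blast
      note a = LL_aut[OF *(1)] ZZ_aut[OF *(2)] NN_aut[OF *(3)]
      have ga: "aut (g y)" using Cf_aut[OF W(2) y] .
      have ginv: "inv (g y) x = inv n (inv z (inv l x))" for x
        unfolding *(4) using o_inv_distrib[OF bij_comp[OF aut_bij[OF a(2)] aut_bij[OF a(1)]] aut_bij[OF a(3)]]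
          o_inv_distrib[OF aut_bij[OF a(1)] aut_bij[OF a(2)]] by simp
      show linM: "linear (M y)" unfolding M_def
        using linear_compose_add[OF pr_linear linear_compose[OF linear_compose[OF pr_linear aut_linear[OF aut_inv[OF ga]]] pr_linear]] by (simp add: o_def)
      show "inj (M y)" unfolding linear_injective_0[OF linM]
      proof (intro allI impI)
        fix x assume x: "M y x = 0"
        have "pr {c..} (M y x) = pr {c..} x" unfolding M_def by (simp add: pr_simps pr_pr d p0)
        then have 1: "pr {c..} x = 0" using x by (simp add: pr_simps)
        then have xG: "x = pr {..<c} x" using spl[of x] by simp
        have "pr {..<c} (inv (g y) (pr {..<c} x)) = 0" using x 1 unfolding M_def by simp
        then have "pr {..<c} (inv (g y) x) = 0" using xG by simp
        then have "inv (g y) x = pr {c..} (inv (g y) x)" using spl[of "inv (g y) x"] by simp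
        then have "inv n (inv z (inv l x)) \<in> G {c..}" using pr_mem[of "{c..}" "inv (g y) x"] unfolding ginv by simp
        from NN_ge[OF *(3) this] have w: "inv z (inv l x) \<in> G {c..}" by (simp add: aut_inv_apply[OF a(3)])
        have "x \<in> G {..<c}" using xG pr_mem[of "{..<c}" x] by simp
        then have "inv z (inv l x) \<in> G {..<c}" using ZZ_G[OF ZZ_inv[OF *(2)]] LL_lt[OF LL_inv[OF *(1)]] by blast
        from G_disjoint[OF w this d(1)] show "x = 0" using aut_eq0[OF aut_inv[OF a(2)]] aut_eq0[OF aut_inv[OF a(1)]] by simp
      qed
      have gl: "gL (g y) = l" unfolding *(4) by (rule gL_eq[OF *(1-3)])
      have yG: "l b - b \<in> G {..<c}" by (rule LL_diff[OF *(1) G_mono[OF bG]]) auto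
      have "inv (g y) (l b) = inv n (inv z b)" unfolding ginv by (simp add: aut_inv_apply[OF a(1)])
      also have "\<dots> \<in> G {c..}" by (rule NN_ge[OF NN_inv[OF *(3)] ZZ_G[OF ZZ_inv[OF *(2)] G_mono[OF bG]]]) auto
      finally have "pr {..<c} (inv (g y) (l b)) = 0" by (rule pr_zero) auto
      then have "pr {..<c} (inv (g y) (l b - b)) = - pr {..<c} (inv (g y) b)"
        by (simp add: linear_diff[OF aut_linear[OF aut_inv[OF ga]]] pr_simps)
      moreover have "pr {c..} (l b - b) = 0" by (rule pr_zero[OF yG]) auto
      ultimately show "M y (gL (g y) b - b) = - pr {..<c} (inv (g y) b)"
        unfolding M_def gl using pr_id[OF yG] by simp
    next
      have inv: "Ck k W (\<lambda>y. pr {..<c} (inv (g y) v))" for v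
        by (rule Ck_linear_comp[OF pr_linear Cf_Ck[OF Cf_inv[OF W]]])
      show "Ck k W (\<lambda>y. M y v)" for v unfolding M_def by (intro Ck_add Ck_const inv)
      show "Ck k W (\<lambda>y. - pr {..<c} (inv (g y) b))" by (rule Ck_linear_comp[OF linear_uminus inv])
    qed
    from Ck_add[OF this Ck_const[of k W b]] show ?thesis by simp
  qed
  show "Ck k W (\<lambda>y. gL (g y) v)" for v
  proof (rule Ck_cong[OF W(1)])
    show "Ck k W (\<lambda>y. \<Sum>b\<in>\<beta>. ip v b *\<^sub>R gL (g y) b)" by (intro Ck_sum Ck_scaleR Ck_const Lb)
    show "(\<Sum>b\<in>\<beta>. ip v b *\<^sub>R gL (g y) b) = gL (g y) v" if "y \<in> W" for y
      using expand[OF lin[OF that], of v] by simp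
  qed
qed

lemma Cf_gZ:
  assumes W: "open W" "Cf k W g" and gs: "\<And>y. y \<in> W \<Longrightarrow> \<exists>l z n. l \<in> LL \<and> z \<in> ZZ \<and> n \<in> NN \<and> g y = l \<circ> z \<circ> n"
  shows "Cf k W (\<lambda>y. gZ (g y))"
  unfolding Cf_def
proof (intro conjI ballI allI)
  show "aut (gZ (g y))" if "y \<in> W" for y using gs[OF that] gZ_eq ZZ_aut by metis
  have "Cf k W (\<lambda>y. inv (gL (g y)) \<circ> g y)" by (intro Cf_comp Cf_inv Cf_gL assms)
  then have "Ck k W (\<lambda>y. pr S ((inv (gL (g y)) \<circ> g y) b))" for S b by (intro Ck_linear_comp[OF pr_linear] Cf_Ck)
  then show "Ck k W (\<lambda>y. gZ (g y) v)" for v unfolding gZ_def by (intro Ck_sum Ck_scaleR Ck_const) simp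
qed

lemma Cf_gN:
  assumes W: "open W" "Cf k W g" and gs: "\<And>y. y \<in> W \<Longrightarrow> \<exists>l z n. l \<in> LL \<and> z \<in> ZZ \<and> n \<in> NN \<and> g y = l \<circ> z \<circ> n"
  shows "Cf k W (\<lambda>y. gN (g y))"
proof -
  have "Cf k W (\<lambda>y. inv (gZ (g y)) \<circ> (inv (gL (g y)) \<circ> g y))" by (intro Cf_comp Cf_inv Cf_gL Cf_gZ assms)
  moreover have "(\<lambda>y. inv (gZ (g y)) \<circ> (inv (gL (g y)) \<circ> g y)) = (\<lambda>y. gN (g y))" by (auto simp: gN_def fun_eq_iff)
  ultimately show ?thesis by simp
qed

lemma iwasawa_gauss:
  assumes "g \<in> inn" shows "\<exists>l z n. l \<in> LL \<and> z \<in> ZZ \<and> n \<in> NN \<and> gadj g \<circ> g = l \<circ> z \<circ> n"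
proof -
  obtain k A n where "k \<in> KK" "A \<in> a" "n \<in> NN" "n \<in> inn" "k \<in> inn" "g = k \<circ> expop (br A) \<circ> n" using iwasawa_exists[OF assms] .
  then show ?thesis using iwasawa_gadj gadj_NN ZZ_comp ea_ZZ by metis
qed

lemma Cf_iN: assumes W: "open W" "Cf k W g" "\<And>y. y \<in> W \<Longrightarrow> g y \<in> inn" shows "Cf k W (\<lambda>y. iN (g y))"
  unfolding iN_def by (rule Cf_gN[OF W(1) Cf_comp[OF W(1) Cf_gadj[OF W(1,2)] W(2)] iwasawa_gauss[OF W(3)]])

lemma Cf_iA: assumes W: "open W" "Cf k W g" "\<And>y. y \<in> W \<Longrightarrow> g y \<in> inn" shows "Cf k W (\<lambda>y. iA (g y))"
  unfolding Cf_def
proof (intro conjI ballI allI)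
  have iw: "\<exists>k A n. k \<in> KK \<and> A \<in> a \<and> n \<in> NN \<and> g y = k \<circ> expop (br A) \<circ> n" if "y \<in> W" for y
    using iwasawa_exists[OF W(3)[OF that]] by metis
  show "aut (iA (g y))" if "y \<in> W" for y using iw[OF that] iA_eq aut_expop by metis
  have "Cf k W (\<lambda>y. gZ (gadj (g y) \<circ> g y))"
    by (rule Cf_gZ[OF W(1) Cf_comp[OF W(1) Cf_gadj[OF W(1,2)] W(2)] iwasawa_gauss[OF W(3)]])
  then have q: "Ck k W (\<lambda>y. ip (gZ (gadj (g y) \<circ> g y) b) b)" for b by (intro Ck_linear_comp[OF ip_lin] Cf_Ck)
  have pos: "ip (gZ (gadj (g y) \<circ> g y) b) b > 0" if "y \<in> W" "b \<in> \<beta>" for y b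
    using iw[OF that(1)] iA_gZ[OF _ _ _ that(2)] by (metis exp_gt_zero zero_less_power)
  have "Ck k W (\<lambda>y. sqrt (ip (gZ (gadj (g y) \<circ> g y) b) b))" if b: "b \<in> \<beta>" for b
    by (rule Ck_compose[OF W(1) q Ck_sqrt_real]) (use pos b in auto)
  then show "Ck k W (\<lambda>y. iA (g y) v)" for v
    unfolding iA_def by (intro Ck_sum Ck_scaleR Ck_bilinear[OF bounded_bilinear_mult] Ck_const) auto
qed

end

section \<open>The charts\<close>

context graded begin

text \<open>Each bracket with an element of positive degrees raises degrees by at least the least
  positive degree d, and all degrees lie in a bounded range. A bound uniform in x makes exp(ad x)
  polynomial, hence smooth, in x.\<close>

lemma ad_nilpotent: "\<exists>K. \<forall>x\<in>G {0<..}. \<forall>v. \<forall>n\<ge>K. (br x ^^ n) v = 0"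
proof -
  let ?D = "deg ` \<beta> \<inter> {0<..}"
  have fin: "finite ?D" "finite (deg ` \<beta>)" using \<beta>_fin by auto
  \<comment> \<open>The value 1 is a default for the case without positive degrees, where any
    positive step works.\<close>
  define d where "d = (if ?D = {} then 1 else Min ?D)"
  have d: "d > 0" using Min_in[OF fin(1)] unfolding d_def by auto
  have dle: "deg ` \<beta> \<inter> {0<..} \<subseteq> {d..}" using fin(1) unfolding d_def by auto
  define M where "M = Max (insert 1 (abs ` deg ` \<beta>))"
  have M: "\<bar>deg b\<bar> \<le> M" if "b \<in> \<beta>" for b unfolding M_def using fin(2) that by (intro Max_ge) auto
  obtain K :: nat where K: "2 * M < real K * d" using reals_Archimedean3[OF d] by blast
  have "(br x ^^ n) v = 0" if x: "x \<in> G {0<..}" and n: "n \<ge> K" for x v n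
  proof -
    have xd: "x \<in> G {d..}" by (rule G_cong_degrees[OF dle x])
    have "v \<in> G UNIV" unfolding G_def by simp
    then have v: "v \<in> G {- M..}"
    proof (rule G_cong_degrees[rotated])
      show "deg ` \<beta> \<inter> UNIV \<subseteq> {- M..}" using M by (auto simp: abs_le_iff minus_le_iff)
    qed
    have "(br x ^^ n) v \<in> G {- M + real n * d..}" for n
    proof (induction n)
      case (Suc n)
      have "br x ((br x ^^ n) v) \<in> G {- M + real (Suc n) * d..}"
        by (rule br_G[OF xd Suc]) (auto simp: algebra_simps)
      then show ?case by simp
    qed (use v in simp)
    then show ?thesis
    proof (rule G_0_of_degrees[rotated])
      have "real K * d \<le> real n * d" using n d by (intro mult_right_mono) auto
      then have "M < - M + real n * d" using K by simp
      then show "deg ` \<beta> \<inter> {- M + real n * d..} = {}" using M by (fastforce simp: abs_le_iff)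
    qed
  qed
  then show ?thesis by blast
qed

lemma Cf_expop_n:
  assumes W: "open W" "Ck k W f" "\<And>y. y \<in> W \<Longrightarrow> f y \<in> G {0<..}"
  shows "Cf k W (\<lambda>y. expop (br (f y)))"
  unfolding Cf_def
proof (intro conjI ballI allI aut_expop)
  fix v
  obtain K where K: "\<forall>x\<in>G {0<..}. \<forall>v. \<forall>n\<ge>K. (br x ^^ n) v = 0" using ad_nilpotent ..
  have pow: "Ck k W (\<lambda>y. (br (f y) ^^ n) v)" for n
    by (induction n) (auto intro: Ck_const Ck_bilinear[OF br_bilinear W(2)])
  show "Ck k W (\<lambda>y. expop (br (f y)) v)"
  proof (rule Ck_cong[OF W(1)])
    show "Ck k W (\<lambda>y. \<Sum>n<K. (1 / fact n) *\<^sub>R (br (f y) ^^ n) v)"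
      by (intro Ck_sum Ck_scaleR Ck_const pow)
    fix y assume y: "y \<in> W"
    have "expop (br (f y)) v - (\<Sum>n<K. (1 / fact n) *\<^sub>R (br (f y) ^^ n) v) \<in> {0}"
      by (rule expop_minus_partial_sum_mem[OF br_linear]) (use K W(3)[OF y] in auto)
    then show "(\<Sum>n<K. (1 / fact n) *\<^sub>R (br (f y) ^^ n) v) = expop (br (f y)) v" by simp
  qed
qed

lemma Cf_expop_l:
  assumes W: "open W" "Ck k W f" "\<And>y. y \<in> W \<Longrightarrow> f y \<in> G {..<0}"
  shows "Cf k W (\<lambda>y. expop (br (f y)))"
proof -
  have "\<theta> (f y) \<in> G {0<..}" if "y \<in> W" for y by (rule \<theta>_G[OF W(3)[OF that]]) auto
  then have "Cf k W (\<lambda>y. expop (br (\<theta> (f y))))" by (rule Cf_expop_n[OF W(1) Ck_linear_comp[OF \<theta>_linear W(2)]])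
  from Cf_theta[OF W(1) this] show ?thesis by (simp add: theta_expop \<theta>\<theta>)
qed

lemma LL_expop: assumes "x \<in> G {..<0}" shows "expop (br x) \<in> LL"
proof -
  have "\<theta> x \<in> G {0<..}" by (rule \<theta>_G[OF assms]) auto
  from NN_theta[OF NN_expop[OF this]] show ?thesis by (simp add: theta_expop \<theta>\<theta>)
qed

lemma triple_split: "v = pr {0<..} v + pr {..<0} v + pr {0} v"
proof -
  have "v = pr ({0<..} \<union> {..<0}) v + pr {0} v" by (rule pr_split) auto
  moreover have "pr ({0<..} \<union> {..<0}) v = pr {0<..} v + pr {..<0} v" by (rule pr_Un) auto
  ultimately show ?thesis by simp
qed

lemma triple_zero:
  assumes "x \<in> G {0<..}" "y \<in> G {..<0}" "w \<in> G {0}" "x + y + w = 0" shows "x = 0" "y = 0" "w = 0"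
proof -
  have d: "{0<..} \<inter> {..<0} = ({}::real set)" "{..<0} \<inter> {0<..} = ({}::real set)" by auto
  have "pr {0<..} (x + y + w) = x" "pr {..<0} (x + y + w) = y" "pr {0} (x + y + w) = w"
    using pr_id[OF assms(1)] pr_id[OF assms(2)] pr_id[OF assms(3)]
      pr_zero[OF assms(1) d(1)] pr_zero[OF assms(1), of "{0}"] pr_zero[OF assms(2) d(2)]
      pr_zero[OF assms(2), of "{0}"] pr_zero[OF assms(3), of "{0<..}"] pr_zero[OF assms(3), of "{..<0}"]
    by (auto simp: pr_simps)
  then show "x = 0" "y = 0" "w = 0" unfolding assms(4) by (auto simp: pr_simps)
qed

text \<open>The map sending v to g0 exp(ad v+) exp(ad v-) (\<Lambda> + v0), with v+, v-, v0 the
  parts of positive, negative and zero degree, is a local diffeomorphism of g at 0 because \<Lambda>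
  is regular. At orbit points v0 = 0, since \<Lambda> + v0 has the spectrum of \<Lambda> and lies
  near it. The section is defined on an open set of g, as smooth extensions require; its factored
  form later identifies its values.\<close>

lemma local_section:
  assumes \<Lambda>: "regular \<Lambda>" and g0: "g0 \<in> inn"
  obtains W s where "open W" "g0 \<Lambda> \<in> W" "\<And>k. Cf k W s" "\<And>y. y \<in> W \<Longrightarrow> s y \<in> inn"
    "\<And>y g. y \<in> W \<Longrightarrow> y = g \<Lambda> \<Longrightarrow> g \<in> inn \<Longrightarrow> s y \<Lambda> = y" "s (g0 \<Lambda>) = g0"
    "\<And>y. y \<in> W \<Longrightarrow> \<exists>x w. x \<in> G {0<..} \<and> w \<in> G {..<0} \<and> s y = g0 \<circ> expop (br x) \<circ> expop (br w)"
proof -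
  note ga = inn_aut[OF g0] and \<Lambda>h = regular_h[OF \<Lambda>]
  define S where "S v = g0 \<circ> expop (br (pr {0<..} v)) \<circ> expop (br (pr {..<0} v))" for v
  have CS: "Cf k UNIV S" for k unfolding S_def
    by (intro Cf_comp Cf_const Cf_expop_n Cf_expop_l ga Ck_linear pr_linear pr_mem open_UNIV)
  define M where "M v = S v (\<Lambda> + pr {0} v)" for v
  have MC: "Ck k UNIV M" for k unfolding M_def
    by (rule Cf_apply[OF open_UNIV CS]) (intro Ck_add Ck_const Ck_linear pr_linear)
  have b0: "expop (br 0) v = v" for v
  proof -
    have "br 0 = (\<lambda>x. 0)" by (auto simp: br_simps)
    then show ?thesis by (simp add: expop_0)
  qed
  have S0: "S 0 = g0" unfolding S_def by (auto simp: pr_simps b0)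
  have M0: "M 0 = g0 \<Lambda>" unfolding M_def S0 by (simp add: pr_simps)
  obtain M' where M': "(M has_derivative M') (at 0)"
    by (rule Ck_SucE[OF MC[of "Suc 0"]]) (use UNIV_I in blast)
  have M'v: "M' v = g0 (br (pr {0<..} v) \<Lambda> + br (pr {..<0} v) \<Lambda> + pr {0} v)" for v
  proof -
    have sc: "br (t *\<^sub>R x) = (\<lambda>y. t *\<^sub>R br x y)" for x t by (auto simp: br_simps)
    have w: "((\<lambda>t. \<Lambda> + t *\<^sub>R pr {0} v) has_vector_derivative pr {0} v) (at 0)"
      by (auto intro!: derivative_eq_intros)
    have "((\<lambda>t. M (t *\<^sub>R v)) has_vector_derivative
        g0 (expop (\<lambda>x. 0 *\<^sub>R br (pr {0<..} v) x) (br (pr {0<..} v) (expop (\<lambda>x. 0 *\<^sub>R br (pr {..<0} v) x) (\<Lambda> + 0 *\<^sub>R pr {0} v)) +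
          expop (\<lambda>x. 0 *\<^sub>R br (pr {..<0} v) x) (br (pr {..<0} v) (\<Lambda> + 0 *\<^sub>R pr {0} v) + pr {0} v)))) (at 0)"
      unfolding M_def S_def comp_def pr_simps(3) sc
      by (intro bounded_linear.has_vector_derivative[of g0] expop_apply_has_vector_derivative br_linear w)
         (use aut_linear[OF ga] linear_conv_bounded_linear in blast)
    then have 1: "((\<lambda>t. M (t *\<^sub>R v)) has_vector_derivative g0 (br (pr {0<..} v) \<Lambda> + br (pr {..<0} v) \<Lambda> + pr {0} v)) (at 0)"
      by (simp add: expop_0 add.assoc)
    have l: "((\<lambda>t::real. t *\<^sub>R v) has_derivative (\<lambda>t. t *\<^sub>R v)) (at 0)"
      by (auto intro!: derivative_eq_intros)
    have "((\<lambda>t. M (t *\<^sub>R v)) has_derivative (\<lambda>t. M' (t *\<^sub>R v))) (at 0)"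
      by (rule has_derivative_compose[OF l, of M M']) (use M' in simp)
    then have "((\<lambda>t. M (t *\<^sub>R v)) has_vector_derivative M' v) (at 0)"
      unfolding has_vector_derivative_def using linear_scale[OF has_derivative_linear[OF M']] by simp
    then show ?thesis using 1 vector_derivative_unique_at by blast
  qed
  have inj: "inj M'" unfolding linear_injective_0[OF has_derivative_linear[OF M']]
  proof (intro allI impI)
    fix v assume "M' v = 0"
    then have z: "br (pr {0<..} v) \<Lambda> + br (pr {..<0} v) \<Lambda> + pr {0} v = 0" using M'v aut_eq0[OF ga] by simp
    have 1: "br (pr {0<..} v) \<Lambda> \<in> G {0<..}" by (rule br_G[OF pr_mem \<Lambda>h]) auto
    have 2: "br (pr {..<0} v) \<Lambda> \<in> G {..<0}" by (rule br_G[OF pr_mem \<Lambda>h]) auto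
    have "br \<Lambda> (pr {0<..} v) = 0" using triple_zero(1)[OF 1 2 pr_mem z] br_anti[of \<Lambda> "pr {0<..} v"] by simp
    then have 3: "pr {0<..} v = 0" by (rule regular_inj[OF \<Lambda> _ pr_mem]) auto
    have "br \<Lambda> (pr {..<0} v) = 0" using triple_zero(2)[OF 1 2 pr_mem z] br_anti[of \<Lambda> "pr {..<0} v"] by simp
    then have 4: "pr {..<0} v = 0" by (rule regular_inj[OF \<Lambda> _ pr_mem]) auto
    show "v = 0" using triple_split[of v] 3 4 triple_zero(3)[OF 1 2 pr_mem z] by simp
  qed
  obtain U' V F where F: "open U'" "U' \<subseteq> UNIV" "0 \<in> U'" "open V" "M 0 \<in> V" "F ` V \<subseteq> U'" "\<And>y. y \<in> V \<Longrightarrow> M (F y) = y"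
    "\<And>k. Ck k V F" "F (M 0) = 0"
    by (rule smooth_inverse_function[OF open_UNIV UNIV_I MC M' inj]) blast
  have "finite {K \<in> hcartan J a. spec K \<subseteq> spec \<Lambda>}"
    by (rule finite_h_spec[OF finite_spec_h]) (use \<Lambda>h G_h in auto)
  \<comment> \<open>The radius e separates \<Lambda> from the other elements of h whose eigenvalues
    all occur for \<Lambda>.\<close>
  from finite_set_avoid[OF this, of \<Lambda>] obtain e where e: "e > 0"
    "\<And>K. K \<in> hcartan J a \<Longrightarrow> spec K \<subseteq> spec \<Lambda> \<Longrightarrow> K \<noteq> \<Lambda> \<Longrightarrow> e \<le> dist \<Lambda> K" by blast
  define W where "W = V \<inter> (\<lambda>y. pr {0} (F y)) -` ball 0 e"
  have cont: "continuous_on V (\<lambda>y. pr {0} (F y))"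
    using Ck_imp_continuous_on[OF Ck_linear_comp[OF pr_linear F(8)[of 0]]] .
  define s where "s y = S (F y)" for y
  show ?thesis
  proof (rule that[of W s])
    show oW: "open W" unfolding W_def by (rule continuous_open_preimage[OF cont F(4) open_ball])
    show "g0 \<Lambda> \<in> W" unfolding W_def using F(5,9) e(1) M0 by (simp add: pr_simps)
    show "s (g0 \<Lambda>) = g0" unfolding s_def using F(9) M0 S0 by simp
    have FW: "Ck k W F" for k by (rule Ck_subset[OF F(8)]) (auto simp: W_def)
    have Fc: "Ck k W (\<lambda>y. pr T (F y))" for k T by (rule Ck_linear_comp[OF pr_linear FW])
    show "Cf k W s" for k unfolding s_def S_def
      by (intro Cf_comp Cf_const Cf_expop_n Cf_expop_l ga Fc pr_mem oW)
    show "s y \<in> inn" if "y \<in> W" for y unfolding s_def S_def by (intro inn_comp g0 inn_expop)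
    then have sa: "aut (s y)" if "y \<in> W" for y using that inn_aut by blast
    show "\<exists>x w. x \<in> G {0<..} \<and> w \<in> G {..<0} \<and> s y = g0 \<circ> expop (br x) \<circ> expop (br w)" for y
      unfolding s_def S_def using pr_mem by blast
    fix y g assume y: "y \<in> W" "y = g \<Lambda>" "g \<in> inn"
    let ?h = "pr {0} (F y)"
    have yV: "y \<in> V" and small: "norm ?h < e" using y(1) unfolding W_def by auto
    have ys: "y = s y (\<Lambda> + ?h)" using F(7)[OF yV] unfolding M_def s_def by simp
    have "spec y = spec \<Lambda>" using spec_aut[OF inn_aut[OF y(3)]] y(2) by simp
    moreover have "spec (s y (\<Lambda> + ?h)) = spec (\<Lambda> + ?h)" by (rule spec_aut[OF sa[OF y(1)]])
    ultimately have sp: "spec (\<Lambda> + ?h) \<subseteq> spec \<Lambda>" using ys by simp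
    have hh: "\<Lambda> + ?h \<in> hcartan J a" using G_add[OF \<Lambda>h pr_mem] G_h by blast
    have "\<Lambda> + ?h = \<Lambda>"
    proof (rule ccontr)
      assume "\<Lambda> + ?h \<noteq> \<Lambda>"
      from e(2)[OF hh sp this] show False using small by (simp add: dist_norm)
    qed
    then show "s y \<Lambda> = y" using ys by simp
  qed
qed

text \<open>The two factorizations differ by an inner z fixing \<Lambda>, hence fixing h. Inverting
  n l = n' l' z and moving z past l by conjugation produces two Gauss decompositions of one
  map.\<close>

lemma NN_LL_orbit_unique:
  assumes \<Lambda>: "regular \<Lambda>" and n: "n \<in> NN" "n \<in> inn" "n' \<in> NN" "n' \<in> inn"
    and l: "l \<in> LL" "l \<in> inn" "l' \<in> LL" "l' \<in> inn" and eq: "n (l \<Lambda>) = n' (l' \<Lambda>)"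
  shows "n = n'" "l = l'"
proof -
  note a = NN_aut[OF n(1)] NN_aut[OF n(3)] LL_aut[OF l(1)] LL_aut[OF l(3)]
  define z where "z = inv l' \<circ> inv n' \<circ> n \<circ> l"
  have zi: "z \<in> inn" unfolding z_def by (intro inn_comp inn_inv n l)
  have "z \<Lambda> = \<Lambda>" unfolding z_def using eq by (simp add: aut_inv_apply[OF a(2)] aut_inv_apply[OF a(4)])
  then have "z H = H" if "H \<in> G {0}" for H
    using stabilizer_fixes_cartan[of \<Lambda> z H] \<Lambda> zi that unfolding regular_def G_h by blast
  then have zZ: "z \<in> ZZ" unfolding ZZ_def using inn_aut[OF zi] by blast
  note za = inn_aut[OF zi]
  have 1: "n (l x) = n' (l' (z x))" for x
    unfolding z_def by (simp add: aut_inv_apply[OF a(2)] aut_inv_apply[OF a(4)])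
  have c: "z \<circ> inv l \<circ> inv z \<in> LL"
    unfolding LL_def
  proof (intro CollectI conjI allI ballI)
    show "aut (z \<circ> inv l \<circ> inv z)" by (intro aut_comp aut_inv za a)
    fix c x assume x: "x \<in> G {..c}"
    have "inv z x \<in> G {..c}" by (rule ZZ_G[OF ZZ_inv[OF zZ] x])
    then have "z (inv l (inv z x) - inv z x) \<in> G {..<c}" by (intro ZZ_G[OF zZ] LL_diff[OF LL_inv[OF l(1)]])
    then show "(z \<circ> inv l \<circ> inv z) x - x \<in> G {..<c}" by (simp add: linear_diff[OF aut_linear[OF za]] aut_inv_apply[OF za])
  qed
  have "(z \<circ> inv l \<circ> inv z) \<circ> z \<circ> inv n = inv l' \<circ> id \<circ> inv n'"
  proof
    fix x
    have "n' (l' (z (inv l (inv n x)))) = x" using 1[of "inv l (inv n x)"] by (simp add: aut_inv_apply[OF a(1)] aut_inv_apply[OF a(3)])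
    then have "z (inv l (inv n x)) = inv l' (inv n' x)" by (metis aut_inv_apply(1)[OF a(2)] aut_inv_apply(1)[OF a(4)])
    then show "((z \<circ> inv l \<circ> inv z) \<circ> z \<circ> inv n) x = (inv l' \<circ> id \<circ> inv n') x" by (simp add: aut_inv_apply[OF za])
  qed
  moreover have "id \<in> ZZ" unfolding ZZ_def using aut_id by simp
  ultimately have nin: "inv n = inv n'" and zid: "z = id"
    using gauss_unique[OF c zZ NN_inv[OF n(1)] LL_inv[OF l(3)] _ NN_inv[OF n(3)]] by auto
  have "inv (inv n) = inv (inv n')" using nin by (rule arg_cong)
  then show nn: "n = n'" unfolding aut_inv_inv[OF a(1)] aut_inv_inv[OF a(2)] .
  show "l = l'"
  proof
    fix x
    have "n' (l x) = n' (l' x)" using 1[of x] unfolding zid nn by simp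
    then have "inv n' (n' (l x)) = inv n' (n' (l' x))" by (rule arg_cong)
    then show "l x = l' x" unfolding aut_inv_apply(1)[OF a(2)] .
  qed
qed

lemma ZZ_conj_NN: assumes "z \<in> ZZ" "n \<in> NN" shows "z \<circ> n \<circ> inv z \<in> NN"
  unfolding NN_def
proof (intro CollectI conjI allI ballI)
  note za = ZZ_aut[OF assms(1)]
  show "aut (z \<circ> n \<circ> inv z)" by (intro aut_comp aut_inv za NN_aut assms)
  fix c x assume x: "x \<in> G {c..}"
  have "inv z x \<in> G {c..}" by (rule ZZ_G[OF ZZ_inv[OF assms(1)] x])
  then have "z (n (inv z x) - inv z x) \<in> G {c<..}" by (intro ZZ_G[OF assms(1)] NN_diff[OF assms(2)])
  then show "(z \<circ> n \<circ> inv z) x - x \<in> G {c<..}" by (simp add: linear_diff[OF aut_linear[OF za]] aut_inv_apply[OF za])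
qed

lemma ZZ_conj_LL: assumes "z \<in> ZZ" "l \<in> LL" shows "z \<circ> l \<circ> inv z \<in> LL"
  unfolding LL_def
proof (intro CollectI conjI allI ballI)
  note za = ZZ_aut[OF assms(1)]
  show "aut (z \<circ> l \<circ> inv z)" by (intro aut_comp aut_inv za LL_aut assms)
  fix c x assume x: "x \<in> G {..c}"
  have "inv z x \<in> G {..c}" by (rule ZZ_G[OF ZZ_inv[OF assms(1)] x])
  then have "z (l (inv z x) - inv z x) \<in> G {..<c}" by (intro ZZ_G[OF assms(1)] LL_diff[OF assms(2)])
  then show "(z \<circ> l \<circ> inv z) x - x \<in> G {..<c}" by (simp add: linear_diff[OF aut_linear[OF za]] aut_inv_apply[OF za])
qed

definition UU :: "'g \<Rightarrow> 'g set" where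
  "UU \<Lambda> = {n (l \<Lambda>) |n l. n \<in> NN \<and> n \<in> inn \<and> l \<in> LL \<and> l \<in> inn}"

text \<open>Since e^A fixes \<Lambda>, both entries have the form v \<Lambda> - \<Lambda>, with v
  the conjugate by e^A of the unipotent Iwasawa factor and of l respectively. \<theta> moves the
  first from positive to negative degrees.\<close>

definition phi0 :: "'g \<Rightarrow> ('g \<Rightarrow> 'g) \<Rightarrow> ('g \<Rightarrow> 'g) \<Rightarrow> 'g \<times> 'g" where
  "phi0 \<Lambda> n l = (\<theta> (iA (n \<circ> l) (iN (n \<circ> l) \<Lambda> - \<Lambda>)), iA (n \<circ> l) (l \<Lambda> - \<Lambda>))"

definition phi :: "'g \<Rightarrow> 'g \<Rightarrow> 'g \<times> 'g" where
  "phi \<Lambda> X = (SOME p. \<exists>n l. n \<in> NN \<and> n \<in> inn \<and> l \<in> LL \<and> l \<in> inn \<and> X = n (l \<Lambda>) \<and> p = phi0 \<Lambda> n l)"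

text \<open>The AN-factor of n l^-1 applied to l \<Lambda>: a formula for the inverse chart.\<close>

definition psi0 :: "'g \<Rightarrow> ('g \<Rightarrow> 'g) \<Rightarrow> ('g \<Rightarrow> 'g) \<Rightarrow> 'g" where
  "psi0 \<Lambda> n l = iA (n \<circ> inv l) (iN (n \<circ> inv l) (l \<Lambda>))"

lemma phi_eq:
  assumes \<Lambda>: "regular \<Lambda>" and n: "n \<in> NN" "n \<in> inn" and l: "l \<in> LL" "l \<in> inn"
  shows "phi \<Lambda> (n (l \<Lambda>)) = phi0 \<Lambda> n l"
  unfolding phi_def
proof (rule some_equality)
  show "\<exists>n' l'. n' \<in> NN \<and> n' \<in> inn \<and> l' \<in> LL \<and> l' \<in> inn \<and> n (l \<Lambda>) = n' (l' \<Lambda>) \<and> phi0 \<Lambda> n l = phi0 \<Lambda> n' l'"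
    using n l by blast
  fix p assume "\<exists>n' l'. n' \<in> NN \<and> n' \<in> inn \<and> l' \<in> LL \<and> l' \<in> inn \<and> n (l \<Lambda>) = n' (l' \<Lambda>) \<and> p = phi0 \<Lambda> n' l'"
  then obtain n' l' where *: "n' \<in> NN" "n' \<in> inn" "l' \<in> LL" "l' \<in> inn" "n (l \<Lambda>) = n' (l' \<Lambda>)" "p = phi0 \<Lambda> n' l'" by blast
  from NN_LL_orbit_unique[OF \<Lambda> n *(1,2) l *(3,4,5)] show "p = phi0 \<Lambda> n l" using *(6) by simp
qed

text \<open>Writing \<open>n2 \<circ> l2 = k \<circ> e\<^sup>A \<circ> u\<close>, the point \<open>n2 (l2 \<Lambda>)\<close> has coordinates given by the conjugates
  \<open>n = e\<^sup>A u e\<^sup>-\<^sup>A\<close> and \<open>l = e\<^sup>A l2 e\<^sup>-\<^sup>A\<close>, and conversely \<open>n \<circ> l\<^sup>-\<^sup>1 = k\<^sup>-\<^sup>1 \<circ> e\<^sup>-\<^sup>A \<circ> (e\<^sup>A n2 e\<^sup>-\<^sup>A)\<close>.\<close>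

lemma chart_correspondence:
  assumes \<Lambda>: "\<Lambda> \<in> G {0}" and n2: "n2 \<in> NN" "n2 \<in> inn" and l2: "l2 \<in> LL" "l2 \<in> inn"
    and k: "k \<in> KK" and A: "A \<in> a" and u: "u \<in> NN" and eq: "n2 \<circ> l2 = k \<circ> expop (br A) \<circ> u"
  defines "n \<equiv> expop (br A) \<circ> u \<circ> expop (br (- A))" and "l \<equiv> expop (br A) \<circ> l2 \<circ> expop (br (- A))"
  shows "n \<in> NN" "l \<in> LL" "l \<in> inn" "phi0 \<Lambda> n2 l2 = (\<theta> (n \<Lambda> - \<Lambda>), l \<Lambda> - \<Lambda>)"
    "n \<circ> inv l = inv k \<circ> expop (br (- A)) \<circ> (expop (br A) \<circ> n2 \<circ> expop (br (- A)))"
    "psi0 \<Lambda> n l = n2 (l2 \<Lambda>)" "k (n \<Lambda>) = n2 (l2 \<Lambda>)"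
proof -
  have mA: "- A \<in> a" using A a_subspace subspace_neg by blast
  note eZ = ea_ZZ[OF A]
  note ua = NN_aut[OF u] and n2a = NN_aut[OF n2(1)] and l2a = LL_aut[OF l2(1)] and ka = KK_aut[OF k]
  have fixL: "expop (br (- A)) \<Lambda> = \<Lambda>" "expop (br A) \<Lambda> = \<Lambda>" using ZZ_h[OF ea_ZZ[OF mA] \<Lambda>] ZZ_h[OF eZ \<Lambda>] by auto
  have linA: "linear (expop (br A))" by (rule linear_expop[OF br_linear])
  show nN: "n \<in> NN" unfolding n_def using ZZ_conj_NN[OF eZ u] unfolding inv_expop_br .
  show lL: "l \<in> LL" unfolding l_def using ZZ_conj_LL[OF eZ l2(1)] unfolding inv_expop_br .
  show "l \<in> inn" unfolding l_def by (intro inn_comp l2 inn_expop)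
  have iA0: "iA (n2 \<circ> l2) = expop (br A)" unfolding eq by (rule iA_eq[OF k A u])
  have iN0: "iN (n2 \<circ> l2) = u" unfolding eq by (rule iN_eq[OF k A u])
  show "phi0 \<Lambda> n2 l2 = (\<theta> (n \<Lambda> - \<Lambda>), l \<Lambda> - \<Lambda>)"
    unfolding phi0_def iA0 iN0 n_def l_def by (simp add: fixL linear_diff[OF linA])
  have eqx: "n2 (l2 x) = k (expop (br A) (u x))" for x using fun_cong[OF eq, of x] by simp
  have il: "inv l = expop (br A) \<circ> inv l2 \<circ> expop (br (- A))"
    by (rule inv_unique_comp) (auto simp: l_def fun_eq_iff expop_br_uminus aut_inv_apply[OF l2a])
  show g1: "n \<circ> inv l = inv k \<circ> expop (br (- A)) \<circ> (expop (br A) \<circ> n2 \<circ> expop (br (- A)))"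
  proof
    fix x
    have "k (expop (br A) (u (inv l2 (expop (br (- A)) x)))) = n2 (expop (br (- A)) x)"
      using eqx[of "inv l2 (expop (br (- A)) x)"] by (simp add: aut_inv_apply[OF l2a])
    then have "expop (br A) (u (inv l2 (expop (br (- A)) x))) = inv k (n2 (expop (br (- A)) x))"
      using aut_inv_apply(1)[OF ka] by metis
    then show "(n \<circ> inv l) x = (inv k \<circ> expop (br (- A)) \<circ> (expop (br A) \<circ> n2 \<circ> expop (br (- A)))) x"
      unfolding il n_def by (simp add: expop_br_uminus)
  qed
  have N': "expop (br A) \<circ> n2 \<circ> expop (br (- A)) \<in> NN" using ZZ_conj_NN[OF eZ n2(1)] unfolding inv_expop_br .
  have iA1: "iA (n \<circ> inv l) = expop (br (- A))" unfolding g1 by (rule iA_eq[OF KK_inv[OF k] mA N'])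
  have iN1: "iN (n \<circ> inv l) = expop (br A) \<circ> n2 \<circ> expop (br (- A))" unfolding g1 by (rule iN_eq[OF KK_inv[OF k] mA N'])
  show "psi0 \<Lambda> n l = n2 (l2 \<Lambda>)" unfolding psi0_def iA1 iN1 by (simp add: l_def expop_br_uminus fixL)
  show "k (n \<Lambda>) = n2 (l2 \<Lambda>)" unfolding eqx n_def by (simp add: fixL)
qed

lemma NN_h_diff: "n \<in> NN \<Longrightarrow> H \<in> G {0} \<Longrightarrow> n H - H \<in> G {0<..}"
  by (rule NN_diff[OF _ G_mono]) auto

lemma LL_h_diff: "l \<in> LL \<Longrightarrow> H \<in> G {0} \<Longrightarrow> l H - H \<in> G {..<0}"
  by (rule LL_diff[OF _ G_mono]) auto

lemma UU_coordinates:
  assumes \<Lambda>: "regular \<Lambda>" and X: "X \<in> UU \<Lambda>"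
  obtains n l where "n \<in> NN" "l \<in> LL" "n \<in> inn" "l \<in> inn" "phi \<Lambda> X = (\<theta> (n \<Lambda> - \<Lambda>), l \<Lambda> - \<Lambda>)" "psi0 \<Lambda> n l = X"
proof -
  obtain n2 l2 where X2: "n2 \<in> NN" "n2 \<in> inn" "l2 \<in> LL" "l2 \<in> inn" "X = n2 (l2 \<Lambda>)" using X unfolding UU_def by blast
  obtain k A u where *: "k \<in> KK" "A \<in> a" "u \<in> NN" "u \<in> inn" "k \<in> inn" "n2 \<circ> l2 = k \<circ> expop (br A) \<circ> u"
    using iwasawa_exists[OF inn_comp[OF X2(2,4)]] .
  note c = chart_correspondence[OF regular_h[OF \<Lambda>] X2(1-4) *(1-3,6)]
  have ni: "expop (br A) \<circ> u \<circ> expop (br (- A)) \<in> inn" by (intro inn_comp inn_expop *)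
  show ?thesis using that[OF c(1,2) ni c(3) _ c(6)[folded X2(5)]] phi_eq[OF \<Lambda> X2(1-4)] c(4) X2(5) by simp
qed

text \<open>Here n l^-1 = k e^B u is decomposed first, and conjugating u and l by e^B gives the
  factors of the orbit point. \<open>chart_correspondence\<close> then applies with A = -B and
  k^-1.\<close>

lemma psi0_UU:
  assumes \<Lambda>: "regular \<Lambda>" and n: "n \<in> NN" "n \<in> inn" and l: "l \<in> LL" "l \<in> inn"
  shows "psi0 \<Lambda> n l \<in> UU \<Lambda>" "phi \<Lambda> (psi0 \<Lambda> n l) = (\<theta> (n \<Lambda> - \<Lambda>), l \<Lambda> - \<Lambda>)"
proof -
  obtain k B u where *: "k \<in> KK" "B \<in> a" "u \<in> NN" "u \<in> inn" "k \<in> inn" "n \<circ> inv l = k \<circ> expop (br B) \<circ> u"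
    using iwasawa_exists[OF inn_comp[OF n(2) inn_inv[OF l(2)]]] .
  define A where "A = - B"
  have A: "A \<in> a" "B = - A" unfolding A_def using *(2) a_subspace subspace_neg by auto
  note na = NN_aut[OF n(1)] and la = LL_aut[OF l(1)] and ka = KK_aut[OF *(1)]
  note Bz = ea_ZZ[OF *(2)]
  define n2 where "n2 = expop (br B) \<circ> u \<circ> expop (br A)"
  define l2 where "l2 = expop (br B) \<circ> l \<circ> expop (br A)"
  define v where "v = expop (br B) \<circ> n \<circ> expop (br A)"
  have n2: "n2 \<in> NN" "n2 \<in> inn"
    unfolding n2_def using ZZ_conj_NN[OF Bz *(3)] by (auto simp: inv_expop_br A_def intro: inn_comp inn_expop *)
  have l2: "l2 \<in> LL" "l2 \<in> inn"
    unfolding l2_def using ZZ_conj_LL[OF Bz l(1)] by (auto simp: inv_expop_br A_def intro: inn_comp inn_expop l)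
  have v: "v \<in> NN" unfolding v_def using ZZ_conj_NN[OF Bz n(1)] by (simp add: inv_expop_br A_def)
  have AB: "expop (br A) (expop (br B) x) = x" "expop (br B) (expop (br A) x) = x" for x
    unfolding A_def by (simp_all add: expop_br_uminus)
  have eqx: "n (inv l x) = k (expop (br B) (u x))" for x using fun_cong[OF *(6), of x] by simp
  have "n2 \<circ> l2 = inv k \<circ> expop (br A) \<circ> v"
  proof
    fix x
    have "inv k (n (inv l (l (expop (br A) x)))) = expop (br B) (u (l (expop (br A) x)))"
      unfolding eqx by (simp add: aut_inv_apply[OF ka])
    then show "(n2 \<circ> l2) x = (inv k \<circ> expop (br A) \<circ> v) x"
      unfolding n2_def l2_def v_def by (simp add: AB aut_inv_apply[OF la])
  qed
  note c = chart_correspondence[OF regular_h[OF \<Lambda>] n2 l2 KK_inv[OF *(1)] A(1) v this]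
  have nn: "expop (br A) \<circ> v \<circ> expop (br (- A)) = n" unfolding v_def A(2)[symmetric] by (auto simp: AB)
  have ll: "expop (br A) \<circ> l2 \<circ> expop (br (- A)) = l" unfolding l2_def A(2)[symmetric] by (auto simp: AB)
  have eq: "psi0 \<Lambda> n l = n2 (l2 \<Lambda>)" using c(6) unfolding nn ll .
  then show "psi0 \<Lambda> n l \<in> UU \<Lambda>" unfolding UU_def using n2 l2 by blast
  show "phi \<Lambda> (psi0 \<Lambda> n l) = (\<theta> (n \<Lambda> - \<Lambda>), l \<Lambda> - \<Lambda>)"
    unfolding eq phi_eq[OF \<Lambda> n2 l2] using c(4) unfolding nn ll .
qed

lemma phi_bij: assumes \<Lambda>: "regular \<Lambda>" shows "inj_on (phi \<Lambda>) (UU \<Lambda>)" "phi \<Lambda> ` UU \<Lambda> = G {..<0} \<times> G {..<0}"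
proof -
  note h = regular_h[OF \<Lambda>]
  show "inj_on (phi \<Lambda>) (UU \<Lambda>)"
  proof (rule inj_onI)
    fix X X' assume X: "X \<in> UU \<Lambda>" "X' \<in> UU \<Lambda>" "phi \<Lambda> X = phi \<Lambda> X'"
    obtain n l where 1: "n \<in> NN" "l \<in> LL" "n \<in> inn" "l \<in> inn" "phi \<Lambda> X = (\<theta> (n \<Lambda> - \<Lambda>), l \<Lambda> - \<Lambda>)" "psi0 \<Lambda> n l = X"
      using UU_coordinates[OF \<Lambda> X(1)] .
    obtain n' l' where 2: "n' \<in> NN" "l' \<in> LL" "n' \<in> inn" "l' \<in> inn" "phi \<Lambda> X' = (\<theta> (n' \<Lambda> - \<Lambda>), l' \<Lambda> - \<Lambda>)" "psi0 \<Lambda> n' l' = X'"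
      using UU_coordinates[OF \<Lambda> X(2)] .
    have "\<theta> (n \<Lambda> - \<Lambda>) = \<theta> (n' \<Lambda> - \<Lambda>)" and ll: "l \<Lambda> = l' \<Lambda>" using X(3) 1(5) 2(5) by auto
    then have "\<theta> (\<theta> (n \<Lambda> - \<Lambda>)) = \<theta> (\<theta> (n' \<Lambda> - \<Lambda>))" by simp
    then have nn: "n \<Lambda> = n' \<Lambda>" by (simp add: \<theta>\<theta>)
    have "inv n' \<circ> n = id"
      by (rule NN_free[OF \<Lambda> NN_comp[OF NN_inv[OF 2(1)] 1(1)]]) (simp add: nn aut_inv_apply[OF NN_aut[OF 2(1)]])
    then have "n' (inv n' (n x)) = n' x" for x by (simp add: fun_eq_iff)
    then have "n = n'" by (simp add: fun_eq_iff aut_inv_apply[OF NN_aut[OF 2(1)]])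
    moreover have "inv l' \<circ> l = id"
      by (rule LL_free[OF \<Lambda> LL_comp[OF LL_inv[OF 2(2)] 1(2)]]) (simp add: ll aut_inv_apply[OF LL_aut[OF 2(2)]])
    then have "l' (inv l' (l x)) = l' x" for x by (simp add: fun_eq_iff)
    then have "l = l'" by (simp add: fun_eq_iff aut_inv_apply[OF LL_aut[OF 2(2)]])
    ultimately show "X = X'" using 1(6) 2(6) by simp
  qed
  show "phi \<Lambda> ` UU \<Lambda> = G {..<0} \<times> G {..<0}"
  proof safe
    fix X Y Z assume X: "X \<in> UU \<Lambda>" "(Y, Z) = phi \<Lambda> X"
    obtain n l where 1: "n \<in> NN" "l \<in> LL" "n \<in> inn" "l \<in> inn" "phi \<Lambda> X = (\<theta> (n \<Lambda> - \<Lambda>), l \<Lambda> - \<Lambda>)" "psi0 \<Lambda> n l = X"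
      using UU_coordinates[OF \<Lambda> X(1)] .
    show "Y \<in> G {..<0}" using X(2) 1(5) \<theta>_G[OF NN_h_diff[OF 1(1) h], of "{..<0}"] by simp
    show "Z \<in> G {..<0}" using X(2) 1(5) LL_h_diff[OF 1(2) h] by simp
  next
    fix Y Z assume YZ: "Y \<in> G {..<0}" "Z \<in> G {..<0}"
    have "\<theta> Y \<in> G {0<..}" by (rule \<theta>_G[OF YZ(1)]) auto
    from NN_transitive[OF \<Lambda> this] obtain n where n: "n \<in> NN" "n \<in> inn" "n \<Lambda> = \<Lambda> + \<theta> Y" .
    from LL_transitive[OF \<Lambda> YZ(2)] obtain l where l: "l \<in> LL" "l \<in> inn" "l \<Lambda> = \<Lambda> + Z" .
    have "phi \<Lambda> (psi0 \<Lambda> n l) = (Y, Z)" using psi0_UU(2)[OF \<Lambda> n(1,2) l(1,2)] n(3) l(3) by (simp add: \<theta>\<theta>)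
    then show "(Y, Z) \<in> phi \<Lambda> ` UU \<Lambda>" using psi0_UU(1)[OF \<Lambda> n(1,2) l(1,2)] by force
  qed
qed

lemma phi_inverse:
  assumes \<Lambda>: "regular \<Lambda>" and n: "n \<in> NN" "n \<in> inn" and l: "l \<in> LL" "l \<in> inn"
  shows "the_inv_into (UU \<Lambda>) (phi \<Lambda>) (\<theta> (n \<Lambda> - \<Lambda>), l \<Lambda> - \<Lambda>) = psi0 \<Lambda> n l"
  using the_inv_into_f_f[OF phi_bij(1)[OF \<Lambda>] psi0_UU(1)[OF \<Lambda> n l]] unfolding psi0_UU(2)[OF \<Lambda> n l] .

lemma Cf_subset: "Cf k W g \<Longrightarrow> V \<subseteq> W \<Longrightarrow> Cf k V g"
  unfolding Cf_def using Ck_subset by blast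

lemma good_open: assumes W: "open W" "Cf 0 W s" shows "open {y\<in>W. good (s y)}"
proof (subst open_subopen, clarify)
  fix y0 assume y0: "y0 \<in> W" "good (s y0)"
  \<comment> \<open>\<open>good_eventually\<close> wants linear maps for every index, so s is
    continued by \<open>id\<close> outside W.\<close>
  define h where "h y = (if y \<in> W then s y else id)" for y
  have ev: "\<forall>\<^sub>F y in nhds y0. y \<in> W" using W(1) y0(1) by (rule eventually_nhds_in_open)
  have "\<forall>\<^sub>F y in nhds y0. good (h y)"
  proof (rule good_eventually[of h "s y0"])
    show "linear (h y)" for y unfolding h_def using Cf_aut[OF W(2)] aut_linear linear_id by auto
    show "linear (s y0)" using Cf_aut[OF W(2) y0(1)] aut_linear by blast
    fix v
    have "isCont (\<lambda>y. s y v) y0" using Ck_imp_continuous_on[OF Cf_Ck[OF W(2)]] W(1) y0(1) by (simp add: continuous_on_eq_continuous_at)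
    then have "((\<lambda>y. s y v) \<longlongrightarrow> s y0 v) (nhds y0)" 
      using tendsto_at_iff_tendsto_nhds[of "\<lambda>y. s y v" y0] by (simp add: isCont_def)
    moreover have "\<forall>\<^sub>F y in nhds y0. h y v = s y v" using ev by eventually_elim (simp add: h_def)
    ultimately show "((\<lambda>y. h y v) \<longlongrightarrow> s y0 v) (nhds y0)" by (simp add: tendsto_cong)
  qed (rule y0(2))
  then have "\<forall>\<^sub>F y in nhds y0. y \<in> {y\<in>W. good (s y)}" using ev by eventually_elim (simp add: h_def)
  then show "\<exists>T. open T \<and> y0 \<in> T \<and> T \<subseteq> {y\<in>W. good (s y)}" unfolding eventually_nhds by blast
qed

text \<open>From g^-1 = l0 z0 n0 one gets g \<Lambda> = n0^-1 (z0^-1 l0^-1 z0) \<Lambda>, as z0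
  fixes \<Lambda>. Writing the factors through \<open>gL\<close>, \<open>gZ\<close> and
  \<open>gN\<close> makes them depend smoothly on g.\<close>

lemma good_inv_factor:
  assumes g: "g \<in> inn" "good (inv g)" and \<Lambda>: "\<Lambda> \<in> G {0}"
  defines "z \<equiv> gZ (inv g)" and "l \<equiv> inv (gZ (inv g)) \<circ> inv (gL (inv g)) \<circ> gZ (inv g)" and "n \<equiv> inv (gN (inv g))"
  shows "n \<in> NN" "n \<in> inn" "l \<in> LL" "l \<in> inn" "g \<Lambda> = n (l \<Lambda>)"
    "\<exists>l z n. l \<in> LL \<and> z \<in> ZZ \<and> n \<in> NN \<and> inv g = l \<circ> z \<circ> n"
proof -
  note gi = inn_inv[OF g(1)] and ga = inn_aut[OF g(1)]
  obtain l0 z0 n0 where *: "l0 \<in> LL" "l0 \<in> inn" "z0 \<in> ZZ" "n0 \<in> NN" "n0 \<in> inn" "inv g = l0 \<circ> z0 \<circ> n0"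
    using gauss_decomposition[OF inn_aut[OF gi] g(2) inn_sigid[OF gi g(2)]] .
  note a = LL_aut[OF *(1)] ZZ_aut[OF *(3)] NN_aut[OF *(4)]
  show "\<exists>l z n. l \<in> LL \<and> z \<in> ZZ \<and> n \<in> NN \<and> inv g = l \<circ> z \<circ> n" using * by blast
  have zd: "z = z0" unfolding z_def *(6) by (rule gZ_eq[OF *(1,3,4)])
  have nd: "n = inv n0" unfolding n_def *(6) using gN_eq[OF *(1,3,4)] by simp
  have ld: "l = inv z0 \<circ> inv l0 \<circ> z0" unfolding l_def *(6) gZ_eq[OF *(1,3,4)] gL_eq[OF *(1,3,4)] ..
  have "z0 = inv l0 \<circ> inv g \<circ> inv n0" unfolding *(6) by (auto simp: fun_eq_iff aut_inv_apply[OF a(1)] aut_inv_apply[OF a(3)])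
  then have zi: "z0 \<in> inn" using inn_comp[OF inn_comp[OF inn_inv[OF *(2)] gi] inn_inv[OF *(5)]] by simp
  show "n \<in> NN" "n \<in> inn" unfolding nd using NN_inv[OF *(4)] inn_inv[OF *(5)] by auto
  show "l \<in> LL" unfolding ld using ZZ_conj_LL[OF ZZ_inv[OF *(3)] LL_inv[OF *(1)]] unfolding aut_inv_inv[OF a(2)] .
  show "l \<in> inn" unfolding ld by (intro inn_comp inn_inv zi *)
  have "inv g (n (l \<Lambda>)) = \<Lambda>"
    unfolding *(6) nd ld using ZZ_h[OF *(3) \<Lambda>] by (simp add: aut_inv_apply[OF a(1)] aut_inv_apply[OF a(2)] aut_inv_apply[OF a(3)])
  then show "g \<Lambda> = n (l \<Lambda>)" using aut_inv_apply(2)[OF ga, of "n (l \<Lambda>)"] by simp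
qed

text \<open>Factoring an orbit point and Gauss-decomposing g^-1 are the same up to inversion.
  Openness and density of the chart domain are thereby read off from \<open>good\<close>.\<close>

lemma UU_iff: assumes "\<Lambda> \<in> G {0}" shows "UU \<Lambda> = {g \<Lambda> |g. g \<in> inn \<and> good (inv g)}"
proof safe
  fix X assume "X \<in> UU \<Lambda>"
  then obtain n l where *: "n \<in> NN" "n \<in> inn" "l \<in> LL" "l \<in> inn" "X = n (l \<Lambda>)" unfolding UU_def by blast
  have "inv (n \<circ> l) = inv l \<circ> id \<circ> inv n"
    using o_inv_distrib[OF aut_bij[OF NN_aut[OF *(1)]] aut_bij[OF LL_aut[OF *(3)]]] by simp
  moreover have "id \<in> ZZ" unfolding ZZ_def using aut_id by simp
  ultimately have "good (inv (n \<circ> l))" using gauss_good[OF LL_inv[OF *(3)] _ NN_inv[OF *(1)]] by metis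
  then show "\<exists>g. X = g \<Lambda> \<and> g \<in> inn \<and> good (inv g)" using *(5) inn_comp[OF *(2,4)] by (intro exI[of _ "n \<circ> l"]) auto
next
  fix g assume g: "g \<in> inn" "good (inv g)"
  show "g \<Lambda> \<in> UU \<Lambda>" unfolding UU_def using good_inv_factor(1-5)[OF g assms] by blast
qed

lemma phi_smooth: assumes \<Lambda>: "regular \<Lambda>" shows "smooth_on_set (UU \<Lambda>) (phi \<Lambda>)"
  unfolding smooth_on_set_def
proof
  note h = regular_h[OF \<Lambda>]
  fix p assume "p \<in> UU \<Lambda>"
  then obtain g0 where g0: "g0 \<in> inn" "good (inv g0)" "p = g0 \<Lambda>" unfolding UU_iff[OF h] by blast
  obtain W s where s: "open W" "g0 \<Lambda> \<in> W" "\<And>k. Cf k W s" "\<And>y. y \<in> W \<Longrightarrow> s y \<in> inn"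
    "\<And>y g. y \<in> W \<Longrightarrow> y = g \<Lambda> \<Longrightarrow> g \<in> inn \<Longrightarrow> s y \<Lambda> = y" "s (g0 \<Lambda>) = g0"
    by (rule local_section[OF \<Lambda> g0(1)]) blast
  define V where "V = {y\<in>W. good (inv (s y))}"
  have oV: "open V" unfolding V_def by (rule good_open[OF s(1) Cf_inv[OF s(1,3)]])
  have VW: "y \<in> W" "s y \<in> inn" "good (inv (s y))" if "y \<in> V" for y using that s(4) unfolding V_def by auto
  have Cs: "Cf k V s" for k by (rule Cf_subset[OF s(3)]) (auto simp: V_def)
  have Ci: "Cf k V (\<lambda>y. inv (s y))" for k by (rule Cf_inv[OF oV Cs])
  note fac = good_inv_factor[OF VW(2,3) h]
  define nn where "nn y = inv (gN (inv (s y)))" for y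
  define ll where "ll y = inv (gZ (inv (s y))) \<circ> inv (gL (inv (s y))) \<circ> gZ (inv (s y))" for y
  have Cn: "Cf k V nn" for k unfolding nn_def by (intro Cf_inv Cf_gN oV Ci) (rule fac(6))
  have Cl: "Cf k V ll" for k unfolding ll_def by (intro Cf_comp Cf_inv Cf_gZ Cf_gL oV Ci) (rule fac(6); assumption)+
  have Cnl: "Cf k V (\<lambda>y. nn y \<circ> ll y)" for k by (rule Cf_comp[OF oV Cn Cl])
  have nli: "nn y \<circ> ll y \<in> inn" if "y \<in> V" for y unfolding nn_def ll_def using fac(2,4)[OF that that] inn_comp by blast
  have CA: "Cf k V (\<lambda>y. iA (nn y \<circ> ll y))" and CN: "Cf k V (\<lambda>y. iN (nn y \<circ> ll y))" for k
    by (rule Cf_iA[OF oV Cnl nli] Cf_iN[OF oV Cnl nli]; assumption)+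
  have "Ck k V (\<lambda>y. phi0 \<Lambda> (nn y) (ll y))" for k
    unfolding phi0_def
    by (intro Ck_Pair Ck_linear_comp[OF \<theta>_linear] Cf_apply[OF oV CA] Ck_diff Ck_const Cf_Ck[OF CN] Cf_Ck[OF Cl])
  then have sm: "smooth_open V (\<lambda>y. phi0 \<Lambda> (nn y) (ll y))" by (rule smooth_open_of_Ck[OF oV])
  have eq: "phi0 \<Lambda> (nn y) (ll y) = phi \<Lambda> y" if y: "y \<in> UU \<Lambda> \<inter> V" for y
  proof -
    have yV: "y \<in> V" using y by blast
    obtain g where "g \<in> inn" "y = g \<Lambda>" using y unfolding UU_iff[OF h] by blast
    then have "s y \<Lambda> = y" using s(5) VW(1)[OF yV] by blast
    then have "y = nn y (ll y \<Lambda>)" using fac(5)[OF yV yV] unfolding nn_def ll_def by simp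
    moreover have "phi \<Lambda> (nn y (ll y \<Lambda>)) = phi0 \<Lambda> (nn y) (ll y)"
      unfolding nn_def ll_def by (rule phi_eq[OF \<Lambda> fac(1-4)[OF yV yV]])
    ultimately show ?thesis by simp
  qed
  have "p \<in> V" unfolding V_def using s(2,6) g0 by simp
  then show "\<exists>W F. p \<in> W \<and> smooth_open W F \<and> (\<forall>y\<in>UU \<Lambda> \<inter> W. F y = phi \<Lambda> y)" using sm eq by blast
qed

text \<open>For arguments near the given one, n \<Lambda> and l \<Lambda> are orbit points near n0
  \<Lambda> and l0 \<Lambda>, where local sections exist. By their factored form and the uniqueness
  of N-L factorizations they return exactly n and l, so \<open>psi0\<close> of the sections is a
  smooth extension.\<close>

lemma psi_smooth: assumes \<Lambda>: "regular \<Lambda>"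
  shows "smooth_on_set (G {..<0} \<times> G {..<0}) (the_inv_into (UU \<Lambda>) (phi \<Lambda>))"
  unfolding smooth_on_set_def
proof
  fix q assume "q \<in> G {..<0} \<times> G {..<0}"
  then obtain Y0 Z0 where q: "q = (Y0, Z0)" "Y0 \<in> G {..<0}" "Z0 \<in> G {..<0}" by blast
  have "\<theta> Y0 \<in> G {0<..}" by (rule \<theta>_G[OF q(2)]) auto
  from NN_transitive[OF \<Lambda> this] obtain n0 where n0: "n0 \<in> NN" "n0 \<in> inn" "n0 \<Lambda> = \<Lambda> + \<theta> Y0" .
  from LL_transitive[OF \<Lambda> q(3)] obtain l0 where l0: "l0 \<in> LL" "l0 \<in> inn" "l0 \<Lambda> = \<Lambda> + Z0" .
  obtain W1 s1 where s1: "open W1" "n0 \<Lambda> \<in> W1" "\<And>k. Cf k W1 s1" "\<And>y. y \<in> W1 \<Longrightarrow> s1 y \<in> inn"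
    "\<And>y g. y \<in> W1 \<Longrightarrow> y = g \<Lambda> \<Longrightarrow> g \<in> inn \<Longrightarrow> s1 y \<Lambda> = y" "s1 (n0 \<Lambda>) = n0"
    "\<And>y. y \<in> W1 \<Longrightarrow> \<exists>x w. x \<in> G {0<..} \<and> w \<in> G {..<0} \<and> s1 y = n0 \<circ> expop (br x) \<circ> expop (br w)"
    by (rule local_section[OF \<Lambda> n0(2)]) blast
  obtain W2 s2 where s2: "open W2" "l0 \<Lambda> \<in> W2" "\<And>k. Cf k W2 s2" "\<And>y. y \<in> W2 \<Longrightarrow> s2 y \<in> inn"
    "\<And>y g. y \<in> W2 \<Longrightarrow> y = g \<Lambda> \<Longrightarrow> g \<in> inn \<Longrightarrow> s2 y \<Lambda> = y" "s2 (l0 \<Lambda>) = l0"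
    "\<And>y. y \<in> W2 \<Longrightarrow> \<exists>x w. x \<in> G {0<..} \<and> w \<in> G {..<0} \<and> s2 y = l0 \<circ> expop (br x) \<circ> expop (br w)"
    by (rule local_section[OF \<Lambda> l0(2)]) blast
  \<comment> \<open>The projections extend both arguments from the product of the negative parts to
    all pairs in g, where open domains are available.\<close>
  define f1 where "f1 p = \<Lambda> + \<theta> (pr {..<0} (fst p))" for p :: "'g \<times> 'g"
  define f2 where "f2 p = \<Lambda> + pr {..<0} (snd p)" for p :: "'g \<times> 'g"
  have C1: "Ck k UNIV f1" and C2: "Ck k UNIV f2" for k
    unfolding f1_def f2_def
    by (intro Ck_add Ck_const Ck_linear_comp[OF \<theta>_linear] Ck_linear_comp[OF pr_linear] Ck_linear
        bounded_linear.linear bounded_linear_fst bounded_linear_snd)+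
  define W where "W = f1 -` W1 \<inter> f2 -` W2"
  have oW: "open W" unfolding W_def
    using Ck_imp_continuous_on[OF C1[of 0]] Ck_imp_continuous_on[OF C2[of 0]] s1(1) s2(1)
    by (intro open_Int open_vimage) auto
  have fW: "f1 ` W \<subseteq> W1" "f2 ` W \<subseteq> W2" unfolding W_def by auto
  have CfC: "Cf k W (\<lambda>p. s (f p))" if "\<And>k. Cf k V s" "open V" "f ` W \<subseteq> V" "\<And>k. Ck k UNIV f"
    for s :: "'g \<Rightarrow> 'g \<Rightarrow> 'g" and f :: "'g \<times> 'g \<Rightarrow> 'g" and V k
    unfolding Cf_def
  proof (intro conjI ballI allI)
    show "aut (s (f y))" if "y \<in> W" for y using Cf_aut[OF \<open>\<And>k. Cf k V s\<close>] that \<open>f ` W \<subseteq> V\<close> by blast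
    show "Ck k W (\<lambda>y. s (f y) v)" for v
      by (rule Ck_compose[OF oW Ck_subset[OF that(4)] Cf_Ck[OF that(1)] that(3,2)]) auto
  qed
  have D1: "Cf k W (\<lambda>p. s1 (f1 p))" for k by (rule CfC[OF s1(3,1) fW(1) C1])
  have D2: "Cf k W (\<lambda>p. s2 (f2 p))" for k by (rule CfC[OF s2(3,1) fW(2) C2])
  define g where "g p = s1 (f1 p) \<circ> inv (s2 (f2 p))" for p
  have Cg: "Cf k W g" for k unfolding g_def by (rule Cf_comp[OF oW D1 Cf_inv[OF oW D2]])
  have gi: "g p \<in> inn" if "p \<in> W" for p
    unfolding g_def using that s1(4) s2(4) fW by (intro inn_comp inn_inv) auto
  have CA: "Cf k W (\<lambda>y. iA (g y))" for k by (rule Cf_iA[OF oW Cg gi])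
  have CN: "Cf k W (\<lambda>y. iN (g y))" for k by (rule Cf_iN[OF oW Cg gi])
  have "Ck k W (\<lambda>p. psi0 \<Lambda> (s1 (f1 p)) (s2 (f2 p)))" for k
    unfolding psi0_def g_def[symmetric] by (intro Cf_apply[OF oW CA] Cf_apply[OF oW CN] Cf_Ck[OF D2])
  then have sm: "smooth_open W (\<lambda>p. psi0 \<Lambda> (s1 (f1 p)) (s2 (f2 p)))" by (rule smooth_open_of_Ck[OF oW])
  have eq: "psi0 \<Lambda> (s1 (f1 p)) (s2 (f2 p)) = the_inv_into (UU \<Lambda>) (phi \<Lambda>) p"
    if p: "p \<in> (G {..<0} \<times> G {..<0}) \<inter> W" for p
  proof -
    obtain Y Z where YZ: "p = (Y, Z)" "Y \<in> G {..<0}" "Z \<in> G {..<0}" using p by blast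
    have f: "f1 p = \<Lambda> + \<theta> Y" "f2 p = \<Lambda> + Z" unfolding f1_def f2_def YZ(1) using pr_id YZ by auto
    have pW: "f1 p \<in> W1" "f2 p \<in> W2" using p fW by auto
    have "\<theta> Y \<in> G {0<..}" by (rule \<theta>_G[OF YZ(2)]) auto
    from NN_transitive[OF \<Lambda> this] obtain n where n: "n \<in> NN" "n \<in> inn" "n \<Lambda> = \<Lambda> + \<theta> Y" .
    from LL_transitive[OF \<Lambda> YZ(3)] obtain l where l: "l \<in> LL" "l \<in> inn" "l \<Lambda> = \<Lambda> + Z" .
    have id: "id \<in> NN" "id \<in> inn" "id \<in> LL" using NN_id inn_id aut_id G_0 unfolding LL_def by auto
    have e1: "s1 (f1 p) = n"
    proof -
      obtain x w where xw: "x \<in> G {0<..}" "w \<in> G {..<0}" "s1 (f1 p) = n0 \<circ> expop (br x) \<circ> expop (br w)" using s1(7)[OF pW(1)] by blast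
      have "s1 (f1 p) \<Lambda> = n (id \<Lambda>)" using s1(5)[OF pW(1) _ n(2)] n(3) f by simp
      then have "(n0 \<circ> expop (br x)) (expop (br w) \<Lambda>) = n (id \<Lambda>)" using xw(3) by simp
      from NN_LL_orbit_unique[OF \<Lambda> NN_comp[OF n0(1) NN_expop[OF xw(1)]] inn_comp[OF n0(2) inn_expop] n(1,2) LL_expop[OF xw(2)] inn_expop id(3,2) this]
      have 1: "n0 \<circ> expop (br x) = n" "expop (br w) = id" .
      show ?thesis unfolding xw(3) 1 by (rule comp_id)
    qed
    have e2: "s2 (f2 p) = l"
    proof -
      obtain x w where xw: "x \<in> G {0<..}" "w \<in> G {..<0}" "s2 (f2 p) = l0 \<circ> expop (br x) \<circ> expop (br w)" using s2(7)[OF pW(2)] by blast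
      have "s2 (f2 p) \<Lambda> = l \<Lambda>" using s2(5)[OF pW(2) _ l(2)] l(3) f by simp
      then have "l0 (expop (br x) (expop (br w) \<Lambda>)) = l \<Lambda>" using xw(3) by simp
      then have "expop (br x) (expop (br w) \<Lambda>) = id ((inv l0 \<circ> l) \<Lambda>)"
        using aut_inv_apply(1)[OF LL_aut[OF l0(1)], of "expop (br x) (expop (br w) \<Lambda>)"] by simp
      from NN_LL_orbit_unique[OF \<Lambda> NN_expop[OF xw(1)] inn_expop id(1,2) LL_expop[OF xw(2)] inn_expop LL_comp[OF LL_inv[OF l0(1)] l(1)] inn_comp[OF inn_inv[OF l0(2)] l(2)] this]
      have 1: "expop (br x) = id" "expop (br w) = inv l0 \<circ> l" .
      show ?thesis unfolding xw(3) 1 by (auto simp: fun_eq_iff aut_inv_apply[OF LL_aut[OF l0(1)]])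
    qed
    have "p = (\<theta> (n \<Lambda> - \<Lambda>), l \<Lambda> - \<Lambda>)" unfolding YZ(1) n(3) l(3) by (simp add: \<theta>\<theta>)
    then show ?thesis unfolding e1 e2 using phi_inverse[OF \<Lambda> n(1,2) l(1,2)] by simp
  qed
  have "q \<in> W" unfolding W_def f1_def f2_def q(1) using s1(2) s2(2) n0(3) l0(3) pr_id q(2,3) by simp
  then show "\<exists>W F. q \<in> W \<and> smooth_open W F \<and> (\<forall>y\<in>(G {..<0} \<times> G {..<0}) \<inter> W. F y = the_inv_into (UU \<Lambda>) (phi \<Lambda>) y)"
    using sm eq by blast
qed

lemma UU_openin: assumes \<Lambda>: "regular \<Lambda>" shows "openin (top_of_set {g \<Lambda> |g. g \<in> inn}) (UU \<Lambda>)"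
proof (subst openin_subopen, clarify)
  note h = regular_h[OF \<Lambda>]
  fix p assume "p \<in> UU \<Lambda>"
  then obtain g0 where g0: "g0 \<in> inn" "good (inv g0)" "p = g0 \<Lambda>" unfolding UU_iff[OF h] by blast
  obtain W s where s: "open W" "g0 \<Lambda> \<in> W" "\<And>k. Cf k W s" "\<And>y. y \<in> W \<Longrightarrow> s y \<in> inn"
    "\<And>y g. y \<in> W \<Longrightarrow> y = g \<Lambda> \<Longrightarrow> g \<in> inn \<Longrightarrow> s y \<Lambda> = y" "s (g0 \<Lambda>) = g0"
    by (rule local_section[OF \<Lambda> g0(1)]) blast
  define V where "V = {y\<in>W. good (inv (s y))}"
  have oV: "open V" unfolding V_def by (rule good_open[OF s(1) Cf_inv[OF s(1,3)]])
  have "{g \<Lambda> |g. g \<in> inn} \<inter> V \<subseteq> UU \<Lambda>"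
  proof
    fix y assume y: "y \<in> {g \<Lambda> |g. g \<in> inn} \<inter> V"
    then have "s y \<Lambda> = y" "s y \<in> inn" "good (inv (s y))" using s(4,5) unfolding V_def by auto
    then show "y \<in> UU \<Lambda>" unfolding UU_iff[OF h] by (intro CollectI exI[of _ "s y"]) simp
  qed
  moreover have "p \<in> {g \<Lambda> |g. g \<in> inn} \<inter> V" unfolding V_def using s(2,6) g0 by auto
  moreover have "openin (top_of_set {g \<Lambda> |g. g \<in> inn}) ({g \<Lambda> |g. g \<in> inn} \<inter> V)" using oV by (simp add: openin_open_Int)
  ultimately show "\<exists>T. openin (top_of_set {g \<Lambda> |g. g \<in> inn}) T \<and> p \<in> T \<and> T \<subseteq> UU \<Lambda>" by blast
qed

end

section \<open>The Toda field in the charts, density and covering\<close>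

context graded begin

lemma Cf_expop_line: "Cf k (UNIV::real set) (\<lambda>t. expop (br (t *\<^sub>R p)))"
  unfolding Cf_def
proof (intro conjI ballI allI aut_expop)
  have sc: "br (t *\<^sub>R p) = (\<lambda>y. t *\<^sub>R br p y)" for t by (auto simp: br_simps)
  have der: "((\<lambda>t. expop (br (t *\<^sub>R p)) v) has_derivative (\<lambda>h. h *\<^sub>R expop (br (t *\<^sub>R p)) (br p v))) (at t)" for t v
    using expop_has_vector_derivative[OF br_linear[of p]] unfolding has_vector_derivative_def sc .
  show "Ck k UNIV (\<lambda>t. expop (br (t *\<^sub>R p)) v)" for v
  proof (induction k arbitrary: v)
    case 0
    have "isCont (\<lambda>t. expop (br (t *\<^sub>R p)) v) t" for t using has_derivative_continuous[OF der] .
    then show ?case by (simp add: continuous_on_eq_continuous_at)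
  next
    case (Suc k)
    show ?case by (rule Ck_SucI[OF der]) (intro Ck_scaleR Ck_const Suc.IH)
  qed
qed

lemma family_derivative:
  assumes K: "Cf (Suc 0) (UNIV::real set) K"
  shows "\<exists>kd. linear kd \<and> (\<forall>v. ((\<lambda>t. K t v) has_vector_derivative kd v) (at 0))"
proof -
  define kd where "kd v = vector_derivative (\<lambda>t. K t v) (at 0)" for v
  have der: "((\<lambda>t. K t v) has_vector_derivative kd v) (at 0)" for v
  proof -
    obtain f' where "\<And>x. x \<in> UNIV \<Longrightarrow> ((\<lambda>t. K t v) has_derivative f' x) (at x)"
      using Cf_Ck[OF K, of v] unfolding Ck.simps by blast
    then have "(\<lambda>t. K t v) differentiable (at 0)" unfolding differentiable_def by blast
    then show ?thesis unfolding kd_def by (simp add: vector_derivative_works)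
  qed
  have lin: "linear (K t)" for t using Cf_aut[OF K] aut_linear by blast
  have "linear kd"
  proof (rule linearI)
    fix u v :: 'g and c :: real
    have "((\<lambda>t. K t (u + v)) has_vector_derivative kd u + kd v) (at 0)"
      using has_vector_derivative_add[OF der[of u] der[of v]] by (simp add: linear_add[OF lin])
    then show "kd (u + v) = kd u + kd v" using der[of "u + v"] vector_derivative_unique_at by blast
    have "((\<lambda>t. K t (c *\<^sub>R v)) has_vector_derivative c *\<^sub>R kd v) (at 0)"
      using bounded_linear.has_vector_derivative[OF bounded_linear_scaleR_right der[of v], of c] by (simp add: linear_scale[OF lin])
    then show "kd (c *\<^sub>R v) = c *\<^sub>R kd v" using der[of "c *\<^sub>R v"] vector_derivative_unique_at by blast
  qed
  then show ?thesis using der by blast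
qed

lemma family_product_derivative:
  fixes K :: "real \<Rightarrow> 'g \<Rightarrow> 'g" and w :: "real \<Rightarrow> 'g"
  assumes lin: "\<And>t. linear (K t)" "linear kd" and K0: "K 0 = id"
    and der: "\<And>v. ((\<lambda>t. K t v) has_vector_derivative kd v) (at 0)" and w: "(w has_vector_derivative w') (at 0)"
  shows "((\<lambda>t. K t (w t)) has_vector_derivative kd (w 0) + w') (at 0)"
proof -
  have c: "((\<lambda>t. ip (w t) b) has_real_derivative ip w' b) (at 0)" for b
  proof -
    have "bounded_linear (\<lambda>x. ip x b)" using ip_lin linear_conv_bounded_linear by blast
    from bounded_linear.has_vector_derivative[OF this w] show ?thesis
      by (simp add: has_real_derivative_iff_has_vector_derivative)
  qed
  have "((\<lambda>t. \<Sum>b\<in>\<beta>. ip (w t) b *\<^sub>R K t b) has_vector_derivative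
      (\<Sum>b\<in>\<beta>. ip (w 0) b *\<^sub>R kd b + ip w' b *\<^sub>R K 0 b)) (at 0)"
    by (intro has_vector_derivative_sum has_vector_derivative_scaleR c der)
  moreover have "(\<lambda>t. \<Sum>b\<in>\<beta>. ip (w t) b *\<^sub>R K t b) = (\<lambda>t. K t (w t))"
    by (rule ext) (rule expand[OF lin(1), symmetric])
  moreover have "(\<Sum>b\<in>\<beta>. ip (w 0) b *\<^sub>R kd b + ip w' b *\<^sub>R K 0 b) = kd (w 0) + w'"
    unfolding K0 sum.distrib expand[OF lin(2), of "w 0"] using \<beta>_exp[of w'] by simp
  ultimately show ?thesis by simp
qed

definition R :: "'g \<Rightarrow> real \<Rightarrow> 'g \<Rightarrow> 'g" where
  "R p t = iA (expop (br (t *\<^sub>R p))) \<circ> iN (expop (br (t *\<^sub>R p)))"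

lemma R_iwasawa:
  obtains k A n where "k \<in> KK" "A \<in> a" "n \<in> NN" "n \<in> inn" "R p t = expop (br A) \<circ> n" "expop (br (t *\<^sub>R p)) = k \<circ> expop (br A) \<circ> n"
proof -
  obtain k A n where *: "k \<in> KK" "A \<in> a" "n \<in> NN" "n \<in> inn" "k \<in> inn" "expop (br (t *\<^sub>R p)) = k \<circ> expop (br A) \<circ> n"
    using iwasawa_exists[OF inn_expop] .
  have "R p t = expop (br A) \<circ> n" unfolding R_def *(6) iA_eq[OF *(1-3)] iN_eq[OF *(1-3)] ..
  then show ?thesis using that * by blast
qed

lemma expop_br_0: "expop (br 0) = id"
proof -
  have "br 0 = (\<lambda>x. 0)" by (auto simp: br_simps)
  then show ?thesis by (auto simp: expop_0)
qed

lemma R_0: "R p 0 = id"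
proof -
  have K: "id \<in> KK" unfolding KK_def using aut_id by simp
  have a0: "0 \<in> a" using subspace_0[OF a_subspace] .
  have e: "expop (br (0 *\<^sub>R p)) = id \<circ> expop (br 0) \<circ> id" by simp
  show ?thesis unfolding R_def e iA_eq[OF K a0 NN_id] iN_eq[OF K a0 NN_id] by (simp add: expop_br_0)
qed

text \<open>The factor \<open>R\<close> has derivative \<open>ad (\<pi>\<^sub>u p)\<close> at 0: its difference with \<open>ad (\<pi>\<^sub>u p)\<close> is both
  skew and triangular with real diagonal.\<close>

lemma R_derivative:
  assumes p: "p = \<kappa> + A1 + \<nu>" "\<theta> \<kappa> = \<kappa>" "A1 \<in> a" "\<nu> \<in> G {0<..}"
  shows "((\<lambda>t. R p t v) has_vector_derivative br (A1 + \<nu>) v) (at 0)"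
proof -
  let ?E = "\<lambda>t. expop (br (t *\<^sub>R p))"
  have CE: "Cf k UNIV ?E" for k by (rule Cf_expop_line)
  have CR: "Cf k UNIV (R p)" for k
    using Cf_comp[OF open_UNIV Cf_iA[OF open_UNIV CE inn_expop] Cf_iN[OF open_UNIV CE inn_expop]] unfolding R_def[abs_def] .
  define K where "K t = ?E t \<circ> inv (R p t)" for t
  have CK: "Cf k UNIV K" for k unfolding K_def by (rule Cf_comp[OF open_UNIV CE Cf_inv[OF open_UNIV CR]])
  have Ra: "aut (R p t)" and Ka: "aut (K t)" for t using Cf_aut[OF CR] Cf_aut[OF CK] by auto
  have KKK: "K t \<in> KK" for t
  proof -
    obtain k A n where *: "k \<in> KK" "A \<in> a" "n \<in> NN" "n \<in> inn" "R p t = expop (br A) \<circ> n" "?E t = k \<circ> expop (br A) \<circ> n"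
      using R_iwasawa .
    have "?E t = k \<circ> R p t" unfolding *(5) *(6) by (simp add: comp_assoc)
    then have "K t = k" unfolding K_def by (auto simp: fun_eq_iff aut_inv_apply[OF Ra])
    then show ?thesis using *(1) by simp
  qed
  have E0: "?E 0 = id" by (simp add: expop_br_0)
  have K0: "K 0 = id" unfolding K_def E0 R_0 by simp
  obtain rd where rd: "linear rd" "\<And>v. ((\<lambda>t. R p t v) has_vector_derivative rd v) (at 0)" using family_derivative[OF CR] by blast
  obtain kd where kd: "linear kd" "\<And>v. ((\<lambda>t. K t v) has_vector_derivative kd v) (at 0)" using family_derivative[OF CK] by blast
  have sumd: "br p v = kd v + rd v" for v
  proof -
    have "((\<lambda>t. K t (R p t v)) has_vector_derivative kd (R p 0 v) + rd v) (at 0)"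
      by (rule family_product_derivative[OF aut_linear[OF Ka] kd(1) K0 kd(2) rd(2)])
    then have "((\<lambda>t. ?E t v) has_vector_derivative kd v + rd v) (at 0)"
      unfolding K_def R_0 by (simp add: aut_inv_apply[OF Ra])
    moreover have "((\<lambda>t. ?E t v) has_vector_derivative ?E 0 (br p v)) (at 0)"
    proof -
      have sc: "br (t *\<^sub>R p) = (\<lambda>y. t *\<^sub>R br p y)" for t by (auto simp: br_simps)
      show ?thesis unfolding sc by (rule expop_has_vector_derivative[OF br_linear])
    qed
    ultimately show ?thesis using vector_derivative_unique_at unfolding E0 id_def by blast
  qed
  have skew: "ip (kd v) w + ip v (kd w) = 0" for v w
  proof -
    have "((\<lambda>t. ip (K t v) (K t w)) has_vector_derivative ip (K 0 v) (kd w) + ip (kd v) (K 0 w)) (at 0)"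
      by (rule bounded_bilinear.has_vector_derivative[OF ip_bounded_bilinear kd(2) kd(2)])
    moreover have "((\<lambda>t. ip (K t v) (K t w)) has_vector_derivative 0) (at 0)"
      unfolding KK_ip[OF KKK] by simp
    ultimately show ?thesis using vector_derivative_unique_at unfolding K0 id_def by (metis add.commute)
  qed
  \<comment> \<open>Inside one degree only e^A contributes, and it is diagonal in \<beta>; so
    off-diagonal entries of equal degree vanish as well.\<close>
  have tri: "ip (rd b) b' = 0" if b: "b \<in> \<beta>" "b' \<in> \<beta>" "deg b' < deg b \<or> deg b' = deg b \<and> b \<noteq> b'" for b b'
  proof -
    have z: "ip (R p t b) b' = 0" for t
    proof -
      obtain k A n where *: "k \<in> KK" "A \<in> a" "n \<in> NN" "n \<in> inn" "R p t = expop (br A) \<circ> n" "?E t = k \<circ> expop (br A) \<circ> n"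
        using R_iwasawa .
      have "n b - b \<in> G {deg b<..}" by (rule NN_diff[OF *(3) G_mono[OF \<beta>_G[OF b(1), of "{deg b}"]]]) auto
      then have "expop (br A) (n b - b) \<in> G {deg b<..}" by (rule ZZ_G[OF ea_ZZ[OF *(2)]])
      then have "ip (expop (br A) (n b - b)) b' = 0" using b unfolding G_def by auto
      moreover have "ip (expop (br A) b) b' = 0" using ea_\<beta>[OF *(2) b(1)] \<beta>_on[OF b(1,2)] b(3) by (auto simp: ip_simps)
      ultimately show ?thesis unfolding *(5) by (simp add: linear_diff[OF linear_expop[OF br_linear]] ip_simps)
    qed
    have "bounded_linear (\<lambda>x. ip x b')" using ip_lin linear_conv_bounded_linear by blast
    from bounded_linear.has_vector_derivative[OF this rd(2)[of b]]
    have "((\<lambda>t. 0::real) has_vector_derivative ip (rd b) b') (at 0)" unfolding z .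
    then show ?thesis using vector_derivative_unique_at[of "\<lambda>t. 0::real" _ 0 0] by force
  qed
  define M where "M v = rd v - br (A1 + \<nu>) v" for v
  have linM: "linear M" unfolding M_def by (rule linear_compose_sub[OF rd(1) br_linear])
  have Mk: "M v = br \<kappa> v - kd v" for v unfolding M_def using sumd[of v] unfolding p(1) by (simp add: br_simps algebra_simps)
  have Mskew: "ip (M v) w = - ip v (M w)" for v w
    unfolding Mk using skew[of v w] ip_br[of \<kappa> v w] by (simp add: ip_simps p(2))
  have Mtri: "ip (M b) b' = 0" if b: "b \<in> \<beta>" "b' \<in> \<beta>" "deg b' < deg b \<or> deg b' = deg b \<and> b \<noteq> b'" for b b'
  proof -
    have "br \<nu> b \<in> G {deg b<..}" by (rule br_G[OF p(4) \<beta>_G[OF b(1), of "{deg b}"]]) auto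
    then have "ip (br \<nu> b) b' = 0" using b unfolding G_def by auto
    moreover have "ip (br A1 b) b' = 0" using br_a_\<beta>[OF p(3) b(1)] \<beta>_on[OF b(1,2)] b(3) by (auto simp: ip_simps)
    ultimately show ?thesis unfolding M_def using tri[OF b] by (simp add: br_simps ip_simps)
  qed
  have "M = (\<lambda>x. 0)"
  proof (rule linear_eqI[OF linM linear_zero])
    fix b assume b: "b \<in> \<beta>"
    show "M b = 0"
    proof (rule ip_eqI)
      fix c assume c: "c \<in> \<beta>"
      consider "deg c < deg b \<or> deg c = deg b \<and> b \<noteq> c" | "b = c" | "deg b < deg c" by linarith
      then show "ip (M b) c = ip 0 c"
      proof cases
        case 1 then show ?thesis using Mtri[OF b c] by (simp add: ip_simps)
      next
        case 2 then show ?thesis using Mskew[of b b] ip_sym[of b "M b"] by (simp add: ip_simps)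
      next
        case 3 then show ?thesis using Mtri[OF c b] Mskew[of b c] ip_sym[of b "M c"] by (simp add: ip_simps)
      qed
    qed
  qed
  then have "rd v = br (A1 + \<nu>) v" unfolding M_def by (metis eq_iff_diff_eq_0)
  then show ?thesis using rd(2)[of v] by simp
qed

lemma ad_conj_KK: assumes "H \<in> a" shows "expop (br (J H)) \<in> KK"
  unfolding KK_def using aut_expop theta_expop[of "J H"] a_p[OF assms] by (simp add: \<theta>_J J_simps)

lemma expop_br_add: assumes "br X Y = 0" shows "expop (br X) (expop (br Y) v) = expop (br (X + Y)) v"
proof -
  have "br (X + Y) = (\<lambda>x. br X x + br Y x)" by (auto simp: br_simps)
  moreover have "br X (br Y x) = br Y (br X x)" for x using jacobi[of X Y x] assms by (simp add: br_simps)
  ultimately show ?thesis using expop_add[OF br_linear[of X] br_linear[of Y]] by simp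
qed

text \<open>Write e^H for exp(ad H) and t \<Lambda> = J C + B. Conjugating n by e^(-J C) and l by
  e^B gives n_t, l_t with n_t l_t^-1 = e^(-J C) n e^(t \<Lambda>) l^-1 e^(-B), where n e^(t
  \<Lambda>) = k^-1 e^(t X) k n because k n \<Lambda> = X. Hence its AN-factor is R_t n2 e^(-A)
  e^(-B), and \<open>psi0\<close> sends the new pair to R_t X.\<close>

lemma chart_flow:
  assumes \<Lambda>: "regular \<Lambda>" and X: "X \<in> UU \<Lambda>" and YZ: "phi \<Lambda> X = (Y, Z)"
  shows "R X t X \<in> UU \<Lambda>"
    "phi \<Lambda> (R X t X) = (expop (br (- t *\<^sub>R J (im \<Lambda>))) Y, expop (br (t *\<^sub>R re \<Lambda>)) Z)"
proof -
  note h = regular_h[OF \<Lambda>]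
  have hc: "\<Lambda> \<in> hcartan J a" using h G_h by blast
  note ri = re_im_a[OF hc]
  define B where "B = t *\<^sub>R re \<Lambda>"
  define C where "C = t *\<^sub>R im \<Lambda>"
  have BC: "B \<in> a" "C \<in> a" unfolding B_def C_def using ri a_subspace subspace_scale by blast+
  have tL: "t *\<^sub>R \<Lambda> = J C + B" unfolding B_def C_def using re_im[of \<Lambda>] by (metis scaleR_add_right J_simps(3))
  obtain n2 l2 where X2: "n2 \<in> NN" "n2 \<in> inn" "l2 \<in> LL" "l2 \<in> inn" "X = n2 (l2 \<Lambda>)" using X unfolding UU_def by blast
  obtain k A u where *: "k \<in> KK" "A \<in> a" "u \<in> NN" "u \<in> inn" "k \<in> inn" "n2 \<circ> l2 = k \<circ> expop (br A) \<circ> u"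
    using iwasawa_exists[OF inn_comp[OF X2(2,4)]] .
  define n where "n = expop (br A) \<circ> u \<circ> expop (br (- A))"
  define l where "l = expop (br A) \<circ> l2 \<circ> expop (br (- A))"
  note c = chart_correspondence[OF h X2(1-4) *(1-3,6), folded n_def l_def]
  have ni: "n \<in> inn" unfolding n_def by (intro inn_comp inn_expop *)
  have kX: "k (n \<Lambda>) = X" using c(7) X2(5) by simp
  have YZ': "Y = \<theta> (n \<Lambda> - \<Lambda>)" "Z = l \<Lambda> - \<Lambda>" using YZ phi_eq[OF \<Lambda> X2(1-4)] c(4) X2(5) by auto
  have mA: "- A \<in> a" "- B \<in> a" using *(2) BC a_subspace subspace_neg by blast+
  note na = NN_aut[OF c(1)] and la = LL_aut[OF c(2)] and ka = KK_aut[OF *(1)] and n2a = NN_aut[OF X2(1)]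
  have JCh: "J C \<in> G {0}" "- J C \<in> G {0}" using J_G[OF a_G0[OF BC(2)]] G_neg by auto
  have JCZ: "expop (br (J C)) \<in> ZZ" "expop (br (- J C)) \<in> ZZ"
  proof -
    have *: "expop (br D) \<in> ZZ" if D: "D \<in> G {0}" for D
      unfolding ZZ_def
    proof (intro CollectI conjI ballI aut_expop)
      fix H assume "H \<in> G {0}"
      then have "br D H = 0 *\<^sub>R H" using h_abelian[OF D] by simp
      from expop_eigenvector[OF br_linear this] show "expop (br D) H = H" by simp
    qed
    show "expop (br (J C)) \<in> ZZ" "expop (br (- J C)) \<in> ZZ" using * JCh by auto
  qed
  note BZ = ea_ZZ[OF BC(1)]
  define nt where "nt = expop (br (- J C)) \<circ> n \<circ> expop (br (J C))"
  define lt where "lt = expop (br B) \<circ> l \<circ> expop (br (- B))"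
  have nt: "nt \<in> NN" "nt \<in> inn"
    unfolding nt_def using ZZ_conj_NN[OF JCZ(2) c(1)] by (auto simp: inv_expop_br intro: inn_comp inn_expop ni)
  have lt: "lt \<in> LL" "lt \<in> inn"
    unfolding lt_def using ZZ_conj_LL[OF BZ c(2)] by (auto simp: inv_expop_br intro: inn_comp inn_expop c(3))
  obtain kt At ut where t: "kt \<in> KK" "At \<in> a" "ut \<in> NN" "ut \<in> inn" "R X t = expop (br At) \<circ> ut"
    "expop (br (t *\<^sub>R X)) = kt \<circ> expop (br At) \<circ> ut" using R_iwasawa .
  have ilt: "inv lt = expop (br B) \<circ> inv l \<circ> expop (br (- B))"
    by (rule inv_unique_comp) (auto simp: lt_def fun_eq_iff expop_br_uminus aut_inv_apply[OF la])
  have nL: "n (expop (br (t *\<^sub>R \<Lambda>)) x) = inv k (expop (br (t *\<^sub>R X)) (k (n x)))" for x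
  proof -
    have "k (n (expop (br (t *\<^sub>R \<Lambda>)) x)) = expop (br (k (n (t *\<^sub>R \<Lambda>)))) (k (n x))"
      by (simp add: aut_expop_conj[OF na] aut_expop_conj[OF ka])
    also have "k (n (t *\<^sub>R \<Lambda>)) = t *\<^sub>R X" by (simp add: linear_scale[OF aut_linear[OF na]] linear_scale[OF aut_linear[OF ka]] kX)
    finally show ?thesis using aut_inv_apply(1)[OF ka, of "n (expop (br (t *\<^sub>R \<Lambda>)) x)"] by simp
  qed
  have kn: "k (n (inv l x)) = n2 (expop (br (- A)) x)" for x
    using fun_cong[OF c(5), of x] aut_inv_apply(2)[OF ka, of "n2 (expop (br (- A)) x)"] by (simp add: expop_br_uminus)
  have JCB: "br (J C) B = 0" using h_abelian[OF JCh(1) a_G0[OF BC(1)]] .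
  define D where "D = - A - B"
  have Da: "D \<in> a" "At + D \<in> a" "- D \<in> a" unfolding D_def using t(2) *(2) BC a_subspace
    by (auto intro: subspace_add subspace_diff subspace_neg)
  \<comment> \<open>Moving e^D to the left of the unipotent factors restores the order compact,
    exponential of a, unipotent.\<close>
  define N where "N = expop (br (- D)) \<circ> (ut \<circ> n2) \<circ> expop (br D)"
  have NN': "N \<in> NN" unfolding N_def using ZZ_conj_NN[OF ea_ZZ[OF Da(3)] NN_comp[OF t(3) X2(1)]] by (simp add: inv_expop_br)
  have KK': "expop (br (- J C)) \<circ> inv k \<circ> kt \<in> KK"
  proof -
    have "- C \<in> a" using BC(2) a_subspace subspace_neg by blast
    from ad_conj_KK[OF this] show ?thesis by (intro KK_comp KK_inv *(1) t(1)) (simp add: J_simps)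
  qed
  have g1: "nt \<circ> inv lt = (expop (br (- J C)) \<circ> inv k \<circ> kt) \<circ> expop (br (At + D)) \<circ> N"
  proof
    fix x
    have "(nt \<circ> inv lt) x = expop (br (- J C)) (n (expop (br (t *\<^sub>R \<Lambda>)) (inv l (expop (br (- B)) x))))"
      unfolding nt_def ilt tL by (simp add: expop_br_add[OF JCB])
    also have "\<dots> = expop (br (- J C)) (inv k (kt (expop (br At) (ut (n2 (expop (br (- A)) (expop (br (- B)) x)))))))"
      unfolding nL kn t(6) by simp
    also have "expop (br (- A)) (expop (br (- B)) x) = expop (br D) x" unfolding ea_add[OF mA] D_def by simp
    finally show "(nt \<circ> inv lt) x = ((expop (br (- J C)) \<circ> inv k \<circ> kt) \<circ> expop (br (At + D)) \<circ> N) x"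
      unfolding N_def by (simp add: expop_br_uminus flip: ea_add[OF t(2) Da(1)])
  qed
  have iA1: "iA (nt \<circ> inv lt) = expop (br (At + D))" unfolding g1 by (rule iA_eq[OF KK' Da(2) NN'])
  have iN1: "iN (nt \<circ> inv lt) = N" unfolding g1 by (rule iN_eq[OF KK' Da(2) NN'])
  have fixL: "expop (br (- B)) \<Lambda> = \<Lambda>" "expop (br (- A)) \<Lambda> = \<Lambda>" "expop (br (J C)) \<Lambda> = \<Lambda>" "expop (br (- J C)) \<Lambda> = \<Lambda>" "expop (br B) \<Lambda> = \<Lambda>"
    using ZZ_h[OF ea_ZZ[OF mA(2)] h] ZZ_h[OF ea_ZZ[OF mA(1)] h] ZZ_h[OF JCZ(1) h] ZZ_h[OF JCZ(2) h] ZZ_h[OF BZ h] by auto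
  have "psi0 \<Lambda> nt lt = expop (br At) (ut (n2 (expop (br D) (lt \<Lambda>))))"
    unfolding psi0_def iA1 iN1 N_def by (simp add: expop_br_uminus flip: ea_add[OF t(2) Da(1)])
  also have "expop (br D) (lt \<Lambda>) = l2 \<Lambda>"
  proof -
    have "expop (br D) (lt \<Lambda>) = expop (br (- A)) (expop (br (- B)) (lt \<Lambda>))" unfolding ea_add[OF mA] D_def by simp
    also have "\<dots> = expop (br (- A)) (l \<Lambda>)" unfolding lt_def by (simp add: expop_br_uminus fixL)
    also have "\<dots> = l2 \<Lambda>" unfolding l_def by (simp add: expop_br_uminus fixL)
    finally show ?thesis .
  qed
  finally have "psi0 \<Lambda> nt lt = expop (br At) (ut X)" unfolding X2(5)[symmetric] .
  then have psi: "psi0 \<Lambda> nt lt = R X t X" by (simp add: t(5))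
  show "R X t X \<in> UU \<Lambda>" using psi0_UU(1)[OF \<Lambda> nt lt] unfolding psi .
  have "\<theta> (J C) = J C" using a_p[OF BC(2)] by (simp add: \<theta>_J J_simps)
  then have th: "\<theta> (- J C) = - J C" by (simp add: \<theta>_simps)
  have "\<theta> (nt \<Lambda> - \<Lambda>) = expop (br (- J C)) Y"
  proof -
    have "nt \<Lambda> - \<Lambda> = expop (br (- J C)) (n \<Lambda> - \<Lambda>)"
      unfolding nt_def by (simp add: fixL linear_diff[OF linear_expop[OF br_linear]])
    then show ?thesis unfolding YZ' by (simp add: theta_expop th)
  qed
  moreover have "lt \<Lambda> - \<Lambda> = expop (br B) Z"
    unfolding lt_def YZ' by (simp add: fixL linear_diff[OF linear_expop[OF br_linear]])
  moreover have "- J C = - t *\<^sub>R J (im \<Lambda>)" unfolding C_def by (simp add: J_simps)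
  ultimately show "phi \<Lambda> (R X t X) = (expop (br (- t *\<^sub>R J (im \<Lambda>))) Y, expop (br (t *\<^sub>R re \<Lambda>)) Z)"
    using psi0_UU(2)[OF \<Lambda> nt lt] unfolding psi B_def by simp
qed

text \<open>Any admissible F can be evaluated along the curve \<open>R p t p\<close>, which stays in
  the chart domain and starts with velocity [A1 + \<nu>, p] = [p - \<kappa>, p] = [p, \<kappa>]; in
  the chart this curve is explicit. V is abstract so that \<open>pi_k\<close> enters only at the
  end.\<close>

lemma phi_transforms:
  assumes \<Lambda>: "regular \<Lambda>"
    and X: "\<And>p. \<exists>\<kappa> A1 \<nu>. p = \<kappa> + A1 + \<nu> \<and> \<theta> \<kappa> = \<kappa> \<and> A1 \<in> a \<and> \<nu> \<in> G {0<..} \<and> V p = br p \<kappa>"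
  shows "transforms_field (UU \<Lambda>) (phi \<Lambda>) V (\<lambda>(Y, Z). (br Y (J (im \<Lambda>)), br Z (- re \<Lambda>)))"
  unfolding transforms_field_def
proof (intro ballI allI impI, elim conjE)
  fix p W F D
  assume p: "p \<in> UU \<Lambda>" and W: "p \<in> W" "smooth_open W F" and F: "\<forall>y\<in>UU \<Lambda> \<inter> W. F y = phi \<Lambda> y" and D: "(F has_derivative D) (at p)"
  obtain \<kappa> A1 \<nu> where *: "p = \<kappa> + A1 + \<nu>" "\<theta> \<kappa> = \<kappa>" "A1 \<in> a" "\<nu> \<in> G {0<..}" "V p = br p \<kappa>" using X[of p] by blast
  obtain Y Z where YZ: "phi \<Lambda> p = (Y, Z)" by fastforce
  let ?c = "\<lambda>t. R p t p"
  have c': "(?c has_vector_derivative br (A1 + \<nu>) p) (at 0)" by (rule R_derivative[OF *(1-4)])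
  have Vp: "br (A1 + \<nu>) p = V p"
  proof -
    have "A1 + \<nu> = p - \<kappa>" using *(1) by simp
    then have "br (A1 + \<nu>) p = - br \<kappa> p" by (simp add: br_simps br_self)
    then show ?thesis using br_anti[of \<kappa> p] *(5) by simp
  qed
  have c0: "?c 0 = p" unfolding R_0 by simp
  have D0: "(F has_derivative D) (at (?c 0))" using D c0 by simp
  have cd: "(?c has_derivative (\<lambda>t. t *\<^sub>R V p)) (at 0)" using c' Vp by (simp add: has_vector_derivative_def)
  have "((\<lambda>t. F (?c t)) has_derivative (\<lambda>t. D (t *\<^sub>R V p))) (at 0)"
    by (rule has_derivative_compose[OF cd, of F D]) (rule D0)
  then have F1: "((\<lambda>t. F (?c t)) has_vector_derivative D (V p)) (at 0)"
    unfolding has_vector_derivative_def using linear_scale[OF has_derivative_linear[OF D]] by simp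
  let ?q = "\<lambda>t. (expop (br (- t *\<^sub>R J (im \<Lambda>))) Y, expop (br (t *\<^sub>R re \<Lambda>)) Z)"
  have "isCont ?c 0" using c' has_vector_derivative_continuous by blast
  then have "(?c \<longlongrightarrow> p) (at 0)" unfolding isCont_def c0 .
  moreover have "open W" using W(2) unfolding smooth_open_def by blast
  ultimately have "\<forall>\<^sub>F t in at 0. ?c t \<in> W" using W(1) topological_tendstoD by blast
  then have ev: "\<forall>\<^sub>F t in at 0. F (?c t) = ?q t"
    by eventually_elim (use F chart_flow[OF \<Lambda> p YZ] in auto)
  have q0: "F (?c 0) = ?q 0" using F chart_flow[OF \<Lambda> p YZ, of 0] c0 W(1) by auto
  have "((\<lambda>t. ?q t) has_vector_derivative D (V p)) (at 0)"
    using F1 unfolding has_vector_derivative_def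
    by (rule has_derivative_transform_eventually[where f="\<lambda>t. F (?c t)"]) (use ev q0 in auto)
  moreover have "(?q has_vector_derivative (br (- J (im \<Lambda>)) Y, br (re \<Lambda>) Z)) (at 0)"
  proof (rule has_vector_derivative_Pair)
    have sc: "br (t *\<^sub>R x) = (\<lambda>y. t *\<^sub>R br x y)" for t x by (auto simp: br_simps)
    have sc': "- t *\<^sub>R x = t *\<^sub>R (- x)" for t and x :: 'g by simp
    have "((\<lambda>t. expop (br (t *\<^sub>R x)) v) has_vector_derivative br x v) (at 0)" for x v
      using expop_has_vector_derivative[OF br_linear[of x], of v 0] unfolding sc by (simp add: expop_0)
    then show "((\<lambda>t. expop (br (- t *\<^sub>R J (im \<Lambda>))) Y) has_vector_derivative br (- J (im \<Lambda>)) Y) (at 0)"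
      "((\<lambda>t. expop (br (t *\<^sub>R re \<Lambda>)) Z) has_vector_derivative br (re \<Lambda>) Z) (at 0)" unfolding sc' by blast+
  qed
  ultimately have "D (V p) = (br (- J (im \<Lambda>)) Y, br (re \<Lambda>) Z)" using vector_derivative_unique_at by blast
  also have "\<dots> = (br Y (J (im \<Lambda>)), br Z (- re \<Lambda>))" using br_anti[of Y "J (im \<Lambda>)"] br_anti[of Z "re \<Lambda>"] by (simp add: br_simps)
  finally show "D (V p) = (\<lambda>(Y, Z). (br Y (J (im \<Lambda>)), br Z (- re \<Lambda>))) (phi \<Lambda> p)" using YZ by simp
qed

section \<open>Density and covering\<close>

lemma UU_dense: assumes \<Lambda>: "regular \<Lambda>" and g: "g \<in> inn" shows "g \<Lambda> \<in> closure (UU \<Lambda>)"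
proof -
  note ga = inn_aut[OF g]
  obtain h where h: "\<And>n::nat. h n \<in> inn" "\<And>n. good (h n)" "\<And>v. (\<lambda>n. h n v) \<longlonglongrightarrow> inv g v"
    using inn_approx[OF inn_inv[OF g]] by blast
  have "(\<lambda>n. inv (h n) \<Lambda>) \<longlonglongrightarrow> g \<Lambda>"
  proof (rule linear_system_tendsto[where M=h and N="inv g" and b="\<lambda>n. \<Lambda>"])
    show "\<forall>\<^sub>F n in sequentially. linear (h n)" using h(1) inn_aut aut_linear by auto
    show "linear (inv g)" "inj (inv g)" using aut_linear[OF aut_inv[OF ga]] aut_bij[OF aut_inv[OF ga]] by (auto simp: bij_is_inj)
    show "(\<lambda>n. \<Lambda>) \<longlonglongrightarrow> inv g (g \<Lambda>)" by (simp add: aut_inv_apply[OF ga])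
    show "\<forall>\<^sub>F n in sequentially. h n (inv (h n) \<Lambda>) = \<Lambda>" using aut_inv_apply(2)[OF inn_aut[OF h(1)]] by simp
  qed (rule h(3))
  moreover have "inv (h n) \<Lambda> \<in> UU \<Lambda>" for n
    unfolding UU_iff[OF regular_h[OF \<Lambda>]] using inn_inv[OF h(1), of n] h(2)[of n] aut_inv_inv[OF inn_aut[OF h(1)], of n]
    by (intro CollectI exI[of _ "inv (h n)"]) simp
  ultimately show ?thesis unfolding closure_sequential by (intro exI[of _ "\<lambda>n. inv (h n) \<Lambda>"]) simp
qed

text \<open>Isometries have bounded images of the finite basis, so subsequences are extracted one
  basis vector at a time. The limit is an isometry, hence bijective, and inherits compatibility with
  the bracket and J by continuity.\<close>

lemma KK_subsequence:
  assumes k: "\<And>j::nat. k j \<in> KK"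
  shows "\<exists>r q. strict_mono (r::nat \<Rightarrow> nat) \<and> q \<in> KK \<and> (\<forall>v. (\<lambda>j. k (r j) v) \<longlonglongrightarrow> q v)"
proof -
  have bd: "bounded (range (\<lambda>j. k (s j) b))" if b: "b \<in> \<beta>" for s :: "nat \<Rightarrow> nat" and b
  proof (rule boundedI)
    fix x assume "x \<in> range (\<lambda>j. k (s j) b)"
    then obtain j where x: "x = k (s j) b" by blast
    have "ip x x = 1" unfolding x KK_ip[OF k] using \<beta>_on[OF b b] by simp
    then have sq: "(\<Sum>c\<in>\<beta>. (ip x c)^2) = 1" using parseval[of x x] by (simp add: power2_eq_square)
    have le: "\<bar>ip x c\<bar> \<le> 1" if "c \<in> \<beta>" for c
    proof -
      have "(ip x c)^2 \<le> (\<Sum>c\<in>\<beta>. (ip x c)^2)" by (rule member_le_sum) (use that \<beta>_fin in auto)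
      then have "(ip x c)^2 \<le> 1" using sq by simp
      then show ?thesis by (simp add: abs_square_le_1)
    qed
    have "norm x = norm (\<Sum>c\<in>\<beta>. ip x c *\<^sub>R c)" using \<beta>_exp[of x] by simp
    also have "\<dots> \<le> (\<Sum>c\<in>\<beta>. norm (ip x c *\<^sub>R c))" by (rule norm_sum)
    also have "\<dots> \<le> (\<Sum>c\<in>\<beta>. norm c)"
      by (rule sum_mono) (use le in \<open>simp add: mult_left_le_one_le\<close>)
    finally show "norm x \<le> (\<Sum>c\<in>\<beta>. norm c)" .
  qed
  have "\<exists>r. strict_mono (r::nat \<Rightarrow> nat) \<and> (\<forall>b\<in>B. \<exists>l. (\<lambda>j. k (r j) b) \<longlonglongrightarrow> l)" if "finite B" "B \<subseteq> \<beta>" for B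
    using that
  proof (induction B rule: finite_induct)
    case empty show ?case by (intro exI[of _ "\<lambda>n. n"]) (auto simp: strict_mono_def)
  next
    case (insert b B)
    then obtain r where r: "strict_mono (r::nat \<Rightarrow> nat)" "\<And>c. c \<in> B \<Longrightarrow> \<exists>l. (\<lambda>j. k (r j) c) \<longlonglongrightarrow> l" by blast
    obtain l r' where r': "strict_mono (r'::nat \<Rightarrow> nat)" "((\<lambda>j. k (r j) b) \<circ> r') \<longlonglongrightarrow> l"
      using bounded_imp_convergent_subsequence[OF bd[of b r]] insert.prems by blast
    have "\<exists>l. (\<lambda>j. k ((r \<circ> r') j) c) \<longlonglongrightarrow> l" if cB: "c \<in> insert b B" for c
    proof (cases "c = b")
      case True then show ?thesis using r'(2) by (auto simp: o_def)
    next
      case False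
      then have "c \<in> B" using cB by blast
      from r(2)[OF this] obtain l where "(\<lambda>j. k (r j) c) \<longlonglongrightarrow> l" ..
      from LIMSEQ_subseq_LIMSEQ[OF this r'(1)] show ?thesis by (auto simp: o_def)
    qed
    then show ?case using strict_mono_o[OF r(1) r'(1)] by blast
  qed
  from this[OF \<beta>_fin] obtain r where r: "strict_mono (r::nat \<Rightarrow> nat)" "\<And>b. b \<in> \<beta> \<Longrightarrow> \<exists>l. (\<lambda>j. k (r j) b) \<longlonglongrightarrow> l" by blast
  then obtain L where L: "\<And>b. b \<in> \<beta> \<Longrightarrow> (\<lambda>j. k (r j) b) \<longlonglongrightarrow> L b" by metis
  define q where "q x = (\<Sum>b\<in>\<beta>. ip x b *\<^sub>R L b)" for x
  have lim: "(\<lambda>j. k (r j) v) \<longlonglongrightarrow> q v" for v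
  proof -
    have "(\<lambda>j. \<Sum>b\<in>\<beta>. ip v b *\<^sub>R k (r j) b) \<longlonglongrightarrow> q v" unfolding q_def by (intro tendsto_intros L)
    then show ?thesis by (simp flip: expand[OF aut_linear[OF KK_aut[OF k]]])
  qed
  note ka = KK_aut[OF k]
  have lin: "linear q"
  proof (rule linearI)
    fix u v :: 'g and c :: real
    have "(\<lambda>j. k (r j) (u + v)) \<longlonglongrightarrow> q u + q v" using tendsto_add[OF lim[of u] lim[of v]] by (simp add: linear_add[OF aut_linear[OF ka]])
    then show "q (u + v) = q u + q v" using lim[of "u + v"] LIMSEQ_unique by blast
    have "(\<lambda>j. k (r j) (c *\<^sub>R v)) \<longlonglongrightarrow> c *\<^sub>R q v" using tendsto_scaleR[OF tendsto_const lim[of v]] by (simp add: linear_scale[OF aut_linear[OF ka]])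
    then show "q (c *\<^sub>R v) = c *\<^sub>R q v" using lim[of "c *\<^sub>R v"] LIMSEQ_unique by blast
  qed
  have ipq: "ip (q x) (q y) = ip x y" for x y
  proof -
    have "(\<lambda>j. ip (k (r j) x) (k (r j) y)) \<longlonglongrightarrow> ip (q x) (q y)"
      by (rule bounded_bilinear.tendsto[OF ip_bounded_bilinear lim lim])
    then have "(\<lambda>j. ip x y) \<longlonglongrightarrow> ip (q x) (q y)" unfolding KK_ip[OF k] .
    then show ?thesis using LIMSEQ_unique[OF tendsto_const] by metis
  qed
  have inj: "inj q" unfolding linear_injective_0[OF lin] using ipq ip_eq0 by (metis linear_0[OF lin])
  have qa: "aut q" unfolding aut_def
  proof (intro conjI allI lin)
    show "bij q" using inj linear_inj_imp_surj[OF lin inj] by (simp add: bij_def)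
    fix x y
    have "(\<lambda>j. br (k (r j) x) (k (r j) y)) \<longlonglongrightarrow> br (q x) (q y)"
      by (rule bounded_bilinear.tendsto[OF br_bilinear lim lim])
    then have "(\<lambda>j. k (r j) (br x y)) \<longlonglongrightarrow> br (q x) (q y)" by (simp add: aut_br[OF ka])
    then show "q (br x y) = br (q x) (q y)" using lim[of "br x y"] LIMSEQ_unique by blast
    have "(\<lambda>j. J (k (r j) x)) \<longlonglongrightarrow> J (q x)"
      using bounded_linear.tendsto[OF _ lim[of x]] J_linear linear_conv_bounded_linear by blast
    then have "(\<lambda>j. k (r j) (J x)) \<longlonglongrightarrow> J (q x)" by (simp add: aut_J[OF ka])
    then show "q (J x) = J (q x)" using lim[of "J x"] LIMSEQ_unique by blast
  qed
  have "q \<in> KK" by (rule KK_of_ip[OF qa ipq])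
  then show ?thesis using r(1) lim by blast
qed

lemma expop_H0: "expop (br (t *\<^sub>R H0)) v = (\<Sum>b\<in>\<beta>. (exp (t * deg b) * ip v b) *\<^sub>R b)"
proof -
  have ta: "t *\<^sub>R H0 \<in> a" using H0_a a_subspace subspace_scale by blast
  have "expop (br (t *\<^sub>R H0)) v = (\<Sum>b\<in>\<beta>. ip v b *\<^sub>R expop (br (t *\<^sub>R H0)) b)" by (rule expand[OF linear_expop[OF br_linear]])
  also have "\<dots> = (\<Sum>b\<in>\<beta>. (exp (t * deg b) * ip v b) *\<^sub>R b)"
    by (rule sum.cong) (auto simp: ea_\<beta>[OF ta] deg_def mult.commute)
  finally show ?thesis .
qed

text \<open>Put V = g^-1 n, with n the positive part. The spaces e^(j H0) V equal k_j n and, along a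
  subsequence, tend to q n. Rescaling shows that the top-degree component of a vector of V survives
  in the limit, and a dimension count that such components span q n. They are eigenvectors of ad H0,
  so q^-1 H0 normalizes n; being in p, it must lie in a.\<close>

lemma orbit_covered:
  assumes \<Lambda>: "regular \<Lambda>" and g: "g \<in> inn"
  shows "\<exists>\<Lambda>'\<in>G {0}. (\<exists>f\<in>inn. \<Lambda>' = f \<Lambda>) \<and> g \<Lambda> \<in> UU \<Lambda>'"
proof -
  note ga = inn_aut[OF g] and gia = aut_inv[OF inn_aut[OF g]]
  define E where "E j = expop (br (real j *\<^sub>R H0))" for j :: nat
  have Ei: "E j \<circ> inv g \<in> inn" for j unfolding E_def by (intro inn_comp inn_inv g inn_expop)
  have "\<exists>k A n. k \<in> KK \<and> A \<in> a \<and> n \<in> NN \<and> k \<in> inn \<and> E j \<circ> inv g = k \<circ> expop (br A) \<circ> n" for j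
    using iwasawa_exists[OF Ei[of j]] by metis
  then obtain k A n where kan: "\<And>j. k j \<in> KK" "\<And>j. A j \<in> a" "\<And>j. n j \<in> NN" "\<And>j. k j \<in> inn"
    "\<And>j. E j \<circ> inv g = k j \<circ> expop (br (A j)) \<circ> n j" by metis
  obtain r q where r: "strict_mono (r::nat \<Rightarrow> nat)" "q \<in> KK" "\<And>v. (\<lambda>j. k (r j) v) \<longlonglongrightarrow> q v"
    using KK_subsequence[of k, OF kan(1)] by blast
  note qa = KK_aut[OF r(2)] and qia = aut_inv[OF KK_aut[OF r(2)]] and ka = KK_aut[OF kan(1)]
  have invlim: "(\<lambda>j. inv (k (r j)) (x j)) \<longlonglongrightarrow> inv q y" if "x \<longlonglongrightarrow> y" for x y
  proof (rule linear_system_tendsto[where M="\<lambda>j. k (r j)" and N=q and b=x])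
    show "\<forall>\<^sub>F j in sequentially. linear (k (r j))" using aut_linear[OF ka] by simp
    show "linear q" "inj q" using aut_linear[OF qa] aut_bij[OF qa] by (auto simp: bij_is_inj)
    show "x \<longlonglongrightarrow> q (inv q y)" using that by (simp add: aut_inv_apply[OF qa])
    show "\<forall>\<^sub>F j in sequentially. k (r j) (inv (k (r j)) (x j)) = x j" by (simp add: aut_inv_apply[OF ka])
  qed (rule r(3))
  define V where "V = inv g ` G {0<..}"
  define Wc where "Wc = (\<Union>c. pr {c} ` (V \<inter> G {..c}))"
  \<comment> \<open>Leading components of elements of \<open>V\<close> survive in the limit of \<open>E j ` V\<close>.\<close>
  have lead: "inv q (pr {c} v) \<in> G {0<..}" if v: "v \<in> V" "v \<in> G {..c}" for v c
  proof -
    define x where "x j = exp (- (real (r j) * c)) *\<^sub>R E (r j) v" for j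
    have xlim: "x \<longlonglongrightarrow> pr {c} v"
    proof -
      have x: "x j = (\<Sum>b\<in>\<beta>. (exp (real (r j) * (deg b - c)) * ip v b) *\<^sub>R b)" for j
        unfolding x_def E_def expop_H0 scaleR_sum_right
        by (rule sum.cong) (auto simp: algebra_simps simp flip: exp_add)
      have "(\<lambda>j. (exp (real (r j) * (deg b - c)) * ip v b) *\<^sub>R b) \<longlonglongrightarrow> (if deg b = c then ip v b else 0) *\<^sub>R b" if b: "b \<in> \<beta>" for b
      proof -
        consider "deg b = c" | "deg b < c" | "deg b > c" by linarith
        then show ?thesis
        proof cases
          case 2
          have "filterlim (\<lambda>j. (c - deg b) * real (r j)) at_top sequentially"
            using 2 by (intro filterlim_tendsto_pos_mult_at_top[OF tendsto_const] filterlim_compose[OF filterlim_real_sequentially filterlim_subseq[OF r(1)]]) auto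
          then have "(\<lambda>j. exp (- ((c - deg b) * real (r j)))) \<longlonglongrightarrow> 0"
            by (intro filterlim_compose[OF exp_at_bot] filterlim_compose[OF filterlim_uminus_at_bot_at_top])
          then have "(\<lambda>j. (exp (- ((c - deg b) * real (r j))) * ip v b) *\<^sub>R b) \<longlonglongrightarrow> (0 * ip v b) *\<^sub>R b" by (intro tendsto_intros)
          then show ?thesis using 2 by (simp add: algebra_simps)
        next
          case 3
          then have "ip v b = 0" using v(2) b unfolding G_def by auto
          then show ?thesis by simp
        qed simp
      qed
      then have "(\<lambda>j. \<Sum>b\<in>\<beta>. (exp (real (r j) * (deg b - c)) * ip v b) *\<^sub>R b) \<longlonglongrightarrow> (\<Sum>b\<in>\<beta>. (if deg b = c then ip v b else 0) *\<^sub>R b)"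
        by (intro tendsto_sum)
      moreover have "(\<Sum>b\<in>\<beta>. (if deg b = c then ip v b else 0) *\<^sub>R b) = pr {c} v"
        using \<beta>_exp[of "pr {c} v"] by (simp add: ip_pr cong: sum.cong)
      ultimately show ?thesis unfolding x[abs_def] by simp
    qed
    obtain w where w: "w \<in> G {0<..}" "v = inv g w" using v(1) unfolding V_def by blast
    have "inv (k (r j)) (x j) \<in> G {0<..}" for j
    proof -
      have "E (r j) v = k (r j) (expop (br (A (r j))) (n (r j) w))" using fun_cong[OF kan(5)[of "r j"], of w] w(2) by simp
      then have "inv (k (r j)) (E (r j) v) = expop (br (A (r j))) (n (r j) w)" by (simp add: aut_inv_apply[OF ka])
      also have "\<dots> \<in> G {0<..}" by (rule ZZ_G[OF ea_ZZ[OF kan(2)] NN_gt[OF kan(3) w(1)]])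
      finally show ?thesis unfolding x_def linear_scale[OF aut_linear[OF aut_inv[OF ka]]] by (rule G_scale)
    qed
    then show ?thesis
      using closed_sequentially[OF closed_subspace[OF G_subspace[of "{0<..}"]] _ invlim[OF xlim]] by blast
  qed
  have Vsub: "subspace V" unfolding V_def by (rule linear_subspace_image[OF aut_linear[OF gia] G_subspace])
  have Nsub: "subspace (q ` G {0<..})" by (rule linear_subspace_image[OF aut_linear[OF qa] G_subspace])
  have WcN: "Wc \<subseteq> q ` G {0<..}"
  proof
    fix x assume "x \<in> Wc"
    then obtain c v where "v \<in> V" "v \<in> G {..c}" "x = pr {c} v" unfolding Wc_def by blast
    then have "inv q x \<in> G {0<..}" "x = q (inv q x)" using lead by (auto simp: aut_inv_apply[OF qa])
    then show "x \<in> q ` G {0<..}" by blast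
  qed
  then have WN: "span Wc \<subseteq> q ` G {0<..}" using span_minimal Nsub by blast
  \<comment> \<open>A nonzero v in V is not orthogonal to its own top-degree component, so the
    leading components separate V.\<close>
  have Vperp: "v = 0" if v: "v \<in> V" "\<And>w. w \<in> Wc \<Longrightarrow> ip v w = 0" for v
  proof (rule ccontr)
    assume "v \<noteq> 0"
    let ?D = "{b\<in>\<beta>. ip v b \<noteq> 0}"
    have fin: "finite ?D" using \<beta>_fin by simp
    have ne: "?D \<noteq> {}" using ip_eqI[of v 0] \<open>v \<noteq> 0\<close> by (auto simp: ip_simps)
    define c where "c = Max (deg ` ?D)"
    have "c \<in> deg ` ?D" unfolding c_def using fin ne by (intro Max_in) auto
    then obtain b where b: "b \<in> \<beta>" "ip v b \<noteq> 0" "deg b = c" by auto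
    have vG: "v \<in> G {..c}" unfolding G_def
    proof (intro CollectI ballI impI)
      fix b assume b: "b \<in> \<beta>" "deg b \<notin> {..c}"
      show "ip v b = 0"
      proof (rule ccontr)
        assume "ip v b \<noteq> 0"
        then have "deg b \<le> c" unfolding c_def using fin b(1) by (intro Max_ge) auto
        then show False using b(2) by simp
      qed
    qed
    have "pr {c} v \<in> Wc" unfolding Wc_def using v(1) vG by blast
    then have "ip v (pr {c} v) = 0" by (rule v(2))
    moreover have "ip v (pr {c} v) = ip (pr {c} v) (pr {c} v)"
    proof -
      have "ip v (pr {c} v) = ip (pr {c} v + pr (- {c}) v) (pr {c} v)" using pr_split[of "{c}" "- {c}" v] by simp
      then show ?thesis using ip_G[OF pr_mem pr_mem, of "- {c}" "{c}" v v] by (simp add: ip_simps)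
    qed
    ultimately have "pr {c} v = 0" using ip_eq0 by simp
    then show False using ip_pr[OF b(1), of "{c}" v] b by (simp add: ip_simps)
  qed
  obtain Bs where Bs: "Bs \<subseteq> Wc" "independent Bs" "Wc \<subseteq> span Bs" using maximal_independent_subset[of Wc] by blast
  have finB: "finite Bs" using Bs(2) independent_bound by blast
  \<comment> \<open>Pairing with a basis of \<open>span Wc\<close> embeds V into it, so
    \<open>span Wc\<close> has at least the dimension of V, which is that of q n, and the inclusion
    \<open>WN\<close> is an equality.\<close>
  define T where "T v = (\<Sum>w\<in>Bs. ip v w *\<^sub>R w)" for v
  have linT: "linear T" unfolding T_def by (rule linearI) (simp_all add: ip_simps algebra_simps sum.distrib scaleR_sum_right)
  have TW: "T v \<in> span Wc" for v unfolding T_def by (intro span_sum span_scale span_base) (use Bs(1) in blast)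
  have T0: "v = 0" if v: "v \<in> V" "T v = 0" for v
  proof (rule Vperp[OF v(1)])
    have z: "ip v w = 0" if "w \<in> Bs" for w
      using independentD[OF Bs(2) finB order_refl v(2)[unfolded T_def] that] .
    fix w assume "w \<in> Wc"
    then have "w \<in> span Bs" using Bs(3) by blast
    then show "ip v w = 0"
    proof (induction rule: span_induct)
      show "subspace {w. ip v w = 0}" unfolding subspace_def by (auto simp: ip_simps)
    qed (rule z)
  qed
  have injT: "inj_on T V"
  proof (rule inj_onI)
    fix x y assume "x \<in> V" "y \<in> V" "T x = T y"
    then have "x - y \<in> V" "T (x - y) = 0" using subspace_diff[OF Vsub] by (auto simp: linear_diff[OF linT])
    then have "x - y = 0" by (rule T0)
    then show "x = y" by simp
  qed
  have spanV: "span V = V" using Vsub by (simp add: span_eq_iff)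
  have "dim (T ` V) = dim V" by (rule dim_image_eq[OF linT]) (simp only: spanV injT)
  moreover have "dim (T ` V) \<le> dim (span Wc)" by (rule dim_subset) (use TW in blast)
  moreover have "dim V = dim (q ` G {0<..})"
    unfolding V_def
      dim_image_eq[OF aut_linear[OF gia] inj_on_subset[OF bij_is_inj[OF aut_bij[OF gia]] subset_UNIV]]
      dim_image_eq[OF aut_linear[OF qa] inj_on_subset[OF bij_is_inj[OF aut_bij[OF qa]] subset_UNIV]] ..
  ultimately have WNeq: "span Wc = q ` G {0<..}" using subspace_dim_equal[OF subspace_span Nsub WN] by simp
  have Winv: "br H0 w \<in> span Wc" if "w \<in> span Wc" for w
    using that
  proof (induction rule: span_induct)
    show "subspace {w. br H0 w \<in> span Wc}"
      using linear_subspace_vimage[OF br_linear[of H0] subspace_span] by (simp add: vimage_def)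
    fix w assume w: "w \<in> Wc"
    then obtain c v where "w = pr {c} v" unfolding Wc_def by blast
    then have "br H0 w = c *\<^sub>R w" using pr_mem[of "{c}" v] unfolding G_eig by simp
    then show "br H0 w \<in> span Wc" using w span_base span_scale by metis
  qed
  define Q where "Q = inv q H0"
  have qQ: "q Q = H0" unfolding Q_def by (simp add: aut_inv_apply[OF qa])
  have norm: "br Q x \<in> G {0<..}" if x: "x \<in> G {0<..}" for x
  proof -
    have "q x \<in> span Wc" using WNeq x by blast
    then have "q (br Q x) \<in> q ` G {0<..}" using Winv WNeq by (simp add: aut_br[OF qa] qQ)
    then show ?thesis using bij_is_inj[OF aut_bij[OF qa]] by (auto dest: injD)
  qed
  have \<theta>Q: "\<theta> Q = - Q"
  proof -
    have "q (\<theta> Q) = \<theta> (q Q)" using r(2) unfolding KK_def by simp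
    also have "\<dots> = q (- Q)" unfolding qQ a_p[OF H0_a] by (simp add: linear_neg[OF aut_linear[OF qa]] qQ)
    finally show ?thesis using bij_is_inj[OF aut_bij[OF qa]] by (rule injD[rotated])
  qed
  \<comment> \<open>The bracket of Q with its positive part has positive degrees, hence is
    orthogonal to H0. Moving ad Q across the product turns this into a vanishing sum of
    \<open>deg b\<close> times squared coefficients.\<close>
  have Q0: "ip Q b = 0" if b: "b \<in> \<beta>" "deg b > 0" for b
  proof -
    let ?x = "pr {0<..} Q"
    have "ip (br Q ?x) H0 = 0" by (rule ip_G[OF norm[OF pr_mem] H0_h]) auto
    then have "ip ?x (br Q H0) = 0" by (simp add: ip_br \<theta>Q br_simps ip_simps)
    then have z: "ip ?x (br H0 Q) = 0" using br_anti[of Q H0] by (simp add: ip_simps)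
    have e: "ip (br H0 Q) b = deg b * ip Q b" if "b \<in> \<beta>" for b
      using that br_a_\<beta>[OF H0_a that] a_p[OF H0_a] by (simp add: ip_br deg_def ip_simps br_simps)
    have "(\<Sum>b\<in>\<beta>. if deg b > 0 then deg b * (ip Q b)^2 else 0) = ip ?x (br H0 Q)"
      by (subst parseval[of ?x], rule sum.cong) (auto simp: ip_pr e power2_eq_square)
    then have "(\<Sum>b\<in>\<beta>. if deg b > 0 then deg b * (ip Q b)^2 else 0) = 0" using z by simp
    then have "\<forall>b\<in>\<beta>. (if deg b > 0 then deg b * (ip Q b)^2 else 0) = 0"
      using \<beta>_fin by (subst (asm) sum_nonneg_eq_0_iff) auto
    then show ?thesis using b by auto
  qed
  have qn: "pr {0<..} Q = 0" by (rule ip_eqI) (auto simp: ip_pr Q0 ip_simps)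
  have ql: "pr {..<0} Q = 0"
  proof -
    have "\<theta> (pr {..<0} Q) \<in> G {0<..}" "\<theta> (pr {0} Q) \<in> G {0}" by (rule \<theta>_G[OF pr_mem]; auto)+
    moreover have "\<theta> (pr {..<0} Q) + 0 + (\<theta> (pr {0} Q) + pr {0} Q) + pr {..<0} Q = 0"
    proof -
      have "Q = pr {..<0} Q + pr {0} Q" using triple_split[of Q] qn by simp
      then have "\<theta> Q + Q = \<theta> (pr {..<0} Q) + \<theta> (pr {0} Q) + (pr {..<0} Q + pr {0} Q)" by (metis \<theta>_simps(1))
      then show ?thesis using \<theta>Q by (simp add: algebra_simps)
    qed
    then have "\<theta> (pr {..<0} Q) + pr {..<0} Q + (\<theta> (pr {0} Q) + pr {0} Q) = 0" by (simp add: algebra_simps)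
    ultimately show ?thesis using triple_zero(2) pr_mem G_add by blast
  qed
  have Qh: "Q \<in> G {0}" using triple_split[of Q] qn ql pr_mem[of "{0}" Q] by simp
  have Qa: "Q \<in> a" by (rule a_maximal[OF \<theta>Q]) (use h_abelian[OF a_G0 Qh] in blast)
  have h_eq: "inv q ` G {0} = G {0}"
  proof -
    have "G {0} \<subseteq> inv q ` G {0}"
    proof
      fix H assume H: "H \<in> G {0}"
      have "br H0 (q H) = q (br Q H)" by (simp add: aut_br[OF qa] qQ)
      also have "\<dots> = 0" using h_abelian[OF Qh H] linear_0[OF aut_linear[OF qa]] by simp
      finally have "q H \<in> G {0}" unfolding G_eig by simp
      then show "H \<in> inv q ` G {0}" using aut_inv_apply(1)[OF qa, of H] by (metis imageI)
    qed
    moreover have "dim (inv q ` G {0}) = dim (G {0})"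
      by (rule dim_image_eq[OF aut_linear[OF qia]]) (rule inj_on_subset[OF bij_is_inj[OF aut_bij[OF qia]] subset_UNIV])
    ultimately show ?thesis
      using subspace_dim_equal[OF G_subspace linear_subspace_image[OF aut_linear[OF qia] G_subspace]] by (metis order_refl)
  qed
  define \<Lambda>' where "\<Lambda>' = inv q \<Lambda>"
  have \<Lambda>'h: "\<Lambda>' \<in> G {0}" unfolding \<Lambda>'_def using h_eq regular_h[OF \<Lambda>] by blast
  have \<Lambda>'r: "regular \<Lambda>'" unfolding regular_def
  proof (intro conjI allI impI \<Lambda>'h)
    fix x assume "br \<Lambda>' x = 0"
    then have "q (br \<Lambda>' x) = 0" by (simp add: linear_0[OF aut_linear[OF qa]])
    then have "br \<Lambda> (q x) = 0" unfolding \<Lambda>'_def by (simp add: aut_br[OF qa] aut_inv_apply[OF qa])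
    then have "q x \<in> G {0}" using \<Lambda> unfolding regular_def by blast
    then have "inv q (q x) \<in> inv q ` G {0}" by blast
    then show "x \<in> G {0}" using h_eq by (simp add: aut_inv_apply[OF qa])
  qed
  define w where "w = inv q \<circ> inv g"
  have wa: "aut w" unfolding w_def by (intro aut_comp qia gia)
  have "\<forall>\<^sub>F j in sequentially. good (inv q \<circ> k (r j))"
  proof (rule good_eventually[OF _ linear_id good_id(1)])
    show "linear (inv q \<circ> k (r j))" for j by (rule aut_linear[OF aut_comp[OF qia ka]])
    have "bounded_linear (inv q)" using aut_linear[OF qia] linear_conv_bounded_linear by blast
    from bounded_linear.tendsto[OF this r(3)]
    show "(\<lambda>j. (inv q \<circ> k (r j)) v) \<longlonglongrightarrow> id v" for v by (simp add: aut_inv_apply[OF qa])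
  qed
  then obtain j where j: "good (inv q \<circ> k (r j))" using eventually_happens'[OF sequentially_bot] by blast
  \<comment> \<open>Writing j for \<open>r j\<close>, one has q^-1 k_j e^(A_j) n_j = e^(j Q) w. As Q
    lies in a, e^(j Q) preserves the negative part, so w inherits transversality from q^-1 k_j,
    which is close to the identity.\<close>
  have wgood: "good w" unfolding good_iff[OF aut_linear[OF wa]]
  proof (intro ballI impI)
    fix x assume x: "x \<in> G {0..}" "w x \<in> G {..<0}"
    let ?y = "expop (br (A (r j))) (n (r j) x)"
    have y: "?y \<in> G {0..}" by (rule ZZ_G[OF ea_ZZ[OF kan(2)] NN_ge[OF kan(3) x(1)]])
    have tQ: "real (r j) *\<^sub>R Q \<in> a" using Qa a_subspace subspace_scale by blast
    have "inv q (k (r j) ?y) = inv q (E (r j) (inv g x))" using fun_cong[OF kan(5)[of "r j"], of x] by simp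
    also have "\<dots> = expop (br (inv q (real (r j) *\<^sub>R H0))) (inv q (inv g x))" unfolding E_def by (rule aut_expop_conj[OF qia])
    also have "\<dots> = expop (br (real (r j) *\<^sub>R Q)) (w x)" unfolding w_def Q_def by (simp add: linear_scale[OF aut_linear[OF qia]])
    also have "\<dots> \<in> G {..<0}" by (rule ZZ_G[OF ea_ZZ[OF tQ] x(2)])
    finally have "(inv q \<circ> k (r j)) ?y \<in> G {..<0}" by simp
    then have "?y = 0" using j y good_iff[OF aut_linear[OF aut_comp[OF qia ka]]] by blast
    then show "x = 0" using aut_eq0[OF aut_expop] aut_eq0[OF NN_aut[OF kan(3)]] by simp
  qed
  \<comment> \<open>q is not known to be inner, so w is treated as the limit of the inner maps
    k_j^-1 g^-1.\<close>
  have wsig: "sigid w"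
  proof (rule inn_limit_sigid[of "\<lambda>j. inv (k (r j)) \<circ> inv g", OF _ wa wgood])
    show "inv (k (r j)) \<circ> inv g \<in> inn" for j by (intro inn_comp inn_inv g kan(4))
    show "(\<lambda>j. (inv (k (r j)) \<circ> inv g) v) \<longlonglongrightarrow> w v" for v
      unfolding w_def using invlim[OF tendsto_const, of "inv g v"] by simp
  qed
  obtain l z m where *: "l \<in> LL" "l \<in> inn" "z \<in> ZZ" "m \<in> NN" "m \<in> inn" "w = l \<circ> z \<circ> m"
    using gauss_decomposition[OF wa wgood wsig] .
  note la = LL_aut[OF *(1)] and za = ZZ_aut[OF *(3)] and ma = NN_aut[OF *(4)]
  define l' where "l' = inv z \<circ> inv l \<circ> z"
  have l'L: "l' \<in> LL" unfolding l'_def using ZZ_conj_LL[OF ZZ_inv[OF *(3)] LL_inv[OF *(1)]] unfolding aut_inv_inv[OF za] .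
  \<comment> \<open>z is only known as an automorphism fixing h, so l' is replaced by an inner l2
    with the same value at \<Lambda>'.\<close>
  have "l' \<Lambda>' - \<Lambda>' \<in> G {..<0}" by (rule LL_h_diff[OF l'L \<Lambda>'h])
  from LL_transitive[OF \<Lambda>'r this] obtain l2 where l2: "l2 \<in> LL" "l2 \<in> inn" "l2 \<Lambda>' = l' \<Lambda>'" by (metis add.commute diff_add_cancel)
  have "w (g \<Lambda>) = \<Lambda>'" unfolding w_def \<Lambda>'_def by (simp add: aut_inv_apply[OF ga])
  then have "l (z (m (g \<Lambda>))) = \<Lambda>'" unfolding *(6) by simp
  then have "m (g \<Lambda>) = inv z (inv l \<Lambda>')" using aut_inv_apply(1)[OF la] aut_inv_apply(1)[OF za] by metis
  also have "\<dots> = l' \<Lambda>'" unfolding l'_def using ZZ_h[OF *(3) \<Lambda>'h] by simp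
  finally have mg: "m (g \<Lambda>) = l2 \<Lambda>'" using l2(3) by simp
  have "g \<Lambda> = inv m (l2 \<Lambda>')" using mg aut_inv_apply(1)[OF ma, of "g \<Lambda>"] by simp
  then have "g \<Lambda> \<in> UU \<Lambda>'" unfolding UU_def using NN_inv[OF *(4)] inn_inv[OF *(5)] l2 by blast
  moreover have "\<Lambda>' = (inv l2 \<circ> m \<circ> g) \<Lambda>" using mg aut_inv_apply(1)[OF LL_aut[OF l2(1)], of \<Lambda>'] by simp
  moreover have "inv l2 \<circ> m \<circ> g \<in> inn" by (intro inn_comp inn_inv l2 * g)
  ultimately show ?thesis using \<Lambda>'h by blast
qed

end

section \<open>Iwasawa projections and the theorem\<close>

text \<open>The ordering may be lexicographic, so Pos need not be cut out by one functional. The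
  convex hull of finitely many elements of Pos stays in Pos and avoids 0; the normal of a separating
  hyperplane, projected to a, is the required element.\<close>

lemma positive_half_space:
  fixes a Pos T :: "'g::euclidean_space set"
  assumes pos: "positivity a Pos" and sub: "subspace a" and T: "finite T" "T \<subseteq> Pos"
  obtains h where "h \<in> a" "\<And>x. x \<in> T \<Longrightarrow> x \<bullet> h > 0"
proof -
  have P: "Pos \<subseteq> a" "0 \<notin> Pos" "\<And>u v. u \<in> Pos \<Longrightarrow> v \<in> Pos \<Longrightarrow> u + v \<in> Pos" "\<And>v c::real. v \<in> Pos \<Longrightarrow> c > 0 \<Longrightarrow> c *\<^sub>R v \<in> Pos"
    using pos unfolding positivity_def by blast+
  have "convex Pos" unfolding convex_def
  proof (intro ballI allI impI)
    fix x y and u v :: real assume "x \<in> Pos" "y \<in> Pos" "0 \<le> u" "0 \<le> v" "u + v = 1"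
    then show "u *\<^sub>R x + v *\<^sub>R y \<in> Pos"
      by (cases "u = 0"; cases "v = 0") (auto intro!: P(3,4))
  qed
  then have hull: "convex hull T \<subseteq> Pos" using T(2) by (rule hull_minimal[rotated])
  have "closed (convex hull T)" using T(1) by (intro compact_imp_closed compact_convex_hull finite_imp_compact)
  then obtain c d where cd: "c \<bullet> 0 < d" "\<And>x. x \<in> convex hull T \<Longrightarrow> c \<bullet> x > d"
    using separating_hyperplane_closed_point[OF convex_convex_hull, of T 0] hull P(2) by blast
  obtain h z where hz: "h \<in> span a" "\<And>w. w \<in> span a \<Longrightarrow> z \<bullet> w = 0" "c = h + z"
    using orthogonal_subspace_decomp_exists[of a c] unfolding real_inner_class.orthogonal_def by metis
  have span: "span a = a" using sub by (simp add: span_eq_iff)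
  have "x \<bullet> h > 0" if x: "x \<in> T" for x
  proof -
    have "z \<bullet> x = 0" using hz(2)[of x] T(2) P(1) x span by auto
    moreover have "c \<bullet> x > 0" using cd(1) cd(2)[of x] hull_inc[OF x, of convex] by simp
    ultimately show ?thesis unfolding hz(3) by (simp add: inner_simps inner_commute)
  qed
  then show thesis using that hz(1) span by blast
qed

context root_setting begin

lemma ordering_element:
  assumes pos: "positivity a Pos"
  obtains h where "h \<in> a" "\<And>b. b \<in> \<beta> \<Longrightarrow> \<alpha> b \<noteq> 0 \<Longrightarrow> \<alpha> b \<in> Pos \<Longrightarrow> \<alpha> b \<bullet> h > 0"
    "\<And>b. b \<in> \<beta> \<Longrightarrow> \<alpha> b \<noteq> 0 \<Longrightarrow> \<alpha> b \<notin> Pos \<Longrightarrow> \<alpha> b \<bullet> h < 0"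
proof -
  \<comment> \<open>Including the negatives of the nonpositive roots makes one element positive on
    the positive roots and negative on the others.\<close>
  define T where "T = \<alpha> ` {b\<in>\<beta>. \<alpha> b \<in> Pos} \<union> (\<lambda>b. - \<alpha> b) ` {b\<in>\<beta>. \<alpha> b \<noteq> 0 \<and> \<alpha> b \<notin> Pos}"
  have m: "- \<alpha> b \<in> Pos" if "b \<in> \<beta>" "\<alpha> b \<noteq> 0" "\<alpha> b \<notin> Pos" for b
    using pos that \<alpha>_a[OF that(1)] unfolding positivity_def by blast
  have "finite T" "T \<subseteq> Pos" unfolding T_def using \<beta>_fin m by auto
  then obtain h where h: "h \<in> a" "\<And>x. x \<in> T \<Longrightarrow> x \<bullet> h > 0"
    using positive_half_space[OF pos a_subspace] by blast
  show thesis
  proof (rule that[OF h(1)])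
    show "\<alpha> b \<bullet> h > 0" if "b \<in> \<beta>" "\<alpha> b \<noteq> 0" "\<alpha> b \<in> Pos" for b
      by (rule h(2)) (use that in \<open>auto simp: T_def\<close>)
    have "- \<alpha> b \<bullet> h > 0" if "b \<in> \<beta>" "\<alpha> b \<noteq> 0" "\<alpha> b \<notin> Pos" for b
      by (rule h(2)) (use that in \<open>auto simp: T_def\<close>)
    then show "\<alpha> b \<bullet> h < 0" if "b \<in> \<beta>" "\<alpha> b \<noteq> 0" "\<alpha> b \<notin> Pos" for b
      using that by simp
  qed
qed

end

locale ordered_graded = graded br J \<theta> a \<beta> \<alpha> H0
  for br :: "'g::euclidean_space \<Rightarrow> 'g \<Rightarrow> 'g" and J \<theta> a \<beta> \<alpha> H0 +
  fixes Pos :: "'g set"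
  assumes H0_pos: "b \<in> \<beta> \<Longrightarrow> \<alpha> b \<noteq> 0 \<Longrightarrow> \<alpha> b \<in> Pos \<Longrightarrow> \<alpha> b \<bullet> H0 > 0"
    and H0_neg: "b \<in> \<beta> \<Longrightarrow> \<alpha> b \<noteq> 0 \<Longrightarrow> \<alpha> b \<notin> Pos \<Longrightarrow> \<alpha> b \<bullet> H0 < 0"
begin

lemma root_of_coeff:
  assumes \<gamma>: "\<gamma> \<in> a" and x: "x \<in> rootspace br a \<gamma>" and b: "b \<in> \<beta>" "ip x b \<noteq> 0"
  shows "\<alpha> b = \<gamma>"
proof -
  have "\<alpha> b \<bullet> H = \<gamma> \<bullet> H" if H: "H \<in> a" for H
  proof -
    have "ip (br H x) b = ip x (br H b)" using a_p[OF H] by (simp add: ip_br br_simps ip_simps)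
    then have "(\<gamma> \<bullet> H) * ip x b = (\<alpha> b \<bullet> H) * ip x b"
      using x H br_a_\<beta>[OF H b(1)] unfolding rootspace_def by (simp add: ip_simps)
    then show ?thesis using b(2) by simp
  qed
  then have "(\<alpha> b - \<gamma>) \<bullet> (\<alpha> b - \<gamma>) = 0"
    using subspace_diff[OF a_subspace \<alpha>_a[OF b(1)] \<gamma>] by (simp add: inner_diff_left)
  then show ?thesis by simp
qed

text \<open>A root vector has coefficients only at basis vectors of the same weight, by
  \<open>root_of_coeff\<close>. The abstract Q serves both n and l.\<close>

lemma span_rootspaces:
  assumes S: "\<And>b. b \<in> \<beta> \<Longrightarrow> deg b \<in> S \<longleftrightarrow> \<alpha> b \<noteq> 0 \<and> Q (\<alpha> b)"
  shows "span (\<Union>{rootspace br a \<gamma> |\<gamma>. is_root br a \<gamma> \<and> Q \<gamma>}) = G S" (is "span ?U = _")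
proof
  have "?U \<subseteq> G S"
  proof
    fix x assume "x \<in> ?U"
    then obtain \<gamma> where \<gamma>: "is_root br a \<gamma>" "Q \<gamma>" "x \<in> rootspace br a \<gamma>" by blast
    then have "\<alpha> b = \<gamma>" if "b \<in> \<beta>" "ip x b \<noteq> 0" for b
      using root_of_coeff[OF _ \<gamma>(3) that] unfolding is_root_def by blast
    then show "x \<in> G S" unfolding G_def using S \<gamma>(1,2) unfolding is_root_def by blast
  qed
  then show "span ?U \<subseteq> G S" by (rule span_minimal[OF _ G_subspace])
  show "G S \<subseteq> span ?U"
  proof
    fix x assume x: "x \<in> G S"
    have "pr S x \<in> span ?U" unfolding pr_def
    proof (intro span_sum span_scale span_base)
      fix b assume "b \<in> {b \<in> \<beta>. deg b \<in> S}"
      then have b: "b \<in> \<beta>" "\<alpha> b \<noteq> 0" "Q (\<alpha> b)" using S by auto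
      have "is_root br a (\<alpha> b)" unfolding is_root_def
        using \<alpha>_a[OF b(1)] b(2) \<beta>_root[OF b(1)] \<beta>_nz[OF b(1)] by auto
      then show "b \<in> ?U" using b(3) \<beta>_root[OF b(1)] by blast
    qed
    then show "x \<in> span ?U" using pr_id[OF x] by simp
  qed
qed

lemma deg_sign: assumes "b \<in> \<beta>"
  shows "deg b \<in> {0<..} \<longleftrightarrow> \<alpha> b \<noteq> 0 \<and> \<alpha> b \<in> Pos" "deg b \<in> {..<0} \<longleftrightarrow> \<alpha> b \<noteq> 0 \<and> \<alpha> b \<notin> Pos"
  using H0_pos[OF assms] H0_neg[OF assms] unfolding deg_def by force+

lemma nplus_G: "nplus br a Pos = G {0<..}"
  unfolding nplus_def by (rule span_rootspaces[OF deg_sign(1)])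

lemma lminus_G: "lminus br a Pos = G {..<0}"
  unfolding lminus_def by (rule span_rootspaces[OF deg_sign(2)])

lemma iwasawa_split: "\<exists>\<kappa> A \<nu>. p = \<kappa> + A + \<nu> \<and> \<theta> \<kappa> = \<kappa> \<and> A \<in> a \<and> \<nu> \<in> G {0<..}"
proof (intro exI conjI)
  let ?l = "pr {..<0} p" and ?h = "pr {0} p" and ?n = "pr {0<..} p"
  have h: "?h \<in> hcartan J a" using pr_mem G_h by blast
  \<comment> \<open>The negative part is completed to an element of k by its \<theta>-image, which
    is then subtracted from the positive part.\<close>
  show "p = (?l + \<theta> ?l + J (im ?h)) + re ?h + (?n - \<theta> ?l)"
    using triple_split[of p] re_im[of ?h] by (simp add: algebra_simps)
  show "\<theta> (?l + \<theta> ?l + J (im ?h)) = ?l + \<theta> ?l + J (im ?h)"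
    using a_p[OF re_im_a(2)[OF h]] by (simp add: \<theta>_simps \<theta>\<theta> \<theta>_J J_simps)
  show "re ?h \<in> a" by (rule re_im_a(1)[OF h])
  show "?n - \<theta> ?l \<in> G {0<..}" by (rule G_diff[OF pr_mem \<theta>_G[OF pr_mem]]) simp
qed

lemma iwasawa_zero:
  assumes "\<theta> (A + \<nu>) = A + \<nu>" "A \<in> a" "\<nu> \<in> G {0<..}" shows "A + \<nu> = 0"
proof -
  have t: "\<theta> \<nu> \<in> G {..<0}" by (rule \<theta>_G[OF assms(3)]) simp
  have A: "A + A \<in> G {0}" using a_G0[OF assms(2)] by (intro G_add)
  have "\<nu> + - \<theta> \<nu> + (A + A) = 0"
    using assms(1) a_p[OF assms(2)] by (simp add: \<theta>_simps algebra_simps)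
  note triple_zero[OF assms(3) G_neg[OF t] A this]
  then show ?thesis by (simp flip: scaleR_2)
qed

lemma pi_k_eq:
  assumes p: "p = \<kappa> + A + \<nu>" and k: "\<theta> \<kappa> = \<kappa>" "A \<in> a" "\<nu> \<in> G {0<..}"
  shows "pi_k br \<theta> a Pos p = \<kappa>"
  unfolding pi_k_def
proof (rule the_equality)
  show "\<kappa> \<in> kpart \<theta> \<and> p - \<kappa> \<in> upart br a Pos"
    unfolding kpart_def upart_def nplus_G using k p by (auto simp: add.assoc)
  fix K assume "K \<in> kpart \<theta> \<and> p - K \<in> upart br a Pos"
  then obtain A' \<nu>' where K: "\<theta> K = K" "p - K = A' + \<nu>'" "A' \<in> a" "\<nu>' \<in> G {0<..}"
    unfolding kpart_def upart_def nplus_G by blast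
  have e: "(A - A') + (\<nu> - \<nu>') = K - \<kappa>" using p K(2) by (simp add: algebra_simps)
  have "(A - A') + (\<nu> - \<nu>') = 0"
  proof (rule iwasawa_zero)
    show "\<theta> ((A - A') + (\<nu> - \<nu>')) = (A - A') + (\<nu> - \<nu>')" unfolding e by (simp add: \<theta>_simps k K)
    show "A - A' \<in> a" using subspace_diff[OF a_subspace k(2) K(3)] .
    show "\<nu> - \<nu>' \<in> G {0<..}" using G_diff[OF k(3) K(4)] .
  qed
  then show "K = \<kappa>" using e by simp
qed

lemma toda_split:
  "\<exists>\<kappa> A \<nu>. p = \<kappa> + A + \<nu> \<and> \<theta> \<kappa> = \<kappa> \<and> A \<in> a \<and> \<nu> \<in> G {0<..} \<and> toda br \<theta> a Pos p = br p \<kappa>"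
  using iwasawa_split[of p] pi_k_eq[of p] unfolding toda_def by metis

lemma inn_orbit_shift: assumes "f \<in> inn" shows "{g (f L) |g. g \<in> inn} = {g L |g. g \<in> inn}"
proof safe
  fix g assume g: "g \<in> inn"
  show "\<exists>h. g (f L) = h L \<and> h \<in> inn" using inn_comp[OF g assms] by (intro exI[of _ "g \<circ> f"]) simp
  have "g L = (g \<circ> inv f) (f L)" by (simp add: aut_inv_apply[OF inn_aut[OF assms]])
  then show "\<exists>h. g L = h (f L) \<and> h \<in> inn" using inn_comp[OF g inn_inv[OF assms]] by blast
qed

lemma toda_charts:
  assumes Orb: "regular_semisimple_orbit br J a Orb"
  shows "finite (Orb \<inter> hcartan J a) \<and> Orb = (\<Union>L\<in>Orb \<inter> hcartan J a. UU L) \<and>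
     (\<forall>L\<in>Orb \<inter> hcartan J a.
        UU L \<subseteq> Orb \<and> openin (top_of_set Orb) (UU L) \<and> L \<in> UU L \<and>
        diffeo_onto (UU L) (lminus br a Pos \<times> lminus br a Pos) (phi L) \<and>
        transforms_field (UU L) (phi L) (toda br \<theta> a Pos)
          (\<lambda>(Y, Z). (br Y (pi_ia J a L), br Z (- pi_a J a L))) \<and>
        Orb \<subseteq> closure (UU L))"
proof -
  obtain L0 where L0: "Orb = {g L0 |g. g \<in> inn}"
    using Orb unfolding regular_semisimple_orbit_def adj_orbit_inn by blast
  have orb: "Orb = {g L |g. g \<in> inn}" if "L \<in> Orb" for L
  proof -
    have "L \<in> {g L0 |g. g \<in> inn}" using that L0 by simp
    then obtain f where "f \<in> inn" "L = f L0" by blast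
    then show ?thesis using inn_orbit_shift[of f L0] L0 by simp
  qed
  have reg: "regular L" if "L \<in> Orb \<inter> hcartan J a" for L
    using regular_of_orbit_dim that Orb unfolding G_h regular_semisimple_orbit_def by blast
  have idN: "id \<in> NN" "id \<in> LL" "id \<in> inn" unfolding LL_def using NN_id aut_id inn_id G_0 by auto
  have inO: "g L \<in> Orb" if "L \<in> Orb" "g \<in> inn" for g L
    by (subst orb[OF that(1)]) (use that(2) in blast)
  have Og: "\<exists>g\<in>inn. x = g L" if L: "L \<in> Orb" and x: "x \<in> Orb" for x L
    using x by (subst (asm) orb[OF L]) blast
  have sub: "UU L \<subseteq> Orb" if L: "L \<in> Orb" for L
  proof
    fix x assume "x \<in> UU L"
    then obtain n l where "x = n (l L)" "n \<in> inn" "l \<in> inn" unfolding UU_def by auto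
    then show "x \<in> Orb" using inO L by simp
  qed
  obtain L1 where L1: "L1 \<in> Orb \<inter> hcartan J a" using Orb unfolding regular_semisimple_orbit_def by blast
  have "finite (Orb \<inter> hcartan J a)"
  proof (rule finite_subset[OF _ finite_h_spec[OF finite_spec_h]])
    show "L1 \<in> hcartan J a" using L1 by blast
    show "Orb \<inter> hcartan J a \<subseteq> {H \<in> hcartan J a. spec H \<subseteq> spec L1}"
      using Og[of L1] L1 spec_aut[OF inn_aut] by fastforce
  qed
  moreover have "Orb = (\<Union>L\<in>Orb \<inter> hcartan J a. UU L)"
  proof
    show "(\<Union>L\<in>Orb \<inter> hcartan J a. UU L) \<subseteq> Orb" using sub by blast
    show "Orb \<subseteq> (\<Union>L\<in>Orb \<inter> hcartan J a. UU L)"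
    proof
      fix x assume "x \<in> Orb"
      then obtain g where g: "g \<in> inn" "x = g L1" using Og L1 by blast
      from orbit_covered[OF reg[OF L1] g(1)] obtain L f where "L \<in> G {0}" "f \<in> inn" "L = f L1" "g L1 \<in> UU L" by blast
      moreover from this have "L \<in> Orb" using inO L1 by simp
      ultimately show "x \<in> (\<Union>L\<in>Orb \<inter> hcartan J a. UU L)" unfolding G_h g(2) by blast
    qed
  qed
  moreover have "UU L \<subseteq> Orb \<and> openin (top_of_set Orb) (UU L) \<and> L \<in> UU L \<and>
        diffeo_onto (UU L) (lminus br a Pos \<times> lminus br a Pos) (phi L) \<and>
        transforms_field (UU L) (phi L) (toda br \<theta> a Pos)
          (\<lambda>(Y, Z). (br Y (pi_ia J a L), br Z (- pi_a J a L))) \<and>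
        Orb \<subseteq> closure (UU L)" if L: "L \<in> Orb \<inter> hcartan J a" for L
  proof (intro conjI)
    have LO: "L \<in> Orb" and Lh: "L \<in> hcartan J a" using L by auto
    note r = reg[OF L]
    show "UU L \<subseteq> Orb" by (rule sub[OF LO])
    show "openin (top_of_set Orb) (UU L)" using UU_openin[OF r] unfolding orb[OF LO, symmetric] .
    show "L \<in> UU L" unfolding UU_def using idN by (metis (mono_tags, lifting) id_apply mem_Collect_eq)
    show "diffeo_onto (UU L) (lminus br a Pos \<times> lminus br a Pos) (phi L)"
      unfolding diffeo_onto_def lminus_G using phi_bij[OF r] phi_smooth[OF r] psi_smooth[OF r] by blast
    show "transforms_field (UU L) (phi L) (toda br \<theta> a Pos)
          (\<lambda>(Y, Z). (br Y (pi_ia J a L), br Z (- pi_a J a L)))"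
      unfolding pi_ia_im[OF Lh] pi_a_re[OF Lh] by (rule phi_transforms[OF r toda_split])
    show "Orb \<subseteq> closure (UU L)"
    proof
      fix x assume "x \<in> Orb"
      then obtain g where "g \<in> inn" "x = g L" using Og[OF LO] by blast
      then show "x \<in> closure (UU L)" using UU_dense[OF r] by blast
    qed
  qed
  ultimately show ?thesis by blast
qed

end

theorem theorem1p1:
  fixes br :: "'g::euclidean_space \<Rightarrow> 'g \<Rightarrow> 'g"
    and J \<theta> :: "'g \<Rightarrow> 'g" and a Pos Orb :: "'g set"
  assumes "iwasawa_setting br J \<theta> a Pos"
    and "regular_semisimple_orbit br J a Orb"
  shows "\<exists>(U :: 'g \<Rightarrow> 'g set) (\<phi> :: 'g \<Rightarrow> 'g \<Rightarrow> 'g \<times> 'g).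
     finite (Orb \<inter> hcartan J a) \<and>
     Orb = (\<Union>L\<in>Orb \<inter> hcartan J a. U L) \<and>
     (\<forall>L\<in>Orb \<inter> hcartan J a.
        U L \<subseteq> Orb \<and> openin (top_of_set Orb) (U L) \<and> L \<in> U L \<and>
        diffeo_onto (U L) (lminus br a Pos \<times> lminus br a Pos) (\<phi> L) \<and>
        transforms_field (U L) (\<phi> L) (toda br \<theta> a Pos)
          (\<lambda>(Y, Z). (br Y (pi_ia J a L), br Z (- pi_a J a L))) \<and>
        Orb \<subseteq> closure (U L))"
proof -
  have pos: "positivity a Pos" using assms(1) unfolding iwasawa_setting_def by blast
  interpret cartan_setting br J \<theta> a
    using assms(1) unfolding iwasawa_setting_def by unfold_locales simp_all
  obtain \<beta> \<alpha> where "finite \<beta>" "\<And>b c. b \<in> \<beta> \<Longrightarrow> c \<in> \<beta> \<Longrightarrow> ip b c = (if b = c then 1 else 0)"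
    "\<And>x. x = (\<Sum>b\<in>\<beta>. ip x b *\<^sub>R b)" "\<And>b. b \<in> \<beta> \<Longrightarrow> \<alpha> b \<in> a" "\<And>b. b \<in> \<beta> \<Longrightarrow> b \<in> rootspace br a (\<alpha> b)"
    by (rule root_basis_exists) blast
  then interpret root_setting br J \<theta> a \<beta> \<alpha> by unfold_locales
  obtain H0 where H0: "H0 \<in> a" "\<And>b. b \<in> \<beta> \<Longrightarrow> \<alpha> b \<noteq> 0 \<Longrightarrow> \<alpha> b \<in> Pos \<Longrightarrow> \<alpha> b \<bullet> H0 > 0"
    "\<And>b. b \<in> \<beta> \<Longrightarrow> \<alpha> b \<noteq> 0 \<Longrightarrow> \<alpha> b \<notin> Pos \<Longrightarrow> \<alpha> b \<bullet> H0 < 0"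
    by (rule ordering_element[OF pos]) blast
  interpret ordered_graded br J \<theta> a \<beta> \<alpha> H0 Pos
    by unfold_locales (use H0 in force)+
  show ?thesis using toda_charts[OF assms(2)] by blast
qed

end
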